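(* Let $d\ge1$ be an integer and $\sigma\ge 3/d$. There exist $\varepsilon=\varepsilon(d)>0$ and a constant $C=C(d)$ such that whenever $\|\{u_n(0)\}\|_{l^2(\mathbb Z^d)}\le\varepsilon$, the discrete nonlinear Schrödinger equation (with either choice of sign) $$ i\,\partial_tu_n+(\Delta_d u)_n\pm|u_n|^{2\sigma}u_n=0,\qquad n\in\mathbb Z^d, $$ with initial data $\{u_n(0)\}$ has a unique global solution, and this solution satisfies $$\|\{u_n(t)\}\|_{L^ql^r}\le C\varepsilon$$ for all Strichartz admissible pairs $(q,r)$. In particular, $\|\{u_n(t)\}\|_{l^r}\to0$ as $t\to\infty$ for every $r>2$.
   Context: The discrete Laplacian on complex sequences on $\mathbb Z^d$ (lattice spacing $1$) is $(\Delta_d u)_n=\sum_{j=1}^d(u_{n+e_j}+u_{n-e_j}-2u_n)$, with $e_1,\dots,e_d$ the standard basis. A pair $(q,r)$ is Strichartz admissible if $q,r\in[2,\infty]$, $\frac1q+\frac{d}{3r}\le\frac d6$ and $(q,r,d)\ne(2,\infty,3)$. The mixed norm is $\|u\|_{L^ql^r}=\big(\int_0^\infty\|\{u_n(t)\}\|_{l^r(\mathbb Z^d)}^q\,dt\big)^{1/q}$ (with the usual supremum modification if an exponent is infinite). A solution is understood as a solution of the integral (Duhamel) equation $u(t)=e^{it\Delta_d}u(0)\pm i\int_0^te^{i(t-s)\Delta_d}\big(|u|^{2\sigma}u\big)(s)\,ds$.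
   Formalization: For d = 3 the constant C may depend on q (not on r, σ, the sign or the data), because a constant uniform over all admissible pairs is false there: the bounds blow up as (q,r) tends to the excluded endpoint (2,∞). For d ≠ 3, C = C(d) as stated. *)

theory Defs
  imports "HOL-Analysis.Analysis"
begin

text \<open>
  Lattice functions on $\mathbb{Z}^d$ have type \<open>int ^ 'd \<Rightarrow> complex\<close>, with \<open>d = CARD('d)\<close>.
\<close>

definition discrete_laplacian :: "(int ^ 'd \<Rightarrow> complex) \<Rightarrow> int ^ 'd \<Rightarrow> complex" where
  "discrete_laplacian f n = (\<Sum>j\<in>UNIV. f (n + axis j 1) + f (n - axis j 1) - 2 * f n)"

text \<open>
  The discrete Laplacian is bounded on every \<open>l\<^sup>p\<close>, so its unitary group is the exponential
  series. On bounded lattice functions the series below converges absolutely at each site.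
\<close>

definition schroedinger_group :: "real \<Rightarrow> (int ^ 'd \<Rightarrow> complex) \<Rightarrow> int ^ 'd \<Rightarrow> complex" where
  "schroedinger_group t f n =
     (\<Sum>k. (\<i> * complex_of_real t) ^ k / fact k * (discrete_laplacian ^^ k) f n)"

text \<open>Only used with \<open>a > 0\<close>; \<open>0 powr a = 0\<close> then gives the right value at \<open>0\<close>.\<close>

definition ennreal_rpow :: "ennreal \<Rightarrow> real \<Rightarrow> ennreal" where
  "ennreal_rpow x a = (if x = \<infinity> then \<infinity> else ennreal (enn2real x powr a))"

definition lr_norm :: "ennreal \<Rightarrow> (int ^ 'd \<Rightarrow> complex) \<Rightarrow> ennreal" where
  "lr_norm r f =
     (if r = \<infinity> then SUP n. ennreal (norm (f n))
      else ennreal_rpow (\<integral>\<^sup>+ n. ennreal (norm (f n) powr enn2real r) \<partial>count_space UNIV)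
             (1 / enn2real r))"

text \<open>
  For \<open>q = \<infinity>\<close> this is a true supremum over \<open>t \<ge> 0\<close>; for functions continuous in time with
  values in \<open>l\<^sup>2\<close> (and \<open>r \<ge> 2\<close>) it agrees with the essential supremum.
\<close>

definition mixed_norm :: "ennreal \<Rightarrow> ennreal \<Rightarrow> (real \<Rightarrow> int ^ 'd \<Rightarrow> complex) \<Rightarrow> ennreal" where
  "mixed_norm q r u =
     (if q = \<infinity> then SUP t\<in>{0..}. lr_norm r (u t)
      else ennreal_rpow (\<integral>\<^sup>+ t\<in>{0..}. ennreal_rpow (lr_norm r (u t)) (enn2real q) \<partial>lborel)
             (1 / enn2real q))"

text \<open>
  In \<open>ennreal\<close> the inverse of \<open>\<infinity>\<close> is \<open>0\<close>, as required. For \<open>d = 3\<close> the excluded pair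
  \<open>(2, \<infinity>)\<close> is a limit of admissible pairs \<open>(q, r)\<close> with \<open>q > 2\<close>, along which the optimal
  constants in the Strichartz estimates are unbounded.
\<close>

definition strichartz_admissible :: "nat \<Rightarrow> ennreal \<Rightarrow> ennreal \<Rightarrow> bool" where
  "strichartz_admissible d q r \<longleftrightarrow>
     2 \<le> q \<and> 2 \<le> r \<and> 1 / q + of_nat d / (3 * r) \<le> of_nat d / 6 \<and> (q, r, d) \<noteq> (2, \<infinity>, 3)"

definition power_nonlinearity :: "real \<Rightarrow> (int ^ 'd \<Rightarrow> complex) \<Rightarrow> int ^ 'd \<Rightarrow> complex" where
  "power_nonlinearity \<sigma> f n = complex_of_real (norm (f n) powr (2 * \<sigma>)) * f n"

definition l2_continuous :: "(real \<Rightarrow> int ^ 'd \<Rightarrow> complex) \<Rightarrow> bool" where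
  "l2_continuous u \<longleftrightarrow>
     (\<forall>t\<ge>0. lr_norm 2 (u t) < \<infinity> \<and>
        ((\<lambda>s. lr_norm 2 (\<lambda>n. u s n - u t n)) \<longlongrightarrow> 0) (at t within {0..}))"

text \<open>
  Global solutions in $C([0,\infty); l^2)$ of the Duhamel equation for
  $i \partial_t u + \Delta_d u + \kappa |u|^{2\sigma} u = 0$ with data \<open>f\<close>, where
  \<open>\<kappa>\<close> is the sign \<open>1\<close> or \<open>-1\<close>. The values \<open>u t\<close> for \<open>t < 0\<close> are irrelevant.
\<close>

definition global_dnls_solution ::
    "real \<Rightarrow> real \<Rightarrow> (int ^ 'd \<Rightarrow> complex) \<Rightarrow> (real \<Rightarrow> int ^ 'd \<Rightarrow> complex) \<Rightarrow> bool" where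
  "global_dnls_solution \<kappa> \<sigma> f u \<longleftrightarrow>
     l2_continuous u \<and> u 0 = f \<and>
     (\<forall>t\<ge>0. \<forall>n.
        (\<lambda>s. schroedinger_group (t - s) (power_nonlinearity \<sigma> (u s)) n) integrable_on {0..t} \<and>
        u t n = schroedinger_group t (u 0) n
          + complex_of_real \<kappa> * \<i> *
            integral {0..t} (\<lambda>s. schroedinger_group (t - s) (power_nonlinearity \<sigma> (u s)) n))"

end

(*
  The kernel of the discrete Schroedinger group is a product of d one-dimensional oscillatory
  integrals, each of size |t|^(-1/3) by van der Corput's lemma, so the group maps l^1 to l^infinity
  with norm O(|t|^(-d/3)). By duality the Strichartz estimates amount to boundedness of the bilinear
  form of <U(t - s) F(s), G(t)> on L^q' l^r'. Off the endpoint, splitting F and G into level sets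
  interpolates the dispersive and the l^2 bound to a kernel |t - s|^(-2/q), to which the
  Hardy-Littlewood-Sobolev inequality applies. At the endpoint q = 2 for d >= 4, the pairs of level
  sets (k, l) are summed directly, cutting each at the distance |t - s| where the two bounds
  balance; the contributions decay geometrically in |k - l|.

  For data of norm at most eps <= 1 conservation of mass keeps |u_n| <= 1, so the
  nonlinearity is dominated by |u|^(1 + 6/d) and agrees with a globally Lipschitz truncation. A continuity
  argument in T for a single Strichartz norm on [0, T] gives the global bound; the other pairs
  follow by interpolation with conservation of mass (and, for d = 3 and 2 < q < 4, by the
  estimate at that q). Finally, sup_n |u_n(t)| is Lipschitz in t with an integrable power, hence
  tends to 0.
*)
theory Submission
  imports Defs
begin

section \<open>The Hilbert space of square-summable functions\<close>

text \<open>The statement speaks of plain functions and of a Duhamel integral at each site. The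
  proof works with vectors of a Hilbert space type and translates at the end, so that continuity,
  Borel measurability and Bochner integrals are available. Space-time estimates are proved first for
  forcings supported in a finite set of sites, with constants independent of this set: maxima, level
  sets and norming functionals are then finite sums, and monotone convergence restores the lattice.
  The smallness condition involves only this exponent, so \<open>\<epsilon>\<close> and
  \<open>C\<close> do not depend on \<open>\<sigma>\<close>. Pairs off the line follow from the
  nesting of the lattice norms: a larger \<open>r\<close> gives a smaller norm. In dimension three
  the kernel decays like 1/|t|, the borderline of integrability. Neither Hardy-Littlewood-Sobolev
  with r = infinity nor the endpoint summation applies, the constants obtained blow up as q tends to
  2, and \<open>C\<close> becomes a function of \<open>q\<close>.\<close>

typedef 'a ell2 = "{f :: 'a \<Rightarrow> complex. (\<lambda>n. (cmod (f n))\<^sup>2) summable_on UNIV}"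
  morphisms ev Abs_ell2
  by (rule exI[of _ "\<lambda>_. 0"]) simp

setup_lifting type_definition_ell2

lemma ell2_eqI: "(\<And>n. ev x n = ev y n) \<Longrightarrow> x = y"
  by (metis ev_inject ext)

lemma ev_square_summable: "(\<lambda>n. (cmod (ev x n))\<^sup>2) summable_on UNIV"
  using ev[of x] by simp

lemma square_summable_add:
  fixes f g :: "'a \<Rightarrow> complex"
  assumes "(\<lambda>n. (cmod (f n))\<^sup>2) summable_on UNIV" "(\<lambda>n. (cmod (g n))\<^sup>2) summable_on UNIV"
  shows "(\<lambda>n. (cmod (f n + g n))\<^sup>2) summable_on UNIV"
proof (rule summable_on_comparison_test)
  show "(\<lambda>n. 2 * (cmod (f n))\<^sup>2 + 2 * (cmod (g n))\<^sup>2) summable_on UNIV"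
    by (intro summable_on_add summable_on_cmult_right assms)
  fix n
  have "(cmod (f n + g n))\<^sup>2 \<le> (cmod (f n) + cmod (g n))\<^sup>2"
    by (intro power_mono norm_triangle_ineq) auto
  also have "\<dots> \<le> 2 * (cmod (f n))\<^sup>2 + 2 * (cmod (g n))\<^sup>2"
    using sum_squares_bound[of "cmod (f n)" "cmod (g n)"] by (simp add: power2_sum)
  finally show "(cmod (f n + g n))\<^sup>2 \<le> 2 * (cmod (f n))\<^sup>2 + 2 * (cmod (g n))\<^sup>2" .
qed auto

lemma square_summable_cmult:
  fixes f :: "'a \<Rightarrow> complex"
  assumes "(\<lambda>n. (cmod (f n))\<^sup>2) summable_on UNIV"
  shows "(\<lambda>n. (cmod (c * f n))\<^sup>2) summable_on UNIV"
  using summable_on_cmult_right[OF assms, of "(cmod c)\<^sup>2"] by (simp add: norm_mult power_mult_distrib)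

lemma inner_ev_summable: "(\<lambda>n. ev x n \<bullet> ev y n) summable_on UNIV"
proof (rule abs_summable_summable, rule summable_on_comparison_test)
  show "(\<lambda>n. (cmod (ev x n))\<^sup>2 + (cmod (ev y n))\<^sup>2) summable_on UNIV"
    by (intro summable_on_add ev_square_summable)
  fix n
  have "norm (ev x n \<bullet> ev y n) \<le> cmod (ev x n) * cmod (ev y n)"
    by (simp add: Cauchy_Schwarz_ineq2)
  also have "\<dots> \<le> (cmod (ev x n))\<^sup>2 + (cmod (ev y n))\<^sup>2"
    using sum_squares_bound[of "cmod (ev x n)" "cmod (ev y n)"]
      mult_nonneg_nonneg[OF norm_ge_zero[of "ev x n"] norm_ge_zero[of "ev y n"]] by linarith
  finally show "norm (ev x n \<bullet> ev y n) \<le> (cmod (ev x n))\<^sup>2 + (cmod (ev y n))\<^sup>2" .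
qed auto

instantiation ell2 :: (type) real_inner
begin

lift_definition zero_ell2 :: "'a ell2" is "\<lambda>_. 0" by simp
lift_definition plus_ell2 :: "'a ell2 \<Rightarrow> 'a ell2 \<Rightarrow> 'a ell2" is "\<lambda>f g n. f n + g n"
  by (rule square_summable_add)
lift_definition uminus_ell2 :: "'a ell2 \<Rightarrow> 'a ell2" is "\<lambda>f n. - f n" by simp
lift_definition minus_ell2 :: "'a ell2 \<Rightarrow> 'a ell2 \<Rightarrow> 'a ell2" is "\<lambda>f g n. f n - g n"
  subgoal for f g using square_summable_add[of f "\<lambda>n. - g n"] by simp
  done
lift_definition scaleR_ell2 :: "real \<Rightarrow> 'a ell2 \<Rightarrow> 'a ell2" is "\<lambda>c f n. c *\<^sub>R f n"
  by (simp add: scaleR_conv_of_real square_summable_cmult del: norm_scaleR)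
definition inner_ell2 :: "'a ell2 \<Rightarrow> 'a ell2 \<Rightarrow> real" where
  "inner_ell2 x y = (\<Sum>\<^sub>\<infinity>n. ev x n \<bullet> ev y n)"
definition norm_ell2 :: "'a ell2 \<Rightarrow> real" where "norm_ell2 x = sqrt (inner x x)"
definition dist_ell2 :: "'a ell2 \<Rightarrow> 'a ell2 \<Rightarrow> real" where "dist_ell2 x y = norm (x - y)"
definition sgn_ell2 :: "'a ell2 \<Rightarrow> 'a ell2" where "sgn_ell2 x = inverse (norm x) *\<^sub>R x"
definition uniformity_ell2 :: "('a ell2 \<times> 'a ell2) filter" where
  "uniformity_ell2 = (INF e\<in>{0 <..}. principal {(x, y). dist x y < e})"
definition open_ell2 :: "'a ell2 set \<Rightarrow> bool" where
  "open_ell2 S \<longleftrightarrow> (\<forall>x\<in>S. \<forall>\<^sub>F (x', y) in uniformity. x' = x \<longrightarrow> y \<in> S)"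

instance
proof
  fix x y z :: "'a ell2" and a b c :: real
  show "a *\<^sub>R (x + y) = a *\<^sub>R x + a *\<^sub>R y" by transfer (simp add: scaleR_add_right)
  show "(a + b) *\<^sub>R x = a *\<^sub>R x + b *\<^sub>R x" by transfer (simp add: scaleR_add_left)
  show "inner x y = inner y x" by (simp add: inner_ell2_def inner_commute)
  show "inner (x + y) z = inner x z + inner y z"
  proof -
    have "ev (x + y) n \<bullet> ev z n = ev x n \<bullet> ev z n + ev y n \<bullet> ev z n" for n
      by (simp add: plus_ell2.rep_eq inner_add_left)
    then show ?thesis by (simp add: inner_ell2_def infsum_add[OF inner_ev_summable inner_ev_summable])
  qed
  show "inner (c *\<^sub>R x) y = c * inner x y"
    by (simp add: inner_ell2_def scaleR_ell2.rep_eq infsum_cmult_right' del: scaleR_conv_of_real)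
  show "0 \<le> inner x x" by (simp add: inner_ell2_def infsum_nonneg)
  show "inner x x = 0 \<longleftrightarrow> x = 0"
  proof
    assume "inner x x = 0"
    then have "ev x n \<bullet> ev x n = 0" for n
      by (intro nonneg_infsum_le_0D[OF _ inner_ev_summable]) (auto simp: inner_ell2_def)
    then show "x = 0" by (intro ell2_eqI) (simp add: zero_ell2.rep_eq)
  qed (simp add: inner_ell2_def zero_ell2.rep_eq)
qed (simp_all add: dist_ell2_def norm_ell2_def sgn_ell2_def uniformity_ell2_def open_ell2_def
      ell2_eqI plus_ell2.rep_eq zero_ell2.rep_eq uminus_ell2.rep_eq minus_ell2.rep_eq
      scaleR_ell2.rep_eq algebra_simps)

end

lemmas ev_simps [simp] = plus_ell2.rep_eq zero_ell2.rep_eq uminus_ell2.rep_eq minus_ell2.rep_eq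
  scaleR_ell2.rep_eq

lemma norm_ell2_square: "(norm x)\<^sup>2 = (\<Sum>\<^sub>\<infinity>n. (cmod (ev x n))\<^sup>2)"
  by (simp add: power2_norm_eq_inner inner_ell2_def)

lemma norm_ell2_has_sum: "((\<lambda>n. (cmod (ev x n))\<^sup>2) has_sum (norm x)\<^sup>2) UNIV"
  using ev_square_summable[of x] by (simp add: norm_ell2_square)

lemma sum_le_norm_ell2: "finite S \<Longrightarrow> (\<Sum>n\<in>S. (cmod (ev x n))\<^sup>2) \<le> (norm x)\<^sup>2"
  unfolding norm_ell2_square by (intro finite_sum_le_infsum ev_square_summable) auto

lemma norm_ev_le: "cmod (ev x n) \<le> norm x"
  using sum_le_norm_ell2[of "{n}" x] by (simp add: power2_le_iff_abs_le)

lemma bounded_linear_ev: "bounded_linear (\<lambda>x. ev x n)"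
  by (rule bounded_linear_intro[where K = 1]) (auto simp: norm_ev_le)

lemmas ev_sum = linear_sum[OF bounded_linear.linear[OF bounded_linear_ev]]

lemma norm_ell2_le:
  assumes "0 \<le> C" "\<And>S. finite S \<Longrightarrow> (\<Sum>n\<in>S. (cmod (ev x n))\<^sup>2) \<le> C\<^sup>2"
  shows "norm x \<le> C"
proof -
  have "(norm x)\<^sup>2 \<le> C\<^sup>2"
    unfolding norm_ell2_square by (intro infsum_le_finite_sums ev_square_summable assms)
  then show ?thesis using assms(1) by (rule power2_le_imp_le)
qed

lemma square_summable_bdd:
  fixes f :: "'a \<Rightarrow> complex"
  assumes "\<And>S. finite S \<Longrightarrow> (\<Sum>n\<in>S. (cmod (f n))\<^sup>2) \<le> C"
  shows "(\<lambda>n. (cmod (f n))\<^sup>2) summable_on UNIV"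
  by (rule nonneg_bounded_partial_sums_imp_summable_on[where C = C])
     (auto intro!: eventually_finite_subsets_at_top_weakI assms)

text \<open>The coordinates of a Cauchy sequence converge, and bounds on finite partial sums survive
  the limit. This finite form of Fatou's lemma gives both square summability of the limit and
  convergence in norm.\<close>

instance ell2 :: (type) banach
proof
  fix X :: "nat \<Rightarrow> 'a ell2"
  assume X: "Cauchy X"
  have "Cauchy (\<lambda>k. ev (X k) n)" for n
    using bounded_linear.Cauchy[OF bounded_linear_ev X] .
  then have "\<exists>l. (\<lambda>k. ev (X k) n) \<longlonglongrightarrow> l" for n
    using Cauchy_convergent convergent_def by blast
  then obtain f where f: "\<And>n. (\<lambda>k. ev (X k) n) \<longlonglongrightarrow> f n" by metis
  have bound: "(\<Sum>n\<in>S. (cmod (f n - ev (X k) n))\<^sup>2) \<le> e\<^sup>2"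
    if "finite S" "0 \<le> e" "\<And>j. j \<ge> k \<Longrightarrow> norm (X j - X k) \<le> e" for S k e
  proof (rule tendsto_upperbound)
    show "(\<lambda>j. \<Sum>n\<in>S. (cmod (ev (X j) n - ev (X k) n))\<^sup>2) \<longlonglongrightarrow> (\<Sum>n\<in>S. (cmod (f n - ev (X k) n))\<^sup>2)"
      by (intro tendsto_intros f)
    have "(\<Sum>n\<in>S. (cmod (ev (X j) n - ev (X k) n))\<^sup>2) \<le> e\<^sup>2" if "j \<ge> k" for j
      using sum_le_norm_ell2[OF \<open>finite S\<close>, of "X j - X k"]
        power_mono[OF \<open>\<And>j. j \<ge> k \<Longrightarrow> norm (X j - X k) \<le> e\<close>[OF that], of 2] by simp
    then show "\<forall>\<^sub>F j in sequentially. (\<Sum>n\<in>S. (cmod (ev (X j) n - ev (X k) n))\<^sup>2) \<le> e\<^sup>2"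
      unfolding eventually_sequentially by blast
  qed simp
  have cau: "\<exists>k. \<forall>i\<ge>k. \<forall>j\<ge>i. norm (X j - X i) \<le> e" if "e > 0" for e
    using CauchyD[OF X that] by (metis less_imp_le order_trans)
  obtain k where k: "\<And>j. j \<ge> k \<Longrightarrow> norm (X j - X k) \<le> 1"
    using cau[of 1] by fastforce
  have "(\<lambda>n. (cmod (f n - ev (X k) n))\<^sup>2) summable_on UNIV"
    using bound[of _ 1 k] k by (intro square_summable_bdd[where C = 1]) auto
  from square_summable_add[OF this ev_square_summable[of "X k"]]
  have sf: "(\<lambda>n. (cmod (f n))\<^sup>2) summable_on UNIV" by simp
  define x where "x = Abs_ell2 f"
  have ev_x: "ev x = f" using sf by (simp add: x_def Abs_ell2_inverse)
  have "X \<longlonglongrightarrow> x"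
  proof (rule LIMSEQ_I)
    fix r :: real assume r: "r > 0"
    obtain k where k: "\<forall>i\<ge>k. \<forall>j\<ge>i. norm (X j - X i) \<le> r / 2" using cau[of "r / 2"] r by auto
    have "norm (x - X i) \<le> r / 2" if "i \<ge> k" for i
      using bound[of _ "r / 2" i] k that r by (intro norm_ell2_le) (auto simp: ev_x)
    then have "norm (X i - x) < r" if "i \<ge> k" for i
      using that r by (smt (verit) norm_minus_commute field_sum_of_halves)
    then show "\<exists>no. \<forall>i\<ge>no. norm (X i - x) < r" by blast
  qed
  then show "convergent X" unfolding convergent_def by blast
qed

definition restr :: "'a set \<Rightarrow> 'a ell2 \<Rightarrow> 'a ell2" where
  "restr S x = Abs_ell2 (\<lambda>n. if n \<in> S then ev x n else 0)"

lemma ev_restr [simp]: "ev (restr S x) n = (if n \<in> S then ev x n else 0)"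
proof -
  have "(\<lambda>n. (cmod (if n \<in> S then ev x n else 0))\<^sup>2) summable_on UNIV"
    by (rule summable_on_comparison_test[OF ev_square_summable[of x]]) auto
  then show ?thesis by (simp add: restr_def Abs_ell2_inverse)
qed

lemma norm_restr_le: "norm (restr S x) \<le> norm x"
proof (rule norm_ell2_le)
  fix F :: "'a set" assume "finite F"
  have "(\<Sum>n\<in>F. (cmod (ev (restr S x) n))\<^sup>2) \<le> (\<Sum>n\<in>F. (cmod (ev x n))\<^sup>2)"
    by (rule sum_mono) auto
  also have "\<dots> \<le> (norm x)\<^sup>2" by (rule sum_le_norm_ell2) fact
  finally show "(\<Sum>n\<in>F. (cmod (ev (restr S x) n))\<^sup>2) \<le> (norm x)\<^sup>2" .
qed simp

lemma bounded_linear_restr: "bounded_linear (restr S)"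
  by (rule bounded_linear_intro[where K = 1]) (auto intro: ell2_eqI simp: norm_restr_le)

lemma norm_finite_support:
  assumes "finite S" "\<And>n. n \<notin> S \<Longrightarrow> ev x n = 0"
  shows "(norm x)\<^sup>2 = (\<Sum>n\<in>S. (cmod (ev x n))\<^sup>2)"
proof -
  have "(\<Sum>\<^sub>\<infinity>n. (cmod (ev x n))\<^sup>2) = (\<Sum>\<^sub>\<infinity>n\<in>S. (cmod (ev x n))\<^sup>2)"
    by (rule infsum_cong_neutral) (auto simp: assms)
  then show ?thesis using assms(1) by (simp add: norm_ell2_square)
qed

lemma inner_finite_support:
  assumes "finite S" "\<And>n. n \<notin> S \<Longrightarrow> ev y n = 0"
  shows "x \<bullet> y = (\<Sum>n\<in>S. ev x n \<bullet> ev y n)"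
proof -
  have "(\<Sum>\<^sub>\<infinity>n. ev x n \<bullet> ev y n) = (\<Sum>\<^sub>\<infinity>n\<in>S. ev x n \<bullet> ev y n)"
    by (rule infsum_cong_neutral) (auto simp: assms)
  then show ?thesis using assms(1) by (simp add: inner_ell2_def)
qed

text \<open>The bound holds for every superset of \<open>S\<close>, so that the sets found for
  finitely many vectors can be united; \<open>uniform_restr_approx\<close> depends on this.\<close>

lemma restr_approx:
  assumes "e > 0"
  obtains S where "finite S" "\<And>S'. S \<subseteq> S' \<Longrightarrow> norm (x - restr S' x) \<le> e"
proof -
  have "\<forall>\<^sub>F S in finite_subsets_at_top UNIV. dist (\<Sum>n\<in>S. (cmod (ev x n))\<^sup>2) ((norm x)\<^sup>2) < e\<^sup>2"
    using norm_ell2_has_sum[of x] assms unfolding has_sum_def by (intro tendstoD) auto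
  then obtain S where S: "finite S" "dist (\<Sum>n\<in>S. (cmod (ev x n))\<^sup>2) ((norm x)\<^sup>2) < e\<^sup>2"
    by (auto simp: eventually_finite_subsets_at_top)
  have "norm (x - restr S' x) \<le> e" if "S \<subseteq> S'" for S'
  proof (rule norm_ell2_le)
    fix F :: "'a set" assume F: "finite F"
    have "(\<Sum>n\<in>F. (cmod (ev (x - restr S' x) n))\<^sup>2) \<le> (\<Sum>n\<in>F - S. (cmod (ev x n))\<^sup>2)"
      using F that by (subst sum.setdiff_irrelevant[symmetric]) (auto intro!: sum_mono2 sum_le_included[where i = id])
    also have "\<dots> = (\<Sum>n\<in>F \<union> S. (cmod (ev x n))\<^sup>2) - (\<Sum>n\<in>S. (cmod (ev x n))\<^sup>2)"
      using F S(1) by (subst sum_diff[symmetric]) (auto simp: Un_Diff)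
    also have "\<dots> \<le> (norm x)\<^sup>2 - (\<Sum>n\<in>S. (cmod (ev x n))\<^sup>2)"
      using sum_le_norm_ell2[of "F \<union> S" x] F S(1) by simp
    also have "\<dots> \<le> e\<^sup>2" using S(2) by (simp add: dist_real_def)
    finally show "(\<Sum>n\<in>F. (cmod (ev (x - restr S' x) n))\<^sup>2) \<le> e\<^sup>2" .
  qed (use assms in simp)
  with S(1) show ?thesis by (rule that)
qed

definition unit_ell2 :: "'a \<Rightarrow> complex \<Rightarrow> 'a ell2" where
  "unit_ell2 m c = Abs_ell2 (\<lambda>n. if n = m then c else 0)"

lemma ev_unit_ell2 [simp]: "ev (unit_ell2 m c) n = (if n = m then c else 0)"
proof -
  have "(cmod (if n = m then c else 0))\<^sup>2 = (if n = m then (cmod c)\<^sup>2 else 0)" for n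
    by simp
  then have "(\<lambda>n. (cmod (if n = m then c else 0))\<^sup>2) summable_on UNIV"
    by (intro square_summable_bdd[where C = "(cmod c)\<^sup>2"]) (simp add: sum.delta)
  then show ?thesis by (simp add: unit_ell2_def Abs_ell2_inverse)
qed

lemma norm_unit_ell2 [simp]: "norm (unit_ell2 m c) = cmod c"
  using norm_finite_support[of "{m}" "unit_ell2 m c"] by (simp add: power2_eq_iff_nonneg)

lemma bounded_linear_unit_ell2: "bounded_linear (unit_ell2 m)"
  by (rule bounded_linear_intro[where K = 1]) (auto intro: ell2_eqI)

lemma restr_eq_sum: "finite S \<Longrightarrow> restr S x = (\<Sum>n\<in>S. unit_ell2 n (ev x n))"
  by (rule ell2_eqI) (simp add: ev_sum sum.delta')

text \<open>Separability is what the Bochner integral and the measurability of sums, differences and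
  jointly continuous maps such as \<open>propag\<close> require. The dense set consists of finitely
  supported vectors with entries from a countable dense subset of the plane.\<close>

instance ell2 :: (countable) second_countable_topology
proof
  obtain Q :: "complex set" where Q: "countable Q" "\<And>X. open X \<Longrightarrow> X \<noteq> {} \<Longrightarrow> \<exists>d\<in>Q. d \<in> X"
    using countable_dense_setE by blast
  define D where "D = (\<Union>S\<in>{S :: 'a set. finite S}. (\<lambda>c. \<Sum>n\<in>S. unit_ell2 n (c n)) ` (PiE S (\<lambda>_. Q)))"
  have "countable D" unfolding D_def
    by (intro countable_UN countable_image countable_PiE Q(1)) (auto intro: countable_Collect_finite)
  have dense: "\<exists>d\<in>D. dist x d < e" if e: "e > 0" for x :: "'a ell2" and e
  proof -
    obtain S where S: "finite S" "norm (x - restr S x) \<le> e / 2"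
      using restr_approx[of "e / 2" x] e by (metis half_gt_zero order_refl)
    have "\<exists>q\<in>Q. q \<in> ball (ev x n) (e / (4 * (card S + 1)))" for n
      by (rule Q(2)) (use e in \<open>auto simp: not_le intro!: divide_pos_pos\<close>)
    then obtain q where q: "\<And>n. q n \<in> Q" "\<And>n. dist (ev x n) (q n) < e / (4 * (card S + 1))"
      by (metis mem_ball)
    define d where "d = (\<Sum>n\<in>S. unit_ell2 n (restrict q S n))"
    have "restrict q S \<in> PiE S (\<lambda>_. Q)" using q(1) by auto
    then have "d \<in> D" unfolding D_def d_def using S(1) by blast
    have "norm (restr S x - d) \<le> (\<Sum>n\<in>S. norm (unit_ell2 n (ev x n) - unit_ell2 n (q n)))"
    proof -
      have "restr S x - d = (\<Sum>n\<in>S. unit_ell2 n (ev x n) - unit_ell2 n (q n))"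
        unfolding d_def restr_eq_sum[OF S(1)] sum_subtractf by (simp cong: sum.cong)
      then show ?thesis by (simp only: norm_sum)
    qed
    also have "\<dots> = (\<Sum>n\<in>S. dist (ev x n) (q n))"
      by (intro sum.cong refl)
         (metis bounded_linear.linear[OF bounded_linear_unit_ell2] dist_norm linear_diff norm_unit_ell2)
    also have "\<dots> \<le> (\<Sum>n\<in>S. e / (4 * (card S + 1)))"
      by (intro sum_mono less_imp_le q(2))
    also have "\<dots> = e / 4 * (card S / (card S + 1))" by simp
    also have "\<dots> \<le> e / 4 * 1" using e by (intro mult_left_mono) auto
    finally have "norm (restr S x - d) \<le> e / 4" by simp
    then have "norm (x - d) < e"
      using S(2) norm_triangle_ineq[of "x - restr S x" "restr S x - d"] e by simp
    with \<open>d \<in> D\<close> show ?thesis by (auto simp: dist_norm)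
  qed
  define B where "B = (\<lambda>(d, k). ball d (1 / Suc k)) ` (D \<times> (UNIV :: nat set))"
  show "\<exists>B :: 'a ell2 set set. countable B \<and> open = generate_topology B"
  proof (intro exI conjI ext)
    show "countable B" unfolding B_def using \<open>countable D\<close> by auto
    fix X :: "'a ell2 set"
    show "open X = generate_topology B X"
    proof
      assume X: "open X"
      have "\<exists>b\<in>B. x \<in> b \<and> b \<subseteq> X" if "x \<in> X" for x
      proof -
        obtain e where e: "e > 0" "ball x e \<subseteq> X" using openE[OF X \<open>x \<in> X\<close>] by blast
        obtain k where k: "1 / Suc k < e / 2" using e(1) nat_approx_posE[of "e / 2"] by auto
        obtain d where d: "d \<in> D" "dist x d < 1 / Suc k" using dense[of "1 / Suc k" x] by auto
        have "ball d (1 / Suc k) \<subseteq> ball x e"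
        proof
          fix z assume "z \<in> ball d (1 / Suc k)"
          then show "z \<in> ball x e" using d(2) k dist_triangle[of x z d] by simp
        qed
        then show ?thesis using d e(2) unfolding B_def
          by (intro bexI[of _ "ball d (1 / Suc k)"]) (auto simp: dist_commute)
      qed
      then have "X = \<Union>{b \<in> B. b \<subseteq> X}" by blast
      moreover have "generate_topology B (\<Union>{b \<in> B. b \<subseteq> X})"
        by (rule generate_topology.UN) (auto intro: generate_topology.Basis)
      ultimately show "generate_topology B X" by simp
    next
      show "generate_topology B X \<Longrightarrow> open X"
        by (induction rule: generate_topology.induct) (auto simp: B_def)
    qed
  qed
qed

section \<open>Flows of bounded generators\<close>

text \<open>The exponential of a bounded skew operator. The condition
  \<open>x \<bullet> A x = 0\<close> is the real form of anti-selfadjointness and makes the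
  exponential norm preserving.\<close>

locale bounded_generator =
  fixes A :: "'a::{real_inner,banach} \<Rightarrow> 'a" and M :: real
  assumes linear_A: "linear A" and norm_A_le: "norm (A x) \<le> M * norm x" and M_nonneg: "0 \<le> M"
    and skew_A: "x \<bullet> A x = 0"
begin

definition flow :: "real \<Rightarrow> 'a \<Rightarrow> 'a" where
  "flow t x = (\<Sum>k. (t ^ k / fact k) *\<^sub>R (A ^^ k) x)"

lemma bounded_linear_A: "bounded_linear A"
  using linear_A norm_A_le by (auto simp: linear_conv_bounded_linear intro!: bounded_linear_intro[where K = M]
      simp: linear_add linear_scale mult.commute)

lemma norm_power_A_le: "norm ((A ^^ k) x) \<le> M ^ k * norm x"
proof (induction k)
  case (Suc k)
  have "norm ((A ^^ Suc k) x) \<le> M * norm ((A ^^ k) x)" using norm_A_le by simp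
  also have "\<dots> \<le> M * (M ^ k * norm x)" using Suc M_nonneg by (rule mult_left_mono)
  finally show ?case by (simp add: mult.assoc)
qed simp

lemma linear_power_A: "linear (A ^^ k)"
  by (induction k) (auto intro!: linearI simp: linear_add linear_scale linear_add[OF linear_A] linear_scale[OF linear_A])

lemma summable_exp_bound: "summable (\<lambda>k. (R * M) ^ k / fact k * c)" for R c :: real
  using summable_mult2[OF summable_exp[of "R * M"], of c] by (simp add: field_simps)

lemma norm_flow_term_le:
  assumes "\<bar>t\<bar> \<le> R"
  shows "norm ((t ^ k / fact k) *\<^sub>R (A ^^ k) x) \<le> (R * M) ^ k / fact k * norm x"
proof -
  have "norm ((t ^ k / fact k) *\<^sub>R (A ^^ k) x) = \<bar>t\<bar> ^ k / fact k * norm ((A ^^ k) x)"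
    by (simp add: power_abs)
  also have "\<dots> \<le> R ^ k / fact k * (M ^ k * norm x)"
    using assms by (intro mult_mono divide_right_mono power_mono norm_power_A_le) auto
  finally show ?thesis by (simp add: power_mult_distrib)
qed

lemma flow_summable: "summable (\<lambda>k. (t ^ k / fact k) *\<^sub>R (A ^^ k) x)"
  by (rule summable_comparison_test'[OF summable_exp_bound[of "\<bar>t\<bar>" "norm x"]])
     (rule norm_flow_term_le, simp)

lemma linear_flow: "linear (flow t)"
proof
  show "flow t (x + y) = flow t x + flow t y" for x y
    unfolding flow_def by (simp add: linear_add[OF linear_power_A] scaleR_add_right
        suminf_add[OF flow_summable flow_summable])
  show "flow t (c *\<^sub>R x) = c *\<^sub>R flow t x" for c x
    unfolding flow_def using flow_summable[of t x]
    by (simp add: linear_scale[OF linear_power_A] suminf_scaleR_right mult.commute)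
qed

lemma flow_0 [simp]: "flow 0 x = x"
proof -
  have "flow 0 x = (\<Sum>k. if k = 0 then x else 0)"
    unfolding flow_def by (rule suminf_cong) auto
  also have "\<dots> = x" by (subst suminf_finite[where N = "{0}"]) auto
  finally show ?thesis .
qed

lemma flow_A_commute: "flow t (A x) = A (flow t x)"
proof -
  have "A (flow t x) = (\<Sum>k. A ((t ^ k / fact k) *\<^sub>R (A ^^ k) x))"
    unfolding flow_def by (rule bounded_linear.suminf[OF bounded_linear_A flow_summable])
  then show ?thesis
    by (simp add: flow_def linear_scale[OF linear_A] funpow_swap1)
qed

text \<open>Termwise differentiation on a bounded interval around \<open>t\<close>: the derivative
  of term \<open>k + 1\<close> is term \<open>k\<close> of the series of \<open>A x\<close>, which
  converges uniformly there by the M-test.\<close>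

lemma flow_has_vector_derivative:
  "((\<lambda>t. flow t x) has_vector_derivative A (flow t x)) (at t)"
proof -
  define R where "R = \<bar>t\<bar> + 1"
  define S where "S = {-R <..< R}"
  define f where "f k t = (t ^ k / fact k) *\<^sub>R (A ^^ k) x" for k and t :: real
  define f' where "f' k t = (if k = 0 then 0 else (t ^ (k - 1) / fact (k - 1)) *\<^sub>R (A ^^ k) x)"
    for k and t :: real
  have f'_Suc: "f' (Suc k) t = (t ^ k / fact k) *\<^sub>R (A ^^ k) (A x)" for k t
    by (simp add: f'_def funpow_swap1)
  have deriv: "(f k has_derivative (\<lambda>h. h *\<^sub>R f' k t)) (at t within S)" for k t
  proof (cases k)
    case (Suc j)
    have "((\<lambda>t. t ^ Suc j / fact (Suc j)) has_real_derivative (t ^ j / fact j)) (at t within S)"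
      by (rule derivative_eq_intros refl | simp)+
    from has_vector_derivative_scaleR[OF this has_vector_derivative_const[of "(A ^^ k) x"]]
    show ?thesis unfolding has_vector_derivative_def f_def f'_def Suc by simp
  next
    case 0
    have "f 0 = (\<lambda>t. x)" by (auto simp: f_def)
    then show ?thesis by (simp add: 0 f'_def)
  qed
  have "uniform_limit S (\<lambda>n t. \<Sum>k<n. f' (Suc k) t) (\<lambda>t. \<Sum>k. f' (Suc k) t) sequentially"
    unfolding f'_Suc
    by (rule Weierstrass_m_test[OF norm_flow_term_le[where R = R] summable_exp_bound])
       (auto simp: S_def)
  then have lim: "uniform_limit S (\<lambda>n t. \<Sum>k<n. f' (Suc k) t) (\<lambda>t. A (flow t x)) sequentially"
    by (simp add: f'_Suc flow_def[symmetric] flow_A_commute)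
  have "\<exists>g. \<forall>t\<in>S. (\<lambda>k. f k t) sums g t \<and> (g has_derivative (\<lambda>h. h *\<^sub>R A (flow t x))) (at t within S)"
  proof (rule has_derivative_series)
    show "convex S" by (simp add: S_def)
    show "(f k has_derivative (\<lambda>h. h *\<^sub>R f' k t)) (at t within S)" for k t by (rule deriv)
    show "0 \<in> S" by (auto simp: S_def R_def)
    show "(\<lambda>k. f k 0) sums flow 0 x"
      unfolding f_def flow_def by (rule summable_sums[OF flow_summable])
    fix e :: real assume e: "e > 0"
    from uniform_limitD[OF lim e] obtain N
      where N: "\<And>n t. n \<ge> N \<Longrightarrow> t \<in> S \<Longrightarrow> dist (\<Sum>k<n. f' (Suc k) t) (A (flow t x)) < e"
      unfolding eventually_sequentially by blast
    show "\<forall>\<^sub>F n in sequentially. \<forall>t\<in>S. \<forall>h. norm ((\<Sum>k<n. h *\<^sub>R f' k t) - h *\<^sub>R A (flow t x)) \<le> e * norm h"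
      unfolding eventually_sequentially
    proof (intro exI allI impI ballI)
      \<comment> \<open>The term of index 0 is constant in time and has derivative 0, so one index
        is lost against the series of \<open>A x\<close>.\<close>
      fix n t and h :: real assume n: "Suc N \<le> n" and t: "t \<in> S"
      then obtain m where m: "n = Suc m" "m \<ge> N" by (cases n) auto
      have "(\<Sum>k<n. f' k t) = (\<Sum>k<m. f' (Suc k) t)"
        unfolding m(1) sum.lessThan_Suc_shift by (simp add: f'_def)
      then have "norm ((\<Sum>k<n. h *\<^sub>R f' k t) - h *\<^sub>R A (flow t x))
          = \<bar>h\<bar> * dist (\<Sum>k<m. f' (Suc k) t) (A (flow t x))"
        by (simp add: scaleR_sum_right[symmetric] scaleR_diff_right[symmetric] dist_norm)
      also have "\<dots> \<le> \<bar>h\<bar> * e" using N[OF m(2) t] by (intro mult_left_mono) auto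
      finally show "norm ((\<Sum>k<n. h *\<^sub>R f' k t) - h *\<^sub>R A (flow t x)) \<le> e * norm h"
        by (simp add: mult.commute)
    qed
  qed
  then obtain g where g: "\<And>t. t \<in> S \<Longrightarrow> (\<lambda>k. f k t) sums g t"
      "\<And>t. t \<in> S \<Longrightarrow> (g has_derivative (\<lambda>h. h *\<^sub>R A (flow t x))) (at t within S)" by blast
  have "t \<in> S" "open S" by (auto simp: S_def R_def)
  moreover have "g s = flow s x" if "s \<in> S" for s
    using g(1)[OF that] unfolding f_def flow_def by (rule sums_unique)
  ultimately show ?thesis unfolding has_vector_derivative_def
    using has_derivative_transform_within_open[OF _ \<open>open S\<close> \<open>t \<in> S\<close>, of g]
      g(2)[of t] at_within_open[OF \<open>t \<in> S\<close> \<open>open S\<close>] by metis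
qed

text \<open>By skewness the derivative of \<open>z t \<bullet> z t\<close> is zero. Applied to a
  difference of two solutions, this is also the uniqueness theorem for the equation z' = A
  z.\<close>

lemma generator_solution_norm:
  assumes "\<And>t. (z has_vector_derivative A (z t)) (at t)"
  shows "norm (z t) = norm (z s)"
proof -
  have "((\<lambda>t. z t \<bullet> z t) has_derivative (\<lambda>h. 0)) (at t)" for t
  proof -
    have "((\<lambda>t. z t \<bullet> z t) has_derivative (\<lambda>h. z t \<bullet> (h *\<^sub>R A (z t)) + (h *\<^sub>R A (z t)) \<bullet> z t)) (at t)"
      using assms[of t] unfolding has_vector_derivative_def by (intro has_derivative_inner)
    then show ?thesis by (simp add: inner_commute skew_A)
  qed
  then have "z t \<bullet> z t = z s \<bullet> z s"
    using has_derivative_zero_unique[of UNIV "\<lambda>t. z t \<bullet> z t" t s] by simp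
  then show ?thesis by (simp add: norm_eq_sqrt_inner)
qed

lemma norm_flow [simp]: "norm (flow t x) = norm x"
  using generator_solution_norm[OF flow_has_vector_derivative, of t x 0] by simp

text \<open>As functions of \<open>s\<close> both sides solve z' = A z and agree at 0, so their
  difference has constant norm 0.\<close>

lemma flow_flow [simp]: "flow s (flow t x) = flow (s + t) x"
proof -
  define z where "z s = flow s (flow t x) - flow (s + t) x" for s
  have "((\<lambda>s. flow (s + t) x) has_vector_derivative A (flow (s + t) x)) (at s)" for s
    using vector_diff_chain_at[of "\<lambda>s. s + t" 1 s "\<lambda>t. flow t x" "A (flow (s + t) x)"]
      flow_has_vector_derivative[of x "s + t"]
      has_vector_derivative_add[OF has_vector_derivative_id[of "at s"] has_vector_derivative_const[of t "at s"]]
    by (auto simp: comp_def)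
  then have "(z has_vector_derivative A (z s)) (at s)" for s
    unfolding z_def linear_diff[OF linear_A]
    by (intro has_vector_derivative_diff flow_has_vector_derivative)
  from generator_solution_norm[OF this, of s 0] show ?thesis by (simp add: z_def)
qed

lemma flow_add: "flow t (x + y) = flow t x + flow t y"
  and flow_diff: "flow t (x - y) = flow t x - flow t y"
  and flow_zero [simp]: "flow t 0 = 0"
  and flow_scaleR: "flow t (c *\<^sub>R x) = c *\<^sub>R flow t x"
  and flow_sum: "flow t (\<Sum>i\<in>I. f i) = (\<Sum>i\<in>I. flow t (f i))"
  using linear_flow by (simp_all add: linear_add linear_diff linear_0 linear_scale linear_sum)

lemma flow_inner_flow [simp]: "flow t x \<bullet> flow t y = x \<bullet> y"
proof -
  have "x \<bullet> y = ((norm (x + y))\<^sup>2 - (norm x)\<^sup>2 - (norm y)\<^sup>2) / 2" for x y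
    by (simp add: power2_norm_eq_inner inner_add inner_commute)
  from this[of "flow t x" "flow t y"] this[of x y] show ?thesis by (simp add: flow_add[symmetric])
qed

lemma flow_inner_left: "flow t x \<bullet> y = x \<bullet> flow (- t) y"
  using flow_inner_flow[of t x "flow (- t) y"] by simp

text \<open>The mean value inequality; a norm-Lipschitz flow reflects the boundedness of the
  generator. It yields joint continuity of the flow and, through \<open>cut_off_solution\<close>,
  the Lipschitz bound behind the decay of the sup norm.\<close>

lemma norm_flow_diff_le: "norm (flow t x - flow s x) \<le> M * norm x * \<bar>t - s\<bar>"
proof -
  have bound: "norm (flow b x - flow a x) \<le> M * norm x * (b - a)" if "a < b" for a b
  proof -
    have "norm (flow b x - flow a x) \<le> M * norm x * b - M * norm x * a"
    proof (rule differentiable_bound_general[OF that])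
      show "continuous_on {a..b} (\<lambda>t. flow t x)"
        using flow_has_vector_derivative by (meson continuous_at_imp_continuous_on has_vector_derivative_continuous)
      show "((\<lambda>t. M * norm x * t) has_vector_derivative M * norm x) (at u)" for u
        using has_vector_derivative_mult_right[OF has_vector_derivative_id, of "M * norm x"] by simp
      show "norm (A (flow u x)) \<le> M * norm x" for u using norm_A_le[of "flow u x"] by simp
    qed (auto intro!: continuous_intros flow_has_vector_derivative)
    then show ?thesis by (simp add: algebra_simps)
  qed
  show ?thesis
    using bound[of s t] bound[of t s] by (cases s t rule: linorder_cases) (auto simp: norm_minus_commute)
qed

lemma continuous_flow: "continuous_on UNIV (\<lambda>(t, x). flow t x)"
proof -
  have "\<exists>d>0. \<forall>p. dist p (t, x) < d \<longrightarrow> dist (flow (fst p) (snd p)) (flow t x) < e"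
    if e: "e > 0" for t x and e :: real
  proof -
    define d where "d = e / (2 * (M * norm x + 1))"
    have nn: "0 \<le> M * norm x" using M_nonneg by simp
    then have d: "d > 0" "d * (2 * (M * norm x + 1)) = e" using e by (auto simp: d_def intro!: divide_pos_pos)
    have "dist (flow (fst p) (snd p)) (flow t x) < e" if p: "dist p (t, x) < min d (e / 2)" for p
    proof -
      obtain s y where p_eq: "p = (s, y)" by fastforce
      have *: "\<bar>s - t\<bar> \<le> d" "norm (y - x) < e / 2"
        using p dist_fst_le[of p "(t, x)"] dist_snd_le[of p "(t, x)"]
        by (auto simp: p_eq dist_norm)
      then have "norm (flow s y - flow s x) < e / 2" "norm (flow s x - flow t x) \<le> M * norm x * d"
        using norm_flow_diff_le[of s x t] mult_left_mono[OF *(1) nn]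
        by (auto simp: linear_diff[OF linear_flow, symmetric])
      moreover have "M * norm x * d \<le> e / 2" using d by (simp add: field_simps)
      ultimately show ?thesis
        using norm_triangle_ineq[of "flow s y - flow s x" "flow s x - flow t x"]
        by (simp add: p_eq dist_norm)
    qed
    then show ?thesis using d e by (intro exI[of _ "min d (e / 2)"]) auto
  qed
  then show ?thesis unfolding continuous_on_iff case_prod_beta
    by (metis prod.collapse)
qed

lemma continuous_on_flow [continuous_intros]:
  fixes f :: "'b::topological_space \<Rightarrow> real"
  assumes "continuous_on S f" "continuous_on S g"
  shows "continuous_on S (\<lambda>s. flow (f s) (g s))"
  using continuous_on_compose2[OF continuous_flow continuous_on_Pair[OF assms]] by simp

end

section \<open>The unitary group of the discrete Laplacian\<close>

definition cmul :: "complex \<Rightarrow> 'a ell2 \<Rightarrow> 'a ell2" where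
  "cmul c x = Abs_ell2 (\<lambda>n. c * ev x n)"

lemma ev_cmul [simp]: "ev (cmul c x) n = c * ev x n"
  using square_summable_cmult[OF ev_square_summable, of c x] by (simp add: cmul_def Abs_ell2_inverse)

definition shift :: "'a \<Rightarrow> 'a::ab_group_add ell2 \<Rightarrow> 'a ell2" where
  "shift v x = Abs_ell2 (\<lambda>n. ev x (n + v))"

lemma bij_add_right: "bij_betw (\<lambda>n. n + v) UNIV (UNIV :: 'a::ab_group_add set)"
  by (rule bij_betwI[where g = "\<lambda>n. n - v"]) auto

lemma ev_shift [simp]: "ev (shift v x) n = ev x (n + v)"
proof -
  have "(\<lambda>n. (cmod (ev x (n + v)))\<^sup>2) summable_on UNIV"
    using summable_on_reindex_bij_betw[OF bij_add_right, of "\<lambda>n. (cmod (ev x n))\<^sup>2" v] ev_square_summable[of x]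
    by simp
  then show ?thesis by (simp add: shift_def Abs_ell2_inverse)
qed

lemma inner_shift: "shift v x \<bullet> shift v y = x \<bullet> y"
  unfolding inner_ell2_def
  using infsum_reindex_bij_betw[OF bij_add_right, of "\<lambda>n. ev x n \<bullet> ev y n" v] by simp

lemma norm_shift [simp]: "norm (shift v x) = norm x"
  by (simp add: norm_eq_sqrt_inner inner_shift)

lemma inner_imaginary: "cmul \<i> x \<bullet> y = - (x \<bullet> cmul \<i> y)"
proof -
  have "ev (cmul \<i> x) n \<bullet> ev y n = - (ev x n \<bullet> ev (cmul \<i> y) n)" for n
    by (simp add: inner_complex_def)
  then show ?thesis by (simp add: inner_ell2_def infsum_uminus)
qed

lemma norm_cmul_i [simp]: "norm (cmul \<i> x) = norm x"
proof -
  have "cmul \<i> (cmul \<i> x) = - x" by (rule ell2_eqI) simp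
  then show ?thesis by (simp add: norm_eq_sqrt_inner inner_imaginary)
qed

text \<open>The factor i belongs to the generator, so that \<open>flow\<close> is the group
  generated by i times the Laplacian, and skewness expresses the symmetry of the Laplacian.\<close>

definition i_laplacian :: "(int ^ 'd) ell2 \<Rightarrow> (int ^ 'd::finite) ell2" where
  "i_laplacian x = cmul \<i> (\<Sum>j\<in>UNIV. shift (axis j 1) x + shift (- axis j 1) x - 2 *\<^sub>R x)"

lemma ev_i_laplacian: "ev (i_laplacian x) n = \<i> * discrete_laplacian (ev x) n"
  by (simp add: i_laplacian_def discrete_laplacian_def ev_sum scaleR_conv_of_real)

lemma cmul_sum: "cmul c (\<Sum>j\<in>I. f j) = (\<Sum>j\<in>I. cmul c (f j))"
  by (rule ell2_eqI) (simp add: ev_sum sum_distrib_left)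

lemma linear_i_laplacian: "linear i_laplacian"
  by (rule linearI; rule ell2_eqI)
     (simp_all add: ev_i_laplacian discrete_laplacian_def algebra_simps sum.distrib sum_subtractf
       scaleR_conv_of_real sum_distrib_left)

lemma norm_i_laplacian_le: "norm (i_laplacian x :: (int ^ 'd) ell2) \<le> 4 * real CARD('d::finite) * norm x"
proof -
  have "norm (\<Sum>j\<in>(UNIV :: 'd set). shift (axis j 1) x + shift (- axis j 1) x - 2 *\<^sub>R x)
      \<le> (\<Sum>j\<in>(UNIV :: 'd set). 4 * norm x)"
  proof (rule sum_norm_le)
    fix j :: 'd
    show "norm (shift (axis j 1) x + shift (- axis j 1) x - 2 *\<^sub>R x) \<le> 4 * norm x"
      using norm_triangle_ineq4[of "shift (axis j 1) x + shift (- axis j 1) x" "2 *\<^sub>R x"]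
        norm_triangle_ineq[of "shift (axis j 1) x" "shift (- axis j 1) x"] by simp
  qed
  then show ?thesis by (simp add: i_laplacian_def mult_ac)
qed

text \<open>The shifts by \<open>v\<close> and \<open>- v\<close> are adjoint to each other, while
  multiplication by i is antisymmetric for \<open>\<bullet>\<close>. The contributions of the two
  neighbours in each direction therefore cancel.\<close>

lemma skew_i_laplacian: "x \<bullet> i_laplacian x = 0"
proof -
  have self: "x \<bullet> cmul \<i> x = 0"
    using inner_imaginary[of x x] by (simp add: inner_commute)
  have "x \<bullet> cmul \<i> (shift v x + shift (- v) x - 2 *\<^sub>R x) = 0" for v
  proof -
    have "cmul \<i> (shift v x + shift (- v) x - 2 *\<^sub>R x)
        = cmul \<i> (shift v x) + cmul \<i> (shift (- v) x) - 2 *\<^sub>R cmul \<i> x"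
      by (rule ell2_eqI) (simp add: algebra_simps scaleR_conv_of_real)
    moreover have "x \<bullet> cmul \<i> (shift (- v) x) = shift v x \<bullet> cmul \<i> x"
    proof -
      have "shift v (cmul \<i> (shift (- v) x)) = cmul \<i> x" by (rule ell2_eqI) simp
      then show ?thesis using inner_shift[of v x "cmul \<i> (shift (- v) x)"] by simp
    qed
    ultimately show ?thesis
      using inner_imaginary[of x "shift v x"]
      by (simp add: inner_add inner_diff self inner_commute)
  qed
  then show ?thesis by (simp add: i_laplacian_def cmul_sum inner_sum_right)
qed

interpretation sg: bounded_generator "i_laplacian :: (int ^ 'd::finite) ell2 \<Rightarrow> _" "4 * real CARD('d)"
  by (intro bounded_generator.intro linear_i_laplacian norm_i_laplacian_le skew_i_laplacian) simp

abbreviation propag :: "real \<Rightarrow> (int ^ 'd::finite) ell2 \<Rightarrow> (int ^ 'd) ell2" where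
  "propag \<equiv> sg.flow"

lemma discrete_laplacian_cmult: "discrete_laplacian (\<lambda>n. c * f n) n = c * discrete_laplacian f n"
  by (simp add: discrete_laplacian_def sum_distrib_left algebra_simps)

lemma discrete_laplacian_power_cmult:
  "(discrete_laplacian ^^ k) (\<lambda>n. c * f n) n = c * (discrete_laplacian ^^ k) f n"
proof (induction k arbitrary: n)
  case (Suc k)
  then have "(discrete_laplacian ^^ k) (\<lambda>n. c * f n) = (\<lambda>n. c * (discrete_laplacian ^^ k) f n)" by blast
  then show ?case by (simp add: discrete_laplacian_cmult)
qed simp

lemma ev_power_i_laplacian: "ev ((i_laplacian ^^ k) x) n = \<i> ^ k * (discrete_laplacian ^^ k) (ev x) n"
proof (induction k arbitrary: n)
  case (Suc k)
  then have "ev ((i_laplacian ^^ k) x) = (\<lambda>n. \<i> ^ k * (discrete_laplacian ^^ k) (ev x) n)" by blast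
  then show ?case by (simp add: ev_i_laplacian discrete_laplacian_cmult)
qed simp

lemma schroedinger_group_eq_propag: "schroedinger_group t (ev x) n = ev (propag t x) n"
proof -
  have "ev (propag t x) n = (\<Sum>k. ev ((t ^ k / fact k) *\<^sub>R (i_laplacian ^^ k) x) n)"
    unfolding sg.flow_def by (rule bounded_linear.suminf[OF bounded_linear_ev sg.flow_summable])
  then show ?thesis
    by (simp add: schroedinger_group_def ev_power_i_laplacian scaleR_conv_of_real power_mult_distrib mult_ac)
qed

lemma schroedinger_group_sums:
  "(\<lambda>k. (\<i> * complex_of_real t) ^ k / fact k * (discrete_laplacian ^^ k) (ev x) n) sums ev (propag t x) n"
proof -
  have "(\<lambda>k. ev ((t ^ k / fact k) *\<^sub>R (i_laplacian ^^ k) x) n) sums ev (propag t x) n"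
    unfolding sg.flow_def
    by (rule bounded_linear.sums[OF bounded_linear_ev summable_sums[OF sg.flow_summable]])
  then show ?thesis
    by (simp add: ev_power_i_laplacian scaleR_conv_of_real power_mult_distrib mult_ac)
qed

text \<open>The abstract flow is only known to be real linear; complex homogeneity is read off from
  its series at each site.\<close>

lemma propag_cmul: "propag t (cmul c x) = cmul c (propag t x)"
proof (rule ell2_eqI)
  fix n
  have "ev (cmul c x) = (\<lambda>n. c * ev x n)" by auto
  then have "(\<lambda>k. c * ((\<i> * complex_of_real t) ^ k / fact k * (discrete_laplacian ^^ k) (ev x) n))
      sums ev (propag t (cmul c x)) n"
    using schroedinger_group_sums[of t "cmul c x" n] by (simp add: discrete_laplacian_power_cmult mult_ac)
  from sums_unique2[OF this sums_mult[OF schroedinger_group_sums]]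
  show "ev (propag t (cmul c x)) n = ev (cmul c (propag t x)) n" by simp
qed

section \<open>The dispersive estimate\<close>

lemma has_vector_derivative_cis_compose:
  assumes "(\<phi> has_real_derivative g) (at x)"
  shows "((\<lambda>x. cis (\<phi> x)) has_vector_derivative (\<i> * of_real g * cis (\<phi> x))) (at x)"
proof -
  have "((\<lambda>x. exp (\<i> * complex_of_real (\<phi> x))) has_vector_derivative
      (\<i> * of_real g * exp (\<i> * complex_of_real (\<phi> x)))) (at x)"
    using field_vector_diff_chain_at[OF has_vector_derivative_mult_right[OF has_vector_derivative_of_real[OF assms], of \<i>] DERIV_exp]
    by (simp add: comp_def)
  then show ?thesis by (simp add: cis_conv_exp)
qed

text \<open>Integration by parts against 1/g. As \<open>g' \<le> 0\<close>, the modulus of the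
  remainder, \<open>- g' / g^2\<close>, is the derivative of \<open>1 / g\<close>, so its integral
  telescopes to at most 2/l; the two boundary terms add 1/l each.\<close>

lemma van_der_Corput_1:
  fixes \<phi> g g' :: "real \<Rightarrow> real"
  assumes "a \<le> b" "l > 0"
    and \<phi>: "\<And>x. x \<in> {a..b} \<Longrightarrow> (\<phi> has_real_derivative g x) (at x)"
    and g: "\<And>x. x \<in> {a..b} \<Longrightarrow> (g has_real_derivative g' x) (at x)"
    and g': "\<And>x. x \<in> {a..b} \<Longrightarrow> g' x \<le> 0"
    and lower: "\<And>x. x \<in> {a..b} \<Longrightarrow> l \<le> \<bar>g x\<bar>"
  shows "cmod (integral {a..b} (\<lambda>x. cis (\<phi> x))) \<le> 4 / l"
proof (cases "a = b")
  case False
  then have ab: "a < b" using assms(1) by simp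
  have g_nz: "g x \<noteq> 0" if "x \<in> {a..b}" for x using lower[OF that] \<open>l > 0\<close> by auto
  have cont: "continuous_on {a..b} (\<lambda>x. cis (\<phi> x))"
    by (intro continuous_at_imp_continuous_on ballI)
       (metis \<phi> has_vector_derivative_cis_compose has_vector_derivative_continuous)
  define E where "E x = - \<i> * (cis (\<phi> x) * inverse (of_real (g x)))" for x
  define F where "F x = integral {a..x} (\<lambda>x. cis (\<phi> x)) - E x" for x
  have inv_le: "\<bar>1 / g x\<bar> \<le> 1 / l" if "x \<in> {a..b}" for x
    using lower[OF that] \<open>l > 0\<close> by (simp add: abs_divide frac_le)
  have quot: "(E has_vector_derivative cis (\<phi> x) + \<i> * (cis (\<phi> x) * of_real (g' x / (g x)\<^sup>2))) (at x)"
    if x: "x \<in> {a..b}" for x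
  proof -
    have "((\<lambda>x. inverse (of_real (g x) :: complex)) has_vector_derivative of_real (- (g' x / (g x)\<^sup>2))) (at x)"
      unfolding of_real_inverse[symmetric]
      using DERIV_inverse_fun[OF g[OF x] g_nz[OF x]]
      by (intro has_vector_derivative_of_real) (simp add: power2_eq_square field_simps)
    from has_vector_derivative_mult[OF has_vector_derivative_cis_compose[OF \<phi>[OF x]] this]
    have "((\<lambda>x. cis (\<phi> x) * inverse (of_real (g x) :: complex)) has_vector_derivative
       (cis (\<phi> x) * of_real (- (g' x / (g x)\<^sup>2)) + \<i> * of_real (g x) * cis (\<phi> x) * inverse (of_real (g x)))) (at x)" .
    from has_vector_derivative_mult_right[OF this, of "- \<i>"] g_nz[OF x]
    show ?thesis unfolding E_def by (simp add: algebra_simps)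
  qed
  have "norm (F b - F a) \<le> 1 / g b - 1 / g a"
  proof (rule differentiable_bound_general[OF ab])
    show "continuous_on {a..b} F"
      unfolding F_def
      by (intro continuous_on_diff indefinite_integral_continuous_1 integrable_continuous_real cont
          continuous_at_imp_continuous_on ballI)
         (metis quot has_vector_derivative_continuous)
    show "continuous_on {a..b} (\<lambda>x. 1 / g x)"
      using g g_nz by (intro continuous_intros continuous_at_imp_continuous_on ballI) (auto intro: DERIV_isCont)
    fix x assume x: "a < x" "x < b"
    then have x': "x \<in> {a..b}" by simp
    have "((\<lambda>x. integral {a..x} (\<lambda>x. cis (\<phi> x))) has_vector_derivative cis (\<phi> x)) (at x)"
      using integral_has_vector_derivative[OF cont x'] x at_within_interior[of x "{a..b}"] by auto
    from has_vector_derivative_diff[OF this quot[OF x']]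
    show "(F has_vector_derivative - (\<i> * (cis (\<phi> x) * of_real (g' x / (g x)\<^sup>2)))) (at x)"
      unfolding F_def by simp
    show "((\<lambda>x. 1 / g x) has_vector_derivative (- g' x / (g x)\<^sup>2)) (at x)"
      using DERIV_inverse_fun[OF g[OF x'] g_nz[OF x']]
      by (simp add: has_real_derivative_iff_has_vector_derivative inverse_eq_divide power2_eq_square field_simps)
    show "norm (- (\<i> * (cis (\<phi> x) * of_real (g' x / (g x)\<^sup>2)))) \<le> - g' x / (g x)\<^sup>2"
      using g'[OF x'] by (simp add: norm_mult norm_divide norm_power)
  qed
  also have "\<dots> \<le> 1 / l + 1 / l"
  proof -
    have "\<bar>1 / g a\<bar> \<le> 1 / l" "\<bar>1 / g b\<bar> \<le> 1 / l" using inv_le ab by auto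
    then show ?thesis by linarith
  qed
  finally have 1: "norm (F b - F a) \<le> 2 / l" by simp
  have 2: "norm (E x) \<le> 1 / l" if "x \<in> {a..b}" for x
    using inv_le[OF that] by (simp add: E_def norm_mult norm_divide inverse_eq_divide abs_divide)
  have "integral {a..b} (\<lambda>x. cis (\<phi> x)) = (F b - F a) + E b - E a"
    by (simp add: F_def)
  also have "norm \<dots> \<le> 2 / l + 1 / l + 1 / l"
    using ab by (intro norm_triangle_le_diff norm_triangle_le add_mono 1 2) auto
  finally show ?thesis by simp
qed (use assms in auto)

text \<open>The derivative \<open>g\<close> decreases at rate at least \<open>\<mu>\<close>, so it
  is large outside a short interval around one point. The two outer parts are covered by
  \<open>van_der_Corput_1\<close>, 4 each, and the middle by its length, 2.\<close>

lemma van_der_Corput_2: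
  fixes \<phi> g g' :: "real \<Rightarrow> real"
  assumes "a \<le> b" "\<mu> > 0"
    and \<phi>: "\<And>x. x \<in> {a..b} \<Longrightarrow> (\<phi> has_real_derivative g x) (at x)"
    and g: "\<And>x. x \<in> {a..b} \<Longrightarrow> (g has_real_derivative g' x) (at x)"
    and g': "\<And>x. x \<in> {a..b} \<Longrightarrow> g' x \<le> - \<mu>"
  shows "cmod (integral {a..b} (\<lambda>x. cis (\<phi> x))) \<le> 10 / sqrt \<mu>"
proof -
  have cont: "continuous_on {a..b} (\<lambda>x. cis (\<phi> x))"
    by (intro continuous_at_imp_continuous_on ballI)
       (metis \<phi> has_vector_derivative_cis_compose has_vector_derivative_continuous)
  have slope: "g y - g x \<le> - \<mu> * (y - x)" if "a \<le> x" "x \<le> y" "y \<le> b" for x y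
  proof -
    have "g y + \<mu> * y \<le> g x + \<mu> * x"
    proof (rule DERIV_nonpos_imp_nonincreasing[of x y "\<lambda>x. g x + \<mu> * x"])
      fix z assume z: "x \<le> z" "z \<le> y"
      then have z': "z \<in> {a..b}" using that by auto
      show "\<exists>d. ((\<lambda>x. g x + \<mu> * x) has_real_derivative d) (at z) \<and> d \<le> 0"
        using g'[OF z'] by (intro exI[of _ "g' z + \<mu>"]) (auto intro!: derivative_eq_intros g[OF z'])
    qed (use that in auto)
    then show ?thesis by (simp add: algebra_simps)
  qed
  \<comment> \<open>\<open>c\<close> is the zero of \<open>g\<close> if \<open>g\<close> changes
    sign, and otherwise the endpoint at which \<open>g\<close> is closest to zero.\<close>
  obtain c where c: "c \<in> {a..b}" "\<And>x. a \<le> x \<Longrightarrow> x < c \<Longrightarrow> \<mu> * (c - x) \<le> g x"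
      "\<And>x. c < x \<Longrightarrow> x \<le> b \<Longrightarrow> g x \<le> - \<mu> * (x - c)"
  proof -
    consider "g b \<ge> 0" | "g a \<le> 0" | "g b < 0" "g a > 0" by linarith
    then show thesis
    proof cases
      case 1
      have "\<mu> * (b - x) \<le> g x" if "a \<le> x" "x < b" for x using slope[of x b] that 1 by simp
      with \<open>a \<le> b\<close> show thesis by (intro that[of b]) auto
    next
      case 2
      have "g x \<le> - \<mu> * (x - a)" if "a < x" "x \<le> b" for x using slope[of a x] that 2 by simp
      with \<open>a \<le> b\<close> show thesis by (intro that[of a]) auto
    next
      case 3
      have "continuous_on {a..b} g" using g by (meson DERIV_isCont continuous_at_imp_continuous_on)
      with 3 \<open>a \<le> b\<close> obtain c where c: "a \<le> c" "c \<le> b" "g c = 0"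
        using IVT2'[of g b 0 a] by auto
      have "g x \<le> - \<mu> * (x - c)" if "c < x" "x \<le> b" for x using slope[of c x] that c by simp
      moreover have "\<mu> * (c - x) \<le> g x" if "a \<le> x" "x < c" for x using slope[of x c] that c by simp
      ultimately show thesis using c by (intro that[of c]) auto
    qed
  qed
  \<comment> \<open>This width balances the length of the middle part against the bound 4 /
    (\<open>\<mu>\<close> h) on the outer parts.\<close>
  define h where "h = 1 / sqrt \<mu>"
  have h: "h > 0" "\<mu> * h = sqrt \<mu>" using \<open>\<mu> > 0\<close> by (auto simp: h_def real_div_sqrt)
  define p where "p = max a (c - h)"
  define r where "r = min b (c + h)"
  have pr: "a \<le> p" "p \<le> c" "c \<le> r" "r \<le> b" "r - p \<le> 2 * h" using c(1) h(1) by (auto simp: p_def r_def)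
  have left: "cmod (integral {a..p} (\<lambda>x. cis (\<phi> x))) \<le> 4 / sqrt \<mu>"
  proof (cases "a = p")
    case False
    then have p: "p = c - h" by (auto simp: p_def)
    show ?thesis
    proof (rule van_der_Corput_1[where g = g and g' = g'])
      fix x assume x: "x \<in> {a..p}"
      then have "\<mu> * h \<le> \<mu> * (c - x)" using \<open>\<mu> > 0\<close> p by (intro mult_left_mono) auto
      then show "sqrt \<mu> \<le> \<bar>g x\<bar>" using c(2)[of x] x pr h p by auto
      show "(\<phi> has_real_derivative g x) (at x)" "(g has_real_derivative g' x) (at x)" "g' x \<le> 0"
        using x pr \<phi>[of x] g[of x] g'[of x] \<open>\<mu> > 0\<close> by auto
    qed (use pr \<open>\<mu> > 0\<close> in auto)
  qed (use \<open>\<mu> > 0\<close> in auto)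
  have right: "cmod (integral {r..b} (\<lambda>x. cis (\<phi> x))) \<le> 4 / sqrt \<mu>"
  proof (cases "r = b")
    case False
    then have r: "r = c + h" by (auto simp: r_def)
    show ?thesis
    proof (rule van_der_Corput_1[where g = g and g' = g'])
      fix x assume x: "x \<in> {r..b}"
      then have "\<mu> * h \<le> \<mu> * (x - c)" using \<open>\<mu> > 0\<close> r by (intro mult_left_mono) auto
      then show "sqrt \<mu> \<le> \<bar>g x\<bar>" using c(3)[of x] x pr h r by auto
      show "(\<phi> has_real_derivative g x) (at x)" "(g has_real_derivative g' x) (at x)" "g' x \<le> 0"
        using x pr \<phi>[of x] g[of x] g'[of x] \<open>\<mu> > 0\<close> by auto
    qed (use pr \<open>\<mu> > 0\<close> in auto)
  qed (use \<open>\<mu> > 0\<close> in auto)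
  have mid: "cmod (integral {p..r} (\<lambda>x. cis (\<phi> x))) \<le> 1 * (r - p)"
    by (rule integral_bound) (use pr cont in \<open>auto intro: continuous_on_subset\<close>)
  have "integral {a..b} (\<lambda>x. cis (\<phi> x)) = integral {a..p} (\<lambda>x. cis (\<phi> x))
      + (integral {p..r} (\<lambda>x. cis (\<phi> x)) + integral {r..b} (\<lambda>x. cis (\<phi> x)))"
    using pr \<open>a \<le> b\<close> cont
    by (subst Henstock_Kurzweil_Integration.integral_combine[of p r b])
       (auto intro!: Henstock_Kurzweil_Integration.integral_combine[symmetric] integrable_continuous_real
         intro: continuous_on_subset)
  also have "norm \<dots> \<le> 4 / sqrt \<mu> + (2 * h + 4 / sqrt \<mu>)"
    using left right mid pr(5) by (intro norm_triangle_le add_mono) auto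
  finally show ?thesis by (simp add: h_def)
qed

text \<open>The second derivative of the phase is \<open>- 2 * \<tau> * cos x\<close>, of one sign
  on this interval and degenerate only at its ends. Cutting off \<open>\<delta>\<close> at each end
  leaves a modulus of at least \<open>\<tau> * \<delta>\<close>; with \<open>\<delta>\<close> the
  power -1/3 of \<open>\<tau>\<close> the bulk contributes \<open>10 * \<delta>\<close> and each end
  \<open>\<delta>\<close>. The slope \<open>a\<close> does not enter, which makes the kernel bound
  uniform in the site.\<close>

lemma half_period_integral_bound:
  assumes "\<tau> \<ge> 1"
  shows "cmod (integral {-(pi/2)..pi/2} (\<lambda>x. cis (a * x + 2 * \<tau> * cos x))) \<le> 12 * \<tau> powr (-(1/3))"
proof -
  define \<delta> where "\<delta> = \<tau> powr (-(1/3))"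
  define f where "f x = cis (a * x + 2 * \<tau> * cos x)" for x
  have cont: "continuous_on T f" for T unfolding f_def by (intro continuous_intros)
  have \<delta>: "\<delta> > 0" "\<delta> \<le> 1" using assms powr_mono[of "-(1/3)" 0 \<tau>] by (auto simp: \<delta>_def)
  have "\<delta> < pi / 2" using \<delta> pi_gt3 by simp
  have sin_ge: "\<delta> / 2 \<le> sin \<delta>"
  proof -
    obtain z where z: "0 < z" "z < \<delta>" "sin \<delta> - sin 0 = (\<delta> - 0) * cos z"
      using MVT2[of 0 \<delta> sin cos] \<delta> by (auto simp: DERIV_sin)
    have "cos (pi / 3) \<le> cos z" using z \<delta> pi_gt3 by (intro cos_monotone_0_pi_le) auto
    then have "\<delta> * (1 / 2) \<le> \<delta> * cos z" using \<delta> by (intro mult_left_mono) (auto simp: cos_60)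
    then show ?thesis using z by simp
  qed
  have mid: "cmod (integral {-(pi/2) + \<delta>..pi/2 - \<delta>} f) \<le> 10 / sqrt (\<tau> * \<delta>)"
    unfolding f_def
  proof (rule van_der_Corput_2[where g = "\<lambda>x. a - 2 * \<tau> * sin x" and g' = "\<lambda>x. - (2 * \<tau> * cos x)"])
    fix x assume x: "x \<in> {-(pi/2) + \<delta>..pi/2 - \<delta>}"
    have "cos (pi/2 - \<delta>) \<le> cos \<bar>x\<bar>" using x \<delta> by (intro cos_monotone_0_pi_le) auto
    then have "\<delta> / 2 \<le> cos x" using sin_ge by (simp add: cos_diff)
    then have "2 * \<tau> * (\<delta> / 2) \<le> 2 * \<tau> * cos x" using assms by (intro mult_left_mono) auto
    then show "- (2 * \<tau> * cos x) \<le> - (\<tau> * \<delta>)" by simp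
  qed (use \<open>\<delta> < pi / 2\<close> \<delta> assms in \<open>auto intro!: derivative_eq_intros\<close>)
  have \<tau>\<delta>: "\<tau> * \<delta> = (\<tau> powr (1/3))\<^sup>2"
  proof -
    have "\<tau> * \<delta> = \<tau> powr 1 * \<tau> powr (-(1/3))" using assms by (simp add: \<delta>_def)
    also have "\<dots> = \<tau> powr (2/3)" by (subst powr_add[symmetric]) simp
    also have "\<dots> = (\<tau> powr (1/3))\<^sup>2" by (simp add: power2_eq_square powr_add[symmetric])
    finally show ?thesis .
  qed
  have "10 / sqrt (\<tau> * \<delta>) = 10 * \<delta>"
    unfolding \<tau>\<delta> by (simp add: \<delta>_def powr_minus_divide)
  with mid have mid: "cmod (integral {-(pi/2) + \<delta>..pi/2 - \<delta>} f) \<le> 10 * \<delta>" by simp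
  have ends: "cmod (integral {u..v} f) \<le> 1 * (v - u)" if "u \<le> v" for u v
    by (rule integral_bound) (use that cont in \<open>auto simp: f_def\<close>)
  have "integral {-(pi/2)..pi/2} f = integral {-(pi/2)..-(pi/2) + \<delta>} f
      + (integral {-(pi/2) + \<delta>..pi/2 - \<delta>} f + integral {pi/2 - \<delta>..pi/2} f)"
    using \<open>\<delta> < pi / 2\<close> \<delta>
    by (subst Henstock_Kurzweil_Integration.integral_combine)
       (auto intro!: Henstock_Kurzweil_Integration.integral_combine[symmetric] integrable_continuous_real cont)
  also have "norm \<dots> \<le> \<delta> + (10 * \<delta> + \<delta>)"
    using mid ends[of "-(pi/2)" "-(pi/2) + \<delta>"] ends[of "pi/2 - \<delta>" "pi/2"] \<delta>
    by (intro norm_triangle_le add_mono) auto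
  finally show ?thesis by (simp add: f_def[abs_def] \<delta>_def)
qed

text \<open>The one-dimensional kernel, a Fourier coefficient of the exponential of the symbol of
  the Laplacian. The period begins at \<open>-(pi/2)\<close> because it then splits into two half
  periods on each of which the cosine has one sign.\<close>

definition kern :: "real \<Rightarrow> int \<Rightarrow> complex" where
  "kern t n = integral {-(pi/2)..3*pi/2} (\<lambda>x. cis (n * x - t * (2 - 2 * cos x))) / (2 * pi)"

lemma norm_kern_le_1: "cmod (kern t n) \<le> 1"
proof -
  have "cmod (integral {-(pi/2)..3*pi/2} (\<lambda>x. cis (n * x - t * (2 - 2 * cos x)))) \<le> 1 * (3*pi/2 - (-(pi/2)))"
    by (rule integral_bound) (auto intro!: continuous_intros)
  then show ?thesis by (simp add: kern_def norm_divide)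
qed

lemma half_period_integral_bound':
  assumes "\<bar>\<tau>\<bar> \<ge> 1"
  shows "cmod (integral {-(pi/2)..pi/2} (\<lambda>x. cis (a * x + 2 * \<tau> * cos x))) \<le> 12 * \<bar>\<tau>\<bar> powr (-(1/3))"
proof (cases "\<tau> \<ge> 0")
  case True
  then show ?thesis using half_period_integral_bound[of \<tau> a] assms by simp
next
  case False
  have "integral {-(pi/2)..pi/2} (\<lambda>x. cnj (cis (- a * x + 2 * (- \<tau>) * cos x)))
      = cnj (integral {-(pi/2)..pi/2} (\<lambda>x. cis (- a * x + 2 * (- \<tau>) * cos x)))"
    by (rule Henstock_Kurzweil_Integration.integral_cnj[symmetric])
  then have "cmod (integral {-(pi/2)..pi/2} (\<lambda>x. cis (a * x + 2 * \<tau> * cos x)))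
      = cmod (integral {-(pi/2)..pi/2} (\<lambda>x. cis (- a * x + 2 * (- \<tau>) * cos x)))"
    by (simp add: cis_cnj algebra_simps)
  then show ?thesis using half_period_integral_bound[of "- \<tau>" "- a"] assms False by simp
qed

text \<open>A translation by \<open>pi\<close> carries the second half period to the first with
  \<open>t\<close> replaced by \<open>- t\<close>, so both are bounded by
  \<open>half_period_integral_bound'\<close>. The factor 4 is 24 / (2 pi) rounded up with pi > 3;
  for small \<open>t\<close> the trivial bound 1 is better than the claim.\<close>

lemma norm_kern_le:
  assumes "t \<noteq> 0"
  shows "cmod (kern t n) \<le> 4 * \<bar>t\<bar> powr (-(1/3))"
proof (cases "\<bar>t\<bar> \<ge> 1")
  case True
  define f where "f x = cis (n * x - t * (2 - 2 * cos x))" for x :: real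
  have cont: "continuous_on T f" for T unfolding f_def by (intro continuous_intros)
  have 1: "cmod (integral {-(pi/2)..pi/2} f) \<le> 12 * \<bar>t\<bar> powr (-(1/3))"
  proof -
    have "f = (\<lambda>x::real. cis (- 2 * t) * cis (n * x + 2 * t * cos x))"
      by (simp add: f_def fun_eq_iff cis_mult algebra_simps)
    then show ?thesis using half_period_integral_bound'[OF True, of n] by (simp add: norm_mult)
  qed
  have 2: "cmod (integral {pi/2..3*pi/2} f) \<le> 12 * \<bar>t\<bar> powr (-(1/3))"
  proof -
    have "integral {pi/2..3*pi/2} f = integral {pi/2 - pi..3*pi/2 - pi} (\<lambda>x. f (x + pi))"
      by (rule integral_shift_real_ivl[symmetric])
    also have "(\<lambda>x. f (x + pi)) = (\<lambda>x::real. cis (n * pi - 2 * t) * cis (n * x + 2 * (- t) * cos x))"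
      by (simp add: f_def fun_eq_iff cis_mult algebra_simps)
    finally show ?thesis using half_period_integral_bound'[of "- t" n] True by (simp add: norm_mult)
  qed
  have "integral {-(pi/2)..3*pi/2} f = integral {-(pi/2)..pi/2} f + integral {pi/2..3*pi/2} f"
    by (auto intro!: Henstock_Kurzweil_Integration.integral_combine[symmetric] integrable_continuous_real cont)
  then have "cmod (integral {-(pi/2)..3*pi/2} f) \<le> 24 * \<bar>t\<bar> powr (-(1/3))"
    using norm_triangle_mono[OF 1 2] by simp
  then have "cmod (integral {-(pi/2)..3*pi/2} f) / (2 * pi) \<le> 24 * \<bar>t\<bar> powr (-(1/3)) / (2 * pi)"
    by (intro divide_right_mono) auto
  moreover have "cmod (kern t n) = cmod (integral {-(pi/2)..3*pi/2} f) / (2 * pi)"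
    unfolding kern_def f_def[abs_def] by (simp add: norm_divide)
  ultimately have "cmod (kern t n) \<le> 24 * \<bar>t\<bar> powr (-(1/3)) / (2 * pi)" by simp
  also have "\<dots> \<le> 24 * \<bar>t\<bar> powr (-(1/3)) / (2 * 3)"
    using pi_gt3 by (intro divide_left_mono) auto
  finally show ?thesis by simp
next
  case False
  have "1 \<le> \<bar>t\<bar> powr (-(1/3))"
    using False assms powr_mono2'[of "-(1/3)" "\<bar>t\<bar>" 1] by simp
  then show ?thesis using norm_kern_le_1[of t n] by linarith
qed

lemma kern_0: "kern 0 n = (if n = 0 then 1 else 0)"
proof (cases "n = 0")
  case False
  have "((\<lambda>x. cis (n * x)) has_integral
     (cis (n * (3*pi/2)) / (\<i> * n) - cis (n * (-(pi/2))) / (\<i> * n))) {-(pi/2)..3*pi/2}"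
  proof (rule fundamental_theorem_of_calculus)
    fix x assume "x \<in> {-(pi/2)..3*pi/2}"
    have "((\<lambda>x. n * x) has_real_derivative n) (at x)" by (auto intro!: derivative_eq_intros)
    from has_vector_derivative_mult_right[OF has_vector_derivative_cis_compose[OF this], of "1 / (\<i> * n)"]
    have "((\<lambda>x. cis (n * x) / (\<i> * n)) has_vector_derivative cis (n * x)) (at x)"
      using False by simp
    then show "((\<lambda>x. cis (n * x) / (\<i> * n)) has_vector_derivative cis (n * x)) (at x within {-(pi/2)..3*pi/2})"
      by (rule has_vector_derivative_at_within)
  qed simp
  moreover have "cis (n * (3*pi/2)) = cis (n * (-(pi/2)))"
  proof -
    have "cis (n * (3*pi/2)) = cis (n * (-(pi/2))) * cis (2 * pi * n)"
      by (simp add: cis_mult algebra_simps)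
    then show ?thesis by (simp add: cis_multiple_2pi)
  qed
  ultimately have "integral {-(pi/2)..3*pi/2} (\<lambda>x. cis (n * x)) = 0" by (simp add: integral_unique)
  then show ?thesis using False by (simp add: kern_def)
qed (simp add: kern_def scaleR_conv_of_real)

text \<open>Differentiation under the integral brings down a multiple of
  \<open>2 - 2 * cos x\<close>, and \<open>2 * cos x\<close> is \<open>cis x + cis (- x)\<close>,
  whose two summands shift \<open>n\<close> by one in either direction.\<close>

lemma kern_has_vector_derivative:
  "((\<lambda>t. kern t n) has_vector_derivative \<i> * (kern t (n + 1) + kern t (n - 1) - 2 * kern t n)) (at t)"
proof -
  define f where "f n t x = cis (real_of_int n * x - t * (2 - 2 * cos x))" for n and t x :: real
  define f' where "f' t x = \<i> * of_real (- (2 - 2 * cos x)) * f n t x" for t x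
  have kern_eq: "kern t n = integral {-(pi/2)..3*pi/2} (f n t) * (1 / (2 * pi))" for t n
    by (simp add: kern_def f_def[abs_def])
  have int: "f n t integrable_on {-(pi/2)..3*pi/2}" for n t
    unfolding f_def by (intro integrable_continuous_real continuous_intros)
  have "((\<lambda>t. integral (cbox (-(pi/2)) (3*pi/2)) (f n t)) has_vector_derivative
      integral (cbox (-(pi/2)) (3*pi/2)) (f' t)) (at t within UNIV)"
  proof (rule leibniz_rule_vector_derivative)
    fix t x :: real
    have "((\<lambda>t. real_of_int n * x - t * (2 - 2 * cos x)) has_real_derivative - (2 - 2 * cos x)) (at t)"
      by (auto intro!: derivative_eq_intros)
    from has_vector_derivative_cis_compose[OF this]
    show "((\<lambda>t. f n t x) has_vector_derivative f' t x) (at t within UNIV)"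
      by (simp add: f_def f'_def)
    show "f n t integrable_on cbox (-(pi/2)) (3*pi/2)" using int by simp
    show "continuous_on (UNIV \<times> cbox (-(pi/2)) (3*pi/2)) (\<lambda>(x, y). f' x y)"
      unfolding f'_def f_def case_prod_beta by (intro continuous_intros)
  qed auto
  then have "((\<lambda>t. integral {-(pi/2)..3*pi/2} (f n t)) has_vector_derivative
      integral {-(pi/2)..3*pi/2} (f' t)) (at t)" by simp
  moreover have "f' t x = \<i> * (f (n + 1) t x + f (n - 1) t x - 2 * f n t x)" for x
  proof -
    have "f (n + 1) t x = cis x * f n t x" "f (n - 1) t x = cis (- x) * f n t x"
      by (simp_all add: f_def cis_mult algebra_simps)
    moreover have "cis x + cis (- x) = of_real (2 * cos x)" by (simp add: complex_eq_iff)
    ultimately show ?thesis unfolding f'_def by (simp add: algebra_simps flip: distrib_right)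
  qed
  then have "integral {-(pi/2)..3*pi/2} (f' t) = integral {-(pi/2)..3*pi/2}
     (\<lambda>x. \<i> * (f (n + 1) t x + f (n - 1) t x - 2 * f n t x))" by presburger
  also have "\<dots> = \<i> * (integral {-(pi/2)..3*pi/2} (f (n + 1) t) + integral {-(pi/2)..3*pi/2} (f (n - 1) t)
     - 2 * integral {-(pi/2)..3*pi/2} (f n t))"
    by (simp add: Henstock_Kurzweil_Integration.integral_diff Henstock_Kurzweil_Integration.integral_add
        integrable_add int)
  ultimately have "((\<lambda>t. integral {-(pi/2)..3*pi/2} (f n t)) has_vector_derivative
     \<i> * (integral {-(pi/2)..3*pi/2} (f (n + 1) t) + integral {-(pi/2)..3*pi/2} (f (n - 1) t)
     - 2 * integral {-(pi/2)..3*pi/2} (f n t))) (at t)" by simp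
  from has_vector_derivative_mult_left[OF this, of "1 / (2 * pi)"]
  show ?thesis by (simp only: kern_eq) (simp only: algebra_simps)
qed

text \<open>Uniqueness among bounded solutions. The kernel is so far only known to be bounded, not
  square summable, so \<open>generator_solution_norm\<close> cannot compare it with the flow.
  Iterating the mean value inequality k times bounds a solution by B (M t)^k / k!, which tends to 0.
  A general unimodular \<open>c\<close> covers reversed time.\<close>

lemma bounded_lattice_solution_zero:
  fixes z :: "real \<Rightarrow> int ^ 'd::finite \<Rightarrow> complex"
  assumes z: "\<And>t n. ((\<lambda>t. z t n) has_vector_derivative c * discrete_laplacian (z t) n) (at t)"
    and c: "cmod c = 1" and bound: "\<And>t n. cmod (z t n) \<le> B" and z0: "\<And>n. z 0 n = 0" and "t \<ge> 0"
  shows "z t n = 0"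
proof -
  define M where "M = 4 * real CARD('d)"
  have lap: "cmod (c * discrete_laplacian f n) \<le> M * b" if "\<And>n. cmod (f n) \<le> b"
    for f :: "int ^ 'd \<Rightarrow> complex" and b n
  proof -
    have "cmod (f (n + axis j 1) + f (n - axis j 1) - 2 * f n) \<le> b + b + 2 * b" for j
      by (intro norm_triangle_le_diff norm_triangle_le add_mono that)
         (simp add: norm_mult that)
    then have "cmod (discrete_laplacian f n) \<le> (\<Sum>j\<in>(UNIV :: 'd set). b + b + 2 * b)"
      unfolding discrete_laplacian_def by (intro sum_norm_le) auto
    then show ?thesis by (simp add: norm_mult c M_def)
  qed
  have bnd: "cmod (z t n) \<le> B * M ^ k * t ^ k / fact k" if "t \<ge> 0" for k t n
    using that
  proof (induction k arbitrary: t n)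
    case (Suc k)
    show ?case
    proof (cases "t = 0")
      case False
      have "cmod (z t n - z 0 n) \<le> B * M ^ Suc k * t ^ Suc k / fact (Suc k) - B * M ^ Suc k * 0 ^ Suc k / fact (Suc k)"
      proof (rule differentiable_bound_general)
        show "continuous_on {0..t} (\<lambda>t. z t n)"
          using z by (meson continuous_at_imp_continuous_on has_vector_derivative_continuous)
        show "continuous_on {0..t} (\<lambda>t. B * M ^ Suc k * t ^ Suc k / fact (Suc k))"
          by (intro continuous_intros) auto
        show "0 < t" using Suc.prems False by simp
        fix s assume s: "0 < s" "s < t"
        show "((\<lambda>t. B * M ^ Suc k * t ^ Suc k / fact (Suc k)) has_vector_derivative
            M * (B * M ^ k * s ^ k / fact k)) (at s)"
          unfolding has_real_derivative_iff_has_vector_derivative[symmetric]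
          by (rule derivative_eq_intros refl | simp)+
        show "cmod (c * discrete_laplacian (z s) n) \<le> M * (B * M ^ k * s ^ k / fact k)"
          by (rule lap, rule Suc.IH) (use s in auto)
        show "((\<lambda>t. z t n) has_vector_derivative c * discrete_laplacian (z s) n) (at s)" by (rule z)
      qed
      then show ?thesis by (simp add: z0)
    qed (simp add: z0)
  qed (use bound in simp)
  have "(\<lambda>k. B * ((M * t) ^ k / fact k)) \<longlonglongrightarrow> B * 0"
    using summable_LIMSEQ_zero[OF summable_exp[of "M * t"]]
    by (intro tendsto_mult tendsto_const) (simp add: field_simps)
  then have "cmod (z t n) \<le> B * 0"
    by (rule LIMSEQ_le_const) (use bnd[OF \<open>t \<ge> 0\<close>] in \<open>auto simp: power_mult_distrib mult_ac\<close>)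
  then show ?thesis by simp
qed

definition kern_prod :: "real \<Rightarrow> int ^ 'd \<Rightarrow> complex" where
  "kern_prod t n = (\<Prod>j\<in>UNIV. kern t (n $ j))"

lemma norm_kern_prod_le_1: "cmod (kern_prod t (n :: int ^ 'd::finite)) \<le> 1"
  unfolding kern_prod_def prod_norm[symmetric] by (rule prod_le_1) (auto simp: norm_kern_le_1)

lemma norm_kern_prod_le:
  assumes "t \<noteq> 0"
  shows "cmod (kern_prod t (n :: int ^ 'd::finite)) \<le> 4 ^ CARD('d) * \<bar>t\<bar> powr (- (CARD('d) / 3))"
proof -
  have "cmod (kern_prod t n) \<le> (\<Prod>j\<in>(UNIV :: 'd set). 4 * \<bar>t\<bar> powr (-(1/3)))"
    unfolding kern_prod_def prod_norm[symmetric] by (rule prod_mono) (auto simp: norm_kern_le[OF assms])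
  also have "\<dots> = 4 ^ CARD('d) * \<bar>t\<bar> powr (- (CARD('d) / 3))"
    using assms by (simp add: power_mult_distrib powr_power)
  finally show ?thesis .
qed

lemma kern_prod_0: "kern_prod 0 n = (if n = 0 then 1 else 0)"
proof (cases "n = 0")
  case False
  then obtain j where "n $ j \<noteq> 0" by (auto simp: vec_eq_iff)
  then show ?thesis using False unfolding kern_prod_def by (auto simp: kern_0 intro!: prod_zero)
qed (simp add: kern_prod_def kern_0)

lemma kern_prod_has_vector_derivative:
  "((\<lambda>t. kern_prod t n) has_vector_derivative \<i> * discrete_laplacian (kern_prod t) n) (at t)"
proof -
  have move: "kern_prod t (n + axis j k) = kern t (n $ j + k) * (\<Prod>i\<in>UNIV - {j}. kern t (n $ i))" for j k
    unfolding kern_prod_def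
    by (subst prod.remove[of UNIV j]) (auto simp: axis_def intro!: prod.cong)
  have "((\<lambda>t. kern_prod t n) has_derivative (\<lambda>h. \<Sum>j\<in>UNIV.
     h *\<^sub>R (\<i> * (kern t (n $ j + 1) + kern t (n $ j - 1) - 2 * kern t (n $ j))) * (\<Prod>i\<in>UNIV - {j}. kern t (n $ i)))) (at t)"
    unfolding kern_prod_def
    by (rule has_derivative_prod) (use kern_has_vector_derivative in \<open>simp add: has_vector_derivative_def\<close>)
  moreover have "(\<Sum>j\<in>UNIV. h *\<^sub>R (\<i> * (kern t (n $ j + 1) + kern t (n $ j - 1) - 2 * kern t (n $ j)))
      * (\<Prod>i\<in>UNIV - {j}. kern t (n $ i))) = h *\<^sub>R (\<i> * discrete_laplacian (kern_prod t) n)" for h :: real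
  proof -
    have "kern_prod t (n + axis j 1) + kern_prod t (n - axis j 1) - 2 * kern_prod t n
        = (kern t (n $ j + 1) + kern t (n $ j - 1) - 2 * kern t (n $ j)) * (\<Prod>i\<in>UNIV - {j}. kern t (n $ i))" for j
    proof -
      have z: "n + axis j 0 = n" "n + axis j (- 1) = n - axis j 1"
        by (auto simp: vec_eq_iff axis_def)
      show ?thesis using move[of j 1] move[of j "-1", unfolded z] move[of j 0, unfolded z]
        by (simp add: algebra_simps)
    qed
    then show ?thesis
      by (simp add: discrete_laplacian_def sum_distrib_left scaleR_conv_of_real mult.assoc)
  qed
  ultimately show ?thesis by (simp add: has_vector_derivative_def)
qed

lemma discrete_laplacian_sum:
  "discrete_laplacian (\<lambda>n. \<Sum>m\<in>S. c m * f (n - m)) n = (\<Sum>m\<in>S. c m * discrete_laplacian f (n - m))"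
proof -
  have "discrete_laplacian (\<lambda>n. \<Sum>m\<in>S. c m * f (n - m)) n
      = (\<Sum>j\<in>UNIV. \<Sum>m\<in>S. c m * (f (n - m + axis j 1) + f (n - m - axis j 1) - 2 * f (n - m)))"
    unfolding discrete_laplacian_def
    by (intro sum.cong refl) (simp add: sum_distrib_left sum.distrib sum_subtractf algebra_simps)
  also have "\<dots> = (\<Sum>m\<in>S. c m * discrete_laplacian f (n - m))"
    unfolding discrete_laplacian_def sum_distrib_left by (rule sum.swap)
  finally show ?thesis .
qed

text \<open>This identifies the flow, defined by a power series, with convolution by the product
  kernel: the difference is a bounded lattice solution vanishing at time 0. For negative times the
  equation is reversed, which changes i to -i.\<close>

lemma ev_propag_finite_support:
  fixes x :: "(int ^ 'd::finite) ell2"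
  assumes S: "finite S" "\<And>n. n \<notin> S \<Longrightarrow> ev x n = 0"
  shows "ev (propag t x) n = (\<Sum>m\<in>S. ev x m * kern_prod t (n - m))"
proof -
  define z where "z t n = ev (propag t x) n - (\<Sum>m\<in>S. ev x m * kern_prod t (n - m))" for t n
  have z: "((\<lambda>t. z t n) has_vector_derivative \<i> * discrete_laplacian (z t) n) (at t)" for t n
  proof -
    have 1: "((\<lambda>t. ev (propag t x) n) has_vector_derivative \<i> * discrete_laplacian (ev (propag t x)) n) (at t)"
      using bounded_linear.has_vector_derivative[OF bounded_linear_ev sg.flow_has_vector_derivative[of x t], of n]
      by (simp add: ev_i_laplacian)
    have 2: "((\<lambda>t. \<Sum>m\<in>S. ev x m * kern_prod t (n - m)) has_vector_derivative
        (\<Sum>m\<in>S. ev x m * (\<i> * discrete_laplacian (kern_prod t) (n - m)))) (at t)"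
      by (intro has_vector_derivative_sum has_vector_derivative_mult_right kern_prod_has_vector_derivative)
    have L: "discrete_laplacian (z t) n = discrete_laplacian (ev (propag t x)) n
        - discrete_laplacian (\<lambda>n. \<Sum>m\<in>S. ev x m * kern_prod t (n - m)) n"
      unfolding z_def discrete_laplacian_def by (simp add: sum_subtractf[symmetric] algebra_simps)
    have "\<i> * discrete_laplacian (z t) n = \<i> * discrete_laplacian (ev (propag t x)) n
        - (\<Sum>m\<in>S. ev x m * (\<i> * discrete_laplacian (kern_prod t) (n - m)))"
      unfolding L discrete_laplacian_sum right_diff_distrib by (simp add: sum_distrib_left mult_ac)
    then show ?thesis
      using has_vector_derivative_diff[OF 1 2] by (simp only: z_def)
  qed
  have bound: "cmod (z t n) \<le> norm x + (\<Sum>m\<in>S. cmod (ev x m))" for t n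
  proof -
    have "cmod (\<Sum>m\<in>S. ev x m * kern_prod t (n - m)) \<le> (\<Sum>m\<in>S. cmod (ev x m) * 1)"
      by (rule sum_norm_le) (auto simp: norm_mult intro!: mult_left_le norm_kern_prod_le_1)
    then show ?thesis
      unfolding z_def using norm_ev_le[of "propag t x" n]
      by (intro norm_triangle_le_diff add_mono) auto
  qed
  have z0: "z 0 n = 0" for n
  proof -
    have "(\<Sum>m\<in>S. ev x m * kern_prod 0 (n - m)) = (\<Sum>m\<in>S. if m = n then ev x m else 0)"
      by (rule sum.cong) (auto simp: kern_prod_0)
    then show ?thesis using S by (simp add: z_def sum.delta')
  qed
  have "z t n = 0"
  proof (cases "t \<ge> 0")
    case True
    show ?thesis by (rule bounded_lattice_solution_zero[OF z _ bound z0 True]) simp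
  next
    case False
    have "((\<lambda>t. z (- t) n) has_vector_derivative - \<i> * discrete_laplacian (z (- t)) n) (at t)" for t n
      using vector_diff_chain_at[of "\<lambda>t. - t" "-1" t "\<lambda>t. z t n" "\<i> * discrete_laplacian (z (- t)) n"] z[of n "- t"]
      by (auto simp: comp_def intro: has_vector_derivative_minus[OF has_vector_derivative_id])
    from bounded_lattice_solution_zero[OF this _ bound, of "- t" n] z0 False show ?thesis by simp
  qed
  then show ?thesis by (simp add: z_def)
qed

definition norm1 :: "'a set \<Rightarrow> 'a ell2 \<Rightarrow> real" where
  "norm1 S x = (\<Sum>n\<in>S. cmod (ev x n))"

lemma norm1_nonneg: "0 \<le> norm1 S x"
  by (simp add: norm1_def sum_nonneg)

text \<open>The bound from l^1 to l^infinity, in the paired form in which all later arguments use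
  it.\<close>

lemma dispersive_estimate:
  fixes x y :: "(int ^ 'd::finite) ell2"
  assumes S: "finite S" "\<And>n. n \<notin> S \<Longrightarrow> ev x n = 0" "\<And>n. n \<notin> S \<Longrightarrow> ev y n = 0" and "t \<noteq> 0"
  shows "\<bar>propag t x \<bullet> y\<bar> \<le> 4 ^ CARD('d) * \<bar>t\<bar> powr (- (CARD('d) / 3)) * norm1 S x * norm1 S y"
proof -
  define D where "D = 4 ^ CARD('d) * \<bar>t\<bar> powr (- (CARD('d) / 3))"
  have pt: "cmod (ev (propag t x) n) \<le> D * norm1 S x" for n
  proof -
    have "ev (propag t x) n = (\<Sum>m\<in>S. ev x m * kern_prod t (n - m))"
      using S by (intro ev_propag_finite_support) auto
    also have "cmod \<dots> \<le> (\<Sum>m\<in>S. cmod (ev x m) * D)"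
      by (rule sum_norm_le)
         (auto simp: norm_mult D_def intro!: mult_left_mono norm_kern_prod_le[OF \<open>t \<noteq> 0\<close>])
    finally show ?thesis by (simp add: norm1_def sum_distrib_left mult.commute)
  qed
  have "propag t x \<bullet> y = (\<Sum>n\<in>S. ev (propag t x) n \<bullet> ev y n)"
    using S by (intro inner_finite_support) auto
  then have "\<bar>propag t x \<bullet> y\<bar> \<le> (\<Sum>n\<in>S. \<bar>ev (propag t x) n \<bullet> ev y n\<bar>)" by simp
  also have "\<dots> \<le> (\<Sum>n\<in>S. D * norm1 S x * cmod (ev y n))"
    by (intro sum_mono order_trans[OF Cauchy_Schwarz_ineq2] mult_right_mono pt) auto
  also have "\<dots> = D * norm1 S x * norm1 S y" by (simp add: norm1_def sum_distrib_left)
  finally show ?thesis by (simp add: D_def)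
qed

section \<open>Global well-posedness in the space of square-summable functions\<close>

text \<open>Finite sets increasing to the whole type. They turn norms over the lattice into
  countable monotone suprema, for which measurability and monotone convergence are
  available.\<close>

definition exhaust :: "nat \<Rightarrow> 'a::countable set" where
  "exhaust k = {n. to_nat n < k}"

lemma finite_exhaust [simp]: "finite (exhaust k)"
  unfolding exhaust_def using finite_vimageI[OF finite_lessThan inj_to_nat, of k]
  by (simp add: vimage_def)

section \<open>Lattice norms as integrals over the counting measure\<close>

lemma nn_integral_count_space_ge_sum:
  fixes f :: "'a \<Rightarrow> ennreal"
  assumes "finite S"
  shows "(\<Sum>n\<in>S. f n) \<le> (\<integral>\<^sup>+ n. f n \<partial>count_space UNIV)"
proof -
  have "(\<Sum>n\<in>S. f n) = (\<integral>\<^sup>+ n. f n * indicator S n \<partial>count_space UNIV)"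
    using assms by (subst nn_integral_count_space'[of S]) (auto simp: indicator_def)
  also have "\<dots> \<le> (\<integral>\<^sup>+ n. f n \<partial>count_space UNIV)"
    by (rule nn_integral_mono) (auto simp: indicator_def)
  finally show ?thesis .
qed

lemma nn_integral_count_space_le:
  fixes f :: "'a::countable \<Rightarrow> ennreal"
  assumes "\<And>S. finite S \<Longrightarrow> (\<Sum>n\<in>S. f n) \<le> C"
  shows "(\<integral>\<^sup>+ n. f n \<partial>count_space UNIV) \<le> C"
proof -
  have "f n = (SUP k. f n * indicator (exhaust k) n)" for n
  proof (rule antisym)
    show "f n \<le> (SUP k. f n * indicator (exhaust k) n)"
      by (rule SUP_upper2[of "Suc (to_nat n)"]) (auto simp: exhaust_def)
    show "(SUP k. f n * indicator (exhaust k) n) \<le> f n"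
      by (rule SUP_least) (auto simp: indicator_def)
  qed
  then have "(\<integral>\<^sup>+ n. f n \<partial>count_space UNIV) = (\<integral>\<^sup>+ n. (SUP k. f n * indicator (exhaust k) n) \<partial>count_space UNIV)"
    by simp
  also have "\<dots> = (SUP k. (\<integral>\<^sup>+ n. f n * indicator (exhaust k) n \<partial>count_space UNIV))"
    by (rule nn_integral_monotone_convergence_SUP)
       (auto simp: incseq_def le_fun_def exhaust_def indicator_def)
  also have "\<dots> \<le> C"
  proof (rule SUP_least)
    fix k
    have "(\<integral>\<^sup>+ n. f n * indicator (exhaust k) n \<partial>count_space UNIV) = (\<Sum>n\<in>exhaust k. f n)"
      by (subst nn_integral_count_space'[of "exhaust k"]) (auto simp: indicator_def)
    then show "(\<integral>\<^sup>+ n. f n * indicator (exhaust k) n \<partial>count_space UNIV) \<le> C"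
      using assms by simp
  qed
  finally show ?thesis .
qed

lemma ennreal_rpow_ennreal: "0 \<le> x \<Longrightarrow> ennreal_rpow (ennreal x) a = ennreal (x powr a)"
  by (simp add: ennreal_rpow_def)

lemma nn_integral_square_ev:
  fixes x :: "'a::countable ell2"
  shows "(\<integral>\<^sup>+ n. ennreal (cmod (ev x n) powr 2) \<partial>count_space UNIV) = ennreal ((norm x)\<^sup>2)"
proof (rule antisym)
  let ?I = "\<integral>\<^sup>+ n. ennreal (cmod (ev x n) powr 2) \<partial>count_space UNIV"
  have sum_eq: "(\<Sum>n\<in>S. ennreal (cmod (ev x n) powr 2)) = ennreal (\<Sum>n\<in>S. (cmod (ev x n))\<^sup>2)" for S
    by (simp add: sum_ennreal)
  show le: "?I \<le> ennreal ((norm x)\<^sup>2)"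
    by (rule nn_integral_count_space_le) (simp only: sum_eq sum_le_norm_ell2 ennreal_leI)
  obtain X where X: "0 \<le> X" "?I = ennreal X"
    using le by (cases ?I rule: ennreal_cases) (auto simp: top_unique)
  have "norm x \<le> sqrt X"
  proof (rule norm_ell2_le)
    fix S :: "'a set" assume S: "finite S"
    have "ennreal (\<Sum>n\<in>S. (cmod (ev x n))\<^sup>2) \<le> ennreal X"
      using nn_integral_count_space_ge_sum[OF S, of "\<lambda>n. ennreal (cmod (ev x n) powr 2)"] X sum_eq by simp
    then show "(\<Sum>n\<in>S. (cmod (ev x n))\<^sup>2) \<le> (sqrt X)\<^sup>2" using X(1) by simp
  qed (use X in simp)
  then show "ennreal ((norm x)\<^sup>2) \<le> ?I"
    using X power_mono[of "norm x" "sqrt X" 2] by (simp add: ennreal_leI)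
qed

lemma lr_norm_2_ev:
  fixes x :: "(int ^ 'd::finite) ell2"
  shows "lr_norm 2 (ev x) = ennreal (norm x)"
proof -
  have "(\<integral>\<^sup>+ n. ennreal (cmod (ev x n) powr enn2real 2) \<partial>count_space UNIV) = ennreal ((norm x)\<^sup>2)"
    using nn_integral_square_ev[of x] by simp
  then show ?thesis
    unfolding lr_norm_def by (simp add: ennreal_rpow_ennreal powr_half_sqrt)
qed

lemma lr_norm_2_finite_imp_ell2:
  fixes f :: "int ^ 'd::finite \<Rightarrow> complex"
  assumes "lr_norm 2 f < \<infinity>"
  obtains x where "f = ev x"
proof -
  let ?I = "\<integral>\<^sup>+ n. ennreal (cmod (f n) powr 2) \<partial>count_space UNIV"
  have "?I \<noteq> \<infinity>" using assms by (auto simp: lr_norm_def ennreal_rpow_def)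
  then obtain X where X: "0 \<le> X" "?I = ennreal X" by (cases ?I rule: ennreal_cases) auto
  have "(\<Sum>n\<in>S. (cmod (f n))\<^sup>2) \<le> X" if S: "finite S" for S
  proof -
    have "ennreal (\<Sum>n\<in>S. (cmod (f n))\<^sup>2) \<le> ennreal X"
      using nn_integral_count_space_ge_sum[OF S, of "\<lambda>n. ennreal (cmod (f n) powr 2)"] X
      by (simp add: sum_ennreal)
    then show ?thesis using X(1) by simp
  qed
  then have "(\<lambda>n. (cmod (f n))\<^sup>2) summable_on UNIV" by (rule square_summable_bdd)
  then have "f = ev (Abs_ell2 f)" by (simp add: Abs_ell2_inverse)
  then show thesis by (rule that)
qed

text \<open>The modulus is capped in the power but not in the factor \<open>z\<close>. The map stays
  globally Lipschitz, keeps the phase of \<open>z\<close>, hence conserves mass, and is the pure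
  power nonlinearity where the modulus is at most \<open>R\<close>.\<close>

definition cut_power :: "real \<Rightarrow> real \<Rightarrow> complex \<Rightarrow> complex" where
  "cut_power R p z = complex_of_real (min (cmod z) R powr p) * z"

text \<open>For \<open>p < 1\<close> the derivative of the power is singular at 0. The factor
  \<open>b\<close> compensates: it lies below the intermediate point of the mean value
  theorem.\<close>

lemma powr_diff_mult_le:
  fixes a b p :: real
  assumes "0 \<le> b" "b \<le> a" "0 \<le> p"
  shows "(a powr p - b powr p) * b \<le> p * a powr p * (a - b)"
proof (cases "b = 0 \<or> a = b")
  case False
  then have ab: "0 < b" "b < a" using assms by auto
  obtain z where z: "b < z" "z < a" "a powr p - b powr p = (a - b) * (p * z powr (p - 1))"
    using MVT2[of b a "\<lambda>x. x powr p" "\<lambda>z. p * z powr (p - 1)"] ab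
    by (auto simp: has_real_derivative_powr)
  have "(a powr p - b powr p) * b = (a - b) * p * (z powr (p - 1) * b)" using z by simp
  also have "\<dots> \<le> (a - b) * p * (z powr (p - 1) * z)"
    using ab z assms by (intro mult_left_mono) auto
  also have "z powr (p - 1) * z = z powr p" using ab z by (simp add: powr_mult_base mult.commute)
  also have "(a - b) * p * z powr p \<le> (a - b) * p * a powr p"
    using ab z assms by (intro mult_left_mono powr_mono2) auto
  finally show ?thesis by (simp add: mult_ac)
qed (use assms in auto)

text \<open>With the larger modulus at \<open>z\<close>, the difference splits into
  \<open>a powr p * (z - w)\<close> and \<open>(a powr p - b powr p) * w\<close>. The first gives
  the constant 1; the second vanishes above the cap and gives \<open>p\<close> below it by
  \<open>powr_diff_mult_le\<close>.\<close>

lemma cut_power_lipschitz: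
  assumes "0 \<le> R" "0 \<le> p"
  shows "cmod (cut_power R p z - cut_power R p w) \<le> (p + 1) * R powr p * cmod (z - w)"
proof -
  have *: "cmod (cut_power R p z - cut_power R p w) \<le> (p + 1) * R powr p * cmod (z - w)"
    if wz: "cmod w \<le> cmod z" for z w
  proof -
    define a b where "a = min (cmod z) R" and "b = min (cmod w) R"
    have ab: "0 \<le> b" "b \<le> a" "a \<le> R" "0 \<le> a" using wz assms by (auto simp: a_def b_def)
    have mono: "a powr p \<le> R powr p" "b powr p \<le> a powr p" using ab assms by (auto intro: powr_mono2)
    have "(a powr p - b powr p) * cmod w \<le> p * R powr p * cmod (z - w)"
    proof (cases "cmod w \<ge> R")
      case True
      then have "a = b" using wz by (simp add: a_def b_def)
      then show ?thesis using assms by simp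
    next
      case False
      then have b: "b = cmod w" by (simp add: b_def)
      have "a - b \<le> cmod (z - w)" unfolding b a_def using norm_triangle_ineq2[of z w] by linarith
      have "(a powr p - b powr p) * cmod w \<le> p * a powr p * (a - b)"
        using powr_diff_mult_le[of b a p] ab assms b by simp
      also have "\<dots> \<le> p * R powr p * cmod (z - w)"
        using mono ab assms \<open>a - b \<le> cmod (z - w)\<close> by (intro mult_mono) auto
      finally show ?thesis .
    qed
    moreover have "a powr p * cmod (z - w) \<le> R powr p * cmod (z - w)"
      using mono by (intro mult_right_mono) auto
    moreover have "cut_power R p z - cut_power R p w
        = of_real (a powr p) * (z - w) + of_real (a powr p - b powr p) * w"
      by (simp add: cut_power_def a_def b_def algebra_simps)
    then have "cmod (cut_power R p z - cut_power R p w) \<le> a powr p * cmod (z - w) + (a powr p - b powr p) * cmod w"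
      using mono norm_triangle_ineq[of "of_real (a powr p) * (z - w)" "of_real (a powr p - b powr p) * w"]
      by (simp add: norm_mult del: of_real_diff)
    ultimately show ?thesis by (simp add: algebra_simps)
  qed
  show ?thesis
    using *[of w z] *[of z w] by (cases "cmod w \<le> cmod z") (auto simp: norm_minus_commute)
qed

lemma cut_power_0 [simp]: "cut_power R p 0 = 0"
  by (simp add: cut_power_def)

lemma norm_cut_power_le: "0 \<le> R \<Longrightarrow> 0 \<le> p \<Longrightarrow> cmod (cut_power R p z) \<le> R powr p * cmod z"
  by (auto simp: cut_power_def norm_mult intro!: mult_right_mono powr_mono2)

lemma norm_ell2_mono:
  assumes "0 \<le> L" "\<And>n. cmod (ev x n) \<le> L * cmod (ev y n)"
  shows "norm x \<le> L * norm y"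
proof (rule norm_ell2_le)
  fix S :: "'a set" assume S: "finite S"
  have "(\<Sum>n\<in>S. (cmod (ev x n))\<^sup>2) \<le> (\<Sum>n\<in>S. (L * cmod (ev y n))\<^sup>2)"
    by (intro sum_mono power_mono assms) auto
  also have "\<dots> \<le> L\<^sup>2 * (norm y)\<^sup>2"
    unfolding power_mult_distrib sum_distrib_left[symmetric]
    by (intro mult_left_mono sum_le_norm_ell2 S) auto
  finally show "(\<Sum>n\<in>S. (cmod (ev x n))\<^sup>2) \<le> (L * norm y)\<^sup>2" by (simp add: power_mult_distrib)
qed (use assms in simp)

text \<open>The maxima make the inner function square summable for all real \<open>R\<close> and
  \<open>p\<close>, so that \<open>Abs_ell2\<close> is always applied to a member of the type. The
  scalar \<open>c\<close> will be i times the sign of the equation.\<close>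

definition nonlin :: "complex \<Rightarrow> real \<Rightarrow> real \<Rightarrow> 'a ell2 \<Rightarrow> 'a ell2" where
  "nonlin c R p x = cmul c (Abs_ell2 (\<lambda>n. cut_power (max R 0) (max p 0) (ev x n)))"

lemma ev_nonlin:
  assumes "0 \<le> R" "0 \<le> p"
  shows "ev (nonlin c R p x) n = c * cut_power R p (ev x n)"
proof -
  have "(\<lambda>n. (cmod (cut_power R p (ev x n)))\<^sup>2) summable_on UNIV"
  proof (rule summable_on_comparison_test)
    show "(\<lambda>n. (R powr p)\<^sup>2 * (cmod (ev x n))\<^sup>2) summable_on UNIV"
      by (intro summable_on_cmult_right ev_square_summable)
    show "(cmod (cut_power R p (ev x n)))\<^sup>2 \<le> (R powr p)\<^sup>2 * (cmod (ev x n))\<^sup>2" for n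
      using power_mono[OF norm_cut_power_le[OF assms, of "ev x n"], of 2] by (simp add: power_mult_distrib)
  qed auto
  then show ?thesis using assms by (simp add: nonlin_def Abs_ell2_inverse)
qed

lemma nonlin_lipschitz:
  assumes "0 \<le> R" "0 \<le> p" "cmod c = 1"
  shows "norm (nonlin c R p x - nonlin c R p y) \<le> (p + 1) * R powr p * norm (x - y)"
proof (rule norm_ell2_mono)
  fix n
  have "ev (nonlin c R p x - nonlin c R p y) n = c * (cut_power R p (ev x n) - cut_power R p (ev y n))"
    using assms by (simp add: ev_nonlin right_diff_distrib)
  then show "cmod (ev (nonlin c R p x - nonlin c R p y) n) \<le> (p + 1) * R powr p * cmod (ev (x - y) n)"
    using cut_power_lipschitz[OF assms(1,2), of "ev x n" "ev y n"] assms(3) by (simp add: norm_mult)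
qed (use assms in auto)

lemma nonlin_0 [simp]: "0 \<le> R \<Longrightarrow> 0 \<le> p \<Longrightarrow> nonlin c R p 0 = 0"
  by (rule ell2_eqI) (simp add: ev_nonlin)

lemma nonlin_skew:
  assumes "0 \<le> R" "0 \<le> p" "Re c = 0"
  shows "x \<bullet> nonlin c R p x = 0"
proof -
  have "ev x n \<bullet> ev (nonlin c R p x) n = 0" for n
    using assms by (simp add: ev_nonlin cut_power_def inner_complex_def algebra_simps)
  then show ?thesis by (simp add: inner_ell2_def)
qed

lemma cmul_nonlin: "nonlin c R p x = cmul c (nonlin 1 R p x)"
  by (rule ell2_eqI) (simp add: nonlin_def)

lemma ev_nonlin_eq_power_nonlinearity:
  assumes "0 \<le> \<sigma>" "\<And>n. cmod (ev x n) \<le> R"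
  shows "ev (nonlin 1 R (2 * \<sigma>) x) = power_nonlinearity \<sigma> (ev x)"
proof -
  have "0 \<le> R" using order_trans[OF norm_ge_zero assms(2)] .
  then show ?thesis using assms by (auto simp: ev_nonlin cut_power_def power_nonlinearity_def min_absorb1)
qed

lemma continuous_on_nonlin [continuous_intros]:
  assumes "0 \<le> R" "0 \<le> p" "cmod c = 1" "continuous_on S f"
  shows "continuous_on S (\<lambda>s. nonlin c R p (f s))"
proof -
  have "((p + 1) * R powr p)-lipschitz_on UNIV (nonlin c R p)"
    using assms by (intro lipschitz_onI) (auto simp: dist_norm nonlin_lipschitz)
  from lipschitz_on_continuous_on[OF this] show ?thesis
    by (rule continuous_on_compose2) (use assms in auto)
qed

text \<open>Picard iteration on the whole half-line in one step: in the sup norm weighted by exp(- l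
  t) with l = L + 1 the integral operator contracts with factor L / l.\<close>

lemma global_ode_solution:
  fixes G :: "real \<Rightarrow> 'b::banach \<Rightarrow> 'b"
  assumes cont: "continuous_on UNIV (\<lambda>(s, w). G s w)"
    and lip: "\<And>s w v. norm (G s w - G s v) \<le> L * norm (w - v)" and G0: "\<And>s. G s 0 = 0" and L: "0 \<le> L"
  obtains w where "continuous_on UNIV w" "\<And>t. 0 \<le> t \<Longrightarrow> w t = x + integral {0..t} (\<lambda>s. G s (w s))"
proof -
  define l where "l = L + 1"
  have l: "l > 0" "L / l < 1" "0 \<le> L / l" using L by (auto simp: l_def)
  \<comment> \<open>\<open>v\<close> is the unknown after division by exp(l t), so bounded
    continuous functions are the right space. \<open>max t 0\<close> freezes the map at its initial
    value for negative times, which keeps it on functions of the whole line.\<close>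
  define F where "F v t = exp (- (l * max t 0)) *\<^sub>R
      (x + integral {0..max t 0} (\<lambda>s. G s (exp (l * s) *\<^sub>R apply_bcontfun v s)))" for v t
  have contG: "continuous_on T (\<lambda>s. G (f s) (g s))" if "continuous_on T f" "continuous_on T g"
    for T :: "real set" and f g
    using continuous_on_compose2[OF cont continuous_on_Pair[OF that]] by simp
  have cv: "continuous_on T (\<lambda>s. G s (exp (l * s) *\<^sub>R apply_bcontfun v s))" for T v
    by (intro contG continuous_intros) auto
  have exp_int: "((\<lambda>s. L * (exp (l * s) * B)) has_integral (L / l * B * (exp (l * t) - 1))) {0..t}"
    if "0 \<le> t" for t B
  proof -
    have "((\<lambda>s. L * (exp (l * s) * B)) has_integral (L / l * B * exp (l * t) - L / l * B * exp (l * 0))) {0..t}"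
    proof (rule fundamental_theorem_of_calculus[OF that])
      fix s assume "s \<in> {0..t}"
      have "((\<lambda>s. L / l * B * exp (l * s)) has_real_derivative L * (exp (l * s) * B)) (at s within {0..t})"
        using l by (auto intro!: derivative_eq_intros)
      then show "((\<lambda>s. L / l * B * exp (l * s)) has_vector_derivative L * (exp (l * s) * B)) (at s within {0..t})"
        by (simp add: has_real_derivative_iff_has_vector_derivative)
    qed
    then show ?thesis by (simp add: algebra_simps)
  qed
  have int_le: "norm (integral {0..t} h) \<le> L / l * B * (exp (l * t) - 1)"
    if "0 \<le> t" "continuous_on {0..t} h" "\<And>s. norm (h s) \<le> L * (exp (l * s) * B)" for t B and h :: "real \<Rightarrow> 'b"
  proof -
    have "norm (integral {0..t} h) \<le> integral {0..t} (\<lambda>s. L * (exp (l * s) * B))"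
    proof (rule Henstock_Kurzweil_Integration.integral_norm_bound_integral)
      show "h integrable_on {0..t}" by (rule integrable_continuous_real[OF that(2)])
      show "(\<lambda>s. L * (exp (l * s) * B)) integrable_on {0..t}" using exp_int[OF that(1)] by blast
    qed (rule that(3))
    then show ?thesis by (simp only: integral_unique[OF exp_int[OF that(1)]])
  qed
  have damp: "exp (- (l * t)) * (L / l * B * (exp (l * t) - 1)) \<le> L / l * B" if "0 \<le> t" "0 \<le> B" for t B
  proof -
    have "exp (- (l * t)) * exp (l * t) = 1" by (simp flip: exp_add)
    moreover have "exp (- (l * t)) * (L / l * B * (exp (l * t) - 1))
        = L / l * B * (exp (- (l * t)) * exp (l * t) - exp (- (l * t)))"
      by (simp only: algebra_simps)
    ultimately have "exp (- (l * t)) * (L / l * B * (exp (l * t) - 1)) = L / l * B * (1 - exp (- (l * t)))"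
      by simp
    also have "\<dots> \<le> L / l * B * 1" using l L that by (intro mult_left_mono) auto
    finally show ?thesis by simp
  qed
  have Fcont: "F v \<in> bcontfun" for v
  proof (rule bcontfun_normI)
    define I where "I t = integral {0..t} (\<lambda>s. G s (exp (l * s) *\<^sub>R apply_bcontfun v s))" for t
    have I: "isCont (\<lambda>t. I (max t 0)) t" for t
    proof -
      have "continuous_on {0..\<bar>t\<bar> + 1} I"
        unfolding I_def by (intro indefinite_integral_continuous_1 integrable_continuous_real cv)
      then have "continuous_on {-1 - \<bar>t\<bar><..<\<bar>t\<bar> + 1} (\<lambda>t. I (max t 0))"
        by (rule continuous_on_compose2) (auto intro!: continuous_intros)
      then show ?thesis by (rule continuous_on_interior) (auto simp: interior_open)
    qed
    show "continuous_on UNIV (F v)"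
      unfolding F_def I_def[symmetric]
      by (intro continuous_intros continuous_at_imp_continuous_on ballI I) 
    fix t :: real
    define t' where "t' = max t 0"
    have "0 \<le> t'" by (simp add: t'_def)
    have "norm (F v t) \<le> exp (- (l * t')) * (norm x + L / l * norm v * (exp (l * t') - 1))"
      unfolding F_def t'_def[symmetric] norm_scaleR I_def
    proof (subst abs_exp_cancel, intro mult_left_mono norm_triangle_le add_mono order_refl int_le cv \<open>0 \<le> t'\<close>)
      fix s
      have "norm (G s (exp (l * s) *\<^sub>R apply_bcontfun v s)) \<le> L * norm (exp (l * s) *\<^sub>R apply_bcontfun v s)"
        using lip[of s "exp (l * s) *\<^sub>R apply_bcontfun v s" 0] G0 by simp
      also have "\<dots> \<le> L * (exp (l * s) * norm v)"
        using L norm_bounded[of v s] by (intro mult_left_mono) auto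
      finally show "norm (G s (exp (l * s) *\<^sub>R apply_bcontfun v s)) \<le> L * (exp (l * s) * norm v)" .
    qed simp
    also have "\<dots> \<le> 1 * norm x + L / l * norm v"
      unfolding distrib_left using damp[OF \<open>0 \<le> t'\<close>, of "norm v"] l \<open>0 \<le> t'\<close>
      by (intro add_mono mult_right_mono) auto
    finally show "norm (F v t) \<le> norm x + L / l * norm v" by simp
  qed
  define \<Phi> where "\<Phi> v = Bcontfun (F v)" for v
  have \<Phi>: "apply_bcontfun (\<Phi> v) = F v" for v
    unfolding \<Phi>_def by (rule Bcontfun_inverse[OF Fcont])
  have "\<exists>!v. \<Phi> v = v"
  proof (rule banach_fix_type[OF l(3,2)], intro allI dist_bound)
    fix v v' :: "real \<Rightarrow>\<^sub>C 'b" and t :: real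
    define t' where "t' = max t 0"
    have "0 \<le> t'" by (simp add: t'_def)
    have "dist (F v t) (F v' t) = exp (- (l * t')) * norm (integral {0..t'} (\<lambda>s.
        G s (exp (l * s) *\<^sub>R apply_bcontfun v s) - G s (exp (l * s) *\<^sub>R apply_bcontfun v' s)))"
      unfolding F_def t'_def[symmetric] dist_norm scaleR_diff_right[symmetric] norm_scaleR
      by (subst Henstock_Kurzweil_Integration.integral_diff) (auto intro!: integrable_continuous_real cv)
    also have "\<dots> \<le> exp (- (l * t')) * (L / l * dist v v' * (exp (l * t') - 1))"
    proof (intro mult_left_mono int_le \<open>0 \<le> t'\<close> continuous_on_diff cv)
      fix s
      have "norm (G s (exp (l * s) *\<^sub>R apply_bcontfun v s) - G s (exp (l * s) *\<^sub>R apply_bcontfun v' s))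
          \<le> L * norm (exp (l * s) *\<^sub>R apply_bcontfun v s - exp (l * s) *\<^sub>R apply_bcontfun v' s)" by (rule lip)
      also have "\<dots> \<le> L * (exp (l * s) * dist v v')"
        using L dist_bounded[of v s v'] by (intro mult_left_mono) (auto simp: scaleR_diff_right[symmetric] dist_norm)
      finally show "norm (G s (exp (l * s) *\<^sub>R apply_bcontfun v s) - G s (exp (l * s) *\<^sub>R apply_bcontfun v' s))
          \<le> L * (exp (l * s) * dist v v')" .
    qed simp
    also have "\<dots> \<le> L / l * dist v v'" by (rule damp) (use \<open>0 \<le> t'\<close> in auto)
    finally show "dist (apply_bcontfun (\<Phi> v) t) (apply_bcontfun (\<Phi> v') t) \<le> L / l * dist v v'"
      by (simp add: \<Phi>)
  qed
  then obtain v where v: "\<Phi> v = v" by blast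
  define w where "w t = exp (l * t) *\<^sub>R apply_bcontfun v t" for t
  show thesis
  proof (rule that)
    show "continuous_on UNIV w" unfolding w_def by (intro continuous_intros) auto
    fix t :: real assume t: "0 \<le> t"
    have "w t = exp (l * t) *\<^sub>R F v t" unfolding w_def using \<Phi>[of v] v by simp
    also have "\<dots> = x + integral {0..t} (\<lambda>s. G s (w s))"
      using t by (simp add: F_def w_def max_absorb1 exp_minus_inverse flip: exp_add)
    finally show "w t = x + integral {0..t} (\<lambda>s. G s (w s))" .
  qed
qed

text \<open>Gronwall's inequality in its homogeneous form. If m is the maximum of
  \<open>exp (- (l * s)) * h s\<close> with l = L + 1, the hypothesis at the maximum gives m <= (L /
  l) m, hence m = 0.\<close>

lemma integral_inequality_zero:
  fixes h :: "real \<Rightarrow> real"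
  assumes h: "continuous_on {0..T} h" "\<And>t. t \<in> {0..T} \<Longrightarrow> 0 \<le> h t"
    and le: "\<And>t. t \<in> {0..T} \<Longrightarrow> h t \<le> L * integral {0..t} h" and L: "0 \<le> L" and t: "t \<in> {0..T}"
  shows "h t = 0"
proof -
  define l where "l = L + 1"
  have l: "l > 0" "L / l < 1" using L by (auto simp: l_def)
  have "\<exists>t0\<in>{0..T}. \<forall>s\<in>{0..T}. exp (- (l * s)) * h s \<le> exp (- (l * t0)) * h t0"
    using t by (intro continuous_attains_sup continuous_intros h) auto
  then obtain t0 where t0: "t0 \<in> {0..T}"
    and max: "\<And>s. s \<in> {0..T} \<Longrightarrow> exp (- (l * s)) * h s \<le> exp (- (l * t0)) * h t0" by blast
  define m where "m = exp (- (l * t0)) * h t0"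
  have hm: "h s \<le> m * exp (l * s)" if "s \<in> {0..T}" for s
    using max[OF that] by (simp add: m_def exp_minus field_simps)
  have m0: "0 \<le> m" using h(2)[OF t0] by (simp add: m_def)
  have int: "((\<lambda>s. m * exp (l * s)) has_integral (m / l * exp (l * t0) - m / l * exp (l * 0))) {0..t0}"
  proof (rule fundamental_theorem_of_calculus)
    fix s assume "s \<in> {0..t0}"
    have "((\<lambda>s. m / l * exp (l * s)) has_real_derivative m * exp (l * s)) (at s within {0..t0})"
      using l by (auto intro!: derivative_eq_intros)
    then show "((\<lambda>s. m / l * exp (l * s)) has_vector_derivative m * exp (l * s)) (at s within {0..t0})"
      by (simp add: has_real_derivative_iff_has_vector_derivative)
  qed (use t0 in simp)
  have "integral {0..t0} h \<le> integral {0..t0} (\<lambda>s. m * exp (l * s))"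
    using t0 h(1) int by (intro integral_le integrable_continuous_real hm)
      (auto intro!: continuous_intros intro: continuous_on_subset)
  also have "\<dots> \<le> m / l * exp (l * t0)" unfolding integral_unique[OF int] using m0 l by simp
  finally have "L * integral {0..t0} h \<le> L * (m / l * exp (l * t0))" using L by (rule mult_left_mono)
  with le[OF t0] have "h t0 \<le> L / l * (m * exp (l * t0))" by simp
  moreover have "h t0 = m * exp (l * t0)" by (simp add: m_def exp_minus)
  ultimately have "m * exp (l * t0) * (1 - L / l) \<le> 0" by (simp add: algebra_simps)
  then have "m \<le> 0" using l by (simp add: mult_le_0_iff)
  then have "h t \<le> 0" using hm[OF t] m0 by simp
  then show ?thesis using h(2)[OF t] by simp
qed

lemma (in bounded_generator) bounded_linear_flow: "bounded_linear (flow t)"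
  by (rule bounded_linear_intro[where K = 1]) (auto simp: flow_add flow_scaleR)

text \<open>\<open>c\<close> stands for i times the sign of the nonlinearity and \<open>p\<close>
  for \<open>2 * \<sigma>\<close>. A purely imaginary \<open>c\<close> is what conservation of mass
  needs, with either sign.\<close>

locale dnls =
  fixes c :: complex and p :: real
  assumes c: "Re c = 0" "cmod c = 1" and p: "0 \<le> p"
begin

abbreviation N :: "real \<Rightarrow> 'a ell2 \<Rightarrow> 'a ell2" where
  "N R \<equiv> nonlin c R p"

text \<open>In the interaction picture, w(t) = \<open>propag (- t)\<close> applied to u(t), the
  Duhamel equation becomes w' = G(t, w). Since \<open>propag\<close> is isometric, \<open>G\<close>
  is Lipschitz uniformly in time, and mass is conserved because
  \<open>w \<bullet> G s w = 0\<close>. The Lipschitz bound in time is recorded for the decay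
  statement.\<close>

lemma cut_off_solution:
  fixes x :: "(int ^ 'd::finite) ell2"
  obtains u where "continuous_on UNIV u"
    "\<And>t. 0 \<le> t \<Longrightarrow> u t = propag t x + integral {0..t} (\<lambda>s. propag (t - s) (N 1 (u s)))"
    "\<And>t. 0 \<le> t \<Longrightarrow> norm (u t) = norm x"
    "\<And>s t. 0 \<le> s \<Longrightarrow> s \<le> t \<Longrightarrow> norm (u t - u s) \<le> (4 * real CARD('d) + p + 1) * norm x * (t - s)"
proof -
  define G where "G s w = propag (- s) (N 1 (propag s w))" for s :: real and w :: "(int ^ 'd) ell2"
  have contG: "continuous_on UNIV (\<lambda>(s, w). G s w)"
    unfolding G_def case_prod_beta using c p by (intro continuous_intros) auto
  have lipG: "norm (G s w - G s v) \<le> (p + 1) * norm (w - v)" for s w v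
  proof -
    have "norm (G s w - G s v) = norm (N 1 (propag s w) - N 1 (propag s v))"
      by (simp add: G_def flip: sg.flow_diff)
    also have "\<dots> \<le> (p + 1) * 1 powr p * norm (propag s w - propag s v)"
      using c p by (intro nonlin_lipschitz) auto
    finally show ?thesis by (simp flip: sg.flow_diff)
  qed
  obtain w where w: "continuous_on UNIV w" "\<And>t. 0 \<le> t \<Longrightarrow> w t = x + integral {0..t} (\<lambda>s. G s (w s))"
    by (rule global_ode_solution[of G "p + 1" x]) (use contG lipG p in \<open>auto simp: G_def\<close>)
  have contGw: "continuous_on S (\<lambda>s. G s (w s))" for S
    using continuous_on_compose2[OF contG continuous_on_Pair[OF continuous_on_id continuous_on_subset[OF w(1) subset_UNIV]], of S]
    by simp
  have norm_w: "norm (w t) = norm x" if t: "0 \<le> t" for t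
  proof -
    have "((\<lambda>t. w t \<bullet> w t) has_derivative (\<lambda>h. 0)) (at s within {0..t})" if s: "s \<in> {0..t}" for s
    proof -
      have "((\<lambda>s. x + integral {0..s} (\<lambda>s. G s (w s))) has_vector_derivative (0 + G s (w s))) (at s within {0..t})"
        by (intro has_vector_derivative_add has_vector_derivative_const integral_has_vector_derivative contGw s)
      then have "(w has_vector_derivative G s (w s)) (at s within {0..t})"
        using has_vector_derivative_transform[OF s, of w] w(2) by simp
      then have "((\<lambda>t. w t \<bullet> w t) has_derivative
          (\<lambda>h. w s \<bullet> (h *\<^sub>R G s (w s)) + (h *\<^sub>R G s (w s)) \<bullet> w s)) (at s within {0..t})"
        unfolding has_vector_derivative_def by (intro has_derivative_inner)
      moreover have "w s \<bullet> G s (w s) = 0"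
        using nonlin_skew[of 1 p c "propag s (w s)"] c p by (simp add: G_def sg.flow_inner_left)
      ultimately show ?thesis by (simp add: inner_commute)
    qed
    then have "w t \<bullet> w t = w 0 \<bullet> w 0"
      using t by (intro has_derivative_zero_unique[of "{0..t}" "\<lambda>t. w t \<bullet> w t"]) auto
    then show ?thesis using w(2)[of 0] by (simp add: norm_eq_sqrt_inner)
  qed
  have w_diff: "norm (w t - w s) \<le> (p + 1) * norm x * (t - s)" if st: "0 \<le> s" "s \<le> t" for s t
  proof -
    have "integral {0..s} (\<lambda>s. G s (w s)) + integral {s..t} (\<lambda>s. G s (w s)) = integral {0..t} (\<lambda>s. G s (w s))"
      using st by (intro Henstock_Kurzweil_Integration.integral_combine integrable_continuous_real contGw) auto
    then have "w t - w s = integral {s..t} (\<lambda>s. G s (w s))"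
      using w(2)[of s] w(2)[of t] st by (simp add: algebra_simps)
    also have "norm \<dots> \<le> (p + 1) * norm x * (t - s)"
    proof (rule integral_bound[OF st(2) contGw])
      show "norm (G r (w r)) \<le> (p + 1) * norm x" if "r \<in> {s..t}" for r
        using lipG[of r "w r" 0] norm_w[of r] that st p by (simp add: G_def)
    qed
    finally show ?thesis .
  qed
  show thesis
  proof (rule that[of "\<lambda>t. propag t (w t)"])
    show "continuous_on UNIV (\<lambda>t. propag t (w t))"
      by (intro continuous_intros w(1))
    show "norm (propag t (w t) - propag s (w s)) \<le> (4 * real CARD('d) + p + 1) * norm x * (t - s)"
      if st: "0 \<le> s" "s \<le> t" for s t
    proof -
      have "norm (propag t (w t) - propag s (w s)) \<le> norm (propag t (w t - w s)) + norm (propag t (w s) - propag s (w s))"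
        using norm_triangle_ineq[of "propag t (w t - w s)" "propag t (w s) - propag s (w s)"] by (simp add: sg.flow_diff)
      also have "\<dots> \<le> (p + 1) * norm x * (t - s) + 4 * real CARD('d) * norm x * (t - s)"
        using w_diff[OF st] sg.norm_flow_diff_le[of t "w s" s] norm_w[OF st(1)] st by (intro add_mono) auto
      finally show ?thesis by (simp add: algebra_simps)
    qed
    show "norm (propag t (w t)) = norm x" if "0 \<le> t" for t using norm_w[OF that] by simp
    fix t :: real assume t: "0 \<le> t"
    have "propag t (integral {0..t} (\<lambda>s. G s (w s))) = integral {0..t} (\<lambda>s. propag t (G s (w s)))"
      using integral_linear[OF integrable_continuous_real[OF contGw] sg.bounded_linear_flow, of 0 t t]
      by (simp add: comp_def)
    then show "propag t (w t) = propag t x + integral {0..t} (\<lambda>s. propag (t - s) (N 1 (propag s (w s))))"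
      by (subst w(2)[OF t]) (simp add: sg.flow_add G_def)
  qed
qed

text \<open>The level \<open>R\<close> is arbitrary because a competing solution is not known to
  have entries of modulus at most 1. On a compact time interval it is bounded, so a large
  \<open>R\<close> truncates neither solution.\<close>

lemma duhamel_unique:
  fixes u v :: "real \<Rightarrow> (int ^ 'd::finite) ell2"
  assumes R: "0 \<le> R" and cont: "continuous_on {0..T} u" "continuous_on {0..T} v"
    and u: "\<And>t. t \<in> {0..T} \<Longrightarrow> u t = propag t x + integral {0..t} (\<lambda>s. propag (t - s) (N R (u s)))"
    and v: "\<And>t. t \<in> {0..T} \<Longrightarrow> v t = propag t x + integral {0..t} (\<lambda>s. propag (t - s) (N R (v s)))"
    and t: "t \<in> {0..T}"
  shows "u t = v t"
proof -
  define L where "L = (p + 1) * R powr p"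
  have "norm (u t - v t) = 0"
  proof (rule integral_inequality_zero[where h = "\<lambda>t. norm (u t - v t)" and L = L, OF _ _ _ _ t])
    show "continuous_on {0..T} (\<lambda>t. norm (u t - v t))" by (intro continuous_intros cont)
    show "0 \<le> L" using p by (simp add: L_def)
    fix t assume t: "t \<in> {0..T}"
    have sub: "continuous_on {0..t} u" "continuous_on {0..t} v"
      using t by (auto intro: continuous_on_subset[OF cont(1)] continuous_on_subset[OF cont(2)])
    have ci: "continuous_on {0..t} (\<lambda>s. propag (t - s) (N R (w s)))" if "continuous_on {0..t} w" for w :: "real \<Rightarrow> (int ^ 'd) ell2"
      using that R c p by (intro continuous_intros)
    have "u t - v t = integral {0..t} (\<lambda>s. propag (t - s) (N R (u s)) - propag (t - s) (N R (v s)))"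
      unfolding u[OF t] v[OF t]
      by (subst Henstock_Kurzweil_Integration.integral_diff) (auto intro!: integrable_continuous_real ci sub)
    also have "norm \<dots> \<le> integral {0..t} (\<lambda>s. L * norm (u s - v s))"
    proof (rule Henstock_Kurzweil_Integration.integral_norm_bound_integral)
      show "norm (propag (t - s) (N R (u s)) - propag (t - s) (N R (v s))) \<le> L * norm (u s - v s)" for s
        using nonlin_lipschitz[OF R p c(2), of "u s" "v s"] by (simp add: L_def flip: sg.flow_diff)
    qed (auto intro!: integrable_continuous_real continuous_intros ci sub)
    finally show "norm (u t - v t) \<le> L * integral {0..t} (\<lambda>t. norm (u t - v t))" by simp
  qed simp
  then show ?thesis by simp
qed

end

section \<open>Scalar convolution inequalities\<close>

lemma nn_integral_diff_swap:
  fixes f :: "real \<Rightarrow> ennreal"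
  assumes [measurable]: "f \<in> borel_measurable borel"
  shows "(\<integral>\<^sup>+ s. f (t - s) \<partial>lborel) = (\<integral>\<^sup>+ x. f x \<partial>lborel)"
    and "(\<integral>\<^sup>+ s. f (s - t) \<partial>lborel) = (\<integral>\<^sup>+ x. f x \<partial>lborel)"
  using nn_integral_real_affine[of f "-1" t] nn_integral_real_affine[of f 1 "- t"] by auto

lemma nn_integral_even_le:
  fixes h :: "real \<Rightarrow> ennreal"
  assumes [measurable]: "h \<in> borel_measurable borel"
  shows "(\<integral>\<^sup>+ x. h \<bar>x\<bar> \<partial>lborel) \<le> 2 * (\<integral>\<^sup>+ x. h x * indicator {0..} x \<partial>lborel)"
proof -
  have "(\<integral>\<^sup>+ x. h \<bar>x\<bar> \<partial>lborel) \<le> (\<integral>\<^sup>+ x. h x * indicator {0..} x + h (- x) * indicator {0..} (- x) \<partial>lborel)"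
    by (rule nn_integral_mono) (auto simp: indicator_def abs_if)
  also have "\<dots> = (\<integral>\<^sup>+ x. h x * indicator {0..} x \<partial>lborel) + (\<integral>\<^sup>+ x. h (- x) * indicator {0..} (- x) \<partial>lborel)"
    by (rule nn_integral_add) auto
  also have "(\<integral>\<^sup>+ x. h (- x) * indicator {0..} (- x) \<partial>lborel) = (\<integral>\<^sup>+ x. h x * indicator {0..} x \<partial>lborel)"
    using nn_integral_diff_swap(1)[of "\<lambda>x. h x * indicator {0..} x" 0] by simp
  finally show ?thesis by (simp add: mult_2)
qed

lemma nn_integral_powr_near:
  assumes "0 \<le> R" "0 \<le> a" "a < 1"
  shows "(\<integral>\<^sup>+ x. ennreal (indicator {..R} \<bar>x\<bar> * \<bar>x\<bar> powr (- a)) \<partial>lborel) \<le> ennreal (2 * R powr (1 - a) / (1 - a))"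
proof -
  have "(\<integral>\<^sup>+ x. ennreal (indicator {..R} \<bar>x\<bar> * \<bar>x\<bar> powr (- a)) \<partial>lborel)
      \<le> 2 * (\<integral>\<^sup>+ x. ennreal (indicator {..R} x * x powr (- a)) * indicator {0..} x \<partial>lborel)"
    by (rule nn_integral_even_le) auto
  also have "(\<integral>\<^sup>+ x. ennreal (indicator {..R} x * x powr (- a)) * indicator {0..} x \<partial>lborel)
      = (\<integral>\<^sup>+ x. ennreal (x powr (- a)) * indicator {0..R} x \<partial>lborel)"
    by (rule nn_integral_cong) (auto simp: indicator_def)
  also have "\<dots> = ennreal (R powr (1 - a) / (1 - a))"
    using nn_integral_has_integral_lebesgue'[OF _ has_integral_powr_from_0[of "- a" R]] assms by simp
  finally show ?thesis by (simp add: ennreal_mult'[symmetric] mult.assoc flip: ennreal_numeral)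
qed

lemma nn_integral_powr_far:
  assumes "0 < R" "1 < a"
  shows "(\<integral>\<^sup>+ x. ennreal (indicator {R..} \<bar>x\<bar> * \<bar>x\<bar> powr (- a)) \<partial>lborel) \<le> ennreal (2 * R powr (1 - a) / (a - 1))"
proof -
  have "(\<integral>\<^sup>+ x. ennreal (indicator {R..} \<bar>x\<bar> * \<bar>x\<bar> powr (- a)) \<partial>lborel)
      \<le> 2 * (\<integral>\<^sup>+ x. ennreal (indicator {R..} x * x powr (- a)) * indicator {0..} x \<partial>lborel)"
    by (rule nn_integral_even_le) auto
  also have "(\<integral>\<^sup>+ x. ennreal (indicator {R..} x * x powr (- a)) * indicator {0..} x \<partial>lborel)
      = (\<integral>\<^sup>+ x. ennreal (x powr (- a)) * indicator {R..} x \<partial>lborel)"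
    using assms by (intro nn_integral_cong) (auto simp: indicator_def)
  also have "\<dots> = ennreal (- (R powr (- a + 1)) / (- a + 1))"
    using assms by (intro nn_integral_has_integral_lebesgue' has_integral_powr_to_inf) auto
  also have "- (R powr (- a + 1)) / (- a + 1) = R powr (1 - a) / (a - 1)"
    using minus_divide_divide[of "R powr (1 - a)" "a - 1"] by (simp add: algebra_simps)
  finally show ?thesis using assms by (simp add: ennreal_mult'[symmetric] mult.assoc flip: ennreal_numeral)
qed

text \<open>Young's inequality for an integrable kernel between two square integrable functions, by
  \<open>b e \<le> b^2 + e^2\<close> and translation invariance. The additive right-hand side can
  later be summed directly over pairs of level sets.\<close>

lemma young_schur:
  fixes b e :: "real \<Rightarrow> real" and w :: "real \<Rightarrow> real"
  assumes [measurable]: "b \<in> borel_measurable borel" "e \<in> borel_measurable borel" "w \<in> borel_measurable borel"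
    and nonneg: "\<And>x. 0 \<le> w x" and W: "(\<integral>\<^sup>+ x. ennreal (w x) \<partial>lborel) \<le> W"
  shows "(\<integral>\<^sup>+ t. \<integral>\<^sup>+ s. ennreal (b s * e t * w (t - s)) \<partial>lborel \<partial>lborel)
    \<le> W * ((\<integral>\<^sup>+ s. ennreal ((b s)\<^sup>2) \<partial>lborel) + (\<integral>\<^sup>+ t. ennreal ((e t)\<^sup>2) \<partial>lborel))"
proof -
  define X where "X = (\<integral>\<^sup>+ x. ennreal (w x) \<partial>lborel)"
  have int1: "(\<integral>\<^sup>+ s. k * ennreal (w (t - s)) \<partial>lborel) = k * X"
    and int2: "(\<integral>\<^sup>+ s. k * ennreal (w (s - t)) \<partial>lborel) = k * X" for k t
    unfolding X_def using nn_integral_diff_swap[of "\<lambda>x. ennreal (w x)" t]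
    by (subst nn_integral_cmult; simp)+
  have "(\<integral>\<^sup>+ t. \<integral>\<^sup>+ s. ennreal (b s * e t * w (t - s)) \<partial>lborel \<partial>lborel)
      \<le> (\<integral>\<^sup>+ t. \<integral>\<^sup>+ s. ennreal ((b s)\<^sup>2) * ennreal (w (t - s)) + ennreal ((e t)\<^sup>2) * ennreal (w (t - s)) \<partial>lborel \<partial>lborel)"
  proof (intro nn_integral_mono)
    fix t s
    have "b s * e t \<le> (b s)\<^sup>2 + (e t)\<^sup>2"
      using sum_squares_bound[of "b s" "e t"] zero_le_power2[of "b s"] zero_le_power2[of "e t"] by linarith
    then have "b s * e t * w (t - s) \<le> (b s)\<^sup>2 * w (t - s) + (e t)\<^sup>2 * w (t - s)"
      using mult_right_mono[OF _ nonneg] by (fastforce simp: distrib_right)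
    then show "ennreal (b s * e t * w (t - s)) \<le> ennreal ((b s)\<^sup>2) * ennreal (w (t - s)) + ennreal ((e t)\<^sup>2) * ennreal (w (t - s))"
      using nonneg by (simp add: ennreal_mult'[symmetric] ennreal_plus[symmetric] ennreal_leI del: ennreal_plus)
  qed
  also have "\<dots> = (\<integral>\<^sup>+ t. \<integral>\<^sup>+ s. ennreal ((b s)\<^sup>2) * ennreal (w (t - s)) \<partial>lborel \<partial>lborel)
      + (\<integral>\<^sup>+ t. \<integral>\<^sup>+ s. ennreal ((e t)\<^sup>2) * ennreal (w (t - s)) \<partial>lborel \<partial>lborel)"
    by (simp add: nn_integral_add)
  also have "(\<integral>\<^sup>+ t. \<integral>\<^sup>+ s. ennreal ((b s)\<^sup>2) * ennreal (w (t - s)) \<partial>lborel \<partial>lborel)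
      = (\<integral>\<^sup>+ s. \<integral>\<^sup>+ t. ennreal ((b s)\<^sup>2) * ennreal (w (t - s)) \<partial>lborel \<partial>lborel)"
    by (rule lborel_pair.Fubini') simp
  also have "\<dots> = X * (\<integral>\<^sup>+ s. ennreal ((b s)\<^sup>2) \<partial>lborel)"
    unfolding int2 by (subst nn_integral_multc) (simp_all add: mult.commute)
  also have "(\<integral>\<^sup>+ t. \<integral>\<^sup>+ s. ennreal ((e t)\<^sup>2) * ennreal (w (t - s)) \<partial>lborel \<partial>lborel)
      = X * (\<integral>\<^sup>+ t. ennreal ((e t)\<^sup>2) \<partial>lborel)"
    unfolding int1 by (subst nn_integral_multc) (simp_all add: mult.commute)
  finally have "(\<integral>\<^sup>+ t. \<integral>\<^sup>+ s. ennreal (b s * e t * w (t - s)) \<partial>lborel \<partial>lborel)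
    \<le> X * ((\<integral>\<^sup>+ s. ennreal ((b s)\<^sup>2) \<partial>lborel) + (\<integral>\<^sup>+ t. ennreal ((e t)\<^sup>2) \<partial>lborel))"
    by (simp add: distrib_left)
  also have "\<dots> \<le> W * ((\<integral>\<^sup>+ s. ennreal ((b s)\<^sup>2) \<partial>lborel) + (\<integral>\<^sup>+ t. ennreal ((e t)\<^sup>2) \<partial>lborel))"
    using W by (intro mult_right_mono) (auto simp: X_def)
  finally show ?thesis .
qed

text \<open>
  The Hardy--Littlewood--Sobolev inequality in the diagonal case. On the half of the plane where
  \<open>f s \<le> g t\<close>, the kernel is cut at distance \<open>g t powr (- p)\<close>: the near part uses \<open>f s \<le> g t\<close>, the
  far part Young's inequality.
\<close>

lemma hls_half_pointwise:
  fixes f g x a p :: real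
  assumes a: "0 < a" "a < 1" and p: "p = 2 / (2 - a)" and fg: "0 \<le> f" "f \<le> g" and x: "x \<noteq> 0"
  shows "f * g * \<bar>x\<bar> powr (- a) \<le> g\<^sup>2 * (indicator {..g powr (- p)} \<bar>x\<bar> * \<bar>x\<bar> powr (- a))
     + g powr p * f powr p + indicator {g powr (- p)..} \<bar>x\<bar> * \<bar>x\<bar> powr (- 2)"
proof (cases "g = 0")
  case False
  then have g: "g > 0" using fg by linarith
  have near_nonneg: "0 \<le> g powr p * f powr p + indicator {g powr (- p)..} \<bar>x\<bar> * \<bar>x\<bar> powr (- 2)" by simp
  show ?thesis
  proof (cases "\<bar>x\<bar> \<le> g powr (- p)")
    case True
    have "f * g * \<bar>x\<bar> powr (- a) \<le> g * g * \<bar>x\<bar> powr (- a)"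
      using fg g by (intro mult_right_mono) auto
    moreover have "indicator {..g powr (- p)} \<bar>x\<bar> = (1::real)" using True by simp
    ultimately show ?thesis using near_nonneg by (simp only: power2_eq_square mult_1)
  next
    case far: False
    define q where "q = 2 / a"
    have pq: "p > 1" "q > 1" "1 / p + 1 / q = 1" using a by (simp_all add: p q_def field_simps)
    have "(f * g) * \<bar>x\<bar> powr (- a) \<le> (f * g) powr p / p + (\<bar>x\<bar> powr (- a)) powr q / q"
      by (rule Youngs_inequality[OF pq]) (use fg g in auto)
    also have "\<dots> \<le> (f * g) powr p / 1 + (\<bar>x\<bar> powr (- a)) powr q / 1"
      using pq by (intro add_mono divide_left_mono) auto
    also have "(\<bar>x\<bar> powr (- a)) powr q = \<bar>x\<bar> powr (- 2)"
      using a by (simp add: powr_powr q_def)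
    finally show ?thesis using far fg by (simp add: powr_mult mult_ac)
  qed
qed (use fg in auto)

lemma hls_half:
  fixes f g :: "real \<Rightarrow> real"
  assumes a: "0 < a" "a < 1" and p: "p = 2 / (2 - a)"
    and [measurable]: "f \<in> borel_measurable borel" "g \<in> borel_measurable borel"
    and nonneg: "\<And>t. 0 \<le> f t" "\<And>t. 0 \<le> g t"
    and f1: "(\<integral>\<^sup>+ s. ennreal (f s powr p) \<partial>lborel) \<le> 1" and g1: "(\<integral>\<^sup>+ t. ennreal (g t powr p) \<partial>lborel) \<le> 1"
  shows "(\<integral>\<^sup>+ t. \<integral>\<^sup>+ s. ennreal (if f s \<le> g t then f s * g t * \<bar>t - s\<bar> powr (- a) else 0) \<partial>lborel \<partial>lborel)
    \<le> ennreal (2 / (1 - a) + 3)"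
proof -
  have inner: "(\<integral>\<^sup>+ s. ennreal (if f s \<le> g t then f s * g t * \<bar>t - s\<bar> powr (- a) else 0) \<partial>lborel)
      \<le> ennreal (2 / (1 - a) + 3) * ennreal (g t powr p)" for t
  proof (cases "g t = 0")
    case True
    then have "(if f s \<le> g t then f s * g t * \<bar>t - s\<bar> powr (- a) else 0) = 0" for s by simp
    then show ?thesis by (simp only:) simp
  next
    case False
    then have g: "g t > 0" using nonneg(2)[of t] by linarith
    define R where "R = g t powr (- p)"
    have R: "R > 0" using g by (simp add: R_def)
    have p1: "p > 1" using a by (simp add: p)
    define A where "A x = ennreal (indicator {..R} \<bar>x\<bar> * \<bar>x\<bar> powr (- a))" for x :: real
    define B where "B x = ennreal (indicator {R..} \<bar>x\<bar> * \<bar>x\<bar> powr (- 2))" for x :: real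
    have [measurable]: "A \<in> borel_measurable borel" "B \<in> borel_measurable borel"
      by (simp_all add: A_def[abs_def] B_def[abs_def])
    have "(\<integral>\<^sup>+ s. ennreal (if f s \<le> g t then f s * g t * \<bar>t - s\<bar> powr (- a) else 0) \<partial>lborel)
      \<le> (\<integral>\<^sup>+ s. ennreal ((g t)\<^sup>2) * A (t - s) + ennreal (g t powr p) * ennreal (f s powr p) + B (t - s) \<partial>lborel)"
    proof (rule nn_integral_mono)
      fix s
      show "ennreal (if f s \<le> g t then f s * g t * \<bar>t - s\<bar> powr (- a) else 0)
          \<le> ennreal ((g t)\<^sup>2) * A (t - s) + ennreal (g t powr p) * ennreal (f s powr p) + B (t - s)"
      proof (cases "f s \<le> g t \<and> t \<noteq> s")
        case True
        then have "f s * g t * \<bar>t - s\<bar> powr (- a) \<le> (g t)\<^sup>2 * (indicator {..R} \<bar>t - s\<bar> * \<bar>t - s\<bar> powr (- a))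
           + g t powr p * f s powr p + indicator {R..} \<bar>t - s\<bar> * \<bar>t - s\<bar> powr (- 2)"
          unfolding R_def using nonneg by (intro hls_half_pointwise[OF a p]) auto
        then show ?thesis using True unfolding A_def B_def
          by (simp add: ennreal_mult'[symmetric] ennreal_plus[symmetric] ennreal_leI del: ennreal_plus)
      next
        case False
        then have "(if f s \<le> g t then f s * g t * \<bar>t - s\<bar> powr (- a) else 0) = 0" by auto
        then show ?thesis by (simp only:) simp
      qed
    qed
    also have "\<dots> = ennreal ((g t)\<^sup>2) * (\<integral>\<^sup>+ x. A x \<partial>lborel)
        + ennreal (g t powr p) * (\<integral>\<^sup>+ s. ennreal (f s powr p) \<partial>lborel) + (\<integral>\<^sup>+ x. B x \<partial>lborel)"
      using nn_integral_diff_swap(1)[of A t] nn_integral_diff_swap(1)[of B t]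
      by (simp add: nn_integral_add nn_integral_cmult)
    also have "\<dots> \<le> ennreal ((g t)\<^sup>2) * ennreal (2 * R powr (1 - a) / (1 - a))
        + ennreal (g t powr p) * 1 + ennreal (2 * R powr (1 - 2) / (2 - 1))"
      unfolding A_def B_def using a R
      by (intro add_mono mult_left_mono f1 nn_integral_powr_near nn_integral_powr_far) auto
    also have "\<dots> = ennreal ((g t)\<^sup>2 * (2 * R powr (1 - a) / (1 - a)) + g t powr p + 2 * R powr (1 - 2) / (2 - 1))"
      using a by (simp add: ennreal_mult'[symmetric] ennreal_plus[symmetric] del: ennreal_plus)
    \<comment> \<open>This identity fixes the exponent: with \<open>R\<close> the power
      \<open>- p\<close> of \<open>g t\<close>, homogeneity requires
      \<open>2 - p * (1 - a) = p\<close>, that is \<open>p = 2 / (2 - a)\<close>.\<close>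
    also have "(g t)\<^sup>2 * (2 * R powr (1 - a) / (1 - a)) = 2 / (1 - a) * g t powr p"
    proof -
      have "(g t)\<^sup>2 * R powr (1 - a) = g t powr 2 * g t powr (- p * (1 - a))"
        using g by (simp add: R_def powr_powr)
      also have "\<dots> = g t powr (2 - p * (1 - a))" by (simp flip: powr_add)
      also have "2 - p * (1 - a) = p" using a by (simp add: p field_simps)
      finally show ?thesis by simp
    qed
    also have "2 * R powr (1 - 2) / (2 - 1) = 2 * g t powr p" using g by (simp add: R_def powr_minus divide_simps)
    also have "2 / (1 - a) * g t powr p + g t powr p + 2 * g t powr p = (2 / (1 - a) + 3) * g t powr p"
      by (simp add: algebra_simps)
    finally show ?thesis using a by (subst ennreal_mult'[symmetric]) auto
  qed
  have "(\<integral>\<^sup>+ t. \<integral>\<^sup>+ s. ennreal (if f s \<le> g t then f s * g t * \<bar>t - s\<bar> powr (- a) else 0) \<partial>lborel \<partial>lborel)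
      \<le> (\<integral>\<^sup>+ t. ennreal (2 / (1 - a) + 3) * ennreal (g t powr p) \<partial>lborel)"
    by (rule nn_integral_mono) (rule inner)
  also have "\<dots> = ennreal (2 / (1 - a) + 3) * (\<integral>\<^sup>+ t. ennreal (g t powr p) \<partial>lborel)"
    by (rule nn_integral_cmult) simp
  also have "\<dots> \<le> ennreal (2 / (1 - a) + 3) * 1" by (intro mult_left_mono g1) simp
  finally show ?thesis by simp
qed

lemma hls:
  fixes f g :: "real \<Rightarrow> real"
  assumes a: "0 < a" "a < 1" and p: "p = 2 / (2 - a)"
    and [measurable]: "f \<in> borel_measurable borel" "g \<in> borel_measurable borel"
    and nonneg: "\<And>t. 0 \<le> f t" "\<And>t. 0 \<le> g t"
    and f1: "(\<integral>\<^sup>+ s. ennreal (f s powr p) \<partial>lborel) \<le> 1" and g1: "(\<integral>\<^sup>+ t. ennreal (g t powr p) \<partial>lborel) \<le> 1"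
  shows "(\<integral>\<^sup>+ t. \<integral>\<^sup>+ s. ennreal (f s * g t * \<bar>t - s\<bar> powr (- a)) \<partial>lborel \<partial>lborel)
    \<le> ennreal (2 * (2 / (1 - a) + 3))"
proof -
  let ?H = "\<lambda>f g t s. ennreal (if f s \<le> g t then f s * g t * \<bar>t - s\<bar> powr (- a) else 0)"
  have "(\<integral>\<^sup>+ t. \<integral>\<^sup>+ s. ennreal (f s * g t * \<bar>t - s\<bar> powr (- a)) \<partial>lborel \<partial>lborel)
      \<le> (\<integral>\<^sup>+ t. \<integral>\<^sup>+ s. ?H f g t s + ?H g f s t \<partial>lborel \<partial>lborel)"
  proof (intro nn_integral_mono)
    fix t s
    show "ennreal (f s * g t * \<bar>t - s\<bar> powr (- a)) \<le> ?H f g t s + ?H g f s t"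
      by (cases "f s \<le> g t") (auto simp: mult.commute abs_minus_commute)
  qed
  also have "\<dots> = (\<integral>\<^sup>+ t. \<integral>\<^sup>+ s. ?H f g t s \<partial>lborel \<partial>lborel) + (\<integral>\<^sup>+ t. \<integral>\<^sup>+ s. ?H g f s t \<partial>lborel \<partial>lborel)"
    by (simp add: nn_integral_add)
  also have "(\<integral>\<^sup>+ t. \<integral>\<^sup>+ s. ?H g f s t \<partial>lborel \<partial>lborel) = (\<integral>\<^sup>+ s. \<integral>\<^sup>+ t. ?H g f s t \<partial>lborel \<partial>lborel)"
    by (rule lborel_pair.Fubini') simp
  also have "(\<integral>\<^sup>+ t. \<integral>\<^sup>+ s. ?H f g t s \<partial>lborel \<partial>lborel) + (\<integral>\<^sup>+ s. \<integral>\<^sup>+ t. ?H g f s t \<partial>lborel \<partial>lborel)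
      \<le> ennreal (2 / (1 - a) + 3) + ennreal (2 / (1 - a) + 3)"
    by (intro add_mono hls_half[OF a p] assms)
  also have "\<dots> = ennreal (2 * (2 / (1 - a) + 3))"
    using a by (simp add: ennreal_plus[symmetric] del: ennreal_plus)
  finally show ?thesis .
qed

section \<open>The bilinear form of the Strichartz estimates\<close>

lemma borel_measurable_propag [measurable (raw)]:
  fixes g :: "'b \<Rightarrow> (int ^ 'd::finite) ell2"
  assumes "f \<in> borel_measurable M" "g \<in> borel_measurable M"
  shows "(\<lambda>x. propag (f x) (g x)) \<in> borel_measurable M"
  using assms by (rule borel_measurable_continuous_Pair) (intro continuous_intros)

lemma borel_measurable_ev [measurable (raw)]:
  fixes g :: "'b \<Rightarrow> 'a::countable ell2"
  assumes "g \<in> borel_measurable M"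
  shows "(\<lambda>x. ev (g x) n) \<in> borel_measurable M"
  using assms by (rule measurable_compose)
    (intro borel_measurable_continuous_onI linear_continuous_on bounded_linear_ev)

text \<open>Test functions, bounded and supported in a compact time interval, so that the double
  integrals converge absolutely. \<open>S\<close> may be the whole lattice; \<open>T\<close> and
  \<open>B\<close> drop out of the final constants.\<close>

definition forcing :: "'a set \<Rightarrow> real \<Rightarrow> real \<Rightarrow> (real \<Rightarrow> 'a ell2) \<Rightarrow> bool" where
  "forcing S T B F \<longleftrightarrow> F \<in> borel_measurable borel \<and> (\<forall>t n. n \<notin> S \<longrightarrow> ev (F t) n = 0) \<and>
     (\<forall>t. t \<notin> {0..T} \<longrightarrow> F t = 0) \<and> (\<forall>t. norm (F t) \<le> B)"

lemma forcingD:
  assumes "forcing S T B F"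
  shows "F \<in> borel_measurable borel" "n \<notin> S \<Longrightarrow> ev (F t) n = 0" "t \<notin> {0..T} \<Longrightarrow> F t = 0"
    "norm (F t) \<le> B" "0 \<le> B"
  using assms order_trans[OF norm_ge_zero, of "F t" B] by (auto simp: forcing_def)

definition bil :: "real set \<Rightarrow> (real \<Rightarrow> (int ^ 'd::finite) ell2) \<Rightarrow> (real \<Rightarrow> (int ^ 'd) ell2) \<Rightarrow> real" where
  "bil I F G = (\<integral>p. indicator I (snd p - fst p) * (propag (snd p - fst p) (F (fst p)) \<bullet> G (snd p))
     \<partial>(lborel \<Otimes>\<^sub>M lborel))"

lemma emeasure_lborel_Icc_finite: "emeasure lborel {a..b::real} < \<infinity>"
  by (simp add: emeasure_lborel_Icc_eq)

lemma bil_integrable: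
  fixes F G :: "real \<Rightarrow> (int ^ 'd::finite) ell2"
  assumes F: "forcing S T B F" and G: "forcing S' T B' G" and [measurable]: "I \<in> sets borel"
  shows "integrable (lborel \<Otimes>\<^sub>M lborel)
    (\<lambda>p. indicator I (snd p - fst p) * (propag (snd p - fst p) (F (fst p)) \<bullet> G (snd p)))"
proof (rule Bochner_Integration.integrable_bound)
  note [measurable] = forcingD(1)[OF F] forcingD(1)[OF G]
  have "emeasure (lborel \<Otimes>\<^sub>M lborel) ({0..T} \<times> {0..T}) < \<infinity>"
    using emeasure_lborel_Icc_finite[of 0 T]
    by (subst lborel.emeasure_pair_measure_Times) (auto simp: ennreal_mult_less_top)
  then have "integrable (lborel \<Otimes>\<^sub>M lborel) (indicat_real ({0..T} \<times> {0..T}))"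
    by (intro integrable_real_indicator) auto
  then show "integrable (lborel \<Otimes>\<^sub>M lborel) (\<lambda>p. B * B' * indicat_real ({0..T} \<times> {0..T}) p)"
    by (rule integrable_mult_right)
  show "(\<lambda>p. indicator I (snd p - fst p) * (propag (snd p - fst p) (F (fst p)) \<bullet> G (snd p)))
      \<in> borel_measurable (lborel \<Otimes>\<^sub>M lborel)" by measurable
  show "AE p in lborel \<Otimes>\<^sub>M lborel. norm (indicator I (snd p - fst p) * (propag (snd p - fst p) (F (fst p)) \<bullet> G (snd p)))
      \<le> norm (B * B' * indicat_real ({0..T} \<times> {0..T}) p)"
  proof (rule AE_I2)
    fix p :: "real \<times> real"
    have "\<bar>propag (snd p - fst p) (F (fst p)) \<bullet> G (snd p)\<bar> \<le> B * B'"
      using Cauchy_Schwarz_ineq2[of "propag (snd p - fst p) (F (fst p))" "G (snd p)"]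
        mult_mono[OF forcingD(4)[OF F, of "fst p"] forcingD(4)[OF G, of "snd p"]] forcingD(5)[OF F] by simp
    moreover have "F (fst p) = 0 \<or> G (snd p) = 0" if "p \<notin> {0..T} \<times> {0..T}"
      using that forcingD(3)[OF F, of "fst p"] forcingD(3)[OF G, of "snd p"] by (cases p) auto
    ultimately show "norm (indicator I (snd p - fst p) * (propag (snd p - fst p) (F (fst p)) \<bullet> G (snd p)))
      \<le> norm (B * B' * indicat_real ({0..T} \<times> {0..T}) p)"
      using forcingD(5)[OF F] forcingD(5)[OF G]
      by (cases "p \<in> {0..T} \<times> {0..T}") (auto simp: indicator_def abs_mult)
  qed
qed

lemma bil_le_nn_integral:
  fixes F G :: "real \<Rightarrow> (int ^ 'd::finite) ell2"
  assumes F: "forcing S T B F" and G: "forcing S' T B' G" and [measurable]: "I \<in> sets borel"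
  shows "ennreal \<bar>bil I F G\<bar> \<le> (\<integral>\<^sup>+ t. \<integral>\<^sup>+ s. ennreal (indicator I (t - s) * \<bar>propag (t - s) (F s) \<bullet> G t\<bar>) \<partial>lborel \<partial>lborel)"
proof -
  note [measurable] = forcingD(1)[OF F] forcingD(1)[OF G]
  have "ennreal \<bar>bil I F G\<bar> \<le> (\<integral>\<^sup>+ p. ennreal (norm (indicator I (snd p - fst p) * (propag (snd p - fst p) (F (fst p)) \<bullet> G (snd p))))
     \<partial>(lborel \<Otimes>\<^sub>M lborel))"
    unfolding bil_def using integral_norm_bound_ennreal[OF bil_integrable[OF assms]] by simp
  also have "\<dots> = (\<integral>\<^sup>+ t. \<integral>\<^sup>+ s. ennreal (norm (indicator I (t - s) * (propag (t - s) (F s) \<bullet> G t))) \<partial>lborel \<partial>lborel)"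
    by (subst lborel_pair.nn_integral_snd[symmetric]) simp_all
  finally show ?thesis by (simp add: abs_mult)
qed

text \<open>The adjoint of \<open>propag t\<close> is \<open>propag (- t)\<close>, so exchanging the
  two arguments reflects the set of lags.\<close>

lemma bil_swap:
  fixes F G :: "real \<Rightarrow> (int ^ 'd::finite) ell2"
  assumes F: "forcing S T B F" and G: "forcing S' T B' G" and [measurable]: "I \<in> sets borel"
  shows "bil I F G = bil (uminus ` I) G F"
proof -
  note [measurable] = forcingD(1)[OF F] forcingD(1)[OF G]
  have uminus: "uminus ` I = uminus -` I" by force
  then have [measurable]: "uminus ` I \<in> sets borel"
    using measurable_sets[of "uminus :: real \<Rightarrow> real" borel borel I] by simp
  have key: "propag (a - b) (G b) \<bullet> F a = propag (b - a) (F a) \<bullet> G b" for a b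
    using sg.flow_inner_left[of "a - b" "G b" "F a"] by (simp add: inner_commute)
  have "bil (uminus ` I) G F = (\<integral>p. (case p of (x, y) \<Rightarrow> indicator I (y - x) * (propag (y - x) (F x) \<bullet> G y)) \<partial>(lborel \<Otimes>\<^sub>M lborel))"
    unfolding bil_def
    by (subst lborel_pair.integral_product_swap[symmetric])
       (auto simp: uminus indicator_def case_prod_beta key intro!: Bochner_Integration.integral_cong)
  then show ?thesis by (simp add: bil_def case_prod_beta)
qed

lemma bil_sum:
  fixes F G :: "'i \<Rightarrow> real \<Rightarrow> (int ^ 'd::finite) ell2"
  assumes F: "\<And>k. k \<in> K \<Longrightarrow> forcing S T B (F k)" and G: "\<And>l. l \<in> L \<Longrightarrow> forcing S' T B' (G l)"
    and I: "I \<in> sets borel"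
  shows "bil I (\<lambda>t. \<Sum>k\<in>K. F k t) (\<lambda>t. \<Sum>l\<in>L. G l t) = (\<Sum>k\<in>K. \<Sum>l\<in>L. bil I (F k) (G l))"
proof -
  have "bil I (\<lambda>t. \<Sum>k\<in>K. F k t) (\<lambda>t. \<Sum>l\<in>L. G l t)
    = (\<integral>p. (\<Sum>k\<in>K. \<Sum>l\<in>L. indicator I (snd p - fst p) * (propag (snd p - fst p) (F k (fst p)) \<bullet> G l (snd p))) \<partial>(lborel \<Otimes>\<^sub>M lborel))"
    unfolding bil_def sg.flow_sum inner_sum_left unfolding inner_sum_right sum_distrib_left by (rule refl)
  also have "\<dots> = (\<Sum>k\<in>K. \<integral>p. (\<Sum>l\<in>L. indicator I (snd p - fst p) * (propag (snd p - fst p) (F k (fst p)) \<bullet> G l (snd p))) \<partial>(lborel \<Otimes>\<^sub>M lborel))"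
    using bil_integrable[OF F G I]
    by (intro Bochner_Integration.integral_sum Bochner_Integration.integrable_sum)
  also have "\<dots> = (\<Sum>k\<in>K. \<Sum>l\<in>L. bil I (F k) (G l))"
    unfolding bil_def using bil_integrable[OF F G I]
    by (intro sum.cong refl Bochner_Integration.integral_sum)
  finally show ?thesis .
qed

lemma bil_split:
  fixes F G :: "real \<Rightarrow> (int ^ 'd::finite) ell2"
  assumes F: "forcing S T B F" and G: "forcing S' T B' G" and [measurable]: "I \<in> sets borel" "J \<in> sets borel"
  shows "bil I F G = bil (I \<inter> J) F G + bil (I - J) F G"
proof -
  have "I \<inter> J \<in> sets borel" "I - J \<in> sets borel" by auto
  note int = bil_integrable[OF F G this(1)] bil_integrable[OF F G this(2)]
  have "indicator I x = (indicator (I \<inter> J) x + indicator (I - J) x :: real)" for x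
    by (auto simp: indicator_def)
  then show ?thesis unfolding bil_def
    by (simp only: distrib_right Bochner_Integration.integral_add[OF int])
qed

text \<open>For \<open>\<delta> > 1\<close> the dispersive kernel is integrable at lags beyond
  \<open>h\<close>, with integral of order h^(1 - \<open>\<delta>\<close>), so Young's inequality is
  enough.\<close>

lemma bil_far:
  fixes F G :: "real \<Rightarrow> (int ^ 'd::finite) ell2"
  assumes F: "forcing S T B F" and G: "forcing S T B' G" and S: "finite S" and J: "J \<in> sets borel"
    and far: "\<And>x. x \<in> J \<Longrightarrow> h \<le> \<bar>x\<bar>" and h: "0 < h" and d: "\<delta> = real CARD('d) / 3" "\<delta> > 1"
    and b: "b \<in> borel_measurable borel" "\<And>s. norm1 S (F s) \<le> \<alpha> * b s"
    and e: "e \<in> borel_measurable borel" "\<And>t. norm1 S (G t) \<le> \<beta> * e t"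
    and nonneg: "0 \<le> \<alpha>" "0 \<le> \<beta>" "\<And>s. 0 \<le> b s" "\<And>t. 0 \<le> e t"
  shows "ennreal \<bar>bil J F G\<bar> \<le> ennreal (4 ^ CARD('d) * \<alpha> * \<beta> * (2 * h powr (1 - \<delta>) / (\<delta> - 1)))
     * ((\<integral>\<^sup>+ s. ennreal ((b s)\<^sup>2) \<partial>lborel) + (\<integral>\<^sup>+ t. ennreal ((e t)\<^sup>2) \<partial>lborel))"
proof -
  note [measurable] = b(1) e(1)
  define D :: real where "D = 4 ^ CARD('d)"
  define w where "w x = D * \<alpha> * \<beta> * (indicator {h..} \<bar>x\<bar> * \<bar>x\<bar> powr (- \<delta>))" for x :: real
  have [measurable]: "w \<in> borel_measurable borel" unfolding w_def[abs_def] by measurable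
  have "ennreal \<bar>bil J F G\<bar> \<le> (\<integral>\<^sup>+ t. \<integral>\<^sup>+ s. ennreal (indicator J (t - s) * \<bar>propag (t - s) (F s) \<bullet> G t\<bar>) \<partial>lborel \<partial>lborel)"
    by (rule bil_le_nn_integral[OF F G J])
  also have "\<dots> \<le> (\<integral>\<^sup>+ t. \<integral>\<^sup>+ s. ennreal (b s * e t * w (t - s)) \<partial>lborel \<partial>lborel)"
  proof (intro nn_integral_mono ennreal_leI)
    fix t s
    show "indicator J (t - s) * \<bar>propag (t - s) (F s) \<bullet> G t\<bar> \<le> b s * e t * w (t - s)"
    proof (cases "t - s \<in> J")
      case True
      then have ts: "h \<le> \<bar>t - s\<bar>" "t - s \<noteq> 0" using far[OF True] h by auto
      have "\<bar>propag (t - s) (F s) \<bullet> G t\<bar> \<le> D * \<bar>t - s\<bar> powr (- \<delta>) * norm1 S (F s) * norm1 S (G t)"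
        unfolding D_def d(1) using ts(2) S forcingD(2)[OF F] forcingD(2)[OF G]
        by (intro dispersive_estimate) auto
      also have "\<dots> \<le> D * \<bar>t - s\<bar> powr (- \<delta>) * (\<alpha> * b s) * (\<beta> * e t)"
        using b(2)[of s] e(2)[of t] nonneg norm1_nonneg[of S "F s"] norm1_nonneg[of S "G t"]
        by (intro mult_mono order_refl mult_nonneg_nonneg) (auto simp: D_def)
      also have "\<dots> = b s * e t * w (t - s)" using ts by (simp add: w_def)
      finally show ?thesis using True by simp
    qed (use nonneg in \<open>auto simp: w_def D_def\<close>)
  qed
  also have "\<dots> \<le> ennreal (D * \<alpha> * \<beta> * (2 * h powr (1 - \<delta>) / (\<delta> - 1)))
     * ((\<integral>\<^sup>+ s. ennreal ((b s)\<^sup>2) \<partial>lborel) + (\<integral>\<^sup>+ t. ennreal ((e t)\<^sup>2) \<partial>lborel))"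
  proof (rule young_schur)
    show "0 \<le> w x" for x using nonneg by (simp add: w_def D_def)
    have "(\<integral>\<^sup>+ x. ennreal (w x) \<partial>lborel)
        = ennreal (D * \<alpha> * \<beta>) * (\<integral>\<^sup>+ x. ennreal (indicator {h..} \<bar>x\<bar> * \<bar>x\<bar> powr (- \<delta>)) \<partial>lborel)"
      unfolding w_def using nonneg by (subst nn_integral_cmult[symmetric]) (auto simp: ennreal_mult' D_def)
    also have "\<dots> \<le> ennreal (D * \<alpha> * \<beta>) * ennreal (2 * h powr (1 - \<delta>) / (\<delta> - 1))"
      by (intro mult_left_mono nn_integral_powr_far h d(2)) simp
    also have "\<dots> = ennreal (D * \<alpha> * \<beta> * (2 * h powr (1 - \<delta>) / (\<delta> - 1)))"
      using nonneg by (intro ennreal_mult'[symmetric]) (auto simp: D_def)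
    finally show "(\<integral>\<^sup>+ x. ennreal (w x) \<partial>lborel) \<le> ennreal (D * \<alpha> * \<beta> * (2 * h powr (1 - \<delta>) / (\<delta> - 1)))" .
  qed measurable
  finally show ?thesis by (simp add: D_def)
qed

definition duhamel :: "real set \<Rightarrow> (real \<Rightarrow> (int ^ 'd::finite) ell2) \<Rightarrow> real \<Rightarrow> (int ^ 'd) ell2" where
  "duhamel J F t = (\<integral>s. indicator J (t - s) *\<^sub>R propag (t - s) (F s) \<partial>lborel)"

lemma duhamel_integrable:
  fixes F :: "real \<Rightarrow> (int ^ 'd::finite) ell2"
  assumes F: "forcing S T B F" and [measurable]: "J \<in> sets borel"
  shows "integrable lborel (\<lambda>s. indicator J (t - s) *\<^sub>R propag (t - s) (F s))"
proof (rule Bochner_Integration.integrable_bound)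
  note [measurable] = forcingD(1)[OF F]
  show "integrable lborel (\<lambda>s. B * indicat_real {0..T} s)"
    using emeasure_lborel_Icc_finite by (intro integrable_mult_right integrable_real_indicator) auto
  show "(\<lambda>s. indicator J (t - s) *\<^sub>R propag (t - s) (F s)) \<in> borel_measurable lborel" by measurable
  show "AE s in lborel. norm (indicator J (t - s) *\<^sub>R propag (t - s) (F s)) \<le> norm (B * indicat_real {0..T} s)"
    using forcingD(3)[OF F] forcingD(4)[OF F] forcingD(5)[OF F]
    by (intro AE_I2) (auto simp: indicator_def)
qed

lemma duhamel_measurable:
  fixes F :: "real \<Rightarrow> (int ^ 'd::finite) ell2"
  assumes F: "forcing S T B F" and [measurable]: "J \<in> sets borel"
  shows "duhamel J F \<in> borel_measurable borel"
proof -
  note [measurable] = forcingD(1)[OF F]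
  have "(\<lambda>t. \<integral>s. indicator J (t - s) *\<^sub>R propag (t - s) (F s) \<partial>lborel) \<in> borel_measurable lborel"
    by (rule lborel.borel_measurable_lebesgue_integral) measurable
  then show ?thesis by (simp add: duhamel_def[abs_def])
qed

lemma bil_eq_integral_duhamel:
  fixes F G :: "real \<Rightarrow> (int ^ 'd::finite) ell2"
  assumes F: "forcing S T B F" and G: "forcing S' T B' G" and J: "J \<in> sets borel"
  shows "bil J F G = (\<integral>t. duhamel J F t \<bullet> G t \<partial>lborel)"
    and "integrable lborel (\<lambda>t. duhamel J F t \<bullet> G t)"
proof -
  have inner: "(\<integral>s. indicator J (t - s) * (propag (t - s) (F s) \<bullet> G t) \<partial>lborel) = duhamel J F t \<bullet> G t" for t
    unfolding duhamel_def integral_inner_left[OF duhamel_integrable[OF F J], symmetric] by simp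
  have int: "integrable (lborel \<Otimes>\<^sub>M lborel) (\<lambda>(s, t). indicator J (t - s) * (propag (t - s) (F s) \<bullet> G t))"
    using bil_integrable[OF F G J] unfolding case_prod_beta' .
  show "bil J F G = (\<integral>t. duhamel J F t \<bullet> G t \<partial>lborel)"
    using lborel_pair.integral_snd[OF int] by (simp add: bil_def inner case_prod_beta')
  show "integrable lborel (\<lambda>t. duhamel J F t \<bullet> G t)"
    using lborel_pair.integrable_snd[OF int] by (simp add: inner)
qed

text \<open>The TT* expansion: the squared norm of an integral is a double integral of inner
  products, and by unitarity \<open>t\<close> cancels from the two propagators, leaving the lag
  \<open>s' - s\<close>.\<close>

lemma norm_duhamel_square_le:
  fixes F :: "real \<Rightarrow> (int ^ 'd::finite) ell2"
  assumes F: "forcing S T B F" and J: "J \<in> sets borel"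
    and b: "\<And>s s'. \<bar>propag (s' - s) (F s) \<bullet> F s'\<bar> \<le> b s * b s' * w (s' - s)"
  shows "ennreal ((norm (duhamel J F t))\<^sup>2)
    \<le> (\<integral>\<^sup>+ s. \<integral>\<^sup>+ s'. ennreal (indicator J (t - s) * indicator J (t - s') * (b s * b s' * w (s' - s))) \<partial>lborel \<partial>lborel)"
proof -
  define v where "v = duhamel J F t"
  define f where "f s = indicator J (t - s) *\<^sub>R propag (t - s) (F s)" for s
  have f: "integrable lborel f" unfolding f_def by (rule duhamel_integrable[OF F J])
  have v: "v = integral\<^sup>L lborel f" by (simp add: v_def duhamel_def f_def[abs_def])
  have fv: "ennreal \<bar>f s \<bullet> v\<bar> \<le> (\<integral>\<^sup>+ s'. ennreal \<bar>f s \<bullet> f s'\<bar> \<partial>lborel)" for s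
    unfolding v integral_inner_right[OF f, symmetric]
    using integral_norm_bound_ennreal[OF integrable_inner_right[OF f], of "f s"] by simp
  have "ennreal ((norm v)\<^sup>2) = ennreal \<bar>\<integral>s. f s \<bullet> v \<partial>lborel\<bar>"
    using integral_inner_left[OF f, of v] by (simp add: v[symmetric] power2_norm_eq_inner)
  also have "\<dots> \<le> (\<integral>\<^sup>+ s. ennreal \<bar>f s \<bullet> v\<bar> \<partial>lborel)"
    using integral_norm_bound_ennreal[OF integrable_inner_left[OF f], of v] by simp
  also have "\<dots> \<le> (\<integral>\<^sup>+ s. \<integral>\<^sup>+ s'. ennreal \<bar>f s \<bullet> f s'\<bar> \<partial>lborel \<partial>lborel)"
    by (rule nn_integral_mono) (rule fv)
  also have "\<dots> \<le> (\<integral>\<^sup>+ s. \<integral>\<^sup>+ s'. ennreal (indicator J (t - s) * indicator J (t - s') * (b s * b s' * w (s' - s))) \<partial>lborel \<partial>lborel)"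
  proof (intro nn_integral_mono ennreal_leI)
    fix s s'
    have "propag (t - s) (F s) \<bullet> propag (t - s') (F s') = propag (s' - s) (F s) \<bullet> F s'"
      using sg.flow_inner_flow[of "t - s'" "propag (s' - s) (F s)" "F s'"] by simp
    then show "\<bar>f s \<bullet> f s'\<bar> \<le> indicator J (t - s) * indicator J (t - s') * (b s * b s' * w (s' - s))"
      using b[of s' s] by (auto simp: f_def indicator_def)
  qed
  finally show ?thesis by (simp add: v_def)
qed

text \<open>A Schur test in three variables: integrating \<open>t\<close> over the window
  \<open>J\<close> contributes its length \<open>h\<close>, integrating the lag between
  \<open>s\<close> and \<open>s'\<close> contributes \<open>W\<close>, and the square of
  \<open>b\<close> remains.\<close>

lemma duhamel_square_integral_le:
  fixes F :: "real \<Rightarrow> (int ^ 'd::finite) ell2"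
  assumes F: "forcing S T B F" and J [measurable]: "J \<in> sets borel" and h: "emeasure lborel J \<le> ennreal h" "0 \<le> h"
    and b: "\<And>s s'. \<bar>propag (s' - s) (F s) \<bullet> F s'\<bar> \<le> b s * b s' * w (s' - s)"
    and bm [measurable]: "b \<in> borel_measurable borel" "w \<in> borel_measurable borel"
    and w: "\<And>x. 0 \<le> w x" and W: "(\<integral>\<^sup>+ x. ennreal (w x) \<partial>lborel) \<le> ennreal W" "0 \<le> W"
  shows "(\<integral>\<^sup>+ t. ennreal ((norm (duhamel J F t))\<^sup>2) \<partial>lborel) \<le> ennreal (2 * h * W) * (\<integral>\<^sup>+ s. ennreal ((b s)\<^sup>2) \<partial>lborel)"
proof -
  define X where "X = (\<integral>\<^sup>+ x. ennreal (w x) \<partial>lborel)"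
  have i1: "(\<integral>\<^sup>+ s'. k * ennreal (w (s' - s)) \<partial>lborel) = k * X"
    and i2: "(\<integral>\<^sup>+ s'. k * ennreal (w (s - s')) \<partial>lborel) = k * X" for k s
    unfolding X_def using nn_integral_diff_swap[of "\<lambda>x. ennreal (w x)" s]
    by (subst nn_integral_cmult; simp)+
  have im: "(\<integral>\<^sup>+ t. k * indicator J (t - s) \<partial>lborel) = k * emeasure lborel J" for k s
    using nn_integral_diff_swap(2)[of "indicator J" s] by (subst nn_integral_cmult) auto
  let ?b = "\<lambda>s. ennreal ((b s)\<^sup>2)"
  let ?Q = "\<integral>\<^sup>+ t. \<integral>\<^sup>+ s. ?b s * indicator J (t - s) * X \<partial>lborel \<partial>lborel"
  have Q: "?Q \<le> ennreal (h * W) * (\<integral>\<^sup>+ s. ?b s \<partial>lborel)"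
  proof -
    have "?Q = (\<integral>\<^sup>+ s. \<integral>\<^sup>+ t. ?b s * indicator J (t - s) * X \<partial>lborel \<partial>lborel)"
      by (rule lborel_pair.Fubini') simp
    also have "\<dots> = (\<integral>\<^sup>+ s. ?b s * emeasure lborel J * X \<partial>lborel)"
      by (subst nn_integral_multc) (simp_all add: im)
    also have "\<dots> = (\<integral>\<^sup>+ s. ?b s \<partial>lborel) * (emeasure lborel J * X)"
      by (simp add: nn_integral_multc mult.assoc)
    also have "\<dots> \<le> (\<integral>\<^sup>+ s. ?b s \<partial>lborel) * (ennreal h * ennreal W)"
      using h W by (intro mult_left_mono mult_mono) (auto simp: X_def)
    also have "\<dots> = ennreal (h * W) * (\<integral>\<^sup>+ s. ?b s \<partial>lborel)"
      using h W by (simp add: ennreal_mult mult.commute)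
    finally show ?thesis .
  qed
  have "(\<integral>\<^sup>+ t. ennreal ((norm (duhamel J F t))\<^sup>2) \<partial>lborel)
      \<le> (\<integral>\<^sup>+ t. \<integral>\<^sup>+ s. \<integral>\<^sup>+ s'. ennreal (indicator J (t - s) * indicator J (t - s') * (b s * b s' * w (s' - s))) \<partial>lborel \<partial>lborel \<partial>lborel)"
    by (rule nn_integral_mono) (rule norm_duhamel_square_le[OF F J b])
  also have "\<dots> \<le> (\<integral>\<^sup>+ t. \<integral>\<^sup>+ s. \<integral>\<^sup>+ s'. ?b s * indicator J (t - s) * ennreal (w (s' - s))
      + ?b s' * indicator J (t - s') * ennreal (w (s' - s)) \<partial>lborel \<partial>lborel \<partial>lborel)"
  proof (intro nn_integral_mono)
    fix t s s'
    show "ennreal (indicator J (t - s) * indicator J (t - s') * (b s * b s' * w (s' - s)))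
       \<le> ?b s * indicator J (t - s) * ennreal (w (s' - s)) + ?b s' * indicator J (t - s') * ennreal (w (s' - s))"
    proof (cases "t - s \<in> J \<and> t - s' \<in> J")
      case True
      have "b s * b s' \<le> (b s)\<^sup>2 + (b s')\<^sup>2"
        using sum_squares_bound[of "b s" "b s'"] zero_le_power2[of "b s"] zero_le_power2[of "b s'"] by linarith
      then have "b s * b s' * w (s' - s) \<le> (b s)\<^sup>2 * w (s' - s) + (b s')\<^sup>2 * w (s' - s)"
        using mult_right_mono[OF _ w] by (fastforce simp: distrib_right)
      then show ?thesis using True w
        by (simp add: ennreal_mult'[symmetric] ennreal_plus[symmetric] ennreal_leI del: ennreal_plus)
    qed (auto simp: indicator_def)
  qed
  also have "\<dots> = (\<integral>\<^sup>+ t. \<integral>\<^sup>+ s. \<integral>\<^sup>+ s'. ?b s * indicator J (t - s) * ennreal (w (s' - s)) \<partial>lborel \<partial>lborel \<partial>lborel)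
      + (\<integral>\<^sup>+ t. \<integral>\<^sup>+ s. \<integral>\<^sup>+ s'. ?b s' * indicator J (t - s') * ennreal (w (s' - s)) \<partial>lborel \<partial>lborel \<partial>lborel)"
    by (simp add: nn_integral_add)
  also have "(\<integral>\<^sup>+ t. \<integral>\<^sup>+ s. \<integral>\<^sup>+ s'. ?b s * indicator J (t - s) * ennreal (w (s' - s)) \<partial>lborel \<partial>lborel \<partial>lborel) = ?Q"
    by (simp only: i1)
  also have "(\<integral>\<^sup>+ t. \<integral>\<^sup>+ s. \<integral>\<^sup>+ s'. ?b s' * indicator J (t - s') * ennreal (w (s' - s)) \<partial>lborel \<partial>lborel \<partial>lborel)
     = (\<integral>\<^sup>+ t. \<integral>\<^sup>+ s'. \<integral>\<^sup>+ s. ?b s' * indicator J (t - s') * ennreal (w (s' - s)) \<partial>lborel \<partial>lborel \<partial>lborel)"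
    by (intro nn_integral_cong lborel_pair.Fubini') simp
  also have "\<dots> = ?Q" by (simp only: i2)
  also have "?Q + ?Q \<le> ennreal (h * W) * (\<integral>\<^sup>+ s. ?b s \<partial>lborel) + ennreal (h * W) * (\<integral>\<^sup>+ s. ?b s \<partial>lborel)"
    by (intro add_mono Q)
  also have "\<dots> = ennreal (2 * h * W) * (\<integral>\<^sup>+ s. ?b s \<partial>lborel)"
    using h W by (simp add: mult_2 ennreal_plus[symmetric] distrib_right[symmetric] algebra_simps del: ennreal_plus)
  finally show ?thesis .
qed

text \<open>
  Pairing the truncated Duhamel integral with \<open>G\<close> in \<open>l\<^sup>2\<close> gains a factor over the dispersive
  estimate when the truncation \<open>J\<close> is short; this makes the endpoint sum converge.
\<close>

lemma bil_near:
  fixes F G :: "real \<Rightarrow> (int ^ 'd::finite) ell2"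
  assumes F: "forcing S T B F" and G: "forcing S' T B' G"
    and J: "J \<in> sets borel" and h: "emeasure lborel J \<le> ennreal h" "0 \<le> h"
    and b: "\<And>s s'. \<bar>propag (s' - s) (F s) \<bullet> F s'\<bar> \<le> b s * b s' * w (s' - s)"
    and bm: "b \<in> borel_measurable borel" "w \<in> borel_measurable borel"
    and w: "\<And>x. 0 \<le> w x" and W: "(\<integral>\<^sup>+ x. ennreal (w x) \<partial>lborel) \<le> ennreal W" "0 \<le> W"
    and e: "e \<in> borel_measurable borel" "\<And>t. norm (G t) \<le> \<beta> * e t" "\<And>t. 0 \<le> e t" "0 \<le> \<beta>"
    and c: "0 < c" "2 * h * W \<le> c\<^sup>2"
  shows "ennreal \<bar>bil J F G\<bar> \<le> ennreal (\<beta> * c)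
     * ((\<integral>\<^sup>+ s. ennreal ((b s)\<^sup>2) \<partial>lborel) + (\<integral>\<^sup>+ t. ennreal ((e t)\<^sup>2) \<partial>lborel))"
proof -
  note [measurable] = e(1) bm duhamel_measurable[OF F J]
  let ?v = "duhamel J F"
  have "ennreal \<bar>bil J F G\<bar> \<le> (\<integral>\<^sup>+ t. ennreal \<bar>?v t \<bullet> G t\<bar> \<partial>lborel)"
    using integral_norm_bound_ennreal[OF bil_eq_integral_duhamel(2)[OF F G J]]
    by (simp add: bil_eq_integral_duhamel(1)[OF F G J])
  also have "\<dots> \<le> (\<integral>\<^sup>+ t. ennreal (\<beta> / c) * ennreal ((norm (?v t))\<^sup>2) + ennreal (\<beta> * c) * ennreal ((e t)\<^sup>2) \<partial>lborel)"
  proof (intro nn_integral_mono)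
    fix t
    have "\<bar>?v t \<bullet> G t\<bar> \<le> norm (?v t) * (\<beta> * e t)"
      by (rule order_trans[OF Cauchy_Schwarz_ineq2]) (intro mult_left_mono e(2) norm_ge_zero)
    \<comment> \<open>The arithmetic-geometric mean with parameter \<open>c\<close>. As
      \<open>c\<close> squared dominates \<open>2 * h * W\<close>, both terms end up with the same
      constant \<open>\<beta> * c\<close> after integration.\<close>
    also have "\<dots> \<le> \<beta> / c * (norm (?v t))\<^sup>2 + \<beta> * c * (e t)\<^sup>2"
    proof -
      have "c * norm (?v t) * e t \<le> (norm (?v t))\<^sup>2 + (c * e t)\<^sup>2"
      proof -
        have "0 \<le> norm (?v t) * (c * e t)" using c e by simp
        then show ?thesis using sum_squares_bound[of "norm (?v t)" "c * e t"] by (simp add: mult_ac)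
      qed
      then have "\<beta> / c * (c * norm (?v t) * e t) \<le> \<beta> / c * ((norm (?v t))\<^sup>2 + (c * e t)\<^sup>2)"
        using c e by (intro mult_left_mono) auto
      then show ?thesis using c by (simp add: power2_eq_square field_simps)
    qed
    finally show "ennreal \<bar>?v t \<bullet> G t\<bar> \<le> ennreal (\<beta> / c) * ennreal ((norm (?v t))\<^sup>2) + ennreal (\<beta> * c) * ennreal ((e t)\<^sup>2)"
      using c e by (simp add: ennreal_mult'[symmetric] ennreal_plus[symmetric] ennreal_leI del: ennreal_plus)
  qed
  also have "\<dots> = ennreal (\<beta> / c) * (\<integral>\<^sup>+ t. ennreal ((norm (?v t))\<^sup>2) \<partial>lborel)
      + ennreal (\<beta> * c) * (\<integral>\<^sup>+ t. ennreal ((e t)\<^sup>2) \<partial>lborel)"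
    by (simp add: nn_integral_add nn_integral_cmult)
  also have "\<dots> \<le> ennreal (\<beta> / c) * (ennreal (c\<^sup>2) * (\<integral>\<^sup>+ s. ennreal ((b s)\<^sup>2) \<partial>lborel))
      + ennreal (\<beta> * c) * (\<integral>\<^sup>+ t. ennreal ((e t)\<^sup>2) \<partial>lborel)"
    using c(2) by (intro add_mono mult_left_mono order_refl
        order_trans[OF duhamel_square_integral_le[OF F J h b bm w W]] mult_right_mono) (auto intro: ennreal_leI)
  also have "\<dots> = ennreal (\<beta> * c) * (\<integral>\<^sup>+ s. ennreal ((b s)\<^sup>2) \<partial>lborel) + ennreal (\<beta> * c) * (\<integral>\<^sup>+ t. ennreal ((e t)\<^sup>2) \<partial>lborel)"
    using c e by (simp add: mult.assoc[symmetric] ennreal_mult'[symmetric] power2_eq_square)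
  finally show ?thesis by (simp add: distrib_left)
qed

section \<open>Decomposition into level sets\<close>

text \<open>
  With \<open>\<rho> = 1 / r\<close>, the dual exponent of \<open>r\<close> is \<open>1 / (1 - \<rho>)\<close>; this parametrisation includes
  \<open>r = \<infinity>\<close> as \<open>\<rho> = 0\<close>.
\<close>

definition mass :: "real \<Rightarrow> 'a set \<Rightarrow> 'a ell2 \<Rightarrow> real" where
  "mass \<rho> S x = (\<Sum>n\<in>S. cmod (ev x n) powr (1 / (1 - \<rho>)))"

definition dual_norm :: "real \<Rightarrow> 'a set \<Rightarrow> 'a ell2 \<Rightarrow> real" where
  "dual_norm \<rho> S x = mass \<rho> S x powr (1 - \<rho>)"

text \<open>Heights are measured by the summands of \<open>mass\<close>, relative to their sum.
  Hence fewer than 2^(k+1) sites can lie above a threshold of index \<open>k\<close> when the mass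
  is positive, whatever the size of \<open>x\<close>.\<close>

definition above :: "real \<Rightarrow> 'a set \<Rightarrow> 'a ell2 \<Rightarrow> nat \<Rightarrow> 'a \<Rightarrow> bool" where
  "above \<rho> S x k n \<longleftrightarrow> mass \<rho> S x * 2 powr (- (real k + 1)) < cmod (ev x n) powr (1 / (1 - \<rho>))"

text \<open>All values too small to be seen at scale \<open>N\<close> are collected in the last level set \<open>k = N\<close>.\<close>

definition level :: "real \<Rightarrow> 'a set \<Rightarrow> nat \<Rightarrow> nat \<Rightarrow> 'a ell2 \<Rightarrow> 'a set" where
  "level \<rho> S N k x = {n\<in>S. k \<le> N \<and> (k = N \<or> above \<rho> S x k n) \<and> (\<forall>j<k. \<not> above \<rho> S x j n)}"

definition piece :: "real \<Rightarrow> 'a set \<Rightarrow> nat \<Rightarrow> nat \<Rightarrow> 'a ell2 \<Rightarrow> 'a ell2" where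
  "piece \<rho> S N k x = restr (level \<rho> S N k x) x"

text \<open>The share of a level in the squared dual norm, which is
  \<open>mass powr (2 - 2 * \<rho>)\<close>. Below \<open>N\<close> it is proportional to the mass
  carried by the level; the last level has no lower bound on its entries and is charged the full
  amount.\<close>

definition weight :: "real \<Rightarrow> 'a set \<Rightarrow> nat \<Rightarrow> nat \<Rightarrow> 'a ell2 \<Rightarrow> real" where
  "weight \<rho> S N k x = (if k < N
     then mass \<rho> S x powr (1 - 2 * \<rho>) * (\<Sum>n\<in>level \<rho> S N k x. cmod (ev x n) powr (1 / (1 - \<rho>)))
     else mass \<rho> S x powr (2 - 2 * \<rho>))"

lemma mass_nonneg: "0 \<le> mass \<rho> S x"
  by (simp add: mass_def sum_nonneg)

lemma dual_norm_nonneg: "0 \<le> dual_norm \<rho> S x"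
  by (simp add: dual_norm_def)

lemma weight_nonneg: "0 \<le> weight \<rho> S N k x"
  by (simp add: weight_def sum_nonneg)

lemma level_subset: "level \<rho> S N k x \<subseteq> S"
  by (auto simp: level_def)

lemma level_subsetD: "n \<in> level \<rho> S N k x \<Longrightarrow> n \<in> S"
  by (auto simp: level_def)

lemma sum_level_eq:
  "finite S \<Longrightarrow> (\<Sum>n\<in>level \<rho> S N k x. f n) = (\<Sum>n\<in>S. if n \<in> level \<rho> S N k x then f n else 0)"
  using sum.inter_restrict[of S f "level \<rho> S N k x"] by (simp add: Int_absorb1[OF level_subset])

lemma finite_level: "finite S \<Longrightarrow> finite (level \<rho> S N k x)"
  by (rule finite_subset[OF level_subset])

lemma ex1_level:
  assumes "n \<in> S"
  shows "\<exists>!k. k \<le> N \<and> n \<in> level \<rho> S N k x"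
proof -
  define k where "k = (LEAST k. k = N \<or> above \<rho> S x k n)"
  have k: "k = N \<or> above \<rho> S x k n" unfolding k_def by (rule LeastI[of _ N]) simp
  have kN: "k \<le> N" unfolding k_def by (rule Least_le) simp
  have min: "\<not> above \<rho> S x j n" if "j < k" for j
    using not_less_Least[of j] that unfolding k_def by blast
  show ?thesis
  proof (rule ex1I[of _ k])
    show "k \<le> N \<and> n \<in> level \<rho> S N k x" using k kN min assms by (simp add: level_def)
    fix k' assume k': "k' \<le> N \<and> n \<in> level \<rho> S N k' x"
    then have *: "k' = N \<or> above \<rho> S x k' n" "\<forall>j<k'. \<not> above \<rho> S x j n" by (auto simp: level_def)
    show "k' = k"
    proof (rule ccontr)
      assume "k' \<noteq> k"
      then consider "k' < k" | "k < k'" by linarith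
      then show False
      proof cases
        case 1
        then show False using min[OF 1] * kN by auto
      next
        case 2
        then show False using * k k' by auto
      qed
    qed
  qed
qed

lemma sum_levels:
  fixes f :: "'a \<Rightarrow> 'b::comm_monoid_add"
  assumes "n \<in> S"
  shows "(\<Sum>k\<le>N. if n \<in> level \<rho> S N k x then c else 0) = (c :: 'b)"
proof -
  obtain k0 where k0: "k0 \<le> N" "n \<in> level \<rho> S N k0 x" "\<And>k. k \<le> N \<Longrightarrow> n \<in> level \<rho> S N k x \<Longrightarrow> k = k0"
    using ex1_level[OF assms, of N \<rho> x] by blast
  then have "n \<in> level \<rho> S N k x \<longleftrightarrow> k = k0" if "k \<le> N" for k using that by blast
  then have "(\<Sum>k\<le>N. if n \<in> level \<rho> S N k x then c else 0) = (\<Sum>k\<le>N. if k = k0 then c else 0)"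
    by (intro sum.cong refl) simp
  then show ?thesis using k0(1) by simp
qed

lemma sum_pieces:
  assumes "\<And>n. n \<notin> S \<Longrightarrow> ev x n = 0"
  shows "(\<Sum>k\<le>N. piece \<rho> S N k x) = x"
proof (rule ell2_eqI)
  fix n
  have "ev (\<Sum>k\<le>N. piece \<rho> S N k x) n = (\<Sum>k\<le>N. if n \<in> level \<rho> S N k x then ev x n else 0)"
    by (simp add: ev_sum piece_def)
  also have "\<dots> = ev x n"
  proof (cases "n \<in> S")
    case True
    then show ?thesis by (rule sum_levels)
  next
    case False
    then show ?thesis using assms[OF False] by (auto intro!: sum.neutral)
  qed
  finally show "ev (\<Sum>k\<le>N. piece \<rho> S N k x) n = ev x n" .
qed

context
  fixes \<rho> :: real and S :: "'a set" and N :: nat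
  assumes \<rho>: "0 \<le> \<rho>" "\<rho> < 1 / 2" and S: "finite S" "card S \<le> 2 ^ N"
begin

lemma sum_level_le_mass:
  "(\<Sum>n\<in>level \<rho> S N k x. cmod (ev x n) powr (1 / (1 - \<rho>))) \<le> mass \<rho> S x"
  unfolding mass_def by (rule sum_mono2) (use S in \<open>auto dest: level_subsetD\<close>)

lemma entry_le_mass: "n \<in> S \<Longrightarrow> cmod (ev x n) powr (1 / (1 - \<rho>)) \<le> mass \<rho> S x"
  unfolding mass_def using S by (intro member_le_sum) auto

lemma level_upper:
  assumes "n \<in> level \<rho> S N k x"
  shows "cmod (ev x n) powr (1 / (1 - \<rho>)) \<le> mass \<rho> S x * 2 powr (- real k)"
proof (cases k)
  case 0
  then show ?thesis using entry_le_mass[of n x] assms by (simp add: level_def)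
next
  case (Suc j)
  then have "\<not> above \<rho> S x j n" using assms by (auto simp: level_def)
  then show ?thesis by (simp add: above_def Suc algebra_simps)
qed

lemma cmod_eq_powr: "cmod z = (cmod z powr (1 / (1 - \<rho>))) powr (1 - \<rho>)"
  using \<rho> by (simp add: powr_powr)

lemma mass_powr_mult: "mass \<rho> S x powr (1 - 2 * \<rho>) * mass \<rho> S x = mass \<rho> S x powr (2 - 2 * \<rho>)"
  using powr_mult_base[OF mass_nonneg, of \<rho> S x "1 - 2 * \<rho>"] by (simp add: mult.commute algebra_simps)

text \<open>This uses the upper bound on the entries of a level: with a the summand of
  \<open>mass\<close>, the squared modulus is a^(2 - 2\<open>\<rho>\<close>), and the factor a^(1 -
  2\<open>\<rho>\<close>) is at most its value at the height of the level.\<close>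

lemma norm_piece_square_le: "(norm (piece \<rho> S N k x))\<^sup>2 \<le> 2 powr (- real k * (1 - 2 * \<rho>)) * weight \<rho> S N k x"
proof -
  let ?L = "level \<rho> S N k x" and ?M = "mass \<rho> S x"
  have "(norm (piece \<rho> S N k x))\<^sup>2 = (\<Sum>n\<in>?L. (cmod (ev x n))\<^sup>2)"
    using norm_finite_support[OF finite_level[OF S(1)], of \<rho> N k x "piece \<rho> S N k x"] by (simp add: piece_def)
  also have "\<dots> \<le> (\<Sum>n\<in>?L. (?M * 2 powr (- real k)) powr (1 - 2 * \<rho>) * cmod (ev x n) powr (1 / (1 - \<rho>)))"
  proof (rule sum_mono)
    fix n assume n: "n \<in> ?L"
    define a where "a = cmod (ev x n) powr (1 / (1 - \<rho>))"
    have a: "0 \<le> a" "a \<le> ?M * 2 powr (- real k)" using level_upper[OF n] by (auto simp: a_def)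
    have "(cmod (ev x n))\<^sup>2 = a powr (1 - \<rho>) * a powr (1 - \<rho>)"
      using cmod_eq_powr[of "ev x n"] by (simp add: a_def power2_eq_square)
    also have "\<dots> = a powr (2 - 2 * \<rho>)" by (simp flip: powr_add)
    also have "\<dots> = a powr (1 - 2 * \<rho>) * a"
      using powr_mult_base[OF a(1), of "1 - 2 * \<rho>"] by (simp add: mult.commute algebra_simps)
    also have "\<dots> \<le> (?M * 2 powr (- real k)) powr (1 - 2 * \<rho>) * a"
      using a \<rho> by (intro mult_right_mono powr_mono2) auto
    finally show "(cmod (ev x n))\<^sup>2 \<le> (?M * 2 powr (- real k)) powr (1 - 2 * \<rho>) * cmod (ev x n) powr (1 / (1 - \<rho>))"
      by (simp add: a_def)
  qed
  also have "\<dots> = 2 powr (- real k * (1 - 2 * \<rho>)) * (?M powr (1 - 2 * \<rho>) * (\<Sum>n\<in>?L. cmod (ev x n) powr (1 / (1 - \<rho>))))"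
    by (simp add: powr_mult mass_nonneg powr_powr sum_distrib_left mult_ac)
  also have "\<dots> \<le> 2 powr (- real k * (1 - 2 * \<rho>)) * weight \<rho> S N k x"
  proof (rule mult_left_mono)
    show "?M powr (1 - 2 * \<rho>) * (\<Sum>n\<in>?L. cmod (ev x n) powr (1 / (1 - \<rho>))) \<le> weight \<rho> S N k x"
      using mult_left_mono[OF sum_level_le_mass[of x k], of "?M powr (1 - 2 * \<rho>)"] mass_powr_mult[of x]
      by (simp add: weight_def)
  qed simp
  finally show ?thesis .
qed

text \<open>This uses the lower bound on the entries of a level: the modulus is
  a^(-\<open>\<rho>\<close>) times a, and a negative power is largest at the threshold, which
  accounts for the \<open>k + 1\<close>. Together with the preceding bound, l^2 norms decrease and
  l^1 norms increase geometrically in \<open>k\<close>.\<close>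

lemma norm1_piece_le: "k \<le> N \<Longrightarrow> norm1 S (piece \<rho> S N k x) \<le> 2 powr ((real k + 1) * \<rho>) * sqrt (weight \<rho> S N k x)"
proof -
  assume kN: "k \<le> N"
  let ?L = "level \<rho> S N k x" and ?M = "mass \<rho> S x"
  have n1: "norm1 S (piece \<rho> S N k x) = (\<Sum>n\<in>?L. cmod (ev x n))"
    unfolding norm1_def piece_def sum_level_eq[OF S(1)] by (intro sum.cong) auto
  show ?thesis
  proof (cases "k < N")
    case True
    define s where "s = (\<Sum>n\<in>?L. cmod (ev x n) powr (1 / (1 - \<rho>)))"
    have s: "0 \<le> s" "s \<le> ?M" using sum_level_le_mass[of x k] by (auto simp: s_def sum_nonneg)
    show ?thesis
    proof (cases "?L = {}")
      case False
      then obtain n0 where "above \<rho> S x k n0" "n0 \<in> S" using True by (auto simp: level_def)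
      then have M: "?M > 0"
        using mass_nonneg[of \<rho> S x] entry_le_mass[of n0 x] by (cases "?M = 0") (auto simp: above_def)
      have "(\<Sum>n\<in>?L. cmod (ev x n)) \<le> (\<Sum>n\<in>?L. (?M * 2 powr (- (real k + 1))) powr (- \<rho>) * cmod (ev x n) powr (1 / (1 - \<rho>)))"
      proof (rule sum_mono)
        fix n assume n: "n \<in> ?L"
        define a where "a = cmod (ev x n) powr (1 / (1 - \<rho>))"
        have a: "?M * 2 powr (- (real k + 1)) < a" using n True by (auto simp: level_def above_def a_def)
        have lower: "0 < ?M * 2 powr (- (real k + 1))" using M by simp
        have "cmod (ev x n) = a powr (- \<rho>) * a"
          using cmod_eq_powr[of "ev x n"] powr_mult_base[of a "- \<rho>"] a lower
          by (simp add: a_def mult.commute algebra_simps)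
        also have "\<dots> \<le> (?M * 2 powr (- (real k + 1))) powr (- \<rho>) * a"
          using a lower \<rho> by (intro mult_right_mono powr_mono2') auto
        finally show "cmod (ev x n) \<le> (?M * 2 powr (- (real k + 1))) powr (- \<rho>) * cmod (ev x n) powr (1 / (1 - \<rho>))"
          by (simp add: a_def)
      qed
      also have "(?M * 2 powr (- (real k + 1))) powr (- \<rho>) = 2 powr ((real k + 1) * \<rho>) * ?M powr (- \<rho>)"
      proof -
        have "- (real k + 1) * - \<rho> = (real k + 1) * \<rho>" by algebra
        then show ?thesis using M by (simp only: powr_mult powr_powr mult.commute)
      qed
      also have "(\<Sum>n\<in>?L. 2 powr ((real k + 1) * \<rho>) * ?M powr (- \<rho>) * cmod (ev x n) powr (1 / (1 - \<rho>)))
          = 2 powr ((real k + 1) * \<rho>) * (?M powr (- \<rho>) * s)"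
        by (simp add: sum_distrib_left s_def mult_ac)
      also have "\<dots> \<le> 2 powr ((real k + 1) * \<rho>) * sqrt (?M powr (1 - 2 * \<rho>) * s)"
      proof (intro mult_left_mono real_le_rsqrt)
        have "(?M powr (- \<rho>) * s)\<^sup>2 = ?M powr (- 2 * \<rho>) * s * s"
        proof -
          have "?M powr (- 2 * \<rho>) = ?M powr (- \<rho>) * ?M powr (- \<rho>)" by (simp flip: powr_add)
          then show ?thesis by (simp add: power2_eq_square mult_ac)
        qed
        also have "\<dots> \<le> ?M powr (- 2 * \<rho>) * s * ?M" using s by (intro mult_left_mono) auto
        also have "\<dots> = ?M powr (1 - 2 * \<rho>) * s"
          using powr_mult_base[of ?M "- 2 * \<rho>"] M by (simp add: algebra_simps)
        finally show "(?M powr (- \<rho>) * s)\<^sup>2 \<le> ?M powr (1 - 2 * \<rho>) * s" .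
      qed simp
      finally show ?thesis using True by (simp add: n1 weight_def s_def)
    qed (simp add: n1 weight_nonneg)
  next
    case False
    \<comment> \<open>The last level has no lower threshold. Instead its entries are counted: there
      are at most 2^N sites in \<open>S\<close>, and the summand of \<open>mass\<close> at each is
      at most 2^(-N) times the mass.\<close>
    then have k: "k = N" using kN by simp
    have "(\<Sum>n\<in>?L. cmod (ev x n)) \<le> (\<Sum>n\<in>?L. (?M * 2 powr (- real N)) powr (1 - \<rho>))"
    proof (rule sum_mono)
      fix n assume n: "n \<in> ?L"
      then show "cmod (ev x n) \<le> (?M * 2 powr (- real N)) powr (1 - \<rho>)"
        using level_upper[OF n] \<rho> k by (subst cmod_eq_powr) (intro powr_mono2, auto)
    qed
    also have "\<dots> \<le> real (card S) * (?M * 2 powr (- real N)) powr (1 - \<rho>)"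
      using card_mono[OF S(1) level_subset, of \<rho> N k x] by (simp add: mult_right_mono)
    also have "\<dots> \<le> 2 powr (real N) * (?M * 2 powr (- real N)) powr (1 - \<rho>)"
    proof (rule mult_right_mono)
      have "real (card S) \<le> real (2 ^ N)" using S(2) by (simp only: of_nat_le_iff)
      then show "real (card S) \<le> 2 powr (real N)" by (simp add: powr_realpow)
    qed simp
    also have "\<dots> = 2 powr (real N * \<rho>) * ?M powr (1 - \<rho>)"
    proof -
      have "real N + - real N * (1 - \<rho>) = real N * \<rho>" by (simp add: algebra_simps)
      then have "2 powr (real N * \<rho>) = 2 powr (real N) * 2 powr (- real N * (1 - \<rho>))"
        by (simp only: powr_add[symmetric])
      then show ?thesis by (simp add: powr_mult mass_nonneg powr_powr)
    qed
    also have "\<dots> \<le> 2 powr ((real N + 1) * \<rho>) * ?M powr (1 - \<rho>)"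
      using \<rho>(1) by (intro mult_right_mono powr_mono) (simp_all add: mult_right_mono)
    also have "?M powr (1 - \<rho>) = sqrt (weight \<rho> S N k x)"
    proof -
      have "?M powr (2 - 2 * \<rho>) = (?M powr (1 - \<rho>))\<^sup>2"
        by (simp add: power2_eq_square flip: powr_add)
      then show ?thesis by (simp add: weight_def k)
    qed
    finally show ?thesis unfolding n1 by (simp only: k)
  qed
qed

text \<open>The levels below \<open>N\<close> are disjoint and contribute at most one squared dual
  norm together; the last level contributes the other.\<close>

lemma sum_weight_le: "(\<Sum>k\<le>N. weight \<rho> S N k x) \<le> 2 * (dual_norm \<rho> S x)\<^sup>2"
proof -
  let ?M = "mass \<rho> S x" and ?a = "\<lambda>n. cmod (ev x n) powr (1 / (1 - \<rho>))"
  have "(\<Sum>k<N. weight \<rho> S N k x) = ?M powr (1 - 2 * \<rho>) * (\<Sum>k<N. \<Sum>n\<in>level \<rho> S N k x. ?a n)"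
    by (simp add: weight_def sum_distrib_left)
  also have "\<dots> \<le> ?M powr (1 - 2 * \<rho>) * (\<Sum>k\<le>N. \<Sum>n\<in>level \<rho> S N k x. ?a n)"
    by (intro mult_left_mono sum_mono2) (auto simp: sum_nonneg)
  also have "(\<Sum>k\<le>N. \<Sum>n\<in>level \<rho> S N k x. ?a n) = (\<Sum>k\<le>N. \<Sum>n\<in>S. if n \<in> level \<rho> S N k x then ?a n else 0)"
    by (simp add: sum_level_eq[OF S(1)])
  also have "\<dots> = (\<Sum>n\<in>S. \<Sum>k\<le>N. if n \<in> level \<rho> S N k x then ?a n else 0)" by (rule sum.swap)
  also have "\<dots> = ?M" unfolding mass_def by (intro sum.cong refl sum_levels)
  finally have "(\<Sum>k<N. weight \<rho> S N k x) \<le> ?M powr (2 - 2 * \<rho>)" by (simp add: mass_powr_mult)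
  moreover have "weight \<rho> S N N x = ?M powr (2 - 2 * \<rho>)" by (simp add: weight_def)
  moreover have "(dual_norm \<rho> S x)\<^sup>2 = ?M powr (2 - 2 * \<rho>)"
    by (simp add: dual_norm_def power2_eq_square flip: powr_add)
  ultimately show ?thesis by (simp flip: lessThan_Suc_atMost)
qed

end

section \<open>Measurability in time of the level set decomposition\<close>

lemma borel_measurable_mass [measurable (raw)]:
  fixes F :: "'b \<Rightarrow> 'a::countable ell2"
  assumes [measurable]: "F \<in> borel_measurable M"
  shows "(\<lambda>t. mass \<rho> S (F t)) \<in> borel_measurable M"
  unfolding mass_def by measurable

lemma borel_measurable_dual_norm [measurable (raw)]:
  fixes F :: "'b \<Rightarrow> 'a::countable ell2"
  assumes [measurable]: "F \<in> borel_measurable M"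
  shows "(\<lambda>t. dual_norm \<rho> S (F t)) \<in> borel_measurable M"
  unfolding dual_norm_def by measurable

lemma pred_above [measurable (raw)]:
  fixes F :: "'b \<Rightarrow> 'a::countable ell2"
  assumes [measurable]: "F \<in> borel_measurable M"
  shows "Measurable.pred M (\<lambda>t. above \<rho> S (F t) k n)"
  unfolding above_def by measurable

lemma pred_level [measurable (raw)]:
  fixes F :: "'b \<Rightarrow> 'a::countable ell2"
  assumes [measurable]: "F \<in> borel_measurable M"
  shows "Measurable.pred M (\<lambda>t. n \<in> level \<rho> S N k (F t))"
proof -
  have "(\<lambda>t. n \<in> level \<rho> S N k (F t))
      = (\<lambda>t. n \<in> S \<and> k \<le> N \<and> (k = N \<or> above \<rho> S (F t) k n) \<and> (\<forall>j\<in>{..<k}. \<not> above \<rho> S (F t) j n))"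
    by (auto simp: level_def)
  then show ?thesis by simp
qed

lemma borel_measurable_weight [measurable (raw)]:
  fixes F :: "'b \<Rightarrow> 'a::countable ell2"
  assumes [measurable]: "F \<in> borel_measurable M" and "finite S"
  shows "(\<lambda>t. weight \<rho> S N k (F t)) \<in> borel_measurable M"
proof -
  have "(\<Sum>n\<in>level \<rho> S N k x. cmod (ev x n) powr (1 / (1 - \<rho>)))
      = (\<Sum>n\<in>S. if n \<in> level \<rho> S N k x then cmod (ev x n) powr (1 / (1 - \<rho>)) else 0)" for x :: "'a ell2"
    by (rule sum_level_eq[OF assms(2)])
  note eq = this
  show ?thesis unfolding weight_def eq by measurable
qed

lemma borel_measurable_unit_ell2 [measurable (raw)]:
  assumes "f \<in> borel_measurable M"
  shows "(\<lambda>t. unit_ell2 n (f t)) \<in> borel_measurable M"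
  using assms by (rule measurable_compose)
    (intro borel_measurable_continuous_onI linear_continuous_on bounded_linear_unit_ell2)

lemma forcing_piece:
  fixes F :: "real \<Rightarrow> 'a::countable ell2"
  assumes F: "forcing S T B F" and S: "finite S"
  shows "forcing S T B (\<lambda>t. piece \<rho> S N k (F t))"
proof -
  note [measurable] = forcingD(1)[OF F]
  have "piece \<rho> S N k x = (\<Sum>n\<in>S. if n \<in> level \<rho> S N k x then unit_ell2 n (ev x n) else 0)" for x :: "'a ell2"
    unfolding piece_def restr_eq_sum[OF finite_level[OF S]] by (rule sum_level_eq[OF S])
  then have "(\<lambda>t. piece \<rho> S N k (F t)) \<in> borel_measurable borel" by simp
  moreover have "norm (piece \<rho> S N k (F t)) \<le> B" for t
    using order_trans[OF norm_restr_le forcingD(4)[OF F]] by (simp add: piece_def)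
  moreover have "piece \<rho> S N k 0 = 0" by (rule ell2_eqI) (simp add: piece_def)
  ultimately show ?thesis
    using forcingD(2)[OF F] forcingD(3)[OF F] by (auto simp: forcing_def piece_def)
qed

text \<open>On either side of the real number \<open>m\<close> the integer parts of the distances to
  distinct integers are distinct, so each side is dominated by one geometric series.\<close>

lemma sum_powr_abs_diff_le:
  fixes \<eta> m :: real
  assumes \<eta>: "\<eta> > 0"
  shows "(\<Sum>l\<le>N. 2 powr (- \<eta> * \<bar>real l - m\<bar>)) \<le> 2 / (1 - 2 powr (- \<eta>))"
proof -
  define q where "q = 2 powr (- \<eta>)"
  have q: "0 < q" "q < 1" using \<eta> by (auto simp: q_def powr_less_one)
  have half: "(\<Sum>l\<in>A. 2 powr (- \<eta> * \<bar>real l - m\<bar>)) \<le> 1 / (1 - q)"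
    if A: "finite A" "inj_on (\<lambda>l. nat \<lfloor>\<bar>real l - m\<bar>\<rfloor>) A" for A
  proof -
    have "(\<Sum>l\<in>A. 2 powr (- \<eta> * \<bar>real l - m\<bar>)) \<le> (\<Sum>l\<in>A. q ^ nat \<lfloor>\<bar>real l - m\<bar>\<rfloor>)"
    proof (rule sum_mono)
      fix l
      have "q ^ j = 2 powr (- \<eta> * real j)" for j
        using q powr_realpow[of q j] by (simp add: q_def powr_powr)
      note this[of "nat \<lfloor>\<bar>real l - m\<bar>\<rfloor>"]
      moreover have "real (nat \<lfloor>\<bar>real l - m\<bar>\<rfloor>) \<le> \<bar>real l - m\<bar>" by simp
      then have "\<eta> * real (nat \<lfloor>\<bar>real l - m\<bar>\<rfloor>) \<le> \<eta> * \<bar>real l - m\<bar>" using \<eta> by (intro mult_left_mono) auto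
      then have "2 powr (- \<eta> * \<bar>real l - m\<bar>) \<le> 2 powr (- \<eta> * real (nat \<lfloor>\<bar>real l - m\<bar>\<rfloor>))"
        by (intro powr_mono) auto
      ultimately show "2 powr (- \<eta> * \<bar>real l - m\<bar>) \<le> q ^ nat \<lfloor>\<bar>real l - m\<bar>\<rfloor>" by (simp only:)
    qed
    also have "\<dots> = (\<Sum>j\<in>(\<lambda>l. nat \<lfloor>\<bar>real l - m\<bar>\<rfloor>) ` A. q ^ j)"
      using A(2) by (simp add: sum.reindex)
    also have "\<dots> \<le> (\<Sum>j. q ^ j)"
      using A(1) q by (intro sum_le_suminf summable_geometric) auto
    also have "\<dots> = 1 / (1 - q)" using q by (intro suminf_geometric) auto
    finally show ?thesis .
  qed
  have "(\<Sum>l\<le>N. 2 powr (- \<eta> * \<bar>real l - m\<bar>)) = (\<Sum>l\<in>{l. l \<le> N \<and> m \<le> real l}. 2 powr (- \<eta> * \<bar>real l - m\<bar>))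
      + (\<Sum>l\<in>{l. l \<le> N \<and> real l < m}. 2 powr (- \<eta> * \<bar>real l - m\<bar>))"
    by (subst sum.union_disjoint[symmetric]) (auto intro!: sum.cong)
  also have "\<dots> \<le> 1 / (1 - q) + 1 / (1 - q)"
  proof (intro add_mono half)
    show "inj_on (\<lambda>l. nat \<lfloor>\<bar>real l - m\<bar>\<rfloor>) {l. l \<le> N \<and> m \<le> real l}"
    proof (rule inj_onI)
      fix x y assume "x \<in> {l. l \<le> N \<and> m \<le> real l}" "y \<in> {l. l \<le> N \<and> m \<le> real l}"
        "nat \<lfloor>\<bar>real x - m\<bar>\<rfloor> = nat \<lfloor>\<bar>real y - m\<bar>\<rfloor>"
      then have "\<lfloor>real x - m\<rfloor> = \<lfloor>real y - m\<rfloor>" by (simp add: eq_nat_nat_iff)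
      then show "x = y" by linarith
    qed
    show "inj_on (\<lambda>l. nat \<lfloor>\<bar>real l - m\<bar>\<rfloor>) {l. l \<le> N \<and> real l < m}"
    proof (rule inj_onI)
      fix x y assume "x \<in> {l. l \<le> N \<and> real l < m}" "y \<in> {l. l \<le> N \<and> real l < m}"
        "nat \<lfloor>\<bar>real x - m\<bar>\<rfloor> = nat \<lfloor>\<bar>real y - m\<bar>\<rfloor>"
      then have "\<lfloor>m - real x\<rfloor> = \<lfloor>m - real y\<rfloor>" by (simp add: eq_nat_nat_iff abs_minus_commute)
      then show "x = y" by linarith
    qed
  qed auto
  finally show ?thesis by (simp add: q_def)
qed

section \<open>Dual Strichartz estimates\<close>

text \<open>The Strichartz estimate in dual form; \<open>q\<close> is the dual of the time exponent.
  The constant precedes \<open>S\<close>, \<open>T\<close> and \<open>B\<close>, which allows the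
  passage to the full lattice, and \<open>I\<close> is any Borel set of lags, so that the same
  constant serves the homogeneous term with \<open>UNIV\<close> and the retarded term with
  \<open>{0..}\<close>.\<close>

definition dual_bound :: "'d::finite itself \<Rightarrow> real \<Rightarrow> real \<Rightarrow> real \<Rightarrow> bool" where
  "dual_bound _ \<rho> q C \<longleftrightarrow> (\<forall>(S :: (int ^ 'd) set) T B I F G. finite S \<longrightarrow> forcing S T B F \<longrightarrow> forcing S T B G \<longrightarrow>
     I \<in> sets borel \<longrightarrow> (\<integral>\<^sup>+ t. ennreal (dual_norm \<rho> S (F t) powr q) \<partial>lborel) \<le> 1 \<longrightarrow>
     (\<integral>\<^sup>+ t. ennreal (dual_norm \<rho> S (G t) powr q) \<partial>lborel) \<le> 1 \<longrightarrow> \<bar>bil I F G\<bar> \<le> C)"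

text \<open>With kernel decay of order \<open>a < 1\<close> this is the Hardy-Littlewood-Sobolev
  inequality for the scalar functions given by the dual norms; the restriction to \<open>I\<close>
  disappears on taking absolute values.\<close>

lemma dual_bound_of_pointwise_decay:
  assumes a: "0 < a" "a < 1" and q: "q = 2 / (2 - a)" and K: "0 \<le> K"
    and decay: "\<And>(S :: (int ^ 'd::finite) set) x y t. finite S \<Longrightarrow> (\<And>n. n \<notin> S \<Longrightarrow> ev x n = 0) \<Longrightarrow>
      (\<And>n. n \<notin> S \<Longrightarrow> ev y n = 0) \<Longrightarrow> t \<noteq> 0 \<Longrightarrow>
      \<bar>propag t x \<bullet> y\<bar> \<le> K * \<bar>t\<bar> powr (- a) * dual_norm \<rho> S x * dual_norm \<rho> S y"
  shows "dual_bound TYPE('d) \<rho> q (K * (2 * (2 / (1 - a) + 3)))"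
  unfolding dual_bound_def
proof (intro allI impI)
  fix S :: "(int ^ 'd) set" and T B :: real and I :: "real set" and F G :: "real \<Rightarrow> (int ^ 'd) ell2"
  assume S: "finite S" and F: "forcing S T B F" and G: "forcing S T B G" and I: "I \<in> sets borel"
    and F1: "(\<integral>\<^sup>+ t. ennreal (dual_norm \<rho> S (F t) powr q) \<partial>lborel) \<le> 1"
    and G1: "(\<integral>\<^sup>+ t. ennreal (dual_norm \<rho> S (G t) powr q) \<partial>lborel) \<le> 1"
  note [measurable] = forcingD(1)[OF F] forcingD(1)[OF G] I
  let ?f = "\<lambda>s. dual_norm \<rho> S (F s)" and ?g = "\<lambda>t. dual_norm \<rho> S (G t)"
  have "ennreal \<bar>bil I F G\<bar> \<le> (\<integral>\<^sup>+ t. \<integral>\<^sup>+ s. ennreal (indicator I (t - s) * \<bar>propag (t - s) (F s) \<bullet> G t\<bar>) \<partial>lborel \<partial>lborel)"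
    by (rule bil_le_nn_integral[OF F G I])
  also have "\<dots> \<le> (\<integral>\<^sup>+ t. \<integral>\<^sup>+ s. ennreal K * ennreal (?f s * ?g t * \<bar>t - s\<bar> powr (- a)) \<partial>lborel \<partial>lborel)"
  \<comment> \<open>The decay hypothesis says nothing at lag 0, so the comparison holds off the
    diagonal only, a null set for each \<open>t\<close>.\<close>
  proof (rule nn_integral_mono, rule nn_integral_mono_AE)
    fix t :: real
    show "AE s in lborel. ennreal (indicator I (t - s) * \<bar>propag (t - s) (F s) \<bullet> G t\<bar>)
        \<le> ennreal K * ennreal (?f s * ?g t * \<bar>t - s\<bar> powr (- a))"
      using AE_lborel_singleton[of t]
    proof eventually_elim
      case (elim s)
      have "\<bar>propag (t - s) (F s) \<bullet> G t\<bar> \<le> K * \<bar>t - s\<bar> powr (- a) * ?f s * ?g t"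
        using elim S forcingD(2)[OF F] forcingD(2)[OF G] by (intro decay) auto
      then have "indicator I (t - s) * \<bar>propag (t - s) (F s) \<bullet> G t\<bar> \<le> K * (?f s * ?g t * \<bar>t - s\<bar> powr (- a))"
        using K dual_norm_nonneg[of \<rho> S] by (auto simp: indicator_def mult_ac)
      then show ?case
        using K dual_norm_nonneg[of \<rho> S] by (simp add: ennreal_mult'[symmetric] ennreal_leI)
    qed
  qed
  also have "\<dots> = ennreal K * (\<integral>\<^sup>+ t. \<integral>\<^sup>+ s. ennreal (?f s * ?g t * \<bar>t - s\<bar> powr (- a)) \<partial>lborel \<partial>lborel)"
    by (simp add: nn_integral_cmult)
  also have "\<dots> \<le> ennreal K * ennreal (2 * (2 / (1 - a) + 3))"
    by (intro mult_left_mono hls[OF a q _ _ _ _ F1 G1]) (auto simp: dual_norm_nonneg)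
  also have "\<dots> = ennreal (K * (2 * (2 / (1 - a) + 3)))"
    using K by (intro ennreal_mult'[symmetric]) auto
  finally show "\<bar>bil I F G\<bar> \<le> K * (2 * (2 / (1 - a) + 3))"
    using K a by (subst (asm) ennreal_le_iff) auto
qed

lemma dual_norm_0: "dual_norm 0 S x = norm1 S x"
  by (simp add: dual_norm_def mass_def norm1_def sum_nonneg)

text \<open>The decay rate d/3 is below 1, so the dispersive bound itself enters
  Hardy-Littlewood-Sobolev, with r = infinity. The exponent 6/(6 - d) is dual to 6/d.\<close>

lemma dual_bound_low_dimension:
  assumes "CARD('d::finite) \<le> 2"
  obtains C where "0 \<le> C" "dual_bound TYPE('d) 0 (6 / (6 - real CARD('d))) C"
proof -
  define a where "a = real CARD('d) / 3"
  have a: "0 < a" "a < 1" using assms by (auto simp: a_def)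
  have "dual_bound TYPE('d) 0 (6 / (6 - real CARD('d))) (4 ^ CARD('d) * (2 * (2 / (1 - a) + 3)))"
  proof (rule dual_bound_of_pointwise_decay[OF a])
    show "6 / (6 - real CARD('d)) = 2 / (2 - a)" using assms by (simp add: a_def field_simps)
  qed (auto simp: dual_norm_0 a_def intro!: dispersive_estimate)
  then show thesis using a by (intro that) auto
qed

text \<open>Interpolation by hand between the l^1 and the l^2 bound. For a pair of levels
  \<open>k\<close>, \<open>l\<close> the first grows and the second decays geometrically in k + l;
  taking the better one leaves decay in the distance of k + l from the balance point, which a Schur
  test sums. The rate \<open>\<eta>\<close> is the smaller of the two slopes, and
  \<open>4 powr \<rho>\<close> comes from the \<open>k + 1\<close> and \<open>l + 1\<close> in
  \<open>norm1_piece_le\<close>.\<close>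

lemma dispersive_interpolated:
  fixes x y :: "(int ^ 'd::finite) ell2"
  assumes \<rho>: "0 < \<rho>" "\<rho> < 1 / 2" and S: "finite S" and x: "\<And>n. n \<notin> S \<Longrightarrow> ev x n = 0"
    and y: "\<And>n. n \<notin> S \<Longrightarrow> ev y n = 0" and t: "t \<noteq> 0"
    and \<eta>: "\<eta> = min \<rho> (1 / 2 - \<rho>)"
  shows "\<bar>propag t x \<bullet> y\<bar> \<le> 4 powr \<rho> * (4 * (2 / (1 - 2 powr (- \<eta>)))) * (4 ^ CARD('d) * \<bar>t\<bar> powr (- (CARD('d) / 3))) powr (1 - 2 * \<rho>)
     * dual_norm \<rho> S x * dual_norm \<rho> S y"
proof -
  define P where "P = 4 ^ CARD('d) * \<bar>t\<bar> powr (- (CARD('d) / 3))"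
  define N where "N = card S"
  define G where "G = 2 / (1 - 2 powr (- \<eta>))"
  define A where "A = dual_norm \<rho> S x"
  define A' where "A' = dual_norm \<rho> S y"
  have P: "P > 0" using t by (simp add: P_def)
  have N: "card S \<le> 2 ^ N" by (simp add: N_def less_imp_le)
  have eta: "\<eta> > 0" using \<rho> by (simp add: \<eta>)
  have G0: "0 \<le> G" using eta by (auto simp: G_def powr_less_one less_imp_le)
  have \<rho>': "0 \<le> \<rho>" using \<rho> by simp
  note L = \<rho>' \<rho>(2) S N
  define b where "b k = sqrt (weight \<rho> S N k x)" for k
  define e where "e k = sqrt (weight \<rho> S N k y)" for k
  have b0: "0 \<le> b k" "0 \<le> e k" for k by (auto simp: b_def e_def weight_nonneg)
  \<comment> \<open>The balance point: with P = 2^(-m/2), the bounds \<open>B1\<close> and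
    \<open>B2\<close> below agree at j = m up to the factor \<open>4 powr \<rho>\<close>.\<close>
  define m where "m = - 2 * log 2 P"
  have Pm: "P = 2 powr (- m / 2)" using P by (simp add: m_def)
  have pair: "\<bar>propag t (piece \<rho> S N k x) \<bullet> piece \<rho> S N l y\<bar>
      \<le> 4 powr \<rho> * P powr (1 - 2 * \<rho>) * 2 powr (- \<eta> * \<bar>real l - (m - real k)\<bar>) * (b k * e l)"
    if "k \<le> N" "l \<le> N" for k l
  proof -
    define j where "j = real k + real l"
    have B1: "\<bar>propag t (piece \<rho> S N k x) \<bullet> piece \<rho> S N l y\<bar> \<le> 4 powr \<rho> * (P * 2 powr (j * \<rho>)) * (b k * e l)"
    proof -
      have "\<bar>propag t (piece \<rho> S N k x) \<bullet> piece \<rho> S N l y\<bar> \<le> P * norm1 S (piece \<rho> S N k x) * norm1 S (piece \<rho> S N l y)"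
        unfolding P_def using S t by (intro dispersive_estimate) (auto simp: piece_def x y)
      also have "\<dots> \<le> P * (2 powr ((real k + 1) * \<rho>) * b k) * (2 powr ((real l + 1) * \<rho>) * e l)"
        using P b0 unfolding b_def e_def
        by (intro mult_mono norm1_piece_le L that order_refl mult_nonneg_nonneg) (auto simp: norm1_nonneg weight_nonneg)
      also have "\<dots> = P * (2 powr ((real k + 1) * \<rho>) * 2 powr ((real l + 1) * \<rho>)) * (b k * e l)" by simp
      also have "2 powr ((real k + 1) * \<rho>) * 2 powr ((real l + 1) * \<rho>) = 2 powr (2 * \<rho>) * 2 powr (j * \<rho>)"
        unfolding powr_add[symmetric] j_def by (simp add: algebra_simps)
      also have "2 powr (2 * \<rho>) = 4 powr \<rho>" by (simp flip: powr_powr)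
      finally show ?thesis by (simp add: mult_ac)
    qed
    have B2: "\<bar>propag t (piece \<rho> S N k x) \<bullet> piece \<rho> S N l y\<bar> \<le> 2 powr (- j * (1 / 2 - \<rho>)) * (b k * e l)"
    proof -
      have nb: "norm (piece \<rho> S N k z) \<le> 2 powr (- real k * (1 / 2 - \<rho>)) * sqrt (weight \<rho> S N k z)" for k z
      proof -
        have root: "sqrt (2 powr (- real k * (1 - 2 * \<rho>))) = 2 powr (- real k * (1 / 2 - \<rho>))"
          by (subst powr_half_sqrt[symmetric]) (simp_all add: powr_powr algebra_simps)
        have "norm (piece \<rho> S N k z) \<le> sqrt (2 powr (- real k * (1 - 2 * \<rho>)) * weight \<rho> S N k z)"
          by (rule real_le_rsqrt) (rule norm_piece_square_le[OF L])
        then show ?thesis by (simp only: real_sqrt_mult root)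
      qed
      have "\<bar>propag t (piece \<rho> S N k x) \<bullet> piece \<rho> S N l y\<bar> \<le> norm (piece \<rho> S N k x) * norm (piece \<rho> S N l y)"
        using Cauchy_Schwarz_ineq2[of "propag t (piece \<rho> S N k x)" "piece \<rho> S N l y"] by simp
      also have "\<dots> \<le> (2 powr (- real k * (1 / 2 - \<rho>)) * b k) * (2 powr (- real l * (1 / 2 - \<rho>)) * e l)"
        unfolding b_def e_def by (intro mult_mono nb) (auto simp: weight_nonneg)
      also have "\<dots> = (2 powr (- real k * (1 / 2 - \<rho>)) * 2 powr (- real l * (1 / 2 - \<rho>))) * (b k * e l)" by simp
      also have "2 powr (- real k * (1 / 2 - \<rho>)) * 2 powr (- real l * (1 / 2 - \<rho>)) = 2 powr (- j * (1 / 2 - \<rho>))"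
        unfolding powr_add[symmetric] j_def by (simp add: algebra_simps)
      finally show ?thesis .
    qed
    have Pp: "P powr (1 - 2 * \<rho>) = 2 powr (- m * (1 / 2 - \<rho>))"
      unfolding Pm powr_powr by (simp add: algebra_simps)
    have abs: "\<bar>real l - (m - real k)\<bar> = \<bar>j - m\<bar>" by (simp add: j_def)
    have four: "1 \<le> 4 powr \<rho>" using \<rho> by (simp add: ge_one_powr_ge_zero)
    show ?thesis
    proof (cases "j \<le> m")
      case True
      have "P * 2 powr (j * \<rho>) = 2 powr (- m * (1 / 2 - \<rho>)) * 2 powr (- \<rho> * \<bar>j - m\<bar>)"
        unfolding Pm powr_add[symmetric] using True by (simp add: algebra_simps)
      also have "\<dots> \<le> 2 powr (- m * (1 / 2 - \<rho>)) * 2 powr (- \<eta> * \<bar>j - m\<bar>)"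
        by (intro mult_left_mono powr_mono mult_right_mono) (auto simp: \<eta>)
      finally have "P * 2 powr (j * \<rho>) \<le> 2 powr (- m * (1 / 2 - \<rho>)) * 2 powr (- \<eta> * \<bar>j - m\<bar>)" .
      then have X: "4 powr \<rho> * (P * 2 powr (j * \<rho>)) * (b k * e l)
          \<le> 4 powr \<rho> * (2 powr (- m * (1 / 2 - \<rho>)) * 2 powr (- \<eta> * \<bar>j - m\<bar>)) * (b k * e l)"
        using b0 by (intro mult_right_mono mult_left_mono) auto
      from order_trans[OF B1 X] show ?thesis unfolding Pp abs by (simp only: mult.assoc)
    next
      case False
      have "2 powr (- j * (1 / 2 - \<rho>)) = 2 powr (- m * (1 / 2 - \<rho>)) * 2 powr (- (1 / 2 - \<rho>) * \<bar>j - m\<bar>)"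
      proof -
        have "- j * (1 / 2 - \<rho>) = - m * (1 / 2 - \<rho>) + - (1 / 2 - \<rho>) * \<bar>j - m\<bar>"
          using False by (simp add: field_simps)
        then show ?thesis by (simp only: powr_add[symmetric])
      qed
      also have "\<dots> \<le> 2 powr (- m * (1 / 2 - \<rho>)) * 2 powr (- \<eta> * \<bar>j - m\<bar>)"
        by (intro mult_left_mono powr_mono mult_right_mono) (auto simp: \<eta>)
      also have "\<dots> \<le> 4 powr \<rho> * (2 powr (- m * (1 / 2 - \<rho>)) * 2 powr (- \<eta> * \<bar>j - m\<bar>))"
        using mult_right_mono[OF four, of "2 powr (- m * (1 / 2 - \<rho>)) * 2 powr (- \<eta> * \<bar>j - m\<bar>)"] by simp
      finally have "2 powr (- j * (1 / 2 - \<rho>)) \<le> 4 powr \<rho> * (2 powr (- m * (1 / 2 - \<rho>)) * 2 powr (- \<eta> * \<bar>j - m\<bar>))" .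
      then have X: "2 powr (- j * (1 / 2 - \<rho>)) * (b k * e l)
          \<le> 4 powr \<rho> * (2 powr (- m * (1 / 2 - \<rho>)) * 2 powr (- \<eta> * \<bar>j - m\<bar>)) * (b k * e l)"
        using b0 by (intro mult_right_mono) auto
      from order_trans[OF B2 X] show ?thesis unfolding Pp abs by (simp only: mult.assoc)
    qed
  qed
  define g where "g k l = 2 powr (- \<eta> * \<bar>real l - (m - real k)\<bar>)" for k l :: nat
  have g_sum: "(\<Sum>l\<le>N. g k l) \<le> G" "(\<Sum>l\<le>N. g l k) \<le> G" for k
    unfolding g_def G_def using sum_powr_abs_diff_le[OF eta, where m = "m - real k" and N = N]
    by (simp_all add: abs_minus_commute algebra_simps)
  \<comment> \<open>After division by \<open>A\<close> and \<open>A'\<close> the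
    arithmetic-geometric mean separates \<open>b k * e l\<close>, and the row and column sums of
    \<open>g\<close> are bounded by \<open>G\<close>. Vanishing dual norms, for which the division
    fails, are treated first.\<close>
  have schur: "(\<Sum>k\<le>N. \<Sum>l\<le>N. g k l * (b k * e l)) \<le> 4 * G * (A * A')"
  proof (cases "A = 0 \<or> A' = 0")
    case True
    have "weight \<rho> S N k z = 0" if "k \<le> N" "dual_norm \<rho> S z = 0" for k and z :: "(int ^ 'd) ell2"
    proof -
      have "weight \<rho> S N k z \<le> (\<Sum>k\<le>N. weight \<rho> S N k z)"
        by (rule member_le_sum) (use that weight_nonneg in auto)
      also have "\<dots> \<le> 0" using sum_weight_le[OF L, of z] that by simp
      finally show ?thesis using weight_nonneg[of \<rho> S N k z] by linarith
    qed
    then have "g k l * (b k * e l) = 0" if "k \<le> N" "l \<le> N" for k l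
      using True that by (auto simp: b_def e_def A_def A'_def)
    then show ?thesis using G0 True by (auto simp: sum.neutral)
  next
    case False
    then have AA: "A > 0" "A' > 0" using dual_norm_nonneg[of \<rho> S x] dual_norm_nonneg[of \<rho> S y] by (auto simp: A_def A'_def)
    define u where "u k = (b k / A)\<^sup>2" for k
    define v where "v k = (e k / A')\<^sup>2" for k
    have uv: "(\<Sum>k\<le>N. u k) \<le> 2" "(\<Sum>k\<le>N. v k) \<le> 2"
    proof -
      have "(\<Sum>k\<le>N. u k) = (\<Sum>k\<le>N. weight \<rho> S N k x) / A\<^sup>2" "(\<Sum>k\<le>N. v k) = (\<Sum>k\<le>N. weight \<rho> S N k y) / A'\<^sup>2"
        by (simp_all add: u_def v_def b_def e_def power_divide weight_nonneg sum_divide_distrib)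
      then show "(\<Sum>k\<le>N. u k) \<le> 2" "(\<Sum>k\<le>N. v k) \<le> 2"
        using sum_weight_le[OF L, of x] sum_weight_le[OF L, of y] AA
        by (simp_all add: A_def A'_def divide_le_eq)
    qed
    have uv0: "0 \<le> u k" "0 \<le> v k" for k by (simp_all add: u_def v_def)
    have be: "b k * e l \<le> A * A' * ((u k + v l) / 2)" for k l
    proof -
      have "(b k / A) * (e l / A') \<le> (u k + v l) / 2"
        using sum_squares_bound[of "b k / A" "e l / A'"] by (simp add: u_def v_def mult_ac)
      then show ?thesis using AA by (simp add: field_simps)
    qed
    have "(\<Sum>k\<le>N. \<Sum>l\<le>N. g k l * (b k * e l)) \<le> (\<Sum>k\<le>N. \<Sum>l\<le>N. g k l * (A * A' * ((u k + v l) / 2)))"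
      by (intro sum_mono mult_left_mono be) (simp add: g_def)
    also have "\<dots> = (\<Sum>k\<le>N. \<Sum>l\<le>N. A * A' / 2 * (g k l * u k) + A * A' / 2 * (g k l * v l))"
      by (intro sum.cong refl) (simp add: field_simps)
    also have "\<dots> = A * A' / 2 * ((\<Sum>k\<le>N. \<Sum>l\<le>N. g k l * u k) + (\<Sum>k\<le>N. \<Sum>l\<le>N. g k l * v l))"
      by (simp only: sum.distrib sum_distrib_left distrib_left)
    also have "(\<Sum>k\<le>N. \<Sum>l\<le>N. g k l * v l) = (\<Sum>l\<le>N. \<Sum>k\<le>N. g k l * v l)" by (rule sum.swap)
    also have "A * A' / 2 * ((\<Sum>k\<le>N. \<Sum>l\<le>N. g k l * u k) + (\<Sum>l\<le>N. \<Sum>k\<le>N. g k l * v l))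
        \<le> A * A' / 2 * ((\<Sum>k\<le>N. G * u k) + (\<Sum>l\<le>N. G * v l))"
      unfolding sum_distrib_right[symmetric] using AA uv0
      by (intro mult_left_mono add_mono sum_mono mult_right_mono g_sum) auto
    also have "\<dots> \<le> A * A' / 2 * (G * 2 + G * 2)"
      unfolding sum_distrib_left[symmetric] using AA G0 by (intro mult_left_mono add_mono uv) auto
    also have "\<dots> \<le> 4 * G * (A * A')" using AA G0 by simp
    finally show ?thesis .
  qed
  have pieces: "(\<Sum>k\<le>N. piece \<rho> S N k x) = x" "(\<Sum>k\<le>N. piece \<rho> S N k y) = y"
    using x y by (auto intro!: sum_pieces)
  have "propag t x \<bullet> y = propag t (\<Sum>k\<le>N. piece \<rho> S N k x) \<bullet> (\<Sum>k\<le>N. piece \<rho> S N k y)"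
    by (simp only: pieces)
  also have "\<dots> = (\<Sum>k\<le>N. \<Sum>l\<le>N. propag t (piece \<rho> S N k x) \<bullet> piece \<rho> S N l y)"
    unfolding sg.flow_sum inner_sum_left unfolding inner_sum_right by (rule refl)
  also have "\<bar>\<dots>\<bar> \<le> (\<Sum>k\<le>N. \<Sum>l\<le>N. \<bar>propag t (piece \<rho> S N k x) \<bullet> piece \<rho> S N l y\<bar>)"
    by (intro order_trans[OF sum_abs] sum_mono sum_abs)
  also have "\<dots> \<le> (\<Sum>k\<le>N. \<Sum>l\<le>N. 4 powr \<rho> * P powr (1 - 2 * \<rho>) * (g k l * (b k * e l)))"
    using pair by (intro sum_mono) (simp add: g_def mult.assoc)
  also have "\<dots> = 4 powr \<rho> * P powr (1 - 2 * \<rho>) * (\<Sum>k\<le>N. \<Sum>l\<le>N. g k l * (b k * e l))"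
    by (simp add: sum_distrib_left)
  also have "\<dots> \<le> 4 powr \<rho> * P powr (1 - 2 * \<rho>) * (4 * G * (A * A'))"
    by (intro mult_left_mono schur) simp
  finally show ?thesis by (simp add: P_def G_def A_def A'_def mult_ac)
qed

text \<open>Here the dispersive decay is exactly 1/|t|, which Hardy-Littlewood-Sobolev does not
  admit. Interpolation improves the exponent to \<open>1 - 2 * \<rho>\<close>, at the price of a
  constant that blows up as \<open>\<rho>\<close> tends to 0, that is as the time exponent tends to
  2.\<close>

lemma dual_bound_dimension_3:
  assumes d: "CARD('d::finite) = 3" and \<rho>: "0 < \<rho>" "\<rho> < 1 / 2"
  obtains C where "0 \<le> C" "dual_bound TYPE('d) \<rho> (1 / (1 / 2 + \<rho>)) C"
proof -
  define \<eta> where "\<eta> = min \<rho> (1 / 2 - \<rho>)"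
  define K where "K = 4 powr \<rho> * (4 * (2 / (1 - 2 powr (- \<eta>)))) * (4 ^ 3) powr (1 - 2 * \<rho>)"
  have "\<eta> > 0" using \<rho> by (simp add: \<eta>_def)
  then have K: "0 \<le> K" by (auto simp: K_def powr_less_one less_imp_le)
  have "dual_bound TYPE('d) \<rho> (1 / (1 / 2 + \<rho>)) (K * (2 * (2 / (1 - (1 - 2 * \<rho>)) + 3)))"
  proof (rule dual_bound_of_pointwise_decay)
    fix S :: "(int ^ 'd) set" and x y and t :: real
    assume S: "finite S" "\<And>n. n \<notin> S \<Longrightarrow> ev x n = 0" "\<And>n. n \<notin> S \<Longrightarrow> ev y n = 0" and t: "t \<noteq> 0"
    have "(4 ^ CARD('d) * \<bar>t\<bar> powr (- (CARD('d) / 3))) powr (1 - 2 * \<rho>)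
        = (4 ^ 3) powr (1 - 2 * \<rho>) * \<bar>t\<bar> powr (- (1 - 2 * \<rho>))"
    proof -
      have "(a * \<bar>t\<bar> powr b) powr c = a powr c * \<bar>t\<bar> powr (b * c)" if "0 \<le> a" for a b c :: real
        using that by (simp add: powr_mult powr_powr)
      from this[of "4 ^ 3" "- (CARD('d) / 3)" "1 - 2 * \<rho>"] show ?thesis by (simp add: d)
    qed
    then show "\<bar>propag t x \<bullet> y\<bar> \<le> K * \<bar>t\<bar> powr (- (1 - 2 * \<rho>)) * dual_norm \<rho> S x * dual_norm \<rho> S y"
      using dispersive_interpolated[OF \<rho> S(1) _ _ t \<eta>_def, of x y] S(2,3) by (simp add: K_def mult_ac)
  qed (use \<rho> K in \<open>auto simp: field_simps\<close>)
  then show thesis using K \<rho> by (intro that) auto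
qed

section \<open>The endpoint in dimension at least four\<close>

text \<open>The condition \<open>\<delta> > 1\<close> means d >= 4, and \<open>\<rho>\<close> is the
  reciprocal of the endpoint exponent r = 2\<open>\<delta>\<close>/(\<open>\<delta>\<close> - 1)
  that belongs to q = 2.\<close>

context
  fixes \<delta> \<rho> :: real and ty :: "'d::finite itself"
  assumes \<delta>: "\<delta> = real CARD('d) / 3" "\<delta> > 1" and \<rho>: "\<rho> = 1 / 2 - 1 / (2 * \<delta>)"
begin

lemma rho_bounds: "0 \<le> \<rho>" "\<rho> < 1 / 2"
  using \<delta>(2) by (auto simp: \<rho> field_simps)

lemma rho_mult: "x * \<rho> = (\<delta> - 1) * (x / (2 * \<delta>))"
  using \<delta>(2) by (simp add: \<rho> field_simps)

lemma norm_piece_le: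
  assumes "finite S" "card S \<le> 2 ^ N"
  shows "norm (piece \<rho> S N k x) \<le> 2 powr (- (real k / \<delta>) / 2) * sqrt (weight \<rho> S N k x)"
proof -
  have e: "- real k * (1 - 2 * \<rho>) = - (real k / \<delta>)" using \<delta>(2) by (simp add: \<rho> field_simps)
  have "norm (piece \<rho> S N k x) \<le> sqrt (2 powr (- (real k / \<delta>)) * weight \<rho> S N k x)"
    by (rule real_le_rsqrt) (use norm_piece_square_le[OF rho_bounds assms, of k x] in \<open>simp only: e\<close>)
  also have "\<dots> = sqrt (2 powr (- (real k / \<delta>))) * sqrt (weight \<rho> S N k x)" by (rule real_sqrt_mult)
  also have "sqrt (2 powr (- (real k / \<delta>))) = 2 powr (- (real k / \<delta>) / 2)"
    by (subst powr_half_sqrt[symmetric]) (simp_all add: powr_powr)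
  finally show ?thesis .
qed

text \<open>A majorant for the pairing of two pieces of the same level: the l^2 bound up to lag
  2^(k/\<open>\<delta>\<close>) and the dispersive bound beyond. At this lag the two have the same
  size, 2^(-k/\<open>\<delta>\<close>), up to a factor independent of \<open>k\<close>.\<close>

definition endpoint_kernel :: "nat \<Rightarrow> real \<Rightarrow> real" where
  "endpoint_kernel k x = 2 powr (- (real k / \<delta>)) * indicator {- (2 powr (real k / \<delta>))..2 powr (real k / \<delta>)} x
     + 4 ^ CARD('d) * (2 powr ((real k + 1) * \<rho>))\<^sup>2 * (indicator {2 powr (real k / \<delta>)..} \<bar>x\<bar> * \<bar>x\<bar> powr (- \<delta>))"

definition endpoint_mass :: real where
  "endpoint_mass = 2 + 4 ^ CARD('d) * 4 powr \<rho> * (2 / (\<delta> - 1))"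

lemma endpoint_mass_pos: "endpoint_mass > 0"
  using \<delta>(2) by (auto simp: endpoint_mass_def intro!: add_pos_nonneg)

text \<open>Both parts have height of order 2^(-k/\<open>\<delta>\<close>) and effective width of
  order 2^(k/\<open>\<delta>\<close>), so the powers of 2 cancel and the integral is bounded
  independently of \<open>k\<close>.\<close>

lemma endpoint_kernel_integral: "(\<integral>\<^sup>+ x. ennreal (endpoint_kernel k x) \<partial>lborel) \<le> ennreal endpoint_mass"
proof -
  define R where "R = 2 powr (real k / \<delta>)"
  define E where "E = 4 ^ CARD('d) * (2 powr ((real k + 1) * \<rho>))\<^sup>2"
  have R: "R > 0" by (simp add: R_def)
  have E: "0 \<le> E" by (simp add: E_def)
  have inv: "2 powr (- (real k / \<delta>)) * R = 1" by (simp add: R_def flip: powr_add)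
  have "(\<integral>\<^sup>+ x. ennreal (endpoint_kernel k x) \<partial>lborel)
      = (\<integral>\<^sup>+ x. ennreal (2 powr (- (real k / \<delta>))) * indicator {-R..R} x + ennreal E * ennreal (indicator {R..} \<bar>x\<bar> * \<bar>x\<bar> powr (- \<delta>)) \<partial>lborel)"
    by (intro nn_integral_cong)
       (auto simp: endpoint_kernel_def R_def[symmetric] E_def[symmetric] E indicator_def ennreal_plus[symmetric] ennreal_mult'[symmetric] simp del: ennreal_plus)
  also have "\<dots> = ennreal (2 powr (- (real k / \<delta>))) * emeasure lborel {-R..R}
      + ennreal E * (\<integral>\<^sup>+ x. ennreal (indicator {R..} \<bar>x\<bar> * \<bar>x\<bar> powr (- \<delta>)) \<partial>lborel)"
    by (simp add: nn_integral_add nn_integral_cmult)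
  also have "\<dots> \<le> ennreal (2 powr (- (real k / \<delta>))) * ennreal (2 * R) + ennreal E * ennreal (2 * R powr (1 - \<delta>) / (\<delta> - 1))"
    using R by (intro add_mono mult_left_mono nn_integral_powr_far \<delta>(2)) auto
  also have "\<dots> = ennreal (2 powr (- (real k / \<delta>)) * (2 * R) + E * (2 * R powr (1 - \<delta>) / (\<delta> - 1)))"
    using R E \<delta>(2) by (simp add: ennreal_plus[symmetric] ennreal_mult'[symmetric] del: ennreal_plus)
  also have "2 powr (- (real k / \<delta>)) * (2 * R) = 2" using inv by simp
  also have "E * (2 * R powr (1 - \<delta>) / (\<delta> - 1)) = 4 ^ CARD('d) * 4 powr \<rho> * (2 / (\<delta> - 1))"
  proof -
    have "(2 powr u)\<^sup>2 * R powr (1 - \<delta>) = 2 powr (2 * u + real k / \<delta> * (1 - \<delta>))" for u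
      by (simp add: R_def powr_powr power2_eq_square flip: powr_add)
    note this[of "(real k + 1) * \<rho>"]
    also have "2 * ((real k + 1) * \<rho>) + real k / \<delta> * (1 - \<delta>) = 2 * \<rho>"
    proof -
      define \<kappa> where "\<kappa> = real k / \<delta>"
      have "2 * (real k * \<rho>) = (\<delta> - 1) * \<kappa>" using rho_mult[of "real k"] by (simp add: \<kappa>_def)
      then show ?thesis unfolding \<kappa>_def[symmetric] by (simp add: algebra_simps)
    qed
    also have "2 powr (2 * \<rho>) = 4 powr \<rho>" by (simp flip: powr_powr)
    finally show ?thesis by (simp add: E_def mult_ac)
  qed
  finally show ?thesis by (simp add: endpoint_mass_def)
qed

lemma endpoint_kernel_bound:
  fixes x y :: "(int ^ 'd) ell2"
  assumes S: "finite S" "card S \<le> 2 ^ N" and k: "k \<le> N"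
    and x: "\<And>n. n \<notin> S \<Longrightarrow> ev x n = 0" and y: "\<And>n. n \<notin> S \<Longrightarrow> ev y n = 0"
  shows "\<bar>propag t (piece \<rho> S N k x) \<bullet> piece \<rho> S N k y\<bar>
    \<le> sqrt (weight \<rho> S N k x) * sqrt (weight \<rho> S N k y) * endpoint_kernel k t"
proof (cases "\<bar>t\<bar> \<le> 2 powr (real k / \<delta>)")
  case True
  have "\<bar>propag t (piece \<rho> S N k x) \<bullet> piece \<rho> S N k y\<bar> \<le> norm (piece \<rho> S N k x) * norm (piece \<rho> S N k y)"
    using Cauchy_Schwarz_ineq2[of "propag t (piece \<rho> S N k x)" "piece \<rho> S N k y"] by simp
  also have "\<dots> \<le> (2 powr (- (real k / \<delta>) / 2) * sqrt (weight \<rho> S N k x)) * (2 powr (- (real k / \<delta>) / 2) * sqrt (weight \<rho> S N k y))"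
    by (intro mult_mono norm_piece_le S) (auto simp: weight_nonneg)
  also have "\<dots> = sqrt (weight \<rho> S N k x) * sqrt (weight \<rho> S N k y) * (2 powr (- (real k / \<delta>) / 2) * 2 powr (- (real k / \<delta>) / 2))"
    by simp
  also have "2 powr (- (real k / \<delta>) / 2) * 2 powr (- (real k / \<delta>) / 2) = 2 powr (- (real k / \<delta>))"
    by (simp flip: powr_add)
  also have "\<dots> \<le> endpoint_kernel k t" using True by (simp add: endpoint_kernel_def abs_le_iff)
  finally show ?thesis by (simp add: mult_left_mono weight_nonneg)
next
  case False
  then have t: "t \<noteq> 0" by auto
  have "\<bar>propag t (piece \<rho> S N k x) \<bullet> piece \<rho> S N k y\<bar>
      \<le> 4 ^ CARD('d) * \<bar>t\<bar> powr (- (CARD('d) / 3)) * norm1 S (piece \<rho> S N k x) * norm1 S (piece \<rho> S N k y)"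
    using S(1) t by (intro dispersive_estimate) (auto simp: piece_def x y)
  also have "\<dots> \<le> 4 ^ CARD('d) * \<bar>t\<bar> powr (- \<delta>) * (2 powr ((real k + 1) * \<rho>) * sqrt (weight \<rho> S N k x)) * (2 powr ((real k + 1) * \<rho>) * sqrt (weight \<rho> S N k y))"
    unfolding \<delta>(1)[symmetric]
    by (intro mult_mono norm1_piece_le rho_bounds S k order_refl mult_nonneg_nonneg) (auto simp: norm1_nonneg weight_nonneg)
  also have "\<dots> = sqrt (weight \<rho> S N k x) * sqrt (weight \<rho> S N k y) * (4 ^ CARD('d) * (2 powr ((real k + 1) * \<rho>))\<^sup>2 * \<bar>t\<bar> powr (- \<delta>))"
    by (simp add: power2_eq_square mult_ac)
  also have "\<dots> \<le> sqrt (weight \<rho> S N k x) * sqrt (weight \<rho> S N k y) * endpoint_kernel k t"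
    using False by (intro mult_left_mono) (auto simp: endpoint_kernel_def weight_nonneg)
  finally show ?thesis .
qed

text \<open>The minimum of the two decay rates found in \<open>bil_piece_pair_ordered\<close>, 1/8
  for the near and (\<open>\<delta>\<close> - 1)/4 for the far part, both in units of (l -
  k)/\<open>\<delta>\<close>.\<close>

definition endpoint_gain :: real where
  "endpoint_gain = min (1 / 8) ((\<delta> - 1) / 4) / \<delta>"

definition endpoint_const :: real where
  "endpoint_const = 2 * sqrt endpoint_mass + 4 ^ CARD('d) * 4 powr \<rho> * (2 / (\<delta> - 1))"

text \<open>The near part pairs the truncated Duhamel integral of the piece of lower index in l^2
  with the piece of higher index, whose l^2 norm carries the smaller factor; the far part uses the
  dispersive bound. The cut is placed so that both decay geometrically in l - k.\<close>

lemma bil_piece_pair_ordered: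
  fixes F G :: "real \<Rightarrow> (int ^ 'd) ell2"
  assumes F: "forcing S T B F" and G: "forcing S T B' G" and I: "I \<in> sets borel"
    and S: "finite S" "card S \<le> 2 ^ N" and kl: "k \<le> l" "l \<le> N"
  shows "ennreal \<bar>bil I (\<lambda>t. piece \<rho> S N k (F t)) (\<lambda>t. piece \<rho> S N l (G t))\<bar>
     \<le> ennreal (endpoint_const * 2 powr (- endpoint_gain * \<bar>real l - real k\<bar>))
       * ((\<integral>\<^sup>+ t. ennreal (weight \<rho> S N k (F t)) \<partial>lborel) + (\<integral>\<^sup>+ t. ennreal (weight \<rho> S N l (G t)) \<partial>lborel))"
proof -
  define K where "K = real k / \<delta>"
  define L where "L = real l / \<delta>"
  \<comment> \<open>At the cut 2^((K + L)/2) the far part would have no gain, while the near part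
    would gain 2^(-(L - K)/4). The extra factor 2^((L - K)/4) spends half of the near gain and
    leaves decay on both sides.\<close>
  define h where "h = 2 powr ((K + L) / 2 + (L - K) / 4)"
  \<comment> \<open>Chosen so that its square is \<open>2 * (2 * h) * endpoint_mass\<close>, as
    \<open>bil_near\<close> requires for a window of length 2h.\<close>
  define c where "c = 2 * sqrt endpoint_mass * 2 powr ((K + L) / 4 + (L - K) / 8)"
  define J where "J = {- h..h}"
  define F' where "F' t = piece \<rho> S N k (F t)" for t
  define G' where "G' t = piece \<rho> S N l (G t)" for t
  define b where "b t = sqrt (weight \<rho> S N k (F t))" for t
  define e where "e t = sqrt (weight \<rho> S N l (G t))" for t
  define X where "X = (\<integral>\<^sup>+ t. ennreal ((b t)\<^sup>2) \<partial>lborel) + (\<integral>\<^sup>+ t. ennreal ((e t)\<^sup>2) \<partial>lborel)"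
  note [measurable] = forcingD(1)[OF F] forcingD(1)[OF G] I
  have F': "forcing S T B F'" and G': "forcing S T B' G'"
    unfolding F'_def G'_def by (intro forcing_piece F G S)+
  have [measurable]: "b \<in> borel_measurable borel" "e \<in> borel_measurable borel" "J \<in> sets borel"
    using S(1) by (simp_all add: b_def[abs_def] e_def[abs_def] J_def)
  have be0: "0 \<le> b t" "0 \<le> e t" for t by (auto simp: b_def e_def weight_nonneg)
  have KL: "K \<le> L" using kl \<delta>(2) by (simp add: K_def L_def divide_right_mono)
  have h0: "h > 0" by (simp add: h_def)
  have suppF: "ev (F t) n = 0" and suppG: "ev (G t) n = 0" if "n \<notin> S" for t n
    using forcingD(2)[OF F that] forcingD(2)[OF G that] by auto
  have gain: "(\<delta> - 1) * (L - K) / 4 \<ge> endpoint_gain * (real l - real k)" "(L - K) / 8 \<ge> endpoint_gain * (real l - real k)"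
  proof -
    have LK: "L - K = (real l - real k) / \<delta>" by (simp add: K_def L_def diff_divide_distrib)
    have z: "0 \<le> (real l - real k) / \<delta>" using kl \<delta>(2) by simp
    have "min (1 / 8) ((\<delta> - 1) / 4) * ((real l - real k) / \<delta>) \<le> (\<delta> - 1) / 4 * ((real l - real k) / \<delta>)"
      "min (1 / 8) ((\<delta> - 1) / 4) * ((real l - real k) / \<delta>) \<le> 1 / 8 * ((real l - real k) / \<delta>)"
      by (rule mult_right_mono[OF min.cobounded2 z], rule mult_right_mono[OF min.cobounded1 z])
    then show "(\<delta> - 1) * (L - K) / 4 \<ge> endpoint_gain * (real l - real k)" "(L - K) / 8 \<ge> endpoint_gain * (real l - real k)"
      by (simp_all add: endpoint_gain_def LK)
  qed
  define g where "g = 2 powr (- endpoint_gain * \<bar>real l - real k\<bar>)"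
  have g: "2 powr (- ((\<delta> - 1) * (L - K) / 4)) \<le> g" "2 powr (- ((L - K) / 8)) \<le> g"
    using gain kl by (auto simp: g_def)
  have near: "ennreal \<bar>bil (I \<inter> J) F' G'\<bar> \<le> ennreal (2 powr (- L / 2) * c) * X"
    unfolding X_def
  proof (rule bil_near[OF F' G'])
    show "emeasure lborel (I \<inter> J) \<le> ennreal (2 * h)"
      using emeasure_mono[of "I \<inter> J" J lborel] h0 by (simp add: J_def)
    show "\<bar>propag (s' - s) (F' s) \<bullet> F' s'\<bar> \<le> b s * b s' * endpoint_kernel k (s' - s)" for s s'
      unfolding F'_def b_def using S kl suppF by (intro endpoint_kernel_bound) auto
    show "0 \<le> endpoint_kernel k x" for x by (simp add: endpoint_kernel_def)
    show "(\<integral>\<^sup>+ x. ennreal (endpoint_kernel k x) \<partial>lborel) \<le> ennreal endpoint_mass" by (rule endpoint_kernel_integral)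
    show "endpoint_kernel k \<in> borel_measurable borel" unfolding endpoint_kernel_def[abs_def] by measurable
    show "norm (G' t) \<le> 2 powr (- L / 2) * e t" for t
      unfolding G'_def e_def L_def using norm_piece_le[OF S, of l "G t"] by simp
    have "c\<^sup>2 = 4 * endpoint_mass * (2 powr ((K + L) / 4 + (L - K) / 8) * 2 powr ((K + L) / 4 + (L - K) / 8))"
      using endpoint_mass_pos by (simp add: c_def power2_eq_square)
    also have "2 powr ((K + L) / 4 + (L - K) / 8) * 2 powr ((K + L) / 4 + (L - K) / 8) = h"
    proof -
      have "((K + L) / 4 + (L - K) / 8) + ((K + L) / 4 + (L - K) / 8) = (K + L) / 2 + (L - K) / 4" by simp
      then show ?thesis unfolding h_def by (simp only: powr_add[symmetric])
    qed
    finally show "2 * (2 * h) * endpoint_mass \<le> c\<^sup>2" by simp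
    show "0 < c" using endpoint_mass_pos by (simp add: c_def)
  qed (use h0 endpoint_mass_pos be0 in auto)
  have "2 powr (- L / 2) * c = 2 * sqrt endpoint_mass * (2 powr (- L / 2) * 2 powr ((K + L) / 4 + (L - K) / 8))"
    by (simp add: c_def)
  also have "2 powr (- L / 2) * 2 powr ((K + L) / 4 + (L - K) / 8) = 2 powr (- ((L - K) / 8))"
  proof -
    have "- L / 2 + ((K + L) / 4 + (L - K) / 8) = - ((L - K) / 8)" by (simp add: field_simps)
    then show ?thesis by (simp only: powr_add[symmetric])
  qed
  also have "2 * sqrt endpoint_mass * \<dots> \<le> 2 * sqrt endpoint_mass * g"
    using g endpoint_mass_pos by (intro mult_left_mono) auto
  finally have near_const: "2 powr (- L / 2) * c \<le> 2 * sqrt endpoint_mass * g" .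
  have far: "ennreal \<bar>bil (I - J) F' G'\<bar> \<le> ennreal (4 ^ CARD('d) * 2 powr ((real k + 1) * \<rho>) * 2 powr ((real l + 1) * \<rho>)
      * (2 * h powr (1 - \<delta>) / (\<delta> - 1))) * X"
    unfolding X_def
  proof (rule bil_far[OF F' G' S(1) _ _ h0 \<delta>])
    show "h \<le> \<bar>x\<bar>" if "x \<in> I - J" for x using that by (auto simp: J_def)
    show "norm1 S (F' s) \<le> 2 powr ((real k + 1) * \<rho>) * b s" for s
      unfolding F'_def b_def using kl by (intro norm1_piece_le rho_bounds S) auto
    show "norm1 S (G' s) \<le> 2 powr ((real l + 1) * \<rho>) * e s" for s
      unfolding G'_def e_def using kl by (intro norm1_piece_le rho_bounds S) auto
  qed (use be0 in auto)
  have "2 powr ((real k + 1) * \<rho>) * 2 powr ((real l + 1) * \<rho>) * h powr (1 - \<delta>)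
      = 2 powr ((real k + 1) * \<rho> + (real l + 1) * \<rho> + ((K + L) / 2 + (L - K) / 4) * (1 - \<delta>))"
    by (simp add: h_def powr_powr flip: powr_add)
  also have "(real k + 1) * \<rho> + (real l + 1) * \<rho> + ((K + L) / 2 + (L - K) / 4) * (1 - \<delta>) = 2 * \<rho> - (\<delta> - 1) * (L - K) / 4"
  proof -
    have "real k * \<rho> = (\<delta> - 1) * (K / 2)" "real l * \<rho> = (\<delta> - 1) * (L / 2)"
      using rho_mult[of "real k"] rho_mult[of "real l"] by (simp_all add: K_def L_def)
    then have "(real k + 1) * \<rho> + (real l + 1) * \<rho> + ((K + L) / 2 + (L - K) / 4) * (1 - \<delta>)
        = (\<delta> - 1) * (K / 2) + (\<delta> - 1) * (L / 2) + 2 * \<rho> + ((K + L) / 2 + (L - K) / 4) * (1 - \<delta>)"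
      by (simp add: distrib_right)
    also have "\<dots> = 2 * \<rho> - (\<delta> - 1) * (L - K) / 4" by (simp add: field_simps)
    finally show ?thesis .
  qed
  also have "2 powr (2 * \<rho> - (\<delta> - 1) * (L - K) / 4) = 4 powr \<rho> * 2 powr (- ((\<delta> - 1) * (L - K) / 4))"
  proof -
    have "2 powr (2 * \<rho>) = 4 powr \<rho>" by (simp flip: powr_powr)
    then show ?thesis by (simp add: powr_diff powr_minus_divide)
  qed
  also have "\<dots> \<le> 4 powr \<rho> * g" using g by (intro mult_left_mono) auto
  finally have "4 ^ CARD('d) * (2 powr ((real k + 1) * \<rho>) * 2 powr ((real l + 1) * \<rho>) * h powr (1 - \<delta>)) * (2 / (\<delta> - 1))
      \<le> 4 ^ CARD('d) * (4 powr \<rho> * g) * (2 / (\<delta> - 1))"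
    using \<delta>(2) by (intro mult_right_mono mult_left_mono) auto
  then have far_const: "4 ^ CARD('d) * 2 powr ((real k + 1) * \<rho>) * 2 powr ((real l + 1) * \<rho>)
      * (2 * h powr (1 - \<delta>) / (\<delta> - 1)) \<le> 4 ^ CARD('d) * 4 powr \<rho> * (2 / (\<delta> - 1)) * g"
    by (simp add: mult_ac)
  have "ennreal \<bar>bil I F' G'\<bar> \<le> ennreal \<bar>bil (I \<inter> J) F' G'\<bar> + ennreal \<bar>bil (I - J) F' G'\<bar>"
    using bil_split[OF F' G', of I J] abs_triangle_ineq[of "bil (I \<inter> J) F' G'" "bil (I - J) F' G'"]
    by (simp add: ennreal_plus[symmetric] ennreal_leI del: ennreal_plus)
  also have "\<dots> \<le> ennreal (2 * sqrt endpoint_mass * g) * X + ennreal (4 ^ CARD('d) * 4 powr \<rho> * (2 / (\<delta> - 1)) * g) * X"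
    by (intro add_mono order_trans[OF near] order_trans[OF far] mult_right_mono ennreal_leI near_const far_const) auto
  also have "\<dots> = ennreal (endpoint_const * g) * X"
    using endpoint_mass_pos \<delta>(2)
    by (simp add: distrib_right[symmetric] ennreal_plus[symmetric] endpoint_const_def g_def del: ennreal_plus)
       (simp add: algebra_simps)
  finally show ?thesis
    by (simp add: X_def b_def e_def weight_nonneg g_def F'_def[abs_def] G'_def[abs_def])
qed

text \<open>For \<open>k > l\<close> the roles of the two forcings are exchanged by
  \<open>bil_swap\<close>, at the cost of reflecting \<open>I\<close>; this is one reason for
  allowing arbitrary sets of lags.\<close>

lemma bil_piece_pair:
  fixes F G :: "real \<Rightarrow> (int ^ 'd) ell2"
  assumes F: "forcing S T B F" and G: "forcing S T B G" and I: "I \<in> sets borel"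
    and S: "finite S" "card S \<le> 2 ^ N" and kl: "k \<le> N" "l \<le> N"
  shows "ennreal \<bar>bil I (\<lambda>t. piece \<rho> S N k (F t)) (\<lambda>t. piece \<rho> S N l (G t))\<bar>
     \<le> ennreal (endpoint_const * 2 powr (- endpoint_gain * \<bar>real l - real k\<bar>))
       * ((\<integral>\<^sup>+ t. ennreal (weight \<rho> S N k (F t)) \<partial>lborel) + (\<integral>\<^sup>+ t. ennreal (weight \<rho> S N l (G t)) \<partial>lborel))"
proof (cases "k \<le> l")
  case True
  then show ?thesis using assms by (intro bil_piece_pair_ordered) auto
next
  case False
  have "uminus ` I = uminus -` I" by force
  then have mI: "uminus ` I \<in> sets borel"
    using measurable_sets[of "uminus :: real \<Rightarrow> real" borel borel I] I by simp
  have "bil I (\<lambda>t. piece \<rho> S N k (F t)) (\<lambda>t. piece \<rho> S N l (G t))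
      = bil (uminus ` I) (\<lambda>t. piece \<rho> S N l (G t)) (\<lambda>t. piece \<rho> S N k (F t))"
    by (rule bil_swap[OF forcing_piece[OF F S(1)] forcing_piece[OF G S(1)] I])
  then show ?thesis
    using bil_piece_pair_ordered[OF G F mI S, of l k] False kl by (simp add: add.commute abs_minus_commute)
qed

text \<open>Row and column sums of the geometric factors are bounded, and what remains is the sum
  over levels of the time integrals of the weights. The weights are quadratic and the dual time
  exponent is 2, so the sum may be taken inside the integral and \<open>sum_weight_le\<close>
  applied at each time.\<close>

lemma dual_bound_endpoint:
  "dual_bound TYPE('d) \<rho> 2 (4 * endpoint_const * (2 / (1 - 2 powr (- endpoint_gain))))"
  unfolding dual_bound_def
proof (intro allI impI)
  fix S :: "(int ^ 'd) set" and T B :: real and I :: "real set" and F G :: "real \<Rightarrow> (int ^ 'd) ell2"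
  assume S: "finite S" and F: "forcing S T B F" and G: "forcing S T B G" and I: "I \<in> sets borel"
    and F1: "(\<integral>\<^sup>+ t. ennreal (dual_norm \<rho> S (F t) powr 2) \<partial>lborel) \<le> 1"
    and G1: "(\<integral>\<^sup>+ t. ennreal (dual_norm \<rho> S (G t) powr 2) \<partial>lborel) \<le> 1"
  define N where "N = card S"
  have N: "card S \<le> 2 ^ N" by (simp add: N_def less_imp_le)
  define Q where "Q = 2 / (1 - 2 powr (- endpoint_gain))"
  have gain: "endpoint_gain > 0" using \<delta>(2) by (simp add: endpoint_gain_def)
  have Q: "0 \<le> Q" using gain by (auto simp: Q_def powr_less_one less_imp_le)
  have C: "0 \<le> endpoint_const" using endpoint_mass_pos \<delta>(2) by (auto simp: endpoint_const_def intro!: add_nonneg_nonneg)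
  define X where "X k = (\<integral>\<^sup>+ t. ennreal (weight \<rho> S N k (F t)) \<partial>lborel)" for k
  define Y where "Y l = (\<integral>\<^sup>+ t. ennreal (weight \<rho> S N l (G t)) \<partial>lborel)" for l
  have XY: "(\<Sum>k\<le>N. \<integral>\<^sup>+ t. ennreal (weight \<rho> S N k (H t)) \<partial>lborel) \<le> 2"
    if H: "forcing S T B H" "(\<integral>\<^sup>+ t. ennreal (dual_norm \<rho> S (H t) powr 2) \<partial>lborel) \<le> 1" for H
  proof -
    note [measurable] = forcingD(1)[OF H(1)]
    have "(\<Sum>k\<le>N. \<integral>\<^sup>+ t. ennreal (weight \<rho> S N k (H t)) \<partial>lborel) = (\<integral>\<^sup>+ t. (\<Sum>k\<le>N. ennreal (weight \<rho> S N k (H t))) \<partial>lborel)"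
      using S by (intro nn_integral_sum[symmetric]) simp
    also have "\<dots> \<le> (\<integral>\<^sup>+ t. 2 * ennreal (dual_norm \<rho> S (H t) powr 2) \<partial>lborel)"
    proof (rule nn_integral_mono)
      fix t
      have "(\<Sum>k\<le>N. weight \<rho> S N k (H t)) \<le> 2 * dual_norm \<rho> S (H t) powr 2"
        using sum_weight_le[OF rho_bounds S N, of "H t"] by (simp add: dual_norm_nonneg)
      then show "(\<Sum>k\<le>N. ennreal (weight \<rho> S N k (H t))) \<le> 2 * ennreal (dual_norm \<rho> S (H t) powr 2)"
        by (simp add: sum_ennreal weight_nonneg ennreal_leI ennreal_mult'[symmetric] flip: ennreal_numeral)
    qed
    also have "\<dots> = 2 * (\<integral>\<^sup>+ t. ennreal (dual_norm \<rho> S (H t) powr 2) \<partial>lborel)" by (rule nn_integral_cmult) simp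
    also have "\<dots> \<le> 2 * 1" by (intro mult_left_mono H(2)) simp
    finally show ?thesis by simp
  qed
  define g where "g k l = endpoint_const * 2 powr (- endpoint_gain * \<bar>real l - real k\<bar>)" for k l :: nat
  have g_sum: "(\<Sum>l\<le>N. ennreal (g k l)) \<le> ennreal (endpoint_const * Q)" "(\<Sum>l\<le>N. ennreal (g l k)) \<le> ennreal (endpoint_const * Q)" for k
  proof -
    have "(\<Sum>l\<le>N. g k l) \<le> endpoint_const * Q"
      unfolding g_def Q_def sum_distrib_left[symmetric] using C by (intro mult_left_mono sum_powr_abs_diff_le gain)
    moreover have "(\<Sum>l\<le>N. ennreal (g k l)) = ennreal (\<Sum>l\<le>N. g k l)"
      using C by (intro sum_ennreal) (simp add: g_def)
    ultimately show *: "(\<Sum>l\<le>N. ennreal (g k l)) \<le> ennreal (endpoint_const * Q)"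
      by (simp add: ennreal_leI)
    have "g l k = g k l" for l by (simp add: g_def abs_minus_commute)
    then show "(\<Sum>l\<le>N. ennreal (g l k)) \<le> ennreal (endpoint_const * Q)" using * by (simp only:)
  qed
  have pieces: "(\<lambda>t. \<Sum>k\<le>N. piece \<rho> S N k (H t)) = H" if "forcing S T B H" for H
    using forcingD(2)[OF that] by (intro ext sum_pieces) auto
  have "bil I F G = bil I (\<lambda>t. \<Sum>k\<le>N. piece \<rho> S N k (F t)) (\<lambda>t. \<Sum>l\<le>N. piece \<rho> S N l (G t))"
    by (simp only: pieces[OF F] pieces[OF G])
  also have "\<dots> = (\<Sum>k\<le>N. \<Sum>l\<le>N. bil I (\<lambda>t. piece \<rho> S N k (F t)) (\<lambda>t. piece \<rho> S N l (G t)))"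
    by (rule bil_sum[OF forcing_piece[OF F S] forcing_piece[OF G S] I])
  finally have "\<bar>bil I F G\<bar> \<le> (\<Sum>k\<le>N. \<Sum>l\<le>N. \<bar>bil I (\<lambda>t. piece \<rho> S N k (F t)) (\<lambda>t. piece \<rho> S N l (G t))\<bar>)"
    by (auto intro!: order_trans[OF sum_abs] sum_mono)
  then have "ennreal \<bar>bil I F G\<bar> \<le> (\<Sum>k\<le>N. \<Sum>l\<le>N. ennreal \<bar>bil I (\<lambda>t. piece \<rho> S N k (F t)) (\<lambda>t. piece \<rho> S N l (G t))\<bar>)"
    by (simp add: sum_ennreal sum_nonneg ennreal_leI)
  also have "\<dots> \<le> (\<Sum>k\<le>N. \<Sum>l\<le>N. ennreal (g k l) * (X k + Y l))"
    unfolding g_def X_def Y_def by (intro sum_mono bil_piece_pair[OF F G I S N]) auto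
  also have "\<dots> = (\<Sum>k\<le>N. (\<Sum>l\<le>N. ennreal (g k l)) * X k) + (\<Sum>l\<le>N. (\<Sum>k\<le>N. ennreal (g k l)) * Y l)"
  proof -
    have "(\<Sum>k\<le>N. \<Sum>l\<le>N. ennreal (g k l) * (X k + Y l))
        = (\<Sum>k\<le>N. \<Sum>l\<le>N. ennreal (g k l) * X k) + (\<Sum>k\<le>N. \<Sum>l\<le>N. ennreal (g k l) * Y l)"
      by (simp only: distrib_left sum.distrib)
    also have "(\<Sum>k\<le>N. \<Sum>l\<le>N. ennreal (g k l) * Y l) = (\<Sum>l\<le>N. \<Sum>k\<le>N. ennreal (g k l) * Y l)"
      by (rule sum.swap)
    finally show ?thesis by (simp only: sum_distrib_right)
  qed
  also have "\<dots> \<le> (\<Sum>k\<le>N. ennreal (endpoint_const * Q) * X k) + (\<Sum>l\<le>N. ennreal (endpoint_const * Q) * Y l)"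
    by (intro add_mono sum_mono mult_right_mono g_sum) auto
  also have "\<dots> \<le> ennreal (endpoint_const * Q) * 2 + ennreal (endpoint_const * Q) * 2"
    unfolding sum_distrib_left[symmetric] X_def Y_def
    by (intro add_mono mult_left_mono XY[OF F F1] XY[OF G G1]) auto
  also have "\<dots> = ennreal (4 * endpoint_const * Q)"
    using C Q by (simp add: ennreal_mult'[symmetric] ennreal_plus[symmetric] distrib_left[symmetric] mult.commute del: ennreal_plus flip: ennreal_numeral)
  finally show "\<bar>bil I F G\<bar> \<le> 4 * endpoint_const * (2 / (1 - 2 powr (- endpoint_gain)))"
    using C Q by (simp add: Q_def)
qed

end

section \<open>Strichartz norms by duality\<close>

text \<open>The l^r norm over \<open>S\<close> for r = 1/\<open>\<rho>\<close>, with
  \<open>\<rho> = 0\<close> for the maximum; the inserted 0 gives the empty set norm 0.\<close>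

definition pnorm :: "real \<Rightarrow> 'a set \<Rightarrow> 'a ell2 \<Rightarrow> real" where
  "pnorm \<rho> S x = (if \<rho> = 0 then Max (insert 0 ((\<lambda>n. cmod (ev x n)) ` S))
     else (\<Sum>n\<in>S. cmod (ev x n) powr (1 / \<rho>)) powr \<rho>)"

lemma pnorm_nonneg: "finite S \<Longrightarrow> 0 \<le> pnorm \<rho> S x"
  by (simp add: pnorm_def)

lemma cmod_le_pnorm:
  assumes "finite S" "n \<in> S" "0 \<le> \<rho>"
  shows "cmod (ev x n) \<le> pnorm \<rho> S x"
proof (cases "\<rho> = 0")
  case False
  have "cmod (ev x n) = (cmod (ev x n) powr (1 / \<rho>)) powr \<rho>" using False by (simp add: powr_powr)
  also have "\<dots> \<le> (\<Sum>n\<in>S. cmod (ev x n) powr (1 / \<rho>)) powr \<rho>"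
    using assms by (intro powr_mono2 member_le_sum) auto
  finally show ?thesis using False by (simp add: pnorm_def)
qed (use assms in \<open>auto simp: pnorm_def intro!: Max_ge\<close>)

lemma pnorm_le:
  assumes S: "finite S" and \<rho>: "0 \<le> \<rho>" and c: "0 \<le> c"
    and le: "\<rho> = 0 \<Longrightarrow> \<forall>n\<in>S. cmod (ev x n) \<le> c"
      "\<rho> > 0 \<Longrightarrow> (\<Sum>n\<in>S. cmod (ev x n) powr (1 / \<rho>)) \<le> c powr (1 / \<rho>)"
  shows "pnorm \<rho> S x \<le> c"
proof (cases "\<rho> = 0")
  case True
  then show ?thesis using S c le(1) by (auto simp: pnorm_def)
next
  case False
  then have "pnorm \<rho> S x \<le> (c powr (1 / \<rho>)) powr \<rho>"
    unfolding pnorm_def using \<rho> le(2) by (auto intro!: powr_mono2 sum_nonneg)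
  then show ?thesis using False c by (simp add: powr_powr)
qed

lemma pnorm_powr_inverse:
  assumes "\<rho> > 0"
  shows "pnorm \<rho> S x powr (1 / \<rho>) = (\<Sum>n\<in>S. cmod (ev x n) powr (1 / \<rho>))"
proof -
  have "\<rho> * (1 / \<rho>) = 1" "0 \<le> (\<Sum>n\<in>S. cmod (ev x n) powr (1 / \<rho>))"
    using assms by (simp_all add: sum_nonneg)
  then have "((\<Sum>n\<in>S. cmod (ev x n) powr (1 / \<rho>)) powr \<rho>) powr (1 / \<rho>) = (\<Sum>n\<in>S. cmod (ev x n) powr (1 / \<rho>))"
    unfolding powr_powr by simp
  then show ?thesis using assms by (simp add: pnorm_def)
qed

lemma pnorm_mono_set:
  assumes "finite T" "S \<subseteq> T" "0 \<le> \<rho>"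
  shows "pnorm \<rho> S x \<le> pnorm \<rho> T x"
proof (rule pnorm_le)
  show "finite S" using assms finite_subset by blast
  show "0 \<le> pnorm \<rho> T x" by (rule pnorm_nonneg) fact
  show "\<forall>n\<in>S. cmod (ev x n) \<le> pnorm \<rho> T x" if "\<rho> = 0"
    using assms cmod_le_pnorm[of T _ \<rho> x] by auto
  show "(\<Sum>n\<in>S. cmod (ev x n) powr (1 / \<rho>)) \<le> pnorm \<rho> T x powr (1 / \<rho>)" if "\<rho> > 0"
    unfolding pnorm_powr_inverse[OF that] using assms by (intro sum_mono2) auto
qed (use assms in auto)

text \<open>Nesting of norms over a counting measure: no entry exceeds the norm, so the surplus
  power of each entry is bounded by a power of the norm. This is what reduces pairs inside the
  admissible region to its boundary.\<close>

lemma pnorm_mono_exponent: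
  assumes S: "finite S" and \<rho>: "0 \<le> \<rho>" "\<rho> \<le> \<rho>'"
  shows "pnorm \<rho> S x \<le> pnorm \<rho>' S x"
proof (rule pnorm_le[OF S \<rho>(1) pnorm_nonneg[OF S]])
  let ?M = "pnorm \<rho>' S x"
  show "\<forall>n\<in>S. cmod (ev x n) \<le> ?M" using cmod_le_pnorm[OF S] \<rho> by auto
  assume pos: "\<rho> > 0"
  then have pos': "\<rho>' > 0" using \<rho> by simp
  have M: "0 \<le> ?M" by (rule pnorm_nonneg[OF S])
  have "(\<Sum>n\<in>S. cmod (ev x n) powr (1 / \<rho>)) \<le> (\<Sum>n\<in>S. cmod (ev x n) powr (1 / \<rho>') * ?M powr (1 / \<rho> - 1 / \<rho>'))"
  proof (rule sum_mono)
    fix n assume n: "n \<in> S"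
    have "cmod (ev x n) powr (1 / \<rho>) = cmod (ev x n) powr (1 / \<rho>') * cmod (ev x n) powr (1 / \<rho> - 1 / \<rho>')"
      by (simp flip: powr_add)
    also have "\<dots> \<le> cmod (ev x n) powr (1 / \<rho>') * ?M powr (1 / \<rho> - 1 / \<rho>')"
      using pos \<rho> cmod_le_pnorm[OF S n, of \<rho>' x] by (intro mult_left_mono powr_mono2) (auto simp: frac_le)
    finally show "cmod (ev x n) powr (1 / \<rho>) \<le> cmod (ev x n) powr (1 / \<rho>') * ?M powr (1 / \<rho> - 1 / \<rho>')" .
  qed
  also have "\<dots> = ?M powr (1 / \<rho>') * ?M powr (1 / \<rho> - 1 / \<rho>')"
    by (simp add: pnorm_powr_inverse[OF pos'] sum_distrib_right)
  also have "\<dots> = ?M powr (1 / \<rho>)" by (simp flip: powr_add)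
  finally show "(\<Sum>n\<in>S. cmod (ev x n) powr (1 / \<rho>)) \<le> ?M powr (1 / \<rho>)" .
qed

lemma pnorm_le_norm:
  assumes S: "finite S" and \<rho>: "0 \<le> \<rho>" "\<rho> \<le> 1 / 2"
  shows "pnorm \<rho> S x \<le> norm x"
proof -
  have "pnorm \<rho> S x \<le> pnorm (1 / 2) S x" by (rule pnorm_mono_exponent[OF S \<rho>])
  also have "\<dots> = sqrt (\<Sum>n\<in>S. (cmod (ev x n))\<^sup>2)" by (simp add: pnorm_def powr_half_sqrt sum_nonneg)
  also have "\<dots> \<le> norm x" using sum_le_norm_ell2[OF S, of x] by (simp add: real_le_lsqrt sum_nonneg)
  finally show ?thesis .
qed

lemma holder_sum:
  fixes u v :: "'a \<Rightarrow> real"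
  assumes S: "finite S" and ab: "0 \<le> \<alpha>" "0 \<le> \<beta>" "\<alpha> + \<beta> = 1"
    and uv: "\<And>n. n \<in> S \<Longrightarrow> 0 < u n" "\<And>n. n \<in> S \<Longrightarrow> 0 < v n"
  shows "(\<Sum>n\<in>S. u n powr \<alpha> * v n powr \<beta>) \<le> (\<Sum>n\<in>S. u n) powr \<alpha> * (\<Sum>n\<in>S. v n) powr \<beta>"
proof (cases "S = {}")
  case False
  define U where "U = (\<Sum>n\<in>S. u n)"
  define V where "V = (\<Sum>n\<in>S. v n)"
  have UV: "U > 0" "V > 0" using S False uv by (auto simp: U_def V_def intro!: sum_pos)
  have "(\<Sum>n\<in>S. u n powr \<alpha> * v n powr \<beta>) \<le> (\<Sum>n\<in>S. U powr \<alpha> * V powr \<beta> * (\<alpha> * (u n / U) + \<beta> * (v n / V)))"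
  proof (rule sum_mono)
    fix n assume n: "n \<in> S"
    have "(u n / U) powr \<alpha> * (v n / V) powr \<beta> \<le> \<alpha> * (u n / U) + \<beta> * (v n / V)"
      using ab uv[OF n] UV by (intro Youngs_inequality_0) auto
    then have "U powr \<alpha> * V powr \<beta> * ((u n / U) powr \<alpha> * (v n / V) powr \<beta>) \<le> U powr \<alpha> * V powr \<beta> * (\<alpha> * (u n / U) + \<beta> * (v n / V))"
      by (intro mult_left_mono) auto
    then show "u n powr \<alpha> * v n powr \<beta> \<le> U powr \<alpha> * V powr \<beta> * (\<alpha> * (u n / U) + \<beta> * (v n / V))"
      using UV uv[OF n] by (simp add: powr_divide less_imp_le)
  qed
  also have "\<dots> = U powr \<alpha> * V powr \<beta> * (\<alpha> * ((\<Sum>n\<in>S. u n) / U) + \<beta> * ((\<Sum>n\<in>S. v n) / V))"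
    by (simp add: sum_distrib_left sum.distrib sum_divide_distrib distrib_left)
  also have "\<dots> = U powr \<alpha> * V powr \<beta>" using UV ab by (simp flip: U_def V_def)
  finally show ?thesis by (simp add: U_def V_def)
qed simp

text \<open>Hoelder's inequality between l^2 and l^(1/\<open>\<rho>\<close>) with weights
  \<open>a / 2\<close> and \<open>b * \<rho>\<close>. Zero entries are removed first, since
  \<open>holder_sum\<close> asks for positive terms. It serves both norm interpolation and the
  estimate of the nonlinearity.\<close>

lemma interpolation_sum:
  assumes S: "finite S" and \<rho>: "0 \<le> \<rho>" and ab: "0 \<le> a" "0 \<le> b" "a / 2 + b * \<rho> = 1"
  shows "(\<Sum>n\<in>S. cmod (ev x n) powr (a + b)) \<le> norm x powr a * pnorm \<rho> S x powr b"
proof -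
  define S' where "S' = {n\<in>S. ev x n \<noteq> 0}"
  have S': "finite S'" "S' \<subseteq> S" using S by (auto simp: S'_def)
  have eq: "(\<Sum>n\<in>S. cmod (ev x n) powr (a + b)) = (\<Sum>n\<in>S'. cmod (ev x n) powr (a + b))"
    using S by (intro sum.mono_neutral_right) (auto simp: S'_def)
  have "(\<Sum>n\<in>S'. cmod (ev x n) powr (a + b)) \<le> norm x powr a * pnorm \<rho> S' x powr b"
  proof (cases "\<rho> = 0")
    case True
    then have a: "a = 2" using ab by simp
    have "(\<Sum>n\<in>S'. cmod (ev x n) powr (a + b)) \<le> (\<Sum>n\<in>S'. (cmod (ev x n))\<^sup>2 * pnorm \<rho> S' x powr b)"
    proof (rule sum_mono)
      fix n assume n: "n \<in> S'"
      have "cmod (ev x n) powr (a + b) = (cmod (ev x n))\<^sup>2 * cmod (ev x n) powr b" by (simp add: powr_add a)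
      also have "\<dots> \<le> (cmod (ev x n))\<^sup>2 * pnorm \<rho> S' x powr b"
        using ab \<rho> by (intro mult_left_mono powr_mono2 cmod_le_pnorm S' n) auto
      finally show "cmod (ev x n) powr (a + b) \<le> (cmod (ev x n))\<^sup>2 * pnorm \<rho> S' x powr b" .
    qed
    also have "\<dots> \<le> (norm x)\<^sup>2 * pnorm \<rho> S' x powr b"
      unfolding sum_distrib_right[symmetric] by (intro mult_right_mono sum_le_norm_ell2 S') auto
    finally show ?thesis by (simp add: a)
  next
    case False
    then have pos: "\<rho> > 0" using \<rho> by simp
    have "(\<Sum>n\<in>S'. cmod (ev x n) powr (a + b)) = (\<Sum>n\<in>S'. ((cmod (ev x n))\<^sup>2) powr (a / 2) * (cmod (ev x n) powr (1 / \<rho>)) powr (b * \<rho>))"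
      using pos by (intro sum.cong refl) (simp add: S'_def powr_powr powr_add flip: powr_numeral)
    also have "\<dots> \<le> (\<Sum>n\<in>S'. (cmod (ev x n))\<^sup>2) powr (a / 2) * (\<Sum>n\<in>S'. cmod (ev x n) powr (1 / \<rho>)) powr (b * \<rho>)"
      using ab pos by (intro holder_sum S') (auto simp: S'_def)
    also have "\<dots> \<le> ((norm x)\<^sup>2) powr (a / 2) * (\<Sum>n\<in>S'. cmod (ev x n) powr (1 / \<rho>)) powr (b * \<rho>)"
      using ab by (intro mult_right_mono powr_mono2 sum_le_norm_ell2 S') (auto simp: sum_nonneg)
    also have "(\<Sum>n\<in>S'. cmod (ev x n) powr (1 / \<rho>)) powr (b * \<rho>) = pnorm \<rho> S' x powr b"
      using False by (simp add: pnorm_def powr_powr mult.commute)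
    also have "((norm x)\<^sup>2) powr (a / 2) = norm x powr a"
      by (cases "norm x = 0") (simp_all add: powr_powr flip: powr_numeral)
    finally show ?thesis .
  qed
  also have "\<dots> \<le> norm x powr a * pnorm \<rho> S x powr b"
    using S S' \<rho> ab by (intro mult_left_mono powr_mono2 pnorm_mono_set pnorm_nonneg) auto
  finally show ?thesis by (simp add: eq)
qed

lemma borel_measurable_pnorm [measurable (raw)]:
  fixes F :: "'b \<Rightarrow> 'a::countable ell2"
  assumes F: "F \<in> borel_measurable M" and S: "finite S"
  shows "(\<lambda>t. pnorm \<rho> S (F t)) \<in> borel_measurable M"
proof (cases "\<rho> = 0")
  case False
  note [measurable] = F
  show ?thesis using False unfolding pnorm_def by simp
next
  case True
  have "(\<lambda>t. Max (insert 0 ((\<lambda>n. cmod (ev (F t) n)) ` S))) \<in> borel_measurable M"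
    using S
  proof (induction S)
    case (insert m S)
    have "Max (insert 0 ((\<lambda>n. cmod (ev (F t) n)) ` insert m S))
        = max (cmod (ev (F t) m)) (Max (insert 0 ((\<lambda>n. cmod (ev (F t) n)) ` S)))" for t
      using insert by (simp add: insert_commute[of 0])
    moreover note [measurable] = F insert.IH
    ultimately show ?case by simp
  qed simp
  then show ?thesis using True by (simp add: pnorm_def)
qed

text \<open>Ties are broken by the smallest code, so that the norming vector for the maximum norm is
  a single-valued and measurable function of \<open>x\<close>.\<close>

definition argmax :: "'a::countable set \<Rightarrow> 'a ell2 \<Rightarrow> 'a \<Rightarrow> bool" where
  "argmax S x n \<longleftrightarrow> n \<in> S \<and> (\<forall>m\<in>S. cmod (ev x m) \<le> cmod (ev x n)) \<and>
     (\<forall>m\<in>S. cmod (ev x n) \<le> cmod (ev x m) \<longrightarrow> to_nat n \<le> to_nat m)"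

lemma argmax_unique: "argmax S x m \<Longrightarrow> argmax S x n \<Longrightarrow> m = n"
  unfolding argmax_def by (meson antisym to_nat_split injD[OF inj_to_nat])

lemma ex_argmax:
  assumes "finite S" "S \<noteq> {}"
  shows "\<exists>n. argmax S x n"
proof -
  define A where "A = {n\<in>S. \<forall>m\<in>S. cmod (ev x m) \<le> cmod (ev x n)}"
  have "Max ((\<lambda>n. cmod (ev x n)) ` S) \<in> (\<lambda>n. cmod (ev x n)) ` S" using assms by (intro Max_in) auto
  then obtain n0 where "n0 \<in> S" "cmod (ev x n0) = Max ((\<lambda>n. cmod (ev x n)) ` S)" by auto
  then have "n0 \<in> A" using assms by (auto simp: A_def)
  then obtain n where n: "n \<in> A" "\<And>m. m \<in> A \<Longrightarrow> to_nat n \<le> to_nat m"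
    using ex_has_least_nat[of "\<lambda>n. n \<in> A" n0 to_nat] by blast
  have "argmax S x n" unfolding argmax_def
  proof (intro conjI ballI impI)
    fix m assume m: "m \<in> S" "cmod (ev x n) \<le> cmod (ev x m)"
    have "m \<in> A" using m n(1) unfolding A_def by (auto intro: order_trans)
    then show "to_nat n \<le> to_nat m" by (rule n(2))
  qed (use n(1) in \<open>auto simp: A_def\<close>)
  then show ?thesis by blast
qed

text \<open>The modulus of the norming functional of \<open>pnorm\<close>: the normalised power r -
  1 of the entries, and for \<open>\<rho> = 0\<close> a point mass at the first maximal entry. When
  the norm is 0, division by zero makes the entries 0 for positive \<open>\<rho>\<close>.\<close>

definition dual_entry :: "real \<Rightarrow> 'a::countable set \<Rightarrow> 'a ell2 \<Rightarrow> 'a \<Rightarrow> real" where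
  "dual_entry \<rho> S x n = (if \<rho> = 0 then (if argmax S x n then 1 else 0)
     else (cmod (ev x n) / pnorm \<rho> S x) powr (1 / \<rho> - 1))"

definition dual_vector :: "real \<Rightarrow> 'a::countable set \<Rightarrow> 'a ell2 \<Rightarrow> 'a ell2" where
  "dual_vector \<rho> S x = (\<Sum>n\<in>S. unit_ell2 n (of_real (dual_entry \<rho> S x n) * sgn (ev x n)))"

lemma ev_dual_vector:
  assumes "finite S"
  shows "ev (dual_vector \<rho> S x) n = (if n \<in> S then of_real (dual_entry \<rho> S x n) * sgn (ev x n) else 0)"
  using assms by (simp add: dual_vector_def ev_sum sum.delta)

context
  fixes \<rho> :: real and S :: "'a::countable set"
  assumes \<rho>: "0 \<le> \<rho>" "\<rho> < 1 / 2" and S: "finite S"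
begin

lemma inner_dual_vector: "x \<bullet> dual_vector \<rho> S x = pnorm \<rho> S x"
proof -
  have "z \<bullet> (of_real c * sgn z) = c * cmod z" for z :: complex and c :: real
  proof -
    have "of_real c * sgn z = (c / cmod z) *\<^sub>R z" by (simp add: sgn_div_norm divide_inverse scaleR_conv_of_real)
    then show ?thesis by (simp add: inner_scaleR_right power2_norm_eq_inner[symmetric] power2_eq_square del: scaleR_conv_of_real)
  qed
  then have eq: "x \<bullet> dual_vector \<rho> S x = (\<Sum>n\<in>S. dual_entry \<rho> S x n * cmod (ev x n))"
    using S by (subst inner_finite_support[of S]) (auto simp: ev_dual_vector)
  show ?thesis
  proof (cases "\<rho> = 0")
    case True
    show ?thesis
    proof (cases "S = {}")
      case False
      then obtain n0 where n0: "argmax S x n0" using ex_argmax S by blast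
      then have "argmax S x n \<longleftrightarrow> n = n0" for n using argmax_unique by blast
      then have "(\<Sum>n\<in>S. dual_entry \<rho> S x n * cmod (ev x n)) = (\<Sum>n\<in>S. if n = n0 then cmod (ev x n) else 0)"
        using True by (intro sum.cong) (auto simp: dual_entry_def)
      also have "\<dots> = cmod (ev x n0)" using S n0 by (simp add: argmax_def)
      also have "\<dots> = Max (insert 0 ((\<lambda>n. cmod (ev x n)) ` S))"
        using S n0 by (intro Max_eqI[symmetric]) (auto simp: argmax_def)
      finally show ?thesis using True eq by (simp add: pnorm_def)
    qed (use True eq in \<open>simp add: pnorm_def\<close>)
  next
    case False
    then have pos: "\<rho> > 0" using \<rho> by simp
    define P where "P = pnorm \<rho> S x"
    have P: "0 \<le> P" unfolding P_def by (rule pnorm_nonneg[OF S])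
    have "(\<Sum>n\<in>S. dual_entry \<rho> S x n * cmod (ev x n)) = P"
    proof (cases "P = 0")
      case True
      then have "cmod (ev x n) = 0" if "n \<in> S" for n
        using cmod_le_pnorm[OF S that \<rho>(1), of x] by (simp add: P_def)
      then show ?thesis using True by simp
    next
      case False
      then have "P > 0" using P by simp
      have "(\<Sum>n\<in>S. dual_entry \<rho> S x n * cmod (ev x n)) = (\<Sum>n\<in>S. cmod (ev x n) powr (1 / \<rho>) / P powr (1 / \<rho> - 1))"
      proof (rule sum.cong)
        fix n
        have "cmod (ev x n) * cmod (ev x n) powr (1 / \<rho> - 1) = cmod (ev x n) powr (1 / \<rho>)"
          using powr_mult_base[of "cmod (ev x n)" "1 / \<rho> - 1"] by simp
        then show "dual_entry \<rho> S x n * cmod (ev x n) = cmod (ev x n) powr (1 / \<rho>) / P powr (1 / \<rho> - 1)"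
          using \<open>P > 0\<close> pos by (simp add: dual_entry_def P_def[symmetric] powr_divide mult.commute)
      qed simp
      also have "\<dots> = P powr (1 / \<rho>) / P powr (1 / \<rho> - 1)"
        by (simp add: P_def pnorm_powr_inverse[OF pos] sum_divide_distrib)
      also have "\<dots> = P" using \<open>P > 0\<close> by (simp add: powr_diff[symmetric])
      finally show ?thesis .
    qed
    then show ?thesis using eq by (simp add: P_def)
  qed
qed

lemma cmod_dual_vector_le_1: "cmod (ev (dual_vector \<rho> S x) n) \<le> 1"
proof -
  have "\<bar>dual_entry \<rho> S x n\<bar> \<le> 1" if n: "n \<in> S"
  proof (cases "\<rho> = 0")
    case False
    have "cmod (ev x n) / pnorm \<rho> S x \<le> 1"
      using cmod_le_pnorm[OF S n \<rho>(1), of x] pnorm_nonneg[OF S, of \<rho> x] by (auto simp: divide_le_eq_1)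
    then have "(cmod (ev x n) / pnorm \<rho> S x) powr (1 / \<rho> - 1) \<le> 1 powr (1 / \<rho> - 1)"
      using \<rho> False pnorm_nonneg[OF S, of \<rho> x] by (intro powr_mono2) (auto simp: field_simps)
    then show ?thesis using False by (simp add: dual_entry_def)
  qed (simp add: dual_entry_def)
  moreover have "cmod (sgn (ev x n)) \<le> 1" by (simp add: norm_sgn)
  ultimately show ?thesis
    using mult_mono[of "\<bar>dual_entry \<rho> S x n\<bar>" 1 "cmod (sgn (ev x n))" 1]
    by (auto simp: ev_dual_vector[OF S] norm_mult)
qed

lemma dual_norm_dual_vector_le_1: "dual_norm \<rho> S (dual_vector \<rho> S x) \<le> 1"
proof -
  have "mass \<rho> S (dual_vector \<rho> S x) \<le> 1"
  proof (cases "\<rho> = 0")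
    case True
    show ?thesis
    proof (cases "S = {}")
      case False
      then obtain n0 where n0: "argmax S x n0" using ex_argmax S by blast
      then have "argmax S x n \<longleftrightarrow> n = n0" for n using argmax_unique by blast
      then have "mass \<rho> S (dual_vector \<rho> S x) \<le> (\<Sum>n\<in>S. if n = n0 then 1 else 0)"
        unfolding mass_def using True
        by (intro sum_mono) (auto simp: ev_dual_vector[OF S] dual_entry_def norm_mult norm_sgn)
      also have "\<dots> \<le> 1" using S by simp
      finally show ?thesis .
    qed (simp add: mass_def)
  next
    case False
    then have pos: "\<rho> > 0" using \<rho> by simp
    define P where "P = pnorm \<rho> S x"
    have P: "0 \<le> P" unfolding P_def by (rule pnorm_nonneg[OF S])
    have "mass \<rho> S (dual_vector \<rho> S x) \<le> (\<Sum>n\<in>S. cmod (ev x n) powr (1 / \<rho>) / P powr (1 / \<rho>))"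
      unfolding mass_def
    proof (rule sum_mono)
      fix n assume n: "n \<in> S"
      have "cmod (ev (dual_vector \<rho> S x) n) \<le> (cmod (ev x n) / P) powr (1 / \<rho> - 1)"
        using n pos by (auto simp: ev_dual_vector[OF S] dual_entry_def norm_mult norm_sgn P_def)
      then have "cmod (ev (dual_vector \<rho> S x) n) powr (1 / (1 - \<rho>)) \<le> ((cmod (ev x n) / P) powr (1 / \<rho> - 1)) powr (1 / (1 - \<rho>))"
        using \<rho> by (intro powr_mono2) auto
      also have "\<dots> = (cmod (ev x n) / P) powr (1 / \<rho>)"
      proof -
        have "(1 / \<rho> - 1) * (1 / (1 - \<rho>)) = 1 / \<rho>" using pos \<rho> by (simp add: field_simps)
        then show ?thesis by (simp add: powr_powr)
      qed
      finally show "cmod (ev (dual_vector \<rho> S x) n) powr (1 / (1 - \<rho>)) \<le> cmod (ev x n) powr (1 / \<rho>) / P powr (1 / \<rho>)"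
        using P by (simp add: powr_divide)
    qed
    also have "\<dots> = P powr (1 / \<rho>) / P powr (1 / \<rho>)"
      unfolding P_def pnorm_powr_inverse[OF pos] by (simp only: sum_divide_distrib)
    also have "\<dots> \<le> 1" by simp
    finally show ?thesis .
  qed
  then have "mass \<rho> S (dual_vector \<rho> S x) powr (1 - \<rho>) \<le> 1 powr (1 - \<rho>)"
    using \<rho> by (intro powr_mono2 mass_nonneg) auto
  then show ?thesis by (simp add: dual_norm_def)
qed

lemma norm_dual_vector_le: "norm (dual_vector \<rho> S x) \<le> real (card S)"
proof -
  have "norm (dual_vector \<rho> S x) \<le> (\<Sum>n\<in>S. 1)"
    unfolding dual_vector_def
  proof (rule sum_norm_le)
    fix n assume "n \<in> S"
    then show "norm (unit_ell2 n (of_real (dual_entry \<rho> S x n) * sgn (ev x n))) \<le> 1"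
      using cmod_dual_vector_le_1[of x n] by (simp add: ev_dual_vector[OF S])
  qed
  then show ?thesis by simp
qed

lemma borel_measurable_dual_vector:
  assumes F [measurable]: "F \<in> borel_measurable M"
  shows "(\<lambda>t. dual_vector \<rho> S (F t)) \<in> borel_measurable M"
proof -
  have [measurable]: "Measurable.pred M (\<lambda>t. argmax S (F t) n)" for n
    unfolding argmax_def using S by measurable
  have [measurable]: "(\<lambda>t. dual_entry \<rho> S (F t) n) \<in> borel_measurable M" for n
    unfolding dual_entry_def using S by measurable
  have [measurable]: "(\<lambda>t. sgn (ev (F t) n)) \<in> borel_measurable M" for n
    unfolding sgn_div_norm by measurable
  show ?thesis unfolding dual_vector_def by measurable
qed

end

section \<open>Strichartz estimates for the Duhamel equation\<close>

lemma mass_scaleR: "\<rho> < 1 \<Longrightarrow> mass \<rho> S (c *\<^sub>R x) = \<bar>c\<bar> powr (1 / (1 - \<rho>)) * mass \<rho> S x"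
  by (simp add: mass_def sum_distrib_left powr_mult norm_scaleR del: scaleR_conv_of_real)

lemma dual_norm_scaleR: "\<rho> < 1 \<Longrightarrow> dual_norm \<rho> S (c *\<^sub>R x) = \<bar>c\<bar> * dual_norm \<rho> S x"
  by (simp add: dual_norm_def mass_scaleR powr_mult mass_nonneg powr_powr)

lemma bil_scaleR: "bil I (\<lambda>t. a *\<^sub>R F t) (\<lambda>t. b *\<^sub>R G t) = a * b * bil I F G"
proof -
  have "bil I (\<lambda>t. a *\<^sub>R F t) (\<lambda>t. b *\<^sub>R G t) = (\<integral>p. (a * b) * (indicator I (snd p - fst p) * (propag (snd p - fst p) (F (fst p)) \<bullet> G (snd p)))
     \<partial>(lborel \<Otimes>\<^sub>M lborel))"
    unfolding bil_def by (intro Bochner_Integration.integral_cong refl) (simp add: sg.flow_scaleR)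
  then show ?thesis by (simp add: bil_def)
qed

lemma bil_diff_left:
  fixes F G :: "real \<Rightarrow> (int ^ 'd::finite) ell2"
  assumes "forcing S T B F" "forcing S1 T B1 F1" "forcing S' T B' G" "I \<in> sets borel"
  shows "bil I (\<lambda>t. F t - F1 t) G = bil I F G - bil I F1 G"
proof -
  have "bil I F G - bil I F1 G = (\<integral>p. indicator I (snd p - fst p) * (propag (snd p - fst p) (F (fst p)) \<bullet> G (snd p))
      - indicator I (snd p - fst p) * (propag (snd p - fst p) (F1 (fst p)) \<bullet> G (snd p)) \<partial>(lborel \<Otimes>\<^sub>M lborel))"
    unfolding bil_def
    by (rule Bochner_Integration.integral_diff[symmetric]) (rule bil_integrable[OF assms(1,3,4)] bil_integrable[OF assms(2,3,4)])+
  also have "\<dots> = bil I (\<lambda>t. F t - F1 t) G"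
    unfolding bil_def
    by (intro Bochner_Integration.integral_cong refl) (simp add: sg.flow_diff inner_diff_left right_diff_distrib)
  finally show ?thesis by simp
qed

lemma bil_le_bounds:
  fixes F G :: "real \<Rightarrow> (int ^ 'd::finite) ell2"
  assumes F: "forcing S T B F" and G: "forcing S' T B' G" and I: "I \<in> sets borel" and T: "0 \<le> T"
  shows "\<bar>bil I F G\<bar> \<le> B * B' * T\<^sup>2"
proof -
  have B: "0 \<le> B" "0 \<le> B'" using forcingD(5)[OF F] forcingD(5)[OF G] by auto
  have "ennreal \<bar>bil I F G\<bar> \<le> (\<integral>\<^sup>+ t. \<integral>\<^sup>+ s. ennreal (indicator I (t - s) * \<bar>propag (t - s) (F s) \<bullet> G t\<bar>) \<partial>lborel \<partial>lborel)"
    by (rule bil_le_nn_integral[OF F G I])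
  also have "\<dots> \<le> (\<integral>\<^sup>+ t. \<integral>\<^sup>+ s. ennreal (B * B') * indicator {0..T} t * indicator {0..T} s \<partial>lborel \<partial>lborel)"
  proof (intro nn_integral_mono)
    fix s t
    have "\<bar>propag (t - s) (F s) \<bullet> G t\<bar> \<le> B * B'"
      using Cauchy_Schwarz_ineq2[of "propag (t - s) (F s)" "G t"]
        mult_mono[OF forcingD(4)[OF F, of s] forcingD(4)[OF G, of t]] B by simp
    moreover have "F s = 0 \<or> G t = 0" if "\<not> (t \<in> {0..T} \<and> s \<in> {0..T})"
      using that forcingD(3)[OF F, of s] forcingD(3)[OF G, of t] by auto
    ultimately show "ennreal (indicator I (t - s) * \<bar>propag (t - s) (F s) \<bullet> G t\<bar>)
        \<le> ennreal (B * B') * indicator {0..T} t * indicator {0..T} s"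
      using B by (cases "t \<in> {0..T} \<and> s \<in> {0..T}") (auto simp: indicator_def intro: ennreal_leI)
  qed
  also have "\<dots> = ennreal (B * B') * ennreal T * ennreal T"
    using T by (simp add: nn_integral_cmult nn_integral_multc)
  also have "\<dots> = ennreal (B * B' * T\<^sup>2)"
    using B T by (simp add: ennreal_mult'[symmetric] power2_eq_square mult.assoc)
  finally show ?thesis using B T by simp
qed

lemma dual_bound_scaled:
  fixes F G :: "real \<Rightarrow> (int ^ 'd::finite) ell2"
  assumes bound: "dual_bound TYPE('d) \<rho> q C" and \<rho>: "\<rho> < 1" and S: "finite S"
    and F: "forcing S T B F" and G: "forcing S T B' G" and I: "I \<in> sets borel" and ab: "0 < a" "0 < b"
    and Fa: "(\<integral>\<^sup>+ t. ennreal (dual_norm \<rho> S (F t) powr q) \<partial>lborel) \<le> ennreal (a powr q)"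
    and Gb: "(\<integral>\<^sup>+ t. ennreal (dual_norm \<rho> S (G t) powr q) \<partial>lborel) \<le> ennreal (b powr q)"
  shows "\<bar>bil I F G\<bar> \<le> C * a * b"
proof -
  have norm1: "(\<integral>\<^sup>+ t. ennreal (dual_norm \<rho> S ((1 / c) *\<^sub>R H t) powr q) \<partial>lborel) \<le> 1"
    if H: "H \<in> borel_measurable borel" and c: "0 < c"
      and le: "(\<integral>\<^sup>+ t. ennreal (dual_norm \<rho> S (H t) powr q) \<partial>lborel) \<le> ennreal (c powr q)"
    for H :: "real \<Rightarrow> (int ^ 'd) ell2" and c
  proof -
    note [measurable] = H
    have "(\<integral>\<^sup>+ t. ennreal (dual_norm \<rho> S ((1 / c) *\<^sub>R H t) powr q) \<partial>lborel)
        = (\<integral>\<^sup>+ t. ennreal ((1 / c) powr q) * ennreal (dual_norm \<rho> S (H t) powr q) \<partial>lborel)"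
    proof (rule nn_integral_cong)
      fix t
      have "dual_norm \<rho> S ((1 / c) *\<^sub>R H t) powr q = (1 / c) powr q * dual_norm \<rho> S (H t) powr q"
        unfolding dual_norm_scaleR[OF \<rho>] powr_mult using c by simp
      then show "ennreal (dual_norm \<rho> S ((1 / c) *\<^sub>R H t) powr q)
          = ennreal ((1 / c) powr q) * ennreal (dual_norm \<rho> S (H t) powr q)"
        by (simp only: ennreal_mult'[symmetric] powr_ge_zero)
    qed
    also have "\<dots> = ennreal ((1 / c) powr q) * (\<integral>\<^sup>+ t. ennreal (dual_norm \<rho> S (H t) powr q) \<partial>lborel)"
      by (rule nn_integral_cmult) simp
    also have "\<dots> \<le> ennreal ((1 / c) powr q) * ennreal (c powr q)" by (intro mult_left_mono le) simp
    also have "\<dots> = ennreal ((1 / c) powr q * c powr q)" by (simp add: ennreal_mult')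
    also have "(1 / c) powr q * c powr q = 1" using c by (simp add: powr_divide)
    finally show ?thesis by simp
  qed
  define B0 where "B0 = max (B / a) (B' / b)"
  have "forcing S T B0 (\<lambda>t. (1 / a) *\<^sub>R F t)" "forcing S T B0 (\<lambda>t. (1 / b) *\<^sub>R G t)"
    using F G ab unfolding forcing_def B0_def by (auto simp: divide_right_mono le_max_iff_disj)
  then have "\<bar>bil I (\<lambda>t. (1 / a) *\<^sub>R F t) (\<lambda>t. (1 / b) *\<^sub>R G t)\<bar> \<le> C"
    using bound S I norm1[OF forcingD(1)[OF F] ab(1) Fa] norm1[OF forcingD(1)[OF G] ab(2) Gb]
    unfolding dual_bound_def by blast
  then show ?thesis using ab by (simp add: bil_scaleR abs_mult abs_divide field_simps)
qed

text \<open>The TT* argument: the integral equals \<open>x \<bullet> V\<close> with \<open>V\<close>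
  the integral of \<open>propag (- s) (G s)\<close>, and the squared norm of \<open>V\<close> is the
  bilinear form of \<open>G\<close> with itself over all lags. Hence the square root of
  \<open>C\<close>.\<close>

lemma homogeneous_pairing:
  fixes x :: "(int ^ 'd::finite) ell2"
  assumes bound: "dual_bound TYPE('d) \<rho> q C" and \<rho>: "\<rho> < 1" and S: "finite S"
    and G: "forcing S T B G" and b: "0 < b"
    and Gb: "(\<integral>\<^sup>+ t. ennreal (dual_norm \<rho> S (G t) powr q) \<partial>lborel) \<le> ennreal (b powr q)"
  shows "\<bar>\<integral>t. propag t x \<bullet> G t \<partial>lborel\<bar> \<le> sqrt C * norm x * b"
    and "integrable lborel (\<lambda>t. propag t x \<bullet> G t)"
proof -
  define V where "V = (\<integral>s. propag (- s) (G s) \<partial>lborel)"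
  have int: "integrable lborel (\<lambda>s. propag (- s) (G s))"
    using duhamel_integrable[OF G, of UNIV 0] by simp
  have eq: "propag t y \<bullet> G t = y \<bullet> propag (- t) (G t)" for t y by (rule sg.flow_inner_left)
  have pair: "(\<integral>t. propag t y \<bullet> G t \<partial>lborel) = y \<bullet> V" for y
    unfolding eq V_def by (rule integral_inner_right) (rule int)
  show "integrable lborel (\<lambda>t. propag t x \<bullet> G t)" unfolding eq by (rule integrable_inner_right) (rule int)
  have "duhamel UNIV G t = propag t V" for t
  proof -
    have "propag t V = (\<integral>s. propag t (propag (- s) (G s)) \<partial>lborel)"
      unfolding V_def by (rule integral_bounded_linear[OF sg.bounded_linear_flow int, symmetric])
    then show ?thesis by (simp add: duhamel_def)
  qed
  then have "bil UNIV G G = V \<bullet> V"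
    using bil_eq_integral_duhamel(1)[OF G G, of UNIV] pair by simp
  then have "V \<bullet> V \<le> C * b * b"
    using dual_bound_scaled[OF bound \<rho> S G G _ b b Gb Gb, of UNIV] by simp
  then have "norm V \<le> sqrt (C * (b * b))" by (simp add: norm_eq_sqrt_inner mult.assoc)
  also have "\<dots> = sqrt C * b" using b by (simp add: real_sqrt_mult)
  finally have "norm V \<le> sqrt C * b" .
  then have "norm x * norm V \<le> norm x * (sqrt C * b)" by (rule mult_left_mono) simp
  then show "\<bar>\<integral>t. propag t x \<bullet> G t \<partial>lborel\<bar> \<le> sqrt C * norm x * b"
    unfolding pair using Cauchy_Schwarz_ineq2[of x V] by (simp add: mult_ac)
qed

text \<open>A continuous orbit over \<open>{0..T}\<close> is compact: the finite sets belonging to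
  the points of a finite net are united. This gives access to the nonlinear forcing, which has
  infinite support.\<close>

lemma uniform_restr_approx:
  fixes f :: "real \<Rightarrow> 'a ell2"
  assumes f: "continuous_on {0..T} f" and S: "finite S" and e: "0 < e"
  obtains S' where "finite S'" "S \<subseteq> S'" "\<And>t. t \<in> {0..T} \<Longrightarrow> norm (f t - restr S' (f t)) \<le> e"
proof -
  have "compact (f ` {0..T})" by (intro compact_continuous_image f) simp
  then obtain K where K: "finite K" "f ` {0..T} \<subseteq> (\<Union>y\<in>K. ball y (e / 3))"
    using e seq_compact_imp_totally_bounded[of "f ` {0..T}"] by (metis compact_imp_seq_compact divide_pos_pos zero_less_numeral)
  have "\<exists>R. finite R \<and> (\<forall>S'. R \<subseteq> S' \<longrightarrow> norm (y - restr S' y) \<le> e / 3)" for y :: "'a ell2"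
  proof -
    obtain R where "finite R" "\<And>S'. R \<subseteq> S' \<Longrightarrow> norm (y - restr S' y) \<le> e / 3"
      using restr_approx[of "e / 3" y] e by auto
    then show ?thesis by blast
  qed
  then have "\<forall>y :: 'a ell2. \<exists>R. finite R \<and> (\<forall>S'. R \<subseteq> S' \<longrightarrow> norm (y - restr S' y) \<le> e / 3)" by blast
  from choice[OF this] obtain R where R_all: "\<forall>y :: 'a ell2. finite (R y) \<and> (\<forall>S'. R y \<subseteq> S' \<longrightarrow> norm (y - restr S' y) \<le> e / 3)" ..
  then have R: "finite (R y)" "R y \<subseteq> S' \<Longrightarrow> norm (y - restr S' y) \<le> e / 3" for y S' by simp_all
  define S' where "S' = S \<union> (\<Union>y\<in>K. R y)"
  show thesis
  proof (rule that[of S'])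
    show "finite S'" "S \<subseteq> S'" using S K(1) R(1) by (auto simp: S'_def)
    fix t assume "t \<in> {0..T}"
    then have "f t \<in> (\<Union>y\<in>K. ball y (e / 3))" using K(2) by blast
    then obtain y where y: "y \<in> K" "dist y (f t) < e / 3" by auto
    have "norm (y - restr S' y) \<le> e / 3" by (rule R(2)) (use y in \<open>auto simp: S'_def\<close>)
    moreover have "norm (restr S' (y - f t)) \<le> e / 3"
      using order_trans[OF norm_restr_le, of "y - f t" "e / 3" S'] y(2) by (simp add: dist_norm)
    moreover have decomp: "f t - restr S' (f t) = - (y - f t) + (y - restr S' y) + restr S' (y - f t)"
      by (simp add: linear_diff[OF bounded_linear.linear[OF bounded_linear_restr]])
    moreover have "norm (- (y - f t)) \<le> e / 3" using y(2) by (simp add: dist_norm norm_minus_commute)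
    ultimately show "norm (f t - restr S' (f t)) \<le> e"
      unfolding decomp using norm_triangle_ineq[of "- (y - f t) + (y - restr S' y)" "restr S' (y - f t)"]
        norm_triangle_ineq[of "- (y - f t)" "y - restr S' y"] by linarith
  qed
qed

text \<open>The equation contains a gauge integral and the bilinear form a Bochner integral. Pairing
  with an arbitrary \<open>y\<close> reduces their comparison to continuous scalar
  functions.\<close>

lemma duhamel_eq_integral:
  fixes f :: "real \<Rightarrow> (int ^ 'd::finite) ell2"
  assumes f: "continuous_on UNIV f" and t: "t \<in> {0..T}" and F: "forcing S T B (\<lambda>s. indicator {0..T} s *\<^sub>R f s)"
  shows "duhamel {0..} (\<lambda>s. indicator {0..T} s *\<^sub>R f s) t = integral {0..t} (\<lambda>s. propag (t - s) (f s))"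
proof -
  let ?h = "\<lambda>s. propag (t - s) (f s)"
  have cont: "continuous_on {0..t} ?h" by (intro continuous_intros continuous_on_subset[OF f]) auto
  have "y \<bullet> duhamel {0..} (\<lambda>s. indicator {0..T} s *\<^sub>R f s) t = y \<bullet> integral {0..t} ?h" for y
  proof -
    have ci: "continuous_on {0..t} (\<lambda>s. y \<bullet> ?h s)" by (intro continuous_intros cont)
    have "y \<bullet> duhamel {0..} (\<lambda>s. indicator {0..T} s *\<^sub>R f s) t
        = (\<integral>s. y \<bullet> (indicator {0..} (t - s) *\<^sub>R propag (t - s) (indicator {0..T} s *\<^sub>R f s)) \<partial>lborel)"
      unfolding duhamel_def by (rule integral_inner_right[symmetric]) (rule duhamel_integrable[OF F], simp)
    also have "\<dots> = (\<integral>s. indicator {0..t} s *\<^sub>R (y \<bullet> ?h s) \<partial>lborel)"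
      using t by (intro Bochner_Integration.integral_cong refl) (auto simp: indicator_def sg.flow_scaleR)
    also have "\<dots> = integral {0..t} (\<lambda>s. y \<bullet> ?h s)"
      using set_borel_integral_eq_integral(2)[OF borel_integrable_atLeastAtMost'[OF ci]]
      by (simp add: set_lebesgue_integral_def)
    also have "\<dots> = y \<bullet> integral {0..t} ?h"
      using integral_linear[OF integrable_continuous_real[OF cont] bounded_linear_inner_right[of y]]
      by (simp add: comp_def)
    finally show ?thesis .
  qed
  then show ?thesis using vector_eq_ldot by blast
qed

lemma mass_superset:
  assumes "finite S'" "S \<subseteq> S'" "\<And>n. n \<notin> S \<Longrightarrow> ev x n = 0"
  shows "mass \<rho> S' x = mass \<rho> S x"
  unfolding mass_def
proof (rule sum.mono_neutral_right[OF assms(1,2)])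
  show "\<forall>n\<in>S' - S. cmod (ev x n) powr (1 / (1 - \<rho>)) = 0" by (simp add: assms(3))
qed

text \<open>\<open>dual_bound\<close> speaks of finitely supported forcings only. \<open>f\<close>
  is cut off to a finite set up to a uniform error, and the error term is estimated crudely by
  \<open>bil_le_bounds\<close>; its dependence on \<open>T\<close> is harmless because the cutoff is
  chosen after \<open>T\<close>.\<close>

lemma inhomogeneous_pairing:
  fixes f :: "real \<Rightarrow> (int ^ 'd::finite) ell2"
  assumes bound: "dual_bound TYPE('d) \<rho> q C" and \<rho>: "\<rho> < 1" and S: "finite S" and C: "0 \<le> C"
    and f: "continuous_on UNIV f" and F: "forcing UNIV T B (\<lambda>s. indicator {0..T} s *\<^sub>R f s)"
    and G: "forcing S T B' G" and ab: "0 < a" "0 < b" and T: "0 \<le> T" and q: "q > 0"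
    and fa: "\<And>S :: (int ^ 'd) set. finite S \<Longrightarrow> (\<integral>\<^sup>+ t. ennreal (dual_norm \<rho> S (f t) powr q) * indicator {0..T} t \<partial>lborel) \<le> ennreal (a powr q)"
    and Gb: "(\<integral>\<^sup>+ t. ennreal (dual_norm \<rho> S (G t) powr q) \<partial>lborel) \<le> ennreal (b powr q)"
  shows "\<bar>bil {0..} (\<lambda>s. indicator {0..T} s *\<^sub>R f s) G\<bar> \<le> C * a * b"
proof (rule field_le_epsilon)
  fix e :: real assume e: "0 < e"
  let ?f = "\<lambda>s. indicator {0..T} s *\<^sub>R f s"
  have B': "0 \<le> B'" using forcingD(5)[OF G] .
  \<comment> \<open>The error of the cutoff is at most \<open>\<eta> * B' * T^2\<close>, hence at
    most \<open>e\<close>; the 1 keeps the denominator positive.\<close>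
  define \<eta> where "\<eta> = e / (B' * T\<^sup>2 + 1)"
  have den: "0 < B' * T\<^sup>2 + 1" using B' by (simp add: add_nonneg_pos)
  then have \<eta>: "0 < \<eta>" using e by (simp add: \<eta>_def)
  obtain S' where S': "finite S'" "S \<subseteq> S'" "\<And>t. t \<in> {0..T} \<Longrightarrow> norm (f t - restr S' (f t)) \<le> \<eta>"
    using uniform_restr_approx[OF continuous_on_subset[OF f subset_UNIV] S \<eta>, of T] by blast
  have rm: "(\<lambda>t. restr S' (?f t)) \<in> borel_measurable borel"
    using forcingD(1)[OF F] by (rule measurable_compose)
      (intro borel_measurable_continuous_onI linear_continuous_on bounded_linear_restr)
  have F': "forcing S' T B (\<lambda>t. restr S' (?f t))"
    using F rm order_trans[OF norm_restr_le] unfolding forcing_def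
    by (auto intro: ell2_eqI simp del: norm_scaleR)
  have G': "forcing S' T B' G" using G S'(2) unfolding forcing_def by auto
  have diff: "forcing UNIV T \<eta> (\<lambda>t. ?f t - restr S' (?f t))"
    unfolding forcing_def
  proof (intro conjI allI impI)
    show "(\<lambda>t. ?f t - restr S' (?f t)) \<in> borel_measurable borel"
      using forcingD(1)[OF F] rm by (rule borel_measurable_diff)
    fix t
    show "norm (?f t - restr S' (?f t)) \<le> \<eta>"
    proof (cases "t \<in> {0..T}")
      case False
      then have "?f t - restr S' (?f t) = 0" by (auto intro!: ell2_eqI)
      then show ?thesis using \<eta> by simp
    qed (use S'(3)[of t] in simp)
    show "?f t - restr S' (?f t) = 0" if "t \<notin> {0..T}" using that by (auto intro!: ell2_eqI)
  qed simp
  have "\<bar>bil {0..} (\<lambda>t. restr S' (?f t)) G\<bar> \<le> C * a * b"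
  proof (rule dual_bound_scaled[OF bound \<rho> S'(1) F' G' _ ab])
    have "(\<integral>\<^sup>+ t. ennreal (dual_norm \<rho> S' (restr S' (?f t)) powr q) \<partial>lborel)
        = (\<integral>\<^sup>+ t. ennreal (dual_norm \<rho> S' (f t) powr q) * indicator {0..T} t \<partial>lborel)"
    proof (rule nn_integral_cong)
      fix t
      have "mass \<rho> S' (restr S' (?f t)) = (if t \<in> {0..T} then mass \<rho> S' (f t) else 0)"
        by (auto simp: mass_def)
      then show "ennreal (dual_norm \<rho> S' (restr S' (?f t)) powr q) = ennreal (dual_norm \<rho> S' (f t) powr q) * indicator {0..T} t"
        using \<rho> q by (auto simp: dual_norm_def)
    qed
    then show "(\<integral>\<^sup>+ t. ennreal (dual_norm \<rho> S' (restr S' (?f t)) powr q) \<partial>lborel) \<le> ennreal (a powr q)"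
      using fa[OF S'(1)] by simp
    have "mass \<rho> S' (G t) = mass \<rho> S (G t)" for t
      using S' forcingD(2)[OF G] by (intro mass_superset) auto
    then show "(\<integral>\<^sup>+ t. ennreal (dual_norm \<rho> S' (G t) powr q) \<partial>lborel) \<le> ennreal (b powr q)"
      using Gb by (simp add: dual_norm_def)
  qed simp
  moreover have "bil {0..} ?f G = bil {0..} (\<lambda>t. restr S' (?f t)) G + bil {0..} (\<lambda>t. ?f t - restr S' (?f t)) G"
    using bil_diff_left[OF F F' G, of "{0..}"] by simp
  moreover have "\<bar>bil {0..} (\<lambda>t. ?f t - restr S' (?f t)) G\<bar> \<le> \<eta> * B' * T\<^sup>2"
    by (rule bil_le_bounds[OF diff G _ T]) simp
  moreover have "\<eta> * B' * T\<^sup>2 \<le> e"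
  proof -
    have "\<eta> * (B' * T\<^sup>2) \<le> \<eta> * (B' * T\<^sup>2 + 1)" using \<eta> by (intro mult_left_mono) auto
    also have "\<dots> = e" using den by (simp add: \<eta>_def)
    finally show ?thesis by (simp add: mult.assoc)
  qed
  ultimately show "\<bar>bil {0..} ?f G\<bar> \<le> C * a * b + e" by linarith
qed

text \<open>Duality: the solution is tested against \<open>p t powr (q - 1)\<close> times the
  norming vector at each time, which turns the pairing into P, the integral of the power
  \<open>q\<close>. The two pairing estimates give P <= K P^(1/q'), and P is known to be finite on
  \<open>{0..T}\<close>, so one may divide.\<close>

lemma strichartz_truncated:
  fixes u f :: "real \<Rightarrow> (int ^ 'd::finite) ell2"
  assumes bound: "dual_bound TYPE('d) \<rho> (q / (q - 1)) C" and C: "0 \<le> C" and \<rho>: "0 \<le> \<rho>" "\<rho> < 1 / 2" and q: "1 < q"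
    and f: "continuous_on UNIV f" and u: "continuous_on UNIV u" and T: "0 \<le> T"
    and duh: "\<And>t. t \<in> {0..T} \<Longrightarrow> u t = propag t x + integral {0..t} (\<lambda>s. propag (t - s) (f s))"
    and a: "0 < a" and fa: "\<And>S :: (int ^ 'd) set. finite S \<Longrightarrow>
      (\<integral>\<^sup>+ t. ennreal (dual_norm \<rho> S (f t) powr (q / (q - 1))) * indicator {0..T} t \<partial>lborel) \<le> ennreal (a powr (q / (q - 1)))"
    and S: "finite S"
  shows "(\<integral>\<^sup>+ t. ennreal (pnorm \<rho> S (u t) powr q) * indicator {0..T} t \<partial>lborel) \<le> ennreal ((sqrt C * norm x + C * a) powr q)"
proof -
  define q' where "q' = q / (q - 1)"
  have q': "q' > 0" "(q - 1) * q' = q" using q by (auto simp: q'_def)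
  have q'': "1 - 1 / q' = 1 / q" using q by (simp add: q'_def diff_divide_distrib)
  have "\<exists>B. \<forall>t\<in>{0..T}. norm (h t) \<le> B" if "continuous_on UNIV h" for h :: "real \<Rightarrow> (int ^ 'd) ell2"
  proof -
    have "bounded (h ` {0..T})"
      by (intro compact_imp_bounded compact_continuous_image continuous_on_subset[OF that]) auto
    then show ?thesis unfolding bounded_iff by blast
  qed
  then obtain Bu Bf where Bu: "\<And>t. t \<in> {0..T} \<Longrightarrow> norm (u t) \<le> Bu" and Bf: "\<And>t. t \<in> {0..T} \<Longrightarrow> norm (f t) \<le> Bf"
    using u f by meson
  have B0: "0 \<le> Bu" "0 \<le> Bf" using Bu[of 0] Bf[of 0] T norm_ge_zero order_trans by (meson atLeastAtMost_iff order_refl)+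
  have um [measurable]: "u \<in> borel_measurable borel" and fm [measurable]: "f \<in> borel_measurable borel"
    using u f by (auto intro: borel_measurable_continuous_onI)
  have [measurable]: "(\<lambda>t. pnorm \<rho> S (u t)) \<in> borel_measurable borel" by (rule borel_measurable_pnorm[OF um S])
  define p where "p t = pnorm \<rho> S (u t)" for t
  have p: "0 \<le> p t" for t unfolding p_def by (rule pnorm_nonneg[OF S])
  have pB: "p t \<le> Bu" if "t \<in> {0..T}" for t
    unfolding p_def using pnorm_le_norm[OF S \<rho>(1), of "u t"] \<rho>(2) Bu[OF that] by simp
  have pm [measurable]: "p \<in> borel_measurable borel" unfolding p_def[abs_def] by measurable
  define g where "g t = indicator {0..T} t * p t powr q" for t
  have g_int: "integrable lborel g"
  proof (rule Bochner_Integration.integrable_bound)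
    show "integrable lborel (\<lambda>t. Bu powr q * indicat_real {0..T} t)"
      using emeasure_lborel_Icc_finite by (intro integrable_mult_right integrable_real_indicator) auto
    show "g \<in> borel_measurable lborel" unfolding g_def[abs_def] by measurable
    show "AE t in lborel. norm (g t) \<le> norm (Bu powr q * indicat_real {0..T} t)"
      using p pB q by (intro AE_I2) (auto simp: g_def indicator_def intro!: powr_mono2)
  qed
  define P where "P = (\<integral>t. g t \<partial>lborel)"
  have g0: "0 \<le> g t" for t by (simp add: g_def)
  have P0: "0 \<le> P" unfolding P_def by (rule integral_nonneg_AE) (simp add: g0)
  have P: "(\<integral>\<^sup>+ t. ennreal (p t powr q) * indicator {0..T} t \<partial>lborel) = ennreal P"
  proof -
    have "(\<integral>\<^sup>+ t. ennreal (p t powr q) * indicator {0..T} t \<partial>lborel) = (\<integral>\<^sup>+ t. ennreal (g t) \<partial>lborel)"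
      by (intro nn_integral_cong) (auto simp: g_def indicator_def)
    also have "\<dots> = ennreal P" unfolding P_def by (rule nn_integral_eq_integral[OF g_int]) (simp add: g0)
    finally show ?thesis .
  qed
  define K where "K = sqrt C * norm x + C * a"
  have K: "0 \<le> K" using C a by (simp add: K_def)
  have "P \<le> K powr q"
  proof (cases "P = 0")
    case False
    then have Ppos: "P > 0" using P0 by simp
    \<comment> \<open>A bound for the dual space-time norm of the test function \<open>G\<close>,
      since \<open>(q - 1) * q' = q\<close>.\<close>
    define b where "b = P powr (1 / q')"
    have b: "b > 0" "b powr q' = P" using Ppos q' by (auto simp: b_def powr_powr)
    define G where "G t = (indicator {0..T} t * p t powr (q - 1)) *\<^sub>R dual_vector \<rho> S (u t)" for t
    have Gm: "G \<in> borel_measurable borel"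
      unfolding G_def[abs_def] using borel_measurable_dual_vector[OF \<rho> S um] by measurable
    have G: "forcing S T (Bu powr (q - 1) * real (card S)) G"
      unfolding forcing_def
    proof (intro conjI allI impI Gm)
      show "norm (G t) \<le> Bu powr (q - 1) * real (card S)" for t
        using norm_dual_vector_le[OF \<rho> S, of "u t"] p pB[of t] q
        by (auto simp: G_def indicator_def intro!: mult_mono powr_mono2)
    qed (auto simp: G_def ev_dual_vector[OF S])
    have F: "forcing UNIV T Bf (\<lambda>s. indicator {0..T} s *\<^sub>R f s)"
      unfolding forcing_def using Bf B0 by (auto simp: indicator_def)
    have Gb: "(\<integral>\<^sup>+ t. ennreal (dual_norm \<rho> S (G t) powr q') \<partial>lborel) \<le> ennreal (b powr q')"
    proof -
      have "(\<integral>\<^sup>+ t. ennreal (dual_norm \<rho> S (G t) powr q') \<partial>lborel) \<le> (\<integral>\<^sup>+ t. ennreal (g t) \<partial>lborel)"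
      proof (intro nn_integral_mono ennreal_leI)
        fix t
        have "dual_norm \<rho> S (G t) \<le> indicator {0..T} t * p t powr (q - 1) * 1"
          unfolding G_def using \<rho> dual_norm_dual_vector_le_1[OF \<rho> S, of "u t"]
          by (simp add: dual_norm_scaleR abs_mult mult_left_le)
        then have "dual_norm \<rho> S (G t) powr q' \<le> (indicator {0..T} t * p t powr (q - 1)) powr q'"
          using q' by (intro powr_mono2 dual_norm_nonneg) auto
        also have "\<dots> = g t" using q' by (simp add: g_def indicator_def powr_powr)
        finally show "dual_norm \<rho> S (G t) powr q' \<le> g t" .
      qed
      also have "\<dots> = ennreal P" unfolding P_def by (rule nn_integral_eq_integral[OF g_int]) (simp add: g0)
      finally show ?thesis by (simp add: b)
    qed
    have \<rho>1: "\<rho> < 1" using \<rho> by simp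
    note hom = homogeneous_pairing[OF bound[folded q'_def] \<rho>1 S G b(1) Gb, of x]
    note inhom = inhomogeneous_pairing[OF bound[folded q'_def] \<rho>1 S C f F G a b(1) T q'(1) fa[folded q'_def] Gb]
    have J: "{0..} \<in> sets (borel :: real measure)" by simp
    have "g t = propag t x \<bullet> G t + duhamel {0..} (\<lambda>s. indicator {0..T} s *\<^sub>R f s) t \<bullet> G t" for t
    proof (cases "t \<in> {0..T}")
      case True
      have "propag t x \<bullet> G t + duhamel {0..} (\<lambda>s. indicator {0..T} s *\<^sub>R f s) t \<bullet> G t = u t \<bullet> G t"
        unfolding duhamel_eq_integral[OF f True F] by (subst duh[OF True]) (simp add: inner_add_left)
      also have "\<dots> = p t powr (q - 1) * p t" using True by (simp add: G_def inner_dual_vector[OF \<rho> S] p_def)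
      also have "\<dots> = g t" using powr_mult_base[OF p, of t "q - 1"] True by (simp add: g_def mult.commute)
      finally show ?thesis by simp
    qed (simp add: g_def G_def)
    then have "P = (\<integral>t. propag t x \<bullet> G t + duhamel {0..} (\<lambda>s. indicator {0..T} s *\<^sub>R f s) t \<bullet> G t \<partial>lborel)"
      by (simp add: P_def)
    also have "\<dots> = (\<integral>t. propag t x \<bullet> G t \<partial>lborel) + bil {0..} (\<lambda>s. indicator {0..T} s *\<^sub>R f s) G"
      unfolding bil_eq_integral_duhamel(1)[OF F G J]
      by (rule Bochner_Integration.integral_add[OF hom(2) bil_eq_integral_duhamel(2)[OF F G J]])
    also have "\<dots> \<le> sqrt C * norm x * b + C * a * b" using hom(1) inhom by linarith
    also have "\<dots> = K * P powr (1 / q')" by (simp add: K_def b_def algebra_simps)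
    finally have "P * P powr (- (1 / q')) \<le> K * P powr (1 / q') * P powr (- (1 / q'))"
      by (rule mult_right_mono) simp
    also have "K * P powr (1 / q') * P powr (- (1 / q')) = K"
      using Ppos by (simp add: mult.assoc flip: powr_add)
    also have "P * P powr (- (1 / q')) = P powr (1 / q)"
      using powr_mult_base[OF P0, of "- (1 / q')"] q'' by simp
    finally have "(P powr (1 / q)) powr q \<le> K powr q" using q by (intro powr_mono2) auto
    then show ?thesis using q Ppos by (simp add: powr_powr)
  qed simp
  then have "ennreal P \<le> ennreal (K powr q)" by (rule ennreal_leI)
  then show ?thesis using P by (simp add: p_def K_def)
qed

section \<open>Lebesgue norms on the whole lattice\<close>

text \<open>For \<open>0 \<le> \<rho> \<le> 1 / 2\<close> the supremum is bounded by the l^2 norm;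
  being countable and monotone, it inherits measurability in time.\<close>

definition lpnorm :: "real \<Rightarrow> 'a::countable ell2 \<Rightarrow> real" where
  "lpnorm \<rho> x = (SUP k. pnorm \<rho> (exhaust k) x)"

lemma bdd_above_pnorm_exhaust:
  "0 \<le> \<rho> \<Longrightarrow> \<rho> \<le> 1 / 2 \<Longrightarrow> bdd_above (range (\<lambda>k. pnorm \<rho> (exhaust k) x))"
  by (rule bdd_aboveI2[of _ _ "norm x"]) (rule pnorm_le_norm[OF finite_exhaust])

lemma pnorm_le_lpnorm:
  assumes S: "finite S" and \<rho>: "0 \<le> \<rho>" "\<rho> \<le> 1 / 2"
  shows "pnorm \<rho> S x \<le> lpnorm \<rho> x"
proof -
  have "finite (to_nat ` S)" using S by simp
  then obtain k where "\<forall>m\<in>to_nat ` S. m < k" using finite_nat_set_iff_bounded by blast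
  then have "S \<subseteq> exhaust k" by (auto simp: exhaust_def)
  then have "pnorm \<rho> S x \<le> pnorm \<rho> (exhaust k) x" using \<rho>(1) by (intro pnorm_mono_set) simp_all
  also have "\<dots> \<le> lpnorm \<rho> x" unfolding lpnorm_def by (rule cSUP_upper[OF UNIV_I bdd_above_pnorm_exhaust[OF \<rho>]])
  finally show ?thesis .
qed

lemma lpnorm_le: "(\<And>S. finite S \<Longrightarrow> pnorm \<rho> S x \<le> c) \<Longrightarrow> lpnorm \<rho> x \<le> c"
  unfolding lpnorm_def by (intro cSUP_least) simp_all

lemma lpnorm_nonneg: "0 \<le> \<rho> \<Longrightarrow> \<rho> \<le> 1 / 2 \<Longrightarrow> 0 \<le> lpnorm \<rho> x"
  using order_trans[OF pnorm_nonneg[OF finite.emptyI] pnorm_le_lpnorm[OF finite.emptyI]] .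

lemma lpnorm_le_norm: "0 \<le> \<rho> \<Longrightarrow> \<rho> \<le> 1 / 2 \<Longrightarrow> lpnorm \<rho> x \<le> norm x"
  by (intro lpnorm_le pnorm_le_norm)

lemma cmod_le_lpnorm: "0 \<le> \<rho> \<Longrightarrow> \<rho> \<le> 1 / 2 \<Longrightarrow> cmod (ev x n) \<le> lpnorm \<rho> x"
  using order_trans[OF cmod_le_pnorm[of "{n}" n] pnorm_le_lpnorm[of "{n}"]] by simp

lemma lpnorm_mono:
  fixes x :: "'a::countable ell2"
  assumes "0 \<le> \<rho>" "\<rho> \<le> \<rho>'" "\<rho>' \<le> 1 / 2"
  shows "lpnorm \<rho> x \<le> lpnorm \<rho>' x"
proof (rule lpnorm_le)
  fix S :: "'a set" assume S: "finite S"
  have "0 \<le> \<rho>'" using assms by simp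
  then show "pnorm \<rho> S x \<le> lpnorm \<rho>' x"
    by (rule order_trans[OF pnorm_mono_exponent[OF S assms(1,2)] pnorm_le_lpnorm[OF S _ assms(3)]])
qed

lemma lpnorm_0_le_add:
  fixes x y :: "'a::countable ell2"
  shows "lpnorm 0 x \<le> lpnorm 0 y + norm (x - y)"
proof (rule lpnorm_le)
  fix S :: "'a set" assume S: "finite S"
  have nn: "0 \<le> lpnorm 0 y" by (rule lpnorm_nonneg) simp_all
  show "pnorm 0 S x \<le> lpnorm 0 y + norm (x - y)"
  proof (rule pnorm_le[OF S])
    have "cmod (ev x n) \<le> lpnorm 0 y + norm (x - y)" for n
      using norm_triangle_ineq[of "ev y n" "ev (x - y) n"] cmod_le_lpnorm[of 0 y n] norm_ev_le[of "x - y" n] by simp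
    then show "\<forall>n\<in>S. cmod (ev x n) \<le> lpnorm 0 y + norm (x - y)" by blast
  qed (use nn in simp_all)
qed

lemma borel_measurable_lpnorm:
  assumes F: "F \<in> borel_measurable M" and \<rho>: "0 \<le> \<rho>" "\<rho> \<le> 1 / 2"
  shows "(\<lambda>t. lpnorm \<rho> (F t)) \<in> borel_measurable M"
  unfolding lpnorm_def
proof (rule borel_measurable_cSUP)
  show "(\<lambda>t. pnorm \<rho> (exhaust k) (F t)) \<in> borel_measurable M" for k
    by (rule borel_measurable_pnorm[OF F finite_exhaust])
qed (auto intro: bdd_above_pnorm_exhaust[OF \<rho>])

lemma pnorm_exhaust_LIMSEQ:
  fixes x :: "'a::countable ell2"
  assumes \<rho>: "0 \<le> \<rho>" "\<rho> \<le> 1 / 2"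
  shows "incseq (\<lambda>k. pnorm \<rho> (exhaust k) x)" "(\<lambda>k. pnorm \<rho> (exhaust k) x) \<longlonglongrightarrow> lpnorm \<rho> x"
proof -
  show inc: "incseq (\<lambda>k. pnorm \<rho> (exhaust k) x)"
  proof (intro incseq_SucI pnorm_mono_set finite_exhaust \<rho>(1))
    show "exhaust k \<subseteq> (exhaust (Suc k) :: 'a set)" for k by (auto simp: exhaust_def)
  qed
  show "(\<lambda>k. pnorm \<rho> (exhaust k) x) \<longlonglongrightarrow> lpnorm \<rho> x"
    unfolding lpnorm_def by (rule LIMSEQ_incseq_SUP[OF bdd_above_pnorm_exhaust[OF \<rho>] inc])
qed

text \<open>Monotone convergence along \<open>exhaust\<close> carries bounds uniform in the finite
  set over to the full lattice.\<close>

lemma nn_integral_lpnorm_le: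
  fixes u :: "real \<Rightarrow> 'a::countable ell2"
  assumes u: "u \<in> borel_measurable borel" and \<rho>: "0 \<le> \<rho>" "\<rho> \<le> 1 / 2" and q: "0 < q" and A: "A \<in> sets borel"
    and le: "\<And>S. finite S \<Longrightarrow> (\<integral>\<^sup>+ t. ennreal (pnorm \<rho> S (u t) powr q) * indicator A t \<partial>lborel) \<le> C"
  shows "(\<integral>\<^sup>+ t. ennreal (lpnorm \<rho> (u t) powr q) * indicator A t \<partial>lborel) \<le> C"
proof -
  let ?f = "\<lambda>k t. ennreal (pnorm \<rho> (exhaust k) (u t) powr q) * indicator A t"
  have "pnorm \<rho> (exhaust k) (u t) \<le> pnorm \<rho> (exhaust (Suc k)) (u t)" for k t
    by (rule incseq_SucD[OF pnorm_exhaust_LIMSEQ(1)[OF \<rho>]])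
  then have inc: "incseq ?f"
    using q by (intro incseq_SucI le_funI mult_right_mono ennreal_leI powr_mono2 pnorm_nonneg) auto
  have [measurable]: "(\<lambda>t. pnorm \<rho> (exhaust k) (u t)) \<in> borel_measurable borel" for k
    by (rule borel_measurable_pnorm[OF u finite_exhaust])
  have "ennreal (lpnorm \<rho> (u t) powr q) * indicator A t = (SUP k. ?f k t)" for t
  proof (rule LIMSEQ_unique)
    show "(\<lambda>k. ?f k t) \<longlonglongrightarrow> (SUP k. ?f k t)" 
      by (rule LIMSEQ_SUP) (rule incseq_SucI, rule le_funD[OF incseq_SucD[OF inc]])
    show "(\<lambda>k. ?f k t) \<longlonglongrightarrow> ennreal (lpnorm \<rho> (u t) powr q) * indicator A t"
    proof (cases "t \<in> A")
      case True
      have "(\<lambda>k. pnorm \<rho> (exhaust k) (u t) powr q) \<longlonglongrightarrow> lpnorm \<rho> (u t) powr q"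
        using q by (intro tendsto_powr'[OF pnorm_exhaust_LIMSEQ(2)[OF \<rho>] tendsto_const]) (auto simp: pnorm_nonneg)
      then show ?thesis using True by (simp add: tendsto_ennrealI)
    qed simp
  qed
  then have "(\<integral>\<^sup>+ t. ennreal (lpnorm \<rho> (u t) powr q) * indicator A t \<partial>lborel) = (SUP k. integral\<^sup>N lborel (?f k))"
    using A by (simp add: nn_integral_monotone_convergence_SUP[OF inc])
  also have "\<dots> \<le> C" by (rule SUP_least) (rule le[OF finite_exhaust])
  finally show ?thesis .
qed

text \<open>The bridge to the norms of the statement. Since the inverse of 0 is infinity in
  \<open>ennreal\<close>, the case \<open>\<rho> = 0\<close> is r = infinity.\<close>

lemma lr_norm_eq_lpnorm:
  fixes x :: "(int ^ 'd::finite) ell2"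
  assumes \<rho>: "0 \<le> \<rho>" "\<rho> \<le> 1 / 2"
  shows "lr_norm (inverse (ennreal \<rho>)) (ev x) = ennreal (lpnorm \<rho> x)"
proof (cases "\<rho> = 0")
  case True
  let ?M = "SUP n. ennreal (cmod (ev x n))"
  have le: "?M \<le> ennreal (lpnorm 0 x)" by (intro SUP_least ennreal_leI cmod_le_lpnorm) simp_all
  define m where "m = enn2real ?M"
  have m: "0 \<le> m" "?M = ennreal m"
    using le_less_trans[OF le ennreal_less_top] by (simp_all add: m_def)
  have "cmod (ev x n) \<le> m" for n
    using SUP_upper[of n UNIV "\<lambda>n. ennreal (cmod (ev x n))"] m by simp
  then have "lpnorm 0 x \<le> m" using m(1) by (intro lpnorm_le pnorm_le) auto
  then show ?thesis using le m True by (simp add: lr_norm_def antisym)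
next
  case False
  then have pos: "0 < \<rho>" using \<rho> by simp
  let ?I = "\<integral>\<^sup>+ n. ennreal (cmod (ev x n) powr (1 / \<rho>)) \<partial>count_space UNIV"
  have le: "?I \<le> ennreal (lpnorm \<rho> x powr (1 / \<rho>))"
  proof (rule nn_integral_count_space_le)
    fix S :: "(int ^ 'd) set" assume S: "finite S"
    have "(\<Sum>n\<in>S. cmod (ev x n) powr (1 / \<rho>)) \<le> lpnorm \<rho> x powr (1 / \<rho>)"
      unfolding pnorm_powr_inverse[OF pos, symmetric]
      using pos by (intro powr_mono2 pnorm_le_lpnorm S \<rho> pnorm_nonneg) simp_all
    then show "(\<Sum>n\<in>S. ennreal (cmod (ev x n) powr (1 / \<rho>))) \<le> ennreal (lpnorm \<rho> x powr (1 / \<rho>))"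
      by (simp add: sum_ennreal ennreal_leI)
  qed
  define i where "i = enn2real ?I"
  have i: "0 \<le> i" "?I = ennreal i"
    using le_less_trans[OF le ennreal_less_top] by (simp_all add: i_def)
  have "i \<le> lpnorm \<rho> x powr (1 / \<rho>)" using le i by simp
  then have "i powr \<rho> \<le> (lpnorm \<rho> x powr (1 / \<rho>)) powr \<rho>" using i pos by (intro powr_mono2) auto
  then have up: "i powr \<rho> \<le> lpnorm \<rho> x" using pos lpnorm_nonneg[OF \<rho>, of x] by (simp add: powr_powr)
  have "lpnorm \<rho> x \<le> i powr \<rho>"
  proof (rule lpnorm_le)
    fix S :: "(int ^ 'd) set" assume S: "finite S"
    have "ennreal (\<Sum>n\<in>S. cmod (ev x n) powr (1 / \<rho>)) \<le> ennreal i"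
      using nn_integral_count_space_ge_sum[OF S, of "\<lambda>n. ennreal (cmod (ev x n) powr (1 / \<rho>))"] i(2)
      by (simp only: sum_ennreal powr_ge_zero)
    then show "pnorm \<rho> S x \<le> i powr \<rho>"
      using i(1) pos by (intro pnorm_le[OF S]) (auto simp: powr_powr)
  qed
  then have "i powr \<rho> = lpnorm \<rho> x" using up by simp
  then show ?thesis
    using pos i by (simp add: lr_norm_def inverse_ennreal ennreal_rpow_ennreal inverse_eq_divide)
qed

lemma lpnorm_interpolation:
  assumes \<kappa>: "0 \<le> \<kappa>" "\<kappa> \<le> 1" and \<rho>': "0 \<le> \<rho>'" "\<rho>' \<le> 1 / 2" and \<rho>: "\<rho> = (1 - \<kappa>) / 2 + \<kappa> * \<rho>'"
  shows "lpnorm \<rho> x \<le> norm x powr (1 - \<kappa>) * lpnorm \<rho>' x powr \<kappa>"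
proof (cases "\<rho> = 0")
  case True
  define z where "z = \<kappa> * \<rho>'"
  have "0 \<le> z" "(1 - \<kappa>) / 2 + z = 0" using \<kappa> \<rho>' True \<rho> by (simp_all add: z_def)
  then have "\<kappa> = 1" using \<kappa> by argo
  then have "\<rho>' = 0" using True \<rho> by simp
  note \<open>\<kappa> = 1\<close> this
  \<comment> \<open>For vanishing \<open>x\<close> the factor
    \<open>norm x powr (1 - \<kappa>)\<close> is \<open>0 powr 0\<close>, which is 0 and not 1, so
    this case is checked apart.\<close>
  moreover have "lpnorm 0 x = 0" if "norm x = 0" using that lpnorm_le_norm[of 0 x] lpnorm_nonneg[of 0 x] by simp
  ultimately show ?thesis using True lpnorm_nonneg[of 0 x] by (cases "norm x = 0") simp_all
next
  case False
  have "0 \<le> \<rho>" unfolding \<rho> using \<kappa> \<rho>' by (intro add_nonneg_nonneg) simp_all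
  then have pos: "0 < \<rho>" using False by simp
  have half: "\<kappa> * \<rho>' \<le> \<kappa> * (1 / 2)" by (rule mult_left_mono) (use \<kappa> \<rho>' in auto)
  show ?thesis
  proof (rule lpnorm_le)
    fix S :: "'a set" assume S: "finite S"
    have "(\<Sum>n\<in>S. cmod (ev x n) powr ((1 - \<kappa>) / \<rho> + \<kappa> / \<rho>))
        \<le> norm x powr ((1 - \<kappa>) / \<rho>) * pnorm \<rho>' S x powr (\<kappa> / \<rho>)"
    proof (rule interpolation_sum[OF S \<rho>'(1)])
      have "(1 - \<kappa>) / \<rho> / 2 + \<kappa> / \<rho> * \<rho>' = ((1 - \<kappa>) / 2 + \<kappa> * \<rho>') / \<rho>" by (simp add: add_divide_distrib)
      then show "(1 - \<kappa>) / \<rho> / 2 + \<kappa> / \<rho> * \<rho>' = 1" using pos unfolding \<rho>[symmetric] by simp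
    qed (use \<kappa> pos in auto)
    also have "(1 - \<kappa>) / \<rho> + \<kappa> / \<rho> = 1 / \<rho>" by (simp add: add_divide_distrib[symmetric])
    also have "norm x powr ((1 - \<kappa>) / \<rho>) * pnorm \<rho>' S x powr (\<kappa> / \<rho>)
        \<le> norm x powr ((1 - \<kappa>) / \<rho>) * lpnorm \<rho>' x powr (\<kappa> / \<rho>)"
      using \<kappa> pos by (intro mult_left_mono powr_mono2 pnorm_le_lpnorm S \<rho>' pnorm_nonneg) auto
    also have "\<dots> = (norm x powr (1 - \<kappa>) * lpnorm \<rho>' x powr \<kappa>) powr (1 / \<rho>)"
      by (simp add: powr_mult powr_powr)
    finally show "pnorm \<rho> S x \<le> norm x powr (1 - \<kappa>) * lpnorm \<rho>' x powr \<kappa>"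
      using pos by (intro pnorm_le[OF S]) auto
  qed
qed

text \<open>
  The exponent \<open>\<rho> = 1 / 2 - 3 / (D q)\<close> is \<open>1 / r\<close> for the pair \<open>(q, r)\<close> on the boundary of the
  admissible region in dimension \<open>D\<close>.
\<close>

lemma dual_norm_nonlin_le:
  fixes x :: "'a::countable ell2"
  assumes S: "finite S" and D: "0 < D" and p: "6 / D \<le> p" and x: "norm x \<le> 1" and c: "cmod c = 1"
    and q: "1 < q" "q \<le> q1" "q1 \<le> 2 + 6 / D"
    and \<rho>: "\<rho> = 1 / 2 - 3 / (D * q)" "0 \<le> \<rho>" and \<rho>1: "\<rho>1 = 1 / 2 - 3 / (D * q1)" "0 \<le> \<rho>1"
  shows "dual_norm \<rho> S (nonlin c 1 p x) powr (q / (q - 1))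
    \<le> norm x powr ((1 + 6 / D) * (q / (q - 1)) - q1) * lpnorm \<rho>1 x powr q1"
proof -
  define q' where "q' = q / (q - 1)"
  define A where "A = 1 + 6 / D - q1 / q'"
  have q': "0 < q'" using q by (simp add: q'_def)
  have p0: "0 \<le> p" using D p by (meson divide_nonneg_pos order_trans zero_le_numeral)
  have inv: "q1 / q' = q1 - q1 / q" using q by (simp add: q'_def field_simps)
  have "1 \<le> q1 / q" using q by simp
  \<comment> \<open>This is where \<open>q1 \<le> 2 + 6 / D\<close> enters: the power of the l^2
    norm left over by Hoelder's inequality is nonnegative.\<close>
  then have A: "0 \<le> A" using q(3) unfolding A_def inv by linarith
  have \<rho>l: "\<rho> < 1 / 2" "\<rho>1 < 1 / 2" using D q \<rho>(1) \<rho>1(1) by auto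
  \<comment> \<open>The reason for the power 1 + 6/D: with both pairs on the boundary line, the
    exponents of Hoelder's inequality add up exactly for this power.\<close>
  have half: "A / 2 + q1 / q' * \<rho>1 = 1 - \<rho>"
    using D q unfolding A_def inv \<rho>(1) \<rho>1(1) by (simp add: field_simps)
  have "mass \<rho> S (nonlin c 1 p x) \<le> (\<Sum>n\<in>S. cmod (ev x n) powr (A / (1 - \<rho>) + q1 / q' / (1 - \<rho>)))"
    unfolding mass_def
  proof (rule sum_mono)
    fix n
    have z: "cmod (ev x n) \<le> 1" using norm_ev_le[of x n] x by simp
    have "cmod (ev (nonlin c 1 p x) n) = cmod (ev x n) powr p * cmod (ev x n)"
      using z p0 c by (simp add: ev_nonlin cut_power_def norm_mult)
    also have "\<dots> = cmod (ev x n) powr (1 + p)" using powr_mult_base[of "cmod (ev x n)" p] by (simp add: mult.commute)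
    also have "\<dots> \<le> cmod (ev x n) powr (1 + 6 / D)" using p z by (intro powr_mono') auto
    finally have "cmod (ev (nonlin c 1 p x) n) powr (1 / (1 - \<rho>)) \<le> (cmod (ev x n) powr (1 + 6 / D)) powr (1 / (1 - \<rho>))"
      using \<rho>l by (intro powr_mono2) auto
    also have "\<dots> = cmod (ev x n) powr (A / (1 - \<rho>) + q1 / q' / (1 - \<rho>))"
    proof -
      have "(1 + 6 / D) * (1 / (1 - \<rho>)) = A / (1 - \<rho>) + q1 / q' / (1 - \<rho>)"
        by (simp only: A_def add_divide_distrib[symmetric]) simp
      then show ?thesis by (simp only: powr_powr)
    qed
    finally show "cmod (ev (nonlin c 1 p x) n) powr (1 / (1 - \<rho>)) \<le> cmod (ev x n) powr (A / (1 - \<rho>) + q1 / q' / (1 - \<rho>))" .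
  qed
  also have "\<dots> \<le> norm x powr (A / (1 - \<rho>)) * pnorm \<rho>1 S x powr (q1 / q' / (1 - \<rho>))"
  proof (rule interpolation_sum[OF S \<rho>1(2)])
    have "A / (1 - \<rho>) / 2 + q1 / q' / (1 - \<rho>) * \<rho>1 = (A / 2 + q1 / q' * \<rho>1) / (1 - \<rho>)"
      by (simp add: add_divide_distrib)
    then show "A / (1 - \<rho>) / 2 + q1 / q' / (1 - \<rho>) * \<rho>1 = 1" unfolding half using \<rho>l by simp
  qed (use A q q' \<rho>l in auto)
  also have "\<dots> \<le> norm x powr (A / (1 - \<rho>)) * lpnorm \<rho>1 x powr (q1 / q' / (1 - \<rho>))"
    using q q' \<rho>l \<rho>1(2) by (intro mult_left_mono powr_mono2 pnorm_le_lpnorm S pnorm_nonneg) auto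
  finally have "mass \<rho> S (nonlin c 1 p x) powr ((1 - \<rho>) * q')
      \<le> (norm x powr (A / (1 - \<rho>)) * lpnorm \<rho>1 x powr (q1 / q' / (1 - \<rho>))) powr ((1 - \<rho>) * q')"
    using \<rho>l q' by (intro powr_mono2 mass_nonneg) auto
  also have "\<dots> = norm x powr (A / (1 - \<rho>) * ((1 - \<rho>) * q')) * lpnorm \<rho>1 x powr (q1 / q' / (1 - \<rho>) * ((1 - \<rho>) * q'))"
    by (simp only: powr_mult powr_powr)
  also have "A / (1 - \<rho>) * ((1 - \<rho>) * q') = (1 + 6 / D) * q' - q1"
  proof -
    have "A / (1 - \<rho>) * ((1 - \<rho>) * q') = A * q'" using \<rho>l by simp
    also have "\<dots> = (1 + 6 / D) * q' - q1" using q' unfolding A_def left_diff_distrib by simp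
    finally show ?thesis .
  qed
  also have "q1 / q' / (1 - \<rho>) * ((1 - \<rho>) * q') = q1" using \<rho>l q' by simp
  finally show ?thesis unfolding dual_norm_def powr_powr q'_def[symmetric] .
qed

section \<open>Time integrals: from bounded intervals to the half-line\<close>

lemma nn_integral_Icc_eq_integral:
  fixes h :: "real \<Rightarrow> real"
  assumes h [measurable]: "h \<in> borel_measurable borel" and b: "\<And>t. t \<in> {0..T} \<Longrightarrow> 0 \<le> h t" "\<And>t. t \<in> {0..T} \<Longrightarrow> h t \<le> B"
  shows "h integrable_on {0..T}"
    and "(\<integral>\<^sup>+ t. ennreal (h t) * indicator {0..T} t \<partial>lborel) = ennreal (integral {0..T} h)"
proof -
  have int: "set_integrable lborel {0..T} h"
    unfolding set_integrable_def
  proof (rule Bochner_Integration.integrable_bound)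
    show "integrable lborel (\<lambda>t. B * indicat_real {0..T} t)"
      using emeasure_lborel_Icc_finite by (intro integrable_mult_right integrable_real_indicator) auto
    show "AE t in lborel. norm (indicator {0..T} t *\<^sub>R h t) \<le> norm (B * indicat_real {0..T} t)"
    proof (rule AE_I2)
      fix t show "norm (indicator {0..T} t *\<^sub>R h t) \<le> norm (B * indicat_real {0..T} t)"
        using b[of t] by (cases "t \<in> {0..T}") auto
    qed
  qed measurable
  show "h integrable_on {0..T}" by (rule set_borel_integral_eq_integral(1)[OF int])
  have "(\<integral>\<^sup>+ t. ennreal (h t) * indicator {0..T} t \<partial>lborel) = (\<integral>\<^sup>+ t. ennreal (indicator {0..T} t *\<^sub>R h t) \<partial>lborel)"
    by (intro nn_integral_cong) (simp add: indicator_def)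
  also have "\<dots> = ennreal (\<integral>t. indicator {0..T} t *\<^sub>R h t \<partial>lborel)"
    using int b(1) by (intro nn_integral_eq_integral) (auto simp: set_integrable_def indicator_def)
  also have "(\<integral>t. indicator {0..T} t *\<^sub>R h t \<partial>lborel) = integral {0..T} h"
    using set_borel_integral_eq_integral(2)[OF int] by (simp add: set_lebesgue_integral_def)
  finally show "(\<integral>\<^sup>+ t. ennreal (h t) * indicator {0..T} t \<partial>lborel) = ennreal (integral {0..T} h)" .
qed

lemma nn_integral_half_line_le:
  assumes f [measurable]: "f \<in> borel_measurable borel"
    and le: "\<And>T::real. 0 \<le> T \<Longrightarrow> (\<integral>\<^sup>+ t. f t * indicator {0..T} t \<partial>lborel) \<le> C"
  shows "(\<integral>\<^sup>+ t. f t * indicator {0..} t \<partial>lborel) \<le> C"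
proof -
  let ?f = "\<lambda>k t. f t * indicator {0..real k} t"
  have inc: "incseq ?f" by (intro incseq_SucI le_funI mult_left_mono) (auto simp: indicator_def)
  have "f t * indicator {0..} t = (SUP k. ?f k t)" for t
  proof (rule antisym)
    obtain k where "t \<le> real k" using real_arch_simple by blast
    then have "f t * indicator {0..} t \<le> ?f k t" by (simp add: indicator_def)
    also have "\<dots> \<le> (SUP k. ?f k t)" by (rule SUP_upper) simp
    finally show "f t * indicator {0..} t \<le> (SUP k. ?f k t)" .
    show "(SUP k. ?f k t) \<le> f t * indicator {0..} t" by (rule SUP_least) (simp add: indicator_def)
  qed
  then have "(\<integral>\<^sup>+ t. f t * indicator {0..} t \<partial>lborel) = (SUP k. integral\<^sup>N lborel (?f k))"
    by (simp add: nn_integral_monotone_convergence_SUP[OF inc])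
  also have "\<dots> \<le> C" by (rule SUP_least) (rule le, simp)
  finally show ?thesis .
qed

text \<open>A value of at least \<open>e\<close> at \<open>t\<close> persists above
  \<open>e / 2\<close> on an interval of fixed length after \<open>t\<close>, by the one-sided
  Lipschitz bound, and contributes a fixed amount to the integral. Beyond \<open>T0\<close> less
  than this amount is left.\<close>

lemma tendsto_0_of_integral_bound:
  fixes \<phi> :: "real \<Rightarrow> real"
  assumes L: "0 < L" and lip: "\<And>s t. 0 \<le> s \<Longrightarrow> s \<le> t \<Longrightarrow> \<phi> s \<le> \<phi> t + L * (t - s)" and nn: "\<And>t. 0 \<le> \<phi> t" and q: "0 < q"
    and int: "\<And>T. 0 \<le> T \<Longrightarrow> (\<lambda>t. \<phi> t powr q) integrable_on {0..T}"
    and M: "\<And>T. 0 \<le> T \<Longrightarrow> integral {0..T} (\<lambda>t. \<phi> t powr q) \<le> M"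
  shows "(\<phi> \<longlongrightarrow> 0) at_top"
proof (rule tendstoI)
  fix e :: real assume e: "0 < e"
  define \<delta> where "\<delta> = e / (2 * L)"
  have \<delta>: "0 < \<delta>" using e L by (simp add: \<delta>_def)
  define g where "g T = integral {0..T} (\<lambda>t. \<phi> t powr q)" for T
  have bdd: "bdd_above (g ` {0..})" using M by (intro bdd_aboveI2[of _ _ M]) (simp add: g_def)
  define s where "s = (SUP T\<in>{0..}. g T)"
  have "0 < (e / 2) powr q * \<delta>" using e \<delta> by simp
  then obtain T0 where T0: "0 \<le> T0" "s - (e / 2) powr q * \<delta> < g T0"
    using less_cSUP_iff[OF _ bdd, of "s - (e / 2) powr q * \<delta>"] by (auto simp: s_def)
  have step: "g b = g a + integral {a..b} (\<lambda>t. \<phi> t powr q)" "(\<lambda>t. \<phi> t powr q) integrable_on {a..b}" if "0 \<le> a" "a \<le> b" for a b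
  proof -
    show "g b = g a + integral {a..b} (\<lambda>t. \<phi> t powr q)"
      unfolding g_def using that int[of b] by (intro Henstock_Kurzweil_Integration.integral_combine[symmetric]) auto
    show "(\<lambda>t. \<phi> t powr q) integrable_on {a..b}"
      by (rule integrable_on_subinterval[OF int[of b]]) (use that in auto)
  qed
  have "\<phi> t < e" if t: "T0 + \<delta> \<le> t" for t
  proof (rule ccontr)
    assume "\<not> \<phi> t < e"
    then have big: "e \<le> \<phi> t" by simp
    have ab: "0 \<le> t" "t \<le> t + \<delta>" using t T0 \<delta> by auto
    have "\<phi> t \<le> \<phi> r + L * \<delta>" if "r \<in> {t..t + \<delta>}" for r
    proof -
      have "L * (r - t) \<le> L * \<delta>" using that L by (intro mult_left_mono) auto
      then show ?thesis using lip[of t r] that ab by auto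
    qed
    then have low: "e / 2 \<le> \<phi> r" if "r \<in> {t..t + \<delta>}" for r
      using that big L by (fastforce simp: \<delta>_def)
    have "integral {t..t + \<delta>} (\<lambda>r. (e / 2) powr q) \<le> integral {t..t + \<delta>} (\<lambda>r. \<phi> r powr q)"
      using low e q step(2)[OF ab] by (intro integral_le) (auto intro!: powr_mono2)
    then have "g t + (e / 2) powr q * \<delta> \<le> g (t + \<delta>)" using step(1)[OF ab] \<delta> by (simp add: mult.commute)
    moreover have "g T0 \<le> g t"
    proof -
      have "0 \<le> integral {T0..t} (\<lambda>t. \<phi> t powr q)"
        using T0 t \<delta> by (intro Henstock_Kurzweil_Integration.integral_nonneg step(2)) auto
      then show ?thesis using step(1)[of T0 t] T0 t \<delta> by simp
    qed
    moreover have "g (t + \<delta>) \<le> s" unfolding s_def using ab by (intro cSUP_upper bdd) auto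
    ultimately show False using T0 by linarith
  qed
  then show "\<forall>\<^sub>F t in at_top. dist (\<phi> t) 0 < e"
    using nn by (intro eventually_at_top_linorderI[of "T0 + \<delta>"]) simp
qed

section \<open>Small solutions\<close>

lemma ennreal_rpow_le:
  assumes "x \<le> ennreal M" "0 \<le> M" "0 < a"
  shows "ennreal_rpow x a \<le> ennreal (M powr a)"
proof -
  have "x \<noteq> \<infinity>" using assms(1) by (auto simp: top_unique)
  moreover have "enn2real x \<le> M" using assms by (intro enn2real_leI)
  ultimately show ?thesis using assms by (auto simp: ennreal_rpow_def intro!: ennreal_leI powr_mono2)
qed

definition admissible_rho :: "nat \<Rightarrow> real \<Rightarrow> real" where
  "admissible_rho d q = 1 / 2 - 3 / (real d * q)"

text \<open>
  The time exponent of the bootstrap, the smallest admissible one except for \<open>d = 3\<close>, where \<open>q = 2\<close>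
  is excluded on the boundary and any \<open>q\<close> with \<open>2 < q \<le> 4\<close> would do.
\<close>

definition base_q :: "nat \<Rightarrow> real" where
  "base_q d = (if d \<le> 2 then 6 / real d else if d = 3 then 4 else 2)"

text \<open>The bound \<open>2 + 6 / real d\<close> keeps the power of the l^2 norm in
  \<open>dual_norm_nonlin_le\<close> nonnegative; in dimension three it is attained.\<close>

lemma base_q_bounds:
  assumes "0 < d"
  shows "2 \<le> base_q d" "base_q d \<le> 2 + 6 / real d" "0 \<le> admissible_rho d (base_q d)"
proof -
  consider "d = 1" | "d = 2" | "d = 3" | "d \<ge> 4" using assms by linarith
  then have "2 \<le> base_q d \<and> base_q d \<le> 2 + 6 / real d \<and> 0 \<le> admissible_rho d (base_q d)"
    by cases (simp_all add: base_q_def admissible_rho_def)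
  then show "2 \<le> base_q d" "base_q d \<le> 2 + 6 / real d" "0 \<le> admissible_rho d (base_q d)" by simp_all
qed

text \<open>Outside dimension three the base exponent is enough. In dimension three all q > 2 are
  kept, because interpolation of the base exponent 4 with the mass reaches only q >= 4.\<close>

lemma ex_dual_bound:
  assumes "CARD('d::finite) \<noteq> 3 \<and> q = base_q CARD('d) \<or> CARD('d) = 3 \<and> 2 < q"
  shows "\<exists>C\<ge>0. dual_bound TYPE('d) (admissible_rho CARD('d) q) (q / (q - 1)) C"
proof -
  consider "CARD('d) \<le> 2" "q = 6 / real CARD('d)" | "CARD('d) = 3" "2 < q" | "CARD('d) \<ge> 4" "q = 2"
  proof (cases "CARD('d) = 3")
    case False
    then consider "CARD('d) \<le> 2" | "CARD('d) \<ge> 4" by linarith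
    then show ?thesis using False assms that(1,3) by cases (simp_all add: base_q_def)
  qed (use assms that(2) in simp)
  then show ?thesis
  proof cases
    case 1
    have "CARD('d) = 1 \<or> CARD('d) = 2" using 1(1) zero_less_card_finite[where 'a = 'd] by linarith
    then have "q / (q - 1) = 6 / (6 - real CARD('d))" "admissible_rho CARD('d) q = 0"
      using 1(2) by (auto simp: admissible_rho_def)
    then show ?thesis using dual_bound_low_dimension[OF 1(1)] by metis
  next
    case 2
    define \<rho> where "\<rho> = admissible_rho CARD('d) q"
    have \<rho>: "\<rho> = 1 / 2 - 1 / q" using 2 by (simp add: \<rho>_def admissible_rho_def)
    have "1 / q < 1 / 2" "0 < 1 / q" using 2 by simp_all
    then have "0 < \<rho>" "\<rho> < 1 / 2" unfolding \<rho> by linarith+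
    then obtain C where "0 \<le> C" "dual_bound TYPE('d) \<rho> (1 / (1 / 2 + \<rho>)) C"
      using dual_bound_dimension_3[OF 2(1)] by metis
    moreover have "1 / (1 / 2 + \<rho>) = q / (q - 1)" using 2 unfolding \<rho> by (simp add: field_simps)
    ultimately show ?thesis unfolding \<rho>_def by auto
  next
    case 3
    have "1 < real CARD('d) / 3" using 3 by simp
    then obtain C where C: "dual_bound TYPE('d) (1 / 2 - 1 / (2 * (real CARD('d) / 3))) 2 C"
      using dual_bound_endpoint[OF refl _ refl] by blast
    have "1 / 2 - 1 / (2 * (real CARD('d) / 3)) = admissible_rho CARD('d) q" "q / (q - 1) = 2"
      using 3 by (simp_all add: admissible_rho_def)
    with C have "dual_bound TYPE('d) (admissible_rho CARD('d) q) (q / (q - 1)) C" by simp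
    then have "dual_bound TYPE('d) (admissible_rho CARD('d) q) (q / (q - 1)) (max 0 C)"
      unfolding dual_bound_def by (meson max.coboundedI2)
    then show ?thesis by (meson max.cobounded1)
  qed
qed

text \<open>A small solution of the equation truncated at level 1, which is the true one for entries
  of modulus at most 1. The parameters \<open>dim\<close>, \<open>q1\<close>, \<open>\<rho>1\<close>
  and \<open>rho\<close> name expressions in the dimension and keep the case distinction in
  \<open>base_q\<close> out of the exponent arithmetic.\<close>

locale small_solution =
  fixes u :: "real \<Rightarrow> (int ^ 'd::finite) ell2" and x :: "(int ^ 'd) ell2" and c :: complex and p \<epsilon> :: real
    and dim q1 \<rho>1 :: real and rho :: "real \<Rightarrow> real"
  assumes dim_eq: "dim = real CARD('d)" and q1_eq: "q1 = base_q CARD('d)"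
    and rho_eq: "rho = admissible_rho CARD('d)" and \<rho>1_eq: "\<rho>1 = rho q1"
    and cont: "continuous_on UNIV u"
    and duh: "\<And>t. 0 \<le> t \<Longrightarrow> u t = propag t x + integral {0..t} (\<lambda>s. propag (t - s) (nonlin c 1 p (u s)))"
    and norm_le: "\<And>t. 0 \<le> t \<Longrightarrow> norm (u t) \<le> \<epsilon>" and norm_x: "norm x \<le> \<epsilon>"
    and eps: "0 < \<epsilon>" "\<epsilon> \<le> 1" and c: "cmod c = 1" and p: "6 / dim \<le> p"
begin

lemma dim: "0 < dim" by (simp add: dim_eq)

lemma rho: "rho q = 1 / 2 - 3 / (dim * q)"
  by (simp add: rho_eq dim_eq admissible_rho_def)

lemma rho_less: "0 < q \<Longrightarrow> rho q < 1 / 2"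
  using dim by (simp add: rho)

lemma q1: "2 \<le> q1" "q1 \<le> 2 + 6 / dim" "0 \<le> \<rho>1" "\<rho>1 < 1 / 2" "\<rho>1 \<le> 1 / 2"
  using base_q_bounds[of "CARD('d)"] rho_less[of q1] by (auto simp: dim_eq q1_eq \<rho>1_eq rho_eq)

lemma measurable_u: "u \<in> borel_measurable borel"
  using cont by (rule borel_measurable_continuous_onI)

lemma measurable_lpnorm_powr:
  assumes "0 \<le> \<rho>" "\<rho> \<le> 1 / 2"
  shows "(\<lambda>t. lpnorm \<rho> (u t) powr q) \<in> borel_measurable borel"
proof -
  have [measurable]: "(\<lambda>t. lpnorm \<rho> (u t)) \<in> borel_measurable borel" by (rule borel_measurable_lpnorm[OF measurable_u assms])
  show ?thesis by measurable
qed

lemma measurable_base [measurable]: "(\<lambda>t. lpnorm \<rho>1 (u t)) \<in> borel_measurable borel"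
  by (rule borel_measurable_lpnorm[OF measurable_u q1(3,5)])

text \<open>A bound on the base norm controls the nonlinearity in the dual norm of any pair with
  \<open>q \<le> q1\<close>, the remaining power of the solution being taken from the mass; the
  Strichartz estimate then returns a bound for that pair. With \<open>q = q1\<close> it drives the
  bootstrap, with \<open>q < q1\<close> it gives the remaining pairs in dimension three.\<close>

lemma strichartz_of_base:
  assumes bound: "dual_bound TYPE('d) (rho q) (q / (q - 1)) C" and C: "0 \<le> C" and q: "1 < q" "q \<le> q1" "0 \<le> rho q"
    and T: "0 \<le> T" and Y: "0 \<le> Y" "(\<integral>\<^sup>+ t. ennreal (lpnorm \<rho>1 (u t) powr q1) * indicator {0..T} t \<partial>lborel) \<le> ennreal Y"
    and a: "0 < a" "\<epsilon> powr ((1 + 6 / dim) * (q / (q - 1)) - q1) * Y \<le> a powr (q / (q - 1))"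
  shows "(\<integral>\<^sup>+ t. ennreal (lpnorm (rho q) (u t) powr q) * indicator {0..T} t \<partial>lborel) \<le> ennreal ((sqrt C * \<epsilon> + C * a) powr q)"
proof -
  have \<rho>: "rho q < 1 / 2" using q by (intro rho_less) auto
  let ?N = "\<lambda>t. nonlin c 1 p (u t)"
  define E where "E = (1 + 6 / dim) * (q / (q - 1)) - q1"
  have p0: "0 \<le> p" using p dim by (meson divide_nonneg_pos order_trans zero_le_numeral)
  have E: "0 \<le> E"
  proof -
    have "q1 * (q - 1) \<le> (1 + 6 / dim) * q"
    proof -
      have "(q1 - (1 + 6 / dim)) * q \<le> 1 * q" using q1(2) q by (intro mult_right_mono) auto
      then show ?thesis using q by (simp add: algebra_simps)
    qed
    then have "q1 \<le> (1 + 6 / dim) * q / (q - 1)" using q by (simp add: pos_le_divide_eq)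
    then show ?thesis by (simp add: E_def)
  qed
  have fa: "(\<integral>\<^sup>+ t. ennreal (dual_norm (rho q) S (?N t) powr (q / (q - 1))) * indicator {0..T} t \<partial>lborel)
      \<le> ennreal (a powr (q / (q - 1)))" if S: "finite S" for S :: "(int ^ 'd) set"
  proof -
    have "(\<integral>\<^sup>+ t. ennreal (dual_norm (rho q) S (?N t) powr (q / (q - 1))) * indicator {0..T} t \<partial>lborel)
        \<le> (\<integral>\<^sup>+ t. ennreal (\<epsilon> powr E) * (ennreal (lpnorm \<rho>1 (u t) powr q1) * indicator {0..T} t) \<partial>lborel)"
    proof (rule nn_integral_mono)
      fix t
      show "ennreal (dual_norm (rho q) S (?N t) powr (q / (q - 1))) * indicator {0..T} t
          \<le> ennreal (\<epsilon> powr E) * (ennreal (lpnorm \<rho>1 (u t) powr q1) * indicator {0..T} t)"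
      proof (cases "t \<in> {0..T}")
        case True
        then have n: "norm (u t) \<le> \<epsilon>" using norm_le by simp
        then have "norm (u t) \<le> 1" using eps by simp
        then have "dual_norm (rho q) S (?N t) powr (q / (q - 1)) \<le> norm (u t) powr E * lpnorm \<rho>1 (u t) powr q1"
          unfolding E_def
          by (intro dual_norm_nonlin_le[OF S dim p _ c q(1,2) q1(2) rho q(3) _ q1(3)]) (auto simp: \<rho>1_eq rho)
        also have "\<dots> \<le> \<epsilon> powr E * lpnorm \<rho>1 (u t) powr q1"
          using n E by (intro mult_right_mono powr_mono2) auto
        finally show ?thesis using True by (simp add: ennreal_mult'[symmetric] ennreal_leI)
      qed simp
    qed
    also have "\<dots> = ennreal (\<epsilon> powr E) * (\<integral>\<^sup>+ t. ennreal (lpnorm \<rho>1 (u t) powr q1) * indicator {0..T} t \<partial>lborel)"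
      by (intro nn_integral_cmult) measurable
    also have "\<dots> \<le> ennreal (\<epsilon> powr E) * ennreal Y" by (intro mult_left_mono Y) simp
    also have "\<dots> = ennreal (\<epsilon> powr E * Y)" using Y by (simp add: ennreal_mult)
    also have "\<dots> \<le> ennreal (a powr (q / (q - 1)))" using a(2) by (intro ennreal_leI) (simp add: E_def)
    finally show ?thesis .
  qed
  have N: "continuous_on UNIV ?N" by (rule continuous_on_nonlin[OF _ p0 c cont]) simp
  have "(\<integral>\<^sup>+ t. ennreal (lpnorm (rho q) (u t) powr q) * indicator {0..T} t \<partial>lborel) \<le> ennreal ((sqrt C * norm x + C * a) powr q)"
  proof (rule nn_integral_lpnorm_le[OF measurable_u q(3)])
    fix S :: "(int ^ 'd) set" assume S: "finite S"
    show "(\<integral>\<^sup>+ t. ennreal (pnorm (rho q) S (u t) powr q) * indicator {0..T} t \<partial>lborel) \<le> ennreal ((sqrt C * norm x + C * a) powr q)"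
      by (rule strichartz_truncated[OF bound C q(3) \<rho> q(1) N cont T _ a(1) fa S]) (auto intro: duh)
  qed (use \<rho> q in auto)
  also have "\<dots> \<le> ennreal ((sqrt C * \<epsilon> + C * a) powr q)"
    using C a q norm_x by (intro ennreal_leI powr_mono2 add_right_mono mult_left_mono) auto
  finally show ?thesis .
qed

end

text \<open>
  The bootstrap: since the integral \<open>g T\<close> below is continuous in \<open>T\<close> and vanishes at \<open>T = 0\<close>,
  it could only exceed the bound by attaining it, where the Strichartz estimate gives a strict
  inequality.
\<close>

locale small_solution_bound = small_solution u x c p \<epsilon> dim q1 \<rho>1 rho
  for u :: "real \<Rightarrow> (int ^ 'd::finite) ell2" and x c p \<epsilon> dim q1 \<rho>1 rho +
  fixes C K :: real
  assumes base: "dual_bound TYPE('d) \<rho>1 (q1 / (q1 - 1)) C" "0 \<le> C"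
    and K: "1 \<le> K" "sqrt C \<le> K" "C \<le> K" and small: "(2 * K) powr (q1 - 1) * \<epsilon> powr (6 / dim) < 1"
begin

lemma base_estimate_truncated:
  assumes T: "0 \<le> T"
  shows "(\<integral>\<^sup>+ t. ennreal (lpnorm \<rho>1 (u t) powr q1) * indicator {0..T} t \<partial>lborel) \<le> ennreal ((2 * K * \<epsilon>) powr q1)"
proof -
  define Z where "Z = 2 * K * \<epsilon>"
  have Z: "0 < Z" using K eps by (simp add: Z_def)
  define h where "h t = lpnorm \<rho>1 (u t) powr q1" for t
  have h: "h \<in> borel_measurable borel" unfolding h_def[abs_def] by (rule measurable_lpnorm_powr[OF q1(3,5)])
  have h1: "h t \<le> 1" if "0 \<le> t" for t
  proof -
    have "lpnorm \<rho>1 (u t) \<le> 1" using lpnorm_le_norm[OF q1(3,5), of "u t"] norm_le[OF that] eps by simp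
    then have "h t \<le> 1 powr q1" unfolding h_def using q1 lpnorm_nonneg[OF q1(3,5)] by (intro powr_mono2) auto
    then show ?thesis by simp
  qed
  have h0: "0 \<le> h t" for t by (simp add: h_def)
  define g where "g T = integral {0..T} h" for T
  have g: "h integrable_on {0..T}" "(\<integral>\<^sup>+ t. ennreal (h t) * indicator {0..T} t \<partial>lborel) = ennreal (g T)" for T
    unfolding g_def using nn_integral_Icc_eq_integral[OF h, of T 1] h0 h1 by auto
  have "g T \<le> Z powr q1"
  proof (rule ccontr)
    assume "\<not> g T \<le> Z powr q1"
    moreover have "continuous_on {0..T} g" unfolding g_def[abs_def] by (rule indefinite_integral_continuous_1[OF g(1)])
    moreover have "g 0 \<le> Z powr q1" by (simp add: g_def)
    ultimately obtain S where S: "0 \<le> S" "g S = Z powr q1"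
      using IVT'[of g 0 "Z powr q1" T] T by auto
    \<comment> \<open>With \<open>a = \<epsilon> * m\<close> the hypothesis of
      \<open>strichartz_of_base\<close> holds with equality for \<open>Y = Z powr q1\<close>. The
      smallness assumption is \<open>m < 1\<close>, and it makes the returned bound strictly smaller
      than \<open>Z\<close>.\<close>
    define m where "m = (2 * K) powr (q1 - 1) * \<epsilon> powr (6 / dim)"
    have m: "0 < m" "m < 1" using small K eps by (simp_all add: m_def)
    define q' where "q' = q1 / (q1 - 1)"
    have q': "(q1 - 1) * q' = q1" using q1 by (simp add: q'_def)
    have "(\<epsilon> * m) powr q' = \<epsilon> powr q' * ((2 * K) powr ((q1 - 1) * q') * \<epsilon> powr (6 / dim * q'))"
      by (simp only: m_def powr_mult powr_powr)
    also have "\<dots> = \<epsilon> powr (q' + 6 / dim * q') * (2 * K) powr q1"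
      unfolding q' by (simp only: powr_add mult_ac)
    also have "q' + 6 / dim * q' = ((1 + 6 / dim) * q' - q1) + q1" by (simp add: algebra_simps)
    also have "\<epsilon> powr (((1 + 6 / dim) * q' - q1) + q1) * (2 * K) powr q1 = \<epsilon> powr ((1 + 6 / dim) * q' - q1) * Z powr q1"
      by (simp only: powr_add Z_def powr_mult mult_ac)
    finally have a: "\<epsilon> powr ((1 + 6 / dim) * (q1 / (q1 - 1)) - q1) * Z powr q1 \<le> (\<epsilon> * m) powr (q1 / (q1 - 1))"
      by (simp add: q'_def)
    have "(\<integral>\<^sup>+ t. ennreal (lpnorm \<rho>1 (u t) powr q1) * indicator {0..S} t \<partial>lborel) \<le> ennreal ((sqrt C * \<epsilon> + C * (\<epsilon> * m)) powr q1)"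
    proof (rule strichartz_of_base[where q = q1, folded \<rho>1_eq, OF base _ _ q1(3) S(1) _ _ _ a])
      show "(\<integral>\<^sup>+ t. ennreal (lpnorm \<rho>1 (u t) powr q1) * indicator {0..S} t \<partial>lborel) \<le> ennreal (Z powr q1)"
        using g(2)[of S] S by (simp add: h_def)
    qed (use q1 eps m in auto)
    then have "ennreal (Z powr q1) \<le> ennreal ((sqrt C * \<epsilon> + C * (\<epsilon> * m)) powr q1)"
      using g(2)[of S] S by (simp add: h_def)
    then have le: "Z powr q1 \<le> (sqrt C * \<epsilon> + C * (\<epsilon> * m)) powr q1" by simp
    have "sqrt C * \<epsilon> \<le> K * \<epsilon>" using K eps by (intro mult_right_mono) auto
    moreover have "C * (\<epsilon> * m) \<le> K * (\<epsilon> * m)" using K eps m by (intro mult_right_mono) auto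
    moreover have "K * (\<epsilon> * m) < K * \<epsilon>" using K eps m by simp
    ultimately have "sqrt C * \<epsilon> + C * (\<epsilon> * m) < Z" by (simp add: Z_def)
    moreover have "0 \<le> sqrt C * \<epsilon> + C * (\<epsilon> * m)" using base(2) eps m by simp
    ultimately have "(sqrt C * \<epsilon> + C * (\<epsilon> * m)) powr q1 < Z powr q1" using q1 by (intro powr_less_mono2) auto
    then show False using le by simp
  qed
  then show ?thesis using g(2)[of T] by (simp add: h_def Z_def ennreal_leI)
qed

lemma base_estimate:
  "(\<integral>\<^sup>+ t. ennreal (lpnorm \<rho>1 (u t) powr q1) * indicator {0..} t \<partial>lborel) \<le> ennreal ((2 * K * \<epsilon>) powr q1)"
  by (rule nn_integral_half_line_le[OF _ base_estimate_truncated]) measurable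

text \<open>The pair of \<open>q\<close> on the boundary line lies between the mass and the base
  pair with weight \<open>q1 / q\<close>, so the integrand is at most
  \<open>\<epsilon> powr (q - q1)\<close> times the base integrand; smaller \<open>\<rho>\<close>
  follow by nesting. Since \<open>2 * K \<ge> 1\<close>, one constant serves all these
  pairs.\<close>

lemma strichartz_above_base:
  assumes q: "q1 \<le> q" and \<rho>: "0 \<le> \<rho>" "\<rho> \<le> rho q"
  shows "(\<integral>\<^sup>+ t. ennreal (lpnorm \<rho> (u t) powr q) * indicator {0..} t \<partial>lborel) \<le> ennreal ((2 * K * \<epsilon>) powr q)"
proof -
  have q0: "0 < q" "q1 / q \<le> 1" "0 \<le> q1 / q" using q q1 by auto
  have half: "rho q \<le> 1 / 2" using q0 rho_less[of q] by simp
  have conv: "rho q = (1 - q1 / q) / 2 + q1 / q * \<rho>1"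
    using q0 q1 dim by (simp add: \<rho>1_eq rho field_simps)
  have le: "lpnorm \<rho> (u t) powr q \<le> \<epsilon> powr (q - q1) * lpnorm \<rho>1 (u t) powr q1" if t: "0 \<le> t" for t
  proof -
    have "lpnorm \<rho> (u t) \<le> norm (u t) powr (1 - q1 / q) * lpnorm \<rho>1 (u t) powr (q1 / q)"
      using lpnorm_mono[OF \<rho> half] lpnorm_interpolation[OF q0(3,2) q1(3,5) conv] order_trans by blast
    also have "\<dots> \<le> \<epsilon> powr (1 - q1 / q) * lpnorm \<rho>1 (u t) powr (q1 / q)"
      using norm_le[OF t] q0 by (intro mult_right_mono powr_mono2) auto
    finally have "lpnorm \<rho> (u t) powr q \<le> (\<epsilon> powr (1 - q1 / q) * lpnorm \<rho>1 (u t) powr (q1 / q)) powr q"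
      using q0 \<rho> half by (intro powr_mono2 lpnorm_nonneg) auto
    also have "\<dots> = \<epsilon> powr ((1 - q1 / q) * q) * lpnorm \<rho>1 (u t) powr (q1 / q * q)"
      by (simp only: powr_mult powr_powr)
    also have "(1 - q1 / q) * q = q - q1" using q0 by (simp add: field_simps)
    finally show ?thesis using q0 by simp
  qed
  have "(\<integral>\<^sup>+ t. ennreal (lpnorm \<rho> (u t) powr q) * indicator {0..} t \<partial>lborel)
      \<le> (\<integral>\<^sup>+ t. ennreal (\<epsilon> powr (q - q1)) * (ennreal (lpnorm \<rho>1 (u t) powr q1) * indicator {0..} t) \<partial>lborel)"
  proof (rule nn_integral_mono)
    fix t show "ennreal (lpnorm \<rho> (u t) powr q) * indicator {0..} t \<le> ennreal (\<epsilon> powr (q - q1)) * (ennreal (lpnorm \<rho>1 (u t) powr q1) * indicator {0..} t)"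
      using le[of t] by (cases "0 \<le> t") (simp_all add: ennreal_mult'[symmetric] ennreal_leI)
  qed
  also have "\<dots> = ennreal (\<epsilon> powr (q - q1)) * (\<integral>\<^sup>+ t. ennreal (lpnorm \<rho>1 (u t) powr q1) * indicator {0..} t \<partial>lborel)"
    by (intro nn_integral_cmult) measurable
  also have "\<dots> \<le> ennreal (\<epsilon> powr (q - q1)) * ennreal ((2 * K * \<epsilon>) powr q1)"
    by (intro mult_left_mono base_estimate) simp
  also have "\<dots> = ennreal (\<epsilon> powr (q - q1) * (2 * K * \<epsilon>) powr q1)" by (simp add: ennreal_mult)
  also have "\<dots> \<le> ennreal ((2 * K * \<epsilon>) powr (q - q1) * (2 * K * \<epsilon>) powr q1)"
    using q K eps by (intro ennreal_leI mult_right_mono powr_mono2) auto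
  also have "(2 * K * \<epsilon>) powr (q - q1) * (2 * K * \<epsilon>) powr q1 = (2 * K * \<epsilon>) powr q"
    by (simp add: powr_add[symmetric])
  finally show ?thesis .
qed

text \<open>A single application of \<open>strichartz_of_base\<close> to the base norm already
  bounded, with \<open>a\<close> equal to \<open>\<epsilon>\<close> times
  \<open>(2 * K) powr q1\<close>. The constant \<open>C'\<close> depends on \<open>q\<close>, but
  \<open>\<epsilon>\<close> need not be decreased further.\<close>

lemma strichartz_below_base:
  assumes bound: "dual_bound TYPE('d) (rho q) (q / (q - 1)) C'" and C': "0 \<le> C'" and q: "1 < q" "q \<le> q1"
    and \<rho>: "0 \<le> \<rho>" "\<rho> \<le> rho q"
  shows "(\<integral>\<^sup>+ t. ennreal (lpnorm \<rho> (u t) powr q) * indicator {0..} t \<partial>lborel)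
    \<le> ennreal (((sqrt C' + C' * (2 * K) powr q1) * \<epsilon>) powr q)"
proof (rule nn_integral_half_line_le)
  have half: "rho q \<le> 1 / 2" using q rho_less[of q] by simp
  show "(\<lambda>t. ennreal (lpnorm \<rho> (u t) powr q)) \<in> borel_measurable borel"
    using measurable_lpnorm_powr[OF \<rho>(1) order_trans[OF \<rho>(2) half]] by (rule measurable_compose) simp
  fix T :: real assume T: "0 \<le> T"
  define q' where "q' = q / (q - 1)"
  have q': "1 \<le> q'" using q by (simp add: q'_def le_divide_eq)
  have "\<epsilon> powr ((1 + 6 / dim) * q' - q1) * (2 * K * \<epsilon>) powr q1
      = \<epsilon> powr (((1 + 6 / dim) * q' - q1) + q1) * (2 * K) powr q1"
    by (simp only: powr_add powr_mult mult_ac)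
  also have "\<dots> \<le> \<epsilon> powr q' * (2 * K) powr (q1 * q')"
  proof (intro mult_mono)
    have "1 * q' \<le> (1 + 6 / dim) * q'" using q' dim by (intro mult_right_mono) auto
    then show "\<epsilon> powr (((1 + 6 / dim) * q' - q1) + q1) \<le> \<epsilon> powr q'" using eps by (intro powr_mono') auto
    have "q1 * 1 \<le> q1 * q'" using q' q1 by (intro mult_left_mono) auto
    then show "(2 * K) powr q1 \<le> (2 * K) powr (q1 * q')" using K by (intro powr_mono) auto
  qed auto
  also have "\<dots> = (\<epsilon> * (2 * K) powr q1) powr q'" by (simp only: powr_mult powr_powr)
  finally have a: "\<epsilon> powr ((1 + 6 / dim) * (q / (q - 1)) - q1) * (2 * K * \<epsilon>) powr q1 \<le> (\<epsilon> * (2 * K) powr q1) powr (q / (q - 1))"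
    by (simp only: q'_def)
  have "(\<integral>\<^sup>+ t. ennreal (lpnorm \<rho> (u t) powr q) * indicator {0..T} t \<partial>lborel)
      \<le> (\<integral>\<^sup>+ t. ennreal (lpnorm (rho q) (u t) powr q) * indicator {0..T} t \<partial>lborel)"
    using q \<rho> half by (intro nn_integral_mono mult_right_mono ennreal_leI powr_mono2 lpnorm_mono lpnorm_nonneg) auto
  also have "\<dots> \<le> ennreal ((sqrt C' * \<epsilon> + C' * (\<epsilon> * (2 * K) powr q1)) powr q)"
    by (rule strichartz_of_base[OF bound C' q _ T _ base_estimate_truncated[OF T] _ a]) (use \<rho> K eps in auto)
  finally show "(\<integral>\<^sup>+ t. ennreal (lpnorm \<rho> (u t) powr q) * indicator {0..T} t \<partial>lborel)
      \<le> ennreal (((sqrt C' + C' * (2 * K) powr q1) * \<epsilon>) powr q)"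
    by (simp add: algebra_simps)
qed

text \<open>The sup norm lies below the base norm by nesting, so its power \<open>q1\<close> has
  bounded integrals; it is Lipschitz in time because it is dominated by the l^2 norm.\<close>

lemma lpnorm_0_tendsto_0:
  assumes L: "0 < L" and lip: "\<And>s t. 0 \<le> s \<Longrightarrow> s \<le> t \<Longrightarrow> norm (u t - u s) \<le> L * (t - s)"
  shows "((\<lambda>t. lpnorm 0 (u t)) \<longlongrightarrow> 0) at_top"
proof (rule tendsto_0_of_integral_bound[OF L])
  let ?h = "\<lambda>t. lpnorm 0 (u t) powr q1"
  have h: "?h \<in> borel_measurable borel" by (rule measurable_lpnorm_powr) simp_all
  have h1: "?h t \<le> 1" if "0 \<le> t" for t
  proof -
    have "lpnorm 0 (u t) \<le> 1" using lpnorm_le_norm[of 0 "u t"] norm_le[OF that] eps by simp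
    then have "?h t \<le> 1 powr q1" using q1 lpnorm_nonneg[of 0 "u t"] by (intro powr_mono2) auto
    then show ?thesis by simp
  qed
  show "?h integrable_on {0..T}" for T
    using nn_integral_Icc_eq_integral(1)[OF h, of T 1] h1 by simp
  show "integral {0..T} ?h \<le> (2 * K * \<epsilon>) powr q1" if T: "0 \<le> T" for T
  proof -
    have "ennreal (integral {0..T} ?h) = (\<integral>\<^sup>+ t. ennreal (?h t) * indicator {0..T} t \<partial>lborel)"
      using nn_integral_Icc_eq_integral(2)[OF h, of T 1] h1 by simp
    also have "\<dots> \<le> (\<integral>\<^sup>+ t. ennreal (lpnorm \<rho>1 (u t) powr q1) * indicator {0..T} t \<partial>lborel)"
      using q1 by (intro nn_integral_mono mult_right_mono ennreal_leI powr_mono2 lpnorm_mono lpnorm_nonneg) auto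
    also have "\<dots> \<le> ennreal ((2 * K * \<epsilon>) powr q1)" by (rule base_estimate_truncated[OF T])
    finally show ?thesis by simp
  qed
  show "lpnorm 0 (u s) \<le> lpnorm 0 (u t) + L * (t - s)" if "0 \<le> s" "s \<le> t" for s t
    using lpnorm_0_le_add[of "u s" "u t"] lip[OF that] by (simp add: norm_minus_commute)
qed (use q1 in \<open>auto intro: lpnorm_nonneg\<close>)

text \<open>Interpolation between the bounded l^2 norm and the vanishing sup norm; for
  \<open>\<rho> < 1 / 2\<close> the latter keeps the positive power
  \<open>1 - 2 * \<rho>\<close>.\<close>

lemma lr_norm_tendsto_0:
  assumes L: "0 < L" and lip: "\<And>s t. 0 \<le> s \<Longrightarrow> s \<le> t \<Longrightarrow> norm (u t - u s) \<le> L * (t - s)"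
    and \<rho>: "0 \<le> \<rho>" "\<rho> < 1 / 2"
  shows "((\<lambda>t. lr_norm (inverse (ennreal \<rho>)) (ev (u t))) \<longlongrightarrow> 0) at_top"
proof -
  have half: "\<rho> \<le> 1 / 2" using \<rho> by simp
  have z: "((\<lambda>t. lpnorm 0 (u t) powr (1 - 2 * \<rho>)) \<longlongrightarrow> 0) at_top"
  proof (rule tendsto_zero_powrI[OF lpnorm_0_tendsto_0[OF L lip] tendsto_const])
    show "\<forall>\<^sub>F t in at_top. 0 \<le> lpnorm 0 (u t)" by (intro always_eventually allI lpnorm_nonneg) simp_all
  qed (use \<rho> in auto)
  have "((\<lambda>t. lpnorm \<rho> (u t)) \<longlongrightarrow> 0) at_top"
  proof (rule Lim_null_comparison[OF _ z])
    show "\<forall>\<^sub>F t in at_top. norm (lpnorm \<rho> (u t)) \<le> lpnorm 0 (u t) powr (1 - 2 * \<rho>)"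
    proof (rule eventually_at_top_linorderI[of 0])
      fix t :: real assume t: "0 \<le> t"
      have "lpnorm \<rho> (u t) \<le> norm (u t) powr (1 - (1 - 2 * \<rho>)) * lpnorm 0 (u t) powr (1 - 2 * \<rho>)"
        by (rule lpnorm_interpolation) (use \<rho> in auto)
      also have "\<dots> \<le> 1 powr (1 - (1 - 2 * \<rho>)) * lpnorm 0 (u t) powr (1 - 2 * \<rho>)"
        using norm_le[OF t] eps \<rho> by (intro mult_right_mono powr_mono2) auto
      finally show "norm (lpnorm \<rho> (u t)) \<le> lpnorm 0 (u t) powr (1 - 2 * \<rho>)"
        using lpnorm_nonneg[OF \<rho>(1) half, of "u t"] by simp
    qed
  qed
  then show ?thesis
    unfolding lr_norm_eq_lpnorm[OF \<rho>(1) half] by (metis ennreal_0 tendsto_ennrealI)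
qed

lemma mixed_norm_le:
  assumes \<rho>: "0 \<le> \<rho>" "\<rho> \<le> 1 / 2" and q: "0 < q" and M: "0 \<le> M"
    and le: "(\<integral>\<^sup>+ t. ennreal (lpnorm \<rho> (u t) powr q) * indicator {0..} t \<partial>lborel) \<le> ennreal (M powr q)"
  shows "mixed_norm (ennreal q) (inverse (ennreal \<rho>)) (\<lambda>t. ev (u t)) \<le> ennreal M"
proof -
  have "mixed_norm (ennreal q) (inverse (ennreal \<rho>)) (\<lambda>t. ev (u t))
      = ennreal_rpow (\<integral>\<^sup>+ t. ennreal (lpnorm \<rho> (u t) powr q) * indicator {0..} t \<partial>lborel) (1 / q)"
  proof -
    have "ennreal_rpow (lr_norm (inverse (ennreal \<rho>)) (ev (u t))) q = ennreal (lpnorm \<rho> (u t) powr q)" for t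
      unfolding lr_norm_eq_lpnorm[OF \<rho>] by (rule ennreal_rpow_ennreal) (rule lpnorm_nonneg[OF \<rho>])
    then show ?thesis using q by (simp add: mixed_norm_def)
  qed
  also have "\<dots> \<le> ennreal ((M powr q) powr (1 / q))" using q by (intro ennreal_rpow_le le) auto
  also have "(M powr q) powr (1 / q) = M" using q M by (simp add: powr_powr)
  finally show ?thesis .
qed

lemma mixed_norm_infinity_le:
  assumes \<rho>: "0 \<le> \<rho>" "\<rho> \<le> 1 / 2"
  shows "mixed_norm \<infinity> (inverse (ennreal \<rho>)) (\<lambda>t. ev (u t)) \<le> ennreal \<epsilon>"
proof -
  have "lr_norm (inverse (ennreal \<rho>)) (ev (u t)) \<le> ennreal \<epsilon>" if "t \<in> {0..}" for t
    unfolding lr_norm_eq_lpnorm[OF \<rho>] using that by (intro ennreal_leI order_trans[OF lpnorm_le_norm[OF \<rho>] norm_le]) simp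
  then show ?thesis unfolding mixed_norm_def if_P[OF refl] by (rule SUP_least)
qed

end

section \<open>Global well-posedness and decay\<close>

lemma exponent_cases:
  fixes r :: ennreal
  assumes "2 \<le> r"
  obtains \<rho> where "0 \<le> \<rho>" "\<rho> \<le> 1 / 2" "r = inverse (ennreal \<rho>)"
proof (cases r)
  case (real s)
  have "ennreal 2 \<le> ennreal s" using assms real by simp
  then have "2 \<le> s" using real by (simp only: ennreal_le_iff)
  then show thesis using real that[of "1 / s"] by (simp add: inverse_ennreal field_simps)
qed (use that[of 0] in simp)

text \<open>The extended-real condition becomes \<open>\<rho> \<le> admissible_rho d q0\<close>.
  Since \<open>\<rho> \<ge> 0\<close>, it forces q0 >= 6/d for d <= 2, so every finite admissible
  exponent is at least the base exponent or belongs to dimension three with q0 > 2.\<close>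

lemma strichartz_admissible_cases:
  assumes adm: "strichartz_admissible d q r" and d: "0 < d"
  obtains (infinite) \<rho> where "0 \<le> \<rho>" "\<rho> \<le> 1 / 2" "r = inverse (ennreal \<rho>)" "q = \<infinity>"
    | (finite) \<rho> q0 where "0 \<le> \<rho>" "\<rho> \<le> 1 / 2" "r = inverse (ennreal \<rho>)" "q = ennreal q0" "2 \<le> q0"
      "\<rho> \<le> admissible_rho d q0" "base_q d \<le> q0 \<or> d = 3 \<and> 2 < q0"
proof -
  have q2: "2 \<le> q" and r2: "2 \<le> r" and le: "1 / q + of_nat d / (3 * r) \<le> of_nat d / 6" and ne: "(q, r, d) \<noteq> (2, \<infinity>, 3)"
    using adm by (auto simp: strichartz_admissible_def)
  obtain \<rho> where \<rho>: "0 \<le> \<rho>" "\<rho> \<le> 1 / 2" "r = inverse (ennreal \<rho>)" using exponent_cases[OF r2] .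
  show thesis
  proof (cases q)
    case top
    then show thesis using infinite[OF \<rho>] by simp
  next
    case (real q0)
    have "ennreal 2 \<le> ennreal q0" using q2 real by simp
    then have q0: "2 \<le> q0" using real by (simp only: ennreal_le_iff)
    have d': "of_nat d = ennreal (real d)" by (simp add: ennreal_of_nat_eq_real_of_nat)
    have "of_nat d / (3 * r) = ennreal (real d * \<rho> / 3)"
    proof (cases "\<rho> = 0")
      case False
      then have "3 * r = ennreal (3 / \<rho>)"
        using \<rho> ennreal_mult[of 3 "1 / \<rho>"] by (simp add: inverse_ennreal inverse_eq_divide)
      then show ?thesis using \<rho> False unfolding d' by (simp add: divide_ennreal)
    qed (use \<rho> in \<open>simp add: ennreal_mult_top\<close>)
    moreover have "1 / q = ennreal (1 / q0)" using real q0 divide_ennreal[of 1 q0] by simp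
    moreover have "of_nat d / (6 :: ennreal) = ennreal (real d / 6)" using divide_ennreal[of "real d" 6] unfolding d' by simp
    ultimately have "ennreal (1 / q0 + real d * \<rho> / 3) \<le> ennreal (real d / 6)"
      using le q0 \<rho> by (simp add: ennreal_plus)
    then have "1 / q0 + real d * \<rho> / 3 \<le> real d / 6" by (subst (asm) ennreal_le_iff) auto
    then have "(1 / q0 + real d * \<rho> / 3) * (3 / real d) \<le> real d / 6 * (3 / real d)"
      using d by (intro mult_right_mono) auto
    then have adm': "\<rho> \<le> admissible_rho d q0" using d q0 by (simp add: admissible_rho_def algebra_simps)
    consider "d = 1" | "d = 2" | "d = 3" | "4 \<le> d" using d by linarith
    then have "base_q d \<le> q0 \<or> d = 3 \<and> 2 < q0"
    proof cases
      case 3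
      have "q0 \<noteq> 2"
      proof
        \<comment> \<open>For d = 3 the boundary value of \<open>\<rho>\<close> at q = 2 is 0, so
          the pair would be the excluded one with r = infinity.\<close>
        assume "q0 = 2"
        then have "\<rho> = 0" using adm' \<rho> 3 by (simp add: admissible_rho_def)
        then show False using ne \<rho>(3) 3 real \<open>q0 = 2\<close> by simp
      qed
      then show ?thesis using 3 q0 by simp
    next
      case 4
      then show ?thesis using q0 by (simp add: base_q_def)
    next
      case 1
      then have "3 / q0 \<le> 1 / 2" using adm' \<rho>(1) by (simp add: admissible_rho_def)
      then show ?thesis using 1 q0 by (simp add: base_q_def divide_le_eq)
    next
      case 2
      then have "3 / (2 * q0) \<le> 1 / 2" using adm' \<rho>(1) by (simp add: admissible_rho_def)
      then show ?thesis using 2 q0 by (simp add: base_q_def divide_le_eq)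
    qed
    then show thesis using finite[OF \<rho> _ q0 adm'] real by simp
  qed
qed

text \<open>The translation between the sitewise Duhamel formula of the statement and the vector
  equation with the truncated nonlinearity, valid when the truncation level \<open>R\<close> exceeds
  all entries on the interval. The complex factor \<open>c\<close> passes through the group by
  \<open>propag_cmul\<close>.\<close>

lemma duhamel_coordinates:
  fixes U :: "real \<Rightarrow> (int ^ 'd::finite) ell2"
  assumes U: "continuous_on {0..t} U" and \<sigma>: "0 \<le> \<sigma>" and R: "0 \<le> R" and c: "cmod c = 1"
    and bound: "\<And>s n. s \<in> {0..t} \<Longrightarrow> cmod (ev (U s) n) \<le> R"
  shows "(\<lambda>s. schroedinger_group (t - s) (power_nonlinearity \<sigma> (ev (U s))) n) integrable_on {0..t}"
    and "ev (propag t x + integral {0..t} (\<lambda>s. propag (t - s) (nonlin c R (2 * \<sigma>) (U s)))) n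
      = schroedinger_group t (ev x) n + c * integral {0..t} (\<lambda>s. schroedinger_group (t - s) (power_nonlinearity \<sigma> (ev (U s))) n)"
proof -
  have p: "0 \<le> 2 * \<sigma>" using \<sigma> by simp
  have int: "(\<lambda>s. propag (t - s) (nonlin b R (2 * \<sigma>) (U s))) integrable_on {0..t}" if "cmod b = 1" for b
    by (intro integrable_continuous_real sg.continuous_on_flow continuous_on_nonlin R p that U continuous_intros)
  have coord: "schroedinger_group (t - s) (power_nonlinearity \<sigma> (ev (U s))) n = ev (propag (t - s) (nonlin 1 R (2 * \<sigma>) (U s))) n"
    if "s \<in> {0..t}" for s
    using ev_nonlin_eq_power_nonlinearity[OF \<sigma> bound[OF that]] by (simp add: schroedinger_group_eq_propag[symmetric])
  have "(\<lambda>s. ev (propag (t - s) (nonlin 1 R (2 * \<sigma>) (U s))) n) integrable_on {0..t}"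
    using integrable_linear[OF int[of 1] bounded_linear_ev] by (simp add: comp_def)
  then show "(\<lambda>s. schroedinger_group (t - s) (power_nonlinearity \<sigma> (ev (U s))) n) integrable_on {0..t}"
    by (rule integrable_eq) (simp add: coord)
  have "ev (integral {0..t} (\<lambda>s. propag (t - s) (nonlin c R (2 * \<sigma>) (U s)))) n
      = integral {0..t} (\<lambda>s. ev (propag (t - s) (nonlin c R (2 * \<sigma>) (U s))) n)"
    using integral_linear[OF int[OF c] bounded_linear_ev] by (simp add: comp_def)
  also have "\<dots> = integral {0..t} (\<lambda>s. c * schroedinger_group (t - s) (power_nonlinearity \<sigma> (ev (U s))) n)"
  proof (rule Henstock_Kurzweil_Integration.integral_cong)
    fix s assume s: "s \<in> {0..t}"
    show "ev (propag (t - s) (nonlin c R (2 * \<sigma>) (U s))) n = c * schroedinger_group (t - s) (power_nonlinearity \<sigma> (ev (U s))) n"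
      unfolding coord[OF s] by (subst cmul_nonlin) (simp add: propag_cmul)
  qed
  also have "\<dots> = c * integral {0..t} (\<lambda>s. schroedinger_group (t - s) (power_nonlinearity \<sigma> (ev (U s))) n)"
    by simp
  finally show "ev (propag t x + integral {0..t} (\<lambda>s. propag (t - s) (nonlin c R (2 * \<sigma>) (U s)))) n
      = schroedinger_group t (ev x) n + c * integral {0..t} (\<lambda>s. schroedinger_group (t - s) (power_nonlinearity \<sigma> (ev (U s))) n)"
    by (simp add: schroedinger_group_eq_propag)
qed

section \<open>Continuity in the sense of the statement and continuity of \<open>ell2\<close>-valued
  functions\<close>

lemma lr_norm_2_diff:
  fixes x y :: "(int ^ 'd::finite) ell2"
  shows "lr_norm 2 (\<lambda>n. ev x n - ev y n) = ennreal (norm (x - y))"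
proof -
  have "(\<lambda>n. ev x n - ev y n) = ev (x - y)" by (rule ext) simp
  then show ?thesis using lr_norm_2_ev[of "x - y"] by simp
qed

lemma l2_continuous_ev:
  fixes U :: "real \<Rightarrow> (int ^ 'd::finite) ell2"
  assumes "continuous_on UNIV U"
  shows "l2_continuous (\<lambda>t. ev (U t))"
  unfolding l2_continuous_def
proof (intro allI impI conjI)
  fix t :: real assume "0 \<le> t"
  show "lr_norm 2 (ev (U t)) < \<infinity>" by (simp add: lr_norm_2_ev)
  have "(U \<longlongrightarrow> U t) (at t within {0..})"
    using assms by (auto simp: continuous_on_def intro: tendsto_within_subset)
  then have "((\<lambda>s. norm (U s - U t)) \<longlongrightarrow> 0) (at t within {0..})" by (simp add: LIM_zero tendsto_norm_zero)
  then show "((\<lambda>s. lr_norm 2 (\<lambda>n. ev (U s) n - ev (U t) n)) \<longlongrightarrow> 0) (at t within {0..})"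
    unfolding lr_norm_2_diff by (metis ennreal_0 tendsto_ennrealI)
qed

lemma l2_continuous_imp_ell2:
  fixes v :: "real \<Rightarrow> int ^ 'd::finite \<Rightarrow> complex"
  assumes v: "l2_continuous v"
  obtains V where "continuous_on {0..} V" "\<And>t. 0 \<le> t \<Longrightarrow> v t = ev (V t)"
proof -
  have "\<exists>x. v t = ev x" if "0 \<le> t" for t
    using lr_norm_2_finite_imp_ell2[of "v t"] v that by (auto simp: l2_continuous_def)
  then have "\<forall>t. \<exists>x. 0 \<le> t \<longrightarrow> v t = ev x" by blast
  from choice[OF this] obtain V where V_all: "\<forall>t. 0 \<le> t \<longrightarrow> v t = ev (V t)" ..
  then have V: "v t = ev (V t)" if "0 \<le> t" for t using that by simp
  have "(V \<longlongrightarrow> V t) (at t within {0..})" if t: "0 \<le> t" for t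
  proof -
    have "((\<lambda>s. lr_norm 2 (\<lambda>n. v s n - v t n)) \<longlongrightarrow> 0) (at t within {0..})"
      using v t by (simp add: l2_continuous_def)
    moreover have "\<forall>\<^sub>F s in at t within {0..}. lr_norm 2 (\<lambda>n. v s n - v t n) = ennreal (norm (V s - V t))"
      using t by (simp add: eventually_at_filter V lr_norm_2_diff)
    ultimately have "((\<lambda>s. ennreal (norm (V s - V t))) \<longlongrightarrow> ennreal 0) (at t within {0..})"
      by (simp add: tendsto_cong)
    then have "((\<lambda>s. norm (V s - V t)) \<longlongrightarrow> 0) (at t within {0..})"
      by (subst (asm) tendsto_ennreal_iff) simp_all
    then show ?thesis by (simp add: tendsto_norm_zero_iff LIM_zero_iff)
  qed
  then show thesis using that V by (auto simp: continuous_on_def)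
qed

text \<open>All constants are fixed by the dimension before the power of the nonlinearity or the
  data appear.\<close>

lemma exists_base_constants:
  obtains C K \<epsilon> :: real where "0 \<le> C" "dual_bound TYPE('d::finite) (admissible_rho CARD('d) (base_q CARD('d)))
      (base_q CARD('d) / (base_q CARD('d) - 1)) C"
    "1 \<le> K" "sqrt C \<le> K" "C \<le> K" "0 < \<epsilon>" "\<epsilon> \<le> 1" "(2 * K) powr (base_q CARD('d) - 1) * \<epsilon> powr (6 / real CARD('d)) < 1"
proof -
  let ?q = "base_q CARD('d)" and ?d = "real CARD('d)"
  have "CARD('d) \<noteq> 3 \<and> ?q = base_q CARD('d) \<or> CARD('d) = 3 \<and> 2 < ?q" by (auto simp: base_q_def)
  from ex_dual_bound[OF this]
  obtain C where C: "0 \<le> C" "dual_bound TYPE('d) (admissible_rho CARD('d) ?q) (?q / (?q - 1)) C" by blast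
  define K where "K = max 1 (max (sqrt C) C)"
  have K: "1 \<le> K" "sqrt C \<le> K" "C \<le> K" by (auto simp: K_def)
  define m where "m = (2 * K) powr (?q - 1)"
  have q: "2 \<le> ?q" using base_q_bounds(1)[of "CARD('d)"] by simp
  have m: "1 \<le> m" unfolding m_def using K q by (intro ge_one_powr_ge_zero) auto
  \<comment> \<open>The exponent inverts the power 6/d, so that
    \<open>m * \<epsilon> powr (6 / ?d)\<close> is exactly 1/2.\<close>
  define \<epsilon> where "\<epsilon> = (1 / (2 * m)) powr (?d / 6)"
  have "\<epsilon> powr (6 / ?d) = (1 / (2 * m)) powr (?d / 6 * (6 / ?d))" by (simp only: \<epsilon>_def powr_powr)
  also have "\<dots> = 1 / (2 * m)" using m by simp
  finally have "m * \<epsilon> powr (6 / ?d) < 1" using m by simp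
  moreover have "0 < \<epsilon>" using m by (simp add: \<epsilon>_def)
  moreover have "\<epsilon> \<le> 1 powr (?d / 6)" unfolding \<epsilon>_def using m by (intro powr_mono2) auto
  ultimately show thesis using that[OF C K, of \<epsilon>] by (simp add: m_def)
qed

text \<open>One number serves as constant for all admissible pairs unless d = 3. There the pairs
  with q between 2 and 4 rest on a Strichartz estimate at \<open>q\<close> itself, whose constant is
  not controlled uniformly as q tends to 2.\<close>

theorem theorem3:
  shows "\<exists>\<epsilon>::real. \<epsilon> > 0 \<and> (\<exists>C :: ennreal \<Rightarrow> real.
    (CARD('d::finite) \<noteq> 3 \<longrightarrow> (\<forall>q q'. C q = C q')) \<and>
    (\<forall>\<sigma>::real. \<sigma> \<ge> 3 / real CARD('d) \<longrightarrow>
      (\<forall>\<kappa>\<in>{1, -1}. \<forall>f :: int ^ 'd \<Rightarrow> complex. lr_norm 2 f \<le> ennreal \<epsilon> \<longrightarrow>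
        (\<exists>u. global_dnls_solution \<kappa> \<sigma> f u \<and>
          (\<forall>v. global_dnls_solution \<kappa> \<sigma> f v \<longrightarrow> (\<forall>t\<ge>0. v t = u t)) \<and>
          (\<forall>q r. strichartz_admissible CARD('d) q r \<longrightarrow>
             mixed_norm q r u \<le> ennreal (C q * \<epsilon>)) \<and>
          (\<forall>r>2. ((\<lambda>t. lr_norm r (u t)) \<longlongrightarrow> 0) at_top)))))"
proof -
  let ?q1 = "base_q CARD('d)" and ?rho = "admissible_rho CARD('d)"
  obtain C0 K \<epsilon> :: real where C0: "0 \<le> C0" "dual_bound TYPE('d) (?rho ?q1) (?q1 / (?q1 - 1)) C0"
    and K: "1 \<le> K" "sqrt C0 \<le> K" "C0 \<le> K" and \<epsilon>: "0 < \<epsilon>" "\<epsilon> \<le> 1"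
    and small: "(2 * K) powr (?q1 - 1) * \<epsilon> powr (6 / real CARD('d)) < 1"
    using exists_base_constants[where 'd = 'd] .
  \<comment> \<open>The dual bound is known to exist for each \<open>q\<close> separately; choosing
    one value for every \<open>q\<close> gives a function that does not depend on the
    solution.\<close>
  define B where "B q = (SOME b. 0 \<le> b \<and> dual_bound TYPE('d) (?rho q) (q / (q - 1)) b)" for q
  have B: "0 \<le> B q \<and> dual_bound TYPE('d) (?rho q) (q / (q - 1)) (B q)" if "CARD('d) = 3" "2 < q" for q
  proof -
    have "\<exists>b. 0 \<le> b \<and> dual_bound TYPE('d) (?rho q) (q / (q - 1)) b" using ex_dual_bound[where 'd = 'd, of q] that by auto
    then show ?thesis unfolding B_def by (rule someI_ex)
  qed
  \<comment> \<open>For q infinite \<open>enn2real q\<close> is 0, and no bound is available for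
    \<open>B 0\<close>; the maximum with \<open>2 * K\<close> keeps the constant large enough there
    and for \<open>q\<close> above the base exponent.\<close>
  define C where "C q = (if CARD('d) = 3 then max (2 * K) (sqrt (B (enn2real q)) + B (enn2real q) * (2 * K) powr ?q1) else 2 * K)"
    for q :: ennreal
  have C_ge: "2 * K \<le> C q" for q by (simp add: C_def)
  have "\<exists>u. global_dnls_solution \<kappa> \<sigma> f u \<and>
      (\<forall>v. global_dnls_solution \<kappa> \<sigma> f v \<longrightarrow> (\<forall>t\<ge>0. v t = u t)) \<and>
      (\<forall>q r. strichartz_admissible CARD('d) q r \<longrightarrow> mixed_norm q r u \<le> ennreal (C q * \<epsilon>)) \<and>
      (\<forall>r>2. ((\<lambda>t. lr_norm r (u t)) \<longlongrightarrow> 0) at_top)"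
    if \<sigma>: "\<sigma> \<ge> 3 / real CARD('d)" and \<kappa>: "\<kappa> \<in> {1, -1}" and f: "lr_norm 2 f \<le> ennreal \<epsilon>"
    for \<sigma> \<kappa> and f :: "int ^ 'd \<Rightarrow> complex"
  proof -
    have "lr_norm 2 f < \<infinity>" using f le_less_trans[OF f ennreal_less_top] by simp
    then obtain x where x: "f = ev x" by (rule lr_norm_2_finite_imp_ell2)
    have nx: "norm x \<le> \<epsilon>" using f \<epsilon> by (simp add: x lr_norm_2_ev)
    have \<sigma>0: "0 \<le> \<sigma>" using \<sigma> by (meson divide_nonneg_nonneg of_nat_0_le_iff order_trans zero_le_numeral)
    have p: "6 / real CARD('d) \<le> 2 * \<sigma>" using \<sigma> by simp
    define c where "c = complex_of_real \<kappa> * \<i>"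
    have c: "cmod c = 1" "Re c = 0" using \<kappa> by (auto simp: c_def)
    interpret D: dnls c "2 * \<sigma>" using c \<sigma>0 by unfold_locales auto
    obtain U where U: "continuous_on UNIV U"
        "\<And>t. 0 \<le> t \<Longrightarrow> U t = propag t x + integral {0..t} (\<lambda>s. propag (t - s) (nonlin c 1 (2 * \<sigma>) (U s)))"
        "\<And>t. 0 \<le> t \<Longrightarrow> norm (U t) = norm x"
        "\<And>s t. 0 \<le> s \<Longrightarrow> s \<le> t \<Longrightarrow> norm (U t - U s) \<le> (4 * real CARD('d) + 2 * \<sigma> + 1) * norm x * (t - s)"
      by (rule D.cut_off_solution[of x]) (rule that)
    interpret S: small_solution_bound U x c "2 * \<sigma>" \<epsilon> "real CARD('d)" ?q1 "?rho ?q1" ?rho C0 K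
    proof
      show "norm (U t) \<le> \<epsilon>" if "0 \<le> t" for t using U(3)[OF that] nx by simp
    qed (fact refl U(1) U(2) C0 K \<epsilon> small nx c p)+
    let ?u = "\<lambda>t. ev (U t)"
    have U_le_1: "cmod (ev (U s) n) \<le> 1" if "0 \<le> s" for s n
      using norm_ev_le[of "U s" n] U(3)[OF that] nx \<epsilon> by simp
    have U_coord: "(\<lambda>s. schroedinger_group (t - s) (power_nonlinearity \<sigma> (?u s)) n) integrable_on {0..t}"
        "?u t n = schroedinger_group t f n + c * integral {0..t} (\<lambda>s. schroedinger_group (t - s) (power_nonlinearity \<sigma> (?u s)) n)"
      if t: "0 \<le> t" for t n
    proof -
      have cont: "continuous_on {0..t} U" using U(1) by (rule continuous_on_subset) simp
      note coord = duhamel_coordinates[where R = 1 and n = n, OF cont \<sigma>0 _ c(1)]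
      show "(\<lambda>s. schroedinger_group (t - s) (power_nonlinearity \<sigma> (?u s)) n) integrable_on {0..t}"
        by (rule coord(1)) (auto intro: U_le_1)
      show "?u t n = schroedinger_group t f n + c * integral {0..t} (\<lambda>s. schroedinger_group (t - s) (power_nonlinearity \<sigma> (?u s)) n)"
        by (subst U(2)[OF t], unfold x, rule coord(2)) (auto intro: U_le_1)
    qed
    have u0: "?u 0 = f" using U(2)[of 0] by (simp add: x)
    have sol: "global_dnls_solution \<kappa> \<sigma> f ?u"
      unfolding global_dnls_solution_def u0 c_def[symmetric] using U_coord l2_continuous_ev[OF U(1)] by blast
    have unique: "v t = ?u t" if v: "global_dnls_solution \<kappa> \<sigma> f v" and t: "0 \<le> t" for v t
    proof -
      have v_coord: "v s n = schroedinger_group s f n + c * integral {0..s} (\<lambda>r. schroedinger_group (s - r) (power_nonlinearity \<sigma> (v r)) n)"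
        if "0 \<le> s" for s n
        using v that unfolding global_dnls_solution_def c_def by simp
      have "l2_continuous v" using v by (simp add: global_dnls_solution_def)
      then obtain V where V: "continuous_on {0..} V" "\<And>t. 0 \<le> t \<Longrightarrow> v t = ev (V t)"
        using l2_continuous_imp_ell2 by blast
      have Vt: "continuous_on {0..t} V" using V(1) by (rule continuous_on_subset) auto
      then have "bounded (V ` {0..t})" by (intro compact_imp_bounded compact_continuous_image) auto
      then obtain R0 where R0: "\<And>s. s \<in> {0..t} \<Longrightarrow> norm (V s) \<le> R0" unfolding bounded_iff by blast
      \<comment> \<open>A level that truncates neither solution: 1 bounds the entries of
        \<open>U\<close> and \<open>R0\<close> those of \<open>V\<close> up to time
        \<open>t\<close>.\<close>
      define R where "R = max 1 R0"
      have R: "0 \<le> R" by (simp add: R_def)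
      have "V t = U t"
      proof (rule D.duhamel_unique[OF R Vt continuous_on_subset[OF U(1)]])
        fix s assume s: "s \<in> {0..t}"
        have Vs: "continuous_on {0..s} V" using Vt by (rule continuous_on_subset) (use s in auto)
        have Us: "continuous_on {0..s} U" using U(1) by (rule continuous_on_subset) simp
        have V_le: "cmod (ev (V r) n) \<le> R" if "r \<in> {0..s}" for r n
          using norm_ev_le[of "V r" n] R0[of r] that s by (simp add: R_def)
        have U_le: "cmod (ev (U r) n) \<le> R" if "r \<in> {0..s}" for r n
          using U_le_1[of r n] that by (simp add: R_def)
        show "V s = propag s x + integral {0..s} (\<lambda>r. propag (s - r) (nonlin c R (2 * \<sigma>) (V r)))"
        proof (rule ell2_eqI)
          fix n
          have "integral {0..s} (\<lambda>r. schroedinger_group (s - r) (power_nonlinearity \<sigma> (v r)) n)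
              = integral {0..s} (\<lambda>r. schroedinger_group (s - r) (power_nonlinearity \<sigma> (ev (V r))) n)"
            by (rule Henstock_Kurzweil_Integration.integral_cong) (simp add: V(2))
          then show "ev (V s) n = ev (propag s x + integral {0..s} (\<lambda>r. propag (s - r) (nonlin c R (2 * \<sigma>) (V r)))) n"
            using v_coord[of s n] V(2)[of s] s by (simp only: duhamel_coordinates(2)[OF Vs \<sigma>0 R c(1) V_le] x) simp
        qed
        show "U s = propag s x + integral {0..s} (\<lambda>r. propag (s - r) (nonlin c R (2 * \<sigma>) (U r)))"
        proof (rule ell2_eqI)
          fix n
          show "ev (U s) n = ev (propag s x + integral {0..s} (\<lambda>r. propag (s - r) (nonlin c R (2 * \<sigma>) (U r)))) n"
            using U_coord(2)[of s n] s by (simp only: duhamel_coordinates(2)[OF Us \<sigma>0 R c(1) U_le] x) simp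
        qed
      qed (use t in auto)
      then show ?thesis using V(2)[OF t] by simp
    qed
    have strichartz: "mixed_norm q r ?u \<le> ennreal (C q * \<epsilon>)" if adm: "strichartz_admissible CARD('d) q r" for q r
      using adm zero_less_card_finite
    proof (cases rule: strichartz_admissible_cases)
      case (infinite \<rho>)
      have "1 * \<epsilon> \<le> C q * \<epsilon>" using C_ge[of q] K \<epsilon> by (intro mult_right_mono) auto
      then show ?thesis
        using order_trans[OF S.mixed_norm_infinity_le[OF infinite(1,2)] ennreal_leI] infinite(3,4) by simp
    next
      case (finite \<rho> q0)
      show ?thesis
      proof (cases "?q1 \<le> q0")
        case True
        have "mixed_norm q r ?u \<le> ennreal (2 * K * \<epsilon>)"
          unfolding finite(3,4)
          by (rule S.mixed_norm_le[OF finite(1,2) _ _ S.strichartz_above_base[OF True finite(1,6)]])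
            (use finite(5) K \<epsilon> in auto)
        also have "\<dots> \<le> ennreal (C q * \<epsilon>)" using C_ge[of q] \<epsilon> by (intro ennreal_leI mult_right_mono) auto
        finally show ?thesis .
      next
        case False
        then have d: "CARD('d) = 3" "2 < q0" using finite(7) by auto
        note b = B[OF d]
        have "mixed_norm q r ?u \<le> ennreal ((sqrt (B q0) + B q0 * (2 * K) powr ?q1) * \<epsilon>)"
          unfolding finite(3,4)
          by (rule S.mixed_norm_le[OF finite(1,2) _ _ S.strichartz_below_base[OF _ _ _ _ finite(1,6)]])
            (use b d False \<epsilon> in auto)
        also have "\<dots> \<le> ennreal (C q * \<epsilon>)"
          using d \<epsilon> finite(4) by (intro ennreal_leI mult_right_mono) (auto simp: C_def)
        finally show ?thesis .
      qed
    qed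
    have decay: "((\<lambda>t. lr_norm r (?u t)) \<longlongrightarrow> 0) at_top" if r: "r > 2" for r
    proof -
      obtain \<rho> where \<rho>: "0 \<le> \<rho>" "\<rho> \<le> 1 / 2" "r = inverse (ennreal \<rho>)" using exponent_cases[OF order.strict_implies_order[OF r]] .
      have "\<rho> \<noteq> 1 / 2"
      proof
        assume half: "\<rho> = 1 / 2"
        have "r = ennreal 2" unfolding \<rho>(3) half by (subst inverse_ennreal) simp_all
        then show False using r by simp
      qed
      then have \<rho>l: "\<rho> < 1 / 2" using \<rho> by simp
      \<comment> \<open>The summand 1 makes \<open>L\<close> positive also for zero data.\<close>
      define L where "L = (4 * real CARD('d) + 2 * \<sigma> + 1) * norm x + 1"
      have L: "0 < L" using \<sigma>0 by (simp add: L_def add_nonneg_pos)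
      have "norm (U t - U s) \<le> L * (t - s)" if "0 \<le> s" "s \<le> t" for s t
        using U(4)[OF that] that by (simp add: L_def algebra_simps)
      then show ?thesis unfolding \<rho>(3) by (intro S.lr_norm_tendsto_0[OF L _ \<rho>(1) \<rho>l])
    qed
    show ?thesis using sol unique strichartz decay by blast
  qed
  then have "(CARD('d) \<noteq> 3 \<longrightarrow> (\<forall>q q'. C q = C q')) \<and>
    (\<forall>\<sigma>::real. \<sigma> \<ge> 3 / real CARD('d) \<longrightarrow>
      (\<forall>\<kappa>\<in>{1, -1}. \<forall>f :: int ^ 'd \<Rightarrow> complex. lr_norm 2 f \<le> ennreal \<epsilon> \<longrightarrow>
        (\<exists>u. global_dnls_solution \<kappa> \<sigma> f u \<and>
          (\<forall>v. global_dnls_solution \<kappa> \<sigma> f v \<longrightarrow> (\<forall>t\<ge>0. v t = u t)) \<and>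
          (\<forall>q r. strichartz_admissible CARD('d) q r \<longrightarrow>
             mixed_norm q r u \<le> ennreal (C q * \<epsilon>)) \<and>
          (\<forall>r>2. ((\<lambda>t. lr_norm r (u t)) \<longlongrightarrow> 0) at_top))))"
    by (simp add: C_def)
  then show ?thesis using \<epsilon>(1) by blast
qed

end
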